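(* Let $X$ be a Banach space, $s>0$, $1<p_0\le p_1<\infty$, and let $w_0\in A_{p_0}$ and $w_1\in A_{p_1}$ be Muckenhoupt weights on $\mathbb{R}^d$. Then the operator $(1-\Delta)^{-s/2}$ is bounded from $L^{p_0}(\mathbb{R}^d,w_0;X)$ to $L^{p_1}(\mathbb{R}^d,w_1;X)$ if and only if $$\sup_{\nu\in\mathbb{N}_0,\ m\in\mathbb{Z}^d} 2^{-\nu s}\, w_0(Q_{\nu,m})^{-1/p_0}\, w_1(Q_{\nu,m})^{1/p_1}<\infty .$$
   Context: $\mathbb{N}_0=\{0,1,2,\dots\}$. A weight is a locally integrable, almost everywhere positive function $w:\mathbb{R}^d\to[0,\infty)$. For $1<p<\infty$, $w\in A_p$ means $$[w]_{A_p}=\sup_{Q}\Big(\frac1{|Q|}\int_Q w\,dx\Big)\Big(\frac1{|Q|}\int_Q w^{-\frac1{p-1}}\,dx\Big)^{p-1}<\infty,$$ the supremum being over all cubes $Q\subset\mathbb{R}^d$. For a weight $w$ and a cube $Q$, $w(Q)=\int_Q w(x)\,dx$. For $\nu\in\mathbb{N}_0$, $m\in\mathbb{Z}^d$, $Q_{\nu,m}\subset\mathbb{R}^d$ is the $d$-dimensional cube with sides parallel to the coordinate axes, centered at $2^{-\nu}m$, with side length $2^{-\nu}$. The space $L^p(\mathbb{R}^d,w;X)$ is given by the norm $\|f\|_{L^p(\mathbb{R}^d,w;X)}=\big(\int_{\mathbb{R}^d}\|f(x)\|_X^p\,w(x)\,dx\big)^{1/p}$. The Bessel-potential operator is defined by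 Fourier transform on $X$-valued tempered distributions: $(1-\Delta)^{-s/2}f=\mathscr{F}^{-1}[(1+|\cdot|^2)^{-s/2}\widehat f\,]$, where $\widehat f=\mathscr{F}f$ is the Fourier transform of $f$. *)

theory Defs
  imports "HOL-Analysis.Analysis"
begin

section \<open>Complex Banach spaces\<close>

text \<open>
  Tempered distributions with values in a Banach space \<open>X\<close> are linear over the complex numbers, so
  \<open>X\<close> carries a complex scalar multiplication that extends the real one of class \<^class>\<open>banach\<close>.
\<close>

class complex_banach = banach +
  fixes scaleC :: "complex \<Rightarrow> 'a \<Rightarrow> 'a"  (infixr \<open>*\<^sub>C\<close> 75)
  assumes scaleC_add_right: "a *\<^sub>C (x + y) = a *\<^sub>C x + a *\<^sub>C y"
    and scaleC_add_left: "(a + b) *\<^sub>C x = a *\<^sub>C x + b *\<^sub>C x"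
    and scaleC_scaleC: "a *\<^sub>C b *\<^sub>C x = (a * b) *\<^sub>C x"
    and scaleC_of_real: "complex_of_real r *\<^sub>C x = r *\<^sub>R x"
    and norm_scaleC: "norm (a *\<^sub>C x) = cmod a * norm x"

instantiation complex :: complex_banach
begin

definition scaleC_complex :: "complex \<Rightarrow> complex \<Rightarrow> complex"
  where "scaleC_complex a x = a * x"

instance
  by standard
    (simp_all add: scaleC_complex_def distrib_left distrib_right mult.assoc scaleR_conv_of_real
      norm_mult)

end


section \<open>Vector-valued integration\<close>

text \<open>
  The library's \<^const>\<open>has_bochner_integral\<close> is restricted by its type to separable codomains.  The
  following is the same definition for an arbitrary normed space; separability of the essential
  range is enforced by the approximation by simple functions.
\<close>

definition has_bochner_integral_ban ::
    "'a measure \<Rightarrow> ('a \<Rightarrow> 'b::real_normed_vector) \<Rightarrow> 'b \<Rightarrow> bool"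
  where "has_bochner_integral_ban M f I \<longleftrightarrow>
    f \<in> borel_measurable M \<and>
    (\<exists>s. (\<forall>i::nat. Bochner_Integration.simple_bochner_integrable M (s i)) \<and>
         (\<lambda>i. \<integral>\<^sup>+x. ennreal (norm (f x - s i x)) \<partial>M) \<longlonglongrightarrow> 0 \<and>
         (\<lambda>i. Bochner_Integration.simple_bochner_integral M (s i)) \<longlonglongrightarrow> I)"

definition strongly_measurable :: "'a measure \<Rightarrow> ('a \<Rightarrow> 'b::real_normed_vector) \<Rightarrow> bool"
  where "strongly_measurable M f \<longleftrightarrow>
    (\<exists>s. (\<forall>i::nat. simple_function M (s i)) \<and> (AE x in M. (\<lambda>i. s i x) \<longlonglongrightarrow> f x))"


section \<open>Cubes and Muckenhoupt weights\<close>

definition cube :: "real^'n \<Rightarrow> real \<Rightarrow> (real^'n) set"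
  where "cube c l = cbox (\<chi> i. c $ i - l / 2) (\<chi> i. c $ i + l / 2)"

definition dyadic_cube :: "nat \<Rightarrow> int^'n \<Rightarrow> (real^'n) set"
  where "dyadic_cube \<nu> m = cube (\<chi> i. real_of_int (m $ i) / 2 ^ \<nu>) (1 / 2 ^ \<nu>)"

definition weight :: "(real^'n \<Rightarrow> real) \<Rightarrow> bool"
  where "weight w \<longleftrightarrow>
    (\<forall>x. 0 \<le> w x) \<and> (AE x in lebesgue. 0 < w x) \<and>
    (\<forall>K. compact K \<longrightarrow> set_integrable lebesgue K w)"

definition weight_measure :: "(real^'n \<Rightarrow> real) \<Rightarrow> (real^'n) set \<Rightarrow> real"
  where "weight_measure w Q = (LINT x:Q|lebesgue. w x)"

definition average :: "(real^'n) set \<Rightarrow> (real^'n \<Rightarrow> real) \<Rightarrow> real"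
  where "average Q f = (LINT x:Q|lebesgue. f x) / measure lebesgue Q"

text \<open>
  Cubes have sides parallel to the axes.  The integrability clause says that the second factor is
  finite on every cube; without it the totalised integral of a non-integrable function would be
  \<open>0\<close> instead of \<open>\<infinity>\<close>.
\<close>

definition Muckenhoupt :: "real \<Rightarrow> (real^'n \<Rightarrow> real) set"
  where "Muckenhoupt p = {w. weight w \<and>
    (\<forall>c l. 0 < l \<longrightarrow> set_integrable lebesgue (cube c l) (\<lambda>x. w x powr (- 1 / (p - 1)))) \<and>
    bdd_above {average (cube c l) w *
        average (cube c l) (\<lambda>x. w x powr (- 1 / (p - 1))) powr (p - 1) | c l. 0 < l}}"


section \<open>Weighted Lebesgue spaces\<close>

definition Lp_space :: "real \<Rightarrow> (real^'n \<Rightarrow> real) \<Rightarrow> (real^'n \<Rightarrow> 'x::complex_banach) set"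
  where "Lp_space p w = {f. strongly_measurable lebesgue f \<and>
    integrable lebesgue (\<lambda>x. norm (f x) powr p * w x)}"

definition Lp_norm :: "real \<Rightarrow> (real^'n \<Rightarrow> real) \<Rightarrow> (real^'n \<Rightarrow> 'x::complex_banach) \<Rightarrow> real"
  where "Lp_norm p w f = (LINT x|lebesgue. norm (f x) powr p * w x) powr (1 / p)"


section \<open>Schwartz functions and tempered distributions\<close>

definition partial_deriv :: "'n \<Rightarrow> (real^'n \<Rightarrow> complex) \<Rightarrow> real^'n \<Rightarrow> complex"
  where "partial_deriv i \<phi> x = frechet_derivative \<phi> (at x) (axis i 1)"

definition iterated_deriv :: "'n list \<Rightarrow> (real^'n \<Rightarrow> complex) \<Rightarrow> real^'n \<Rightarrow> complex"
  where "iterated_deriv is \<phi> = foldr partial_deriv is \<phi>"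

definition schwartz_space :: "(real^'n \<Rightarrow> complex) set"
  where "schwartz_space = {\<phi>. \<forall>is.
    (\<forall>x. iterated_deriv is \<phi> differentiable (at x)) \<and>
    (\<forall>k::nat. bounded (range (\<lambda>x. (1 + norm x) ^ k *\<^sub>R iterated_deriv is \<phi> x)))}"

text \<open>The increasing family of norms that defines the topology of the Schwartz space.\<close>

definition schwartz_norm :: "nat \<Rightarrow> (real^'n \<Rightarrow> complex) \<Rightarrow> real"
  where "schwartz_norm k \<phi> =
    (SUP (is, x) \<in> {is. length is \<le> k} \<times> UNIV. (1 + norm x) ^ k * cmod (iterated_deriv is \<phi> x))"

text \<open>
  A distribution is represented by a function on all of \<open>real^'n \<Rightarrow> complex\<close>; only its values on
  \<^const>\<open>schwartz_space\<close> are meaningful.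
\<close>

type_synonym ('n, 'x) distribution = "(real^'n \<Rightarrow> complex) \<Rightarrow> 'x"

definition tempered :: "('n::finite, 'x::complex_banach) distribution \<Rightarrow> bool"
  where "tempered u \<longleftrightarrow>
    (\<forall>\<phi>\<in>schwartz_space. \<forall>\<psi>\<in>schwartz_space. u (\<lambda>x. \<phi> x + \<psi> x) = u \<phi> + u \<psi>) \<and>
    (\<forall>a. \<forall>\<phi>\<in>schwartz_space. u (\<lambda>x. a * \<phi> x) = a *\<^sub>C u \<phi>) \<and>
    (\<exists>C k. \<forall>\<phi>\<in>schwartz_space. norm (u \<phi>) \<le> C * schwartz_norm k \<phi>)"

text \<open>The function \<open>f\<close>, regarded as an element of the space of tempered distributions, is \<open>u\<close>.\<close>

definition is_distribution_of :: "(real^'n \<Rightarrow> 'x::complex_banach) \<Rightarrow> ('n, 'x) distribution \<Rightarrow> bool"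
  where "is_distribution_of f u \<longleftrightarrow> tempered u \<and>
    (\<forall>\<phi>\<in>schwartz_space. has_bochner_integral_ban lebesgue (\<lambda>x. \<phi> x *\<^sub>C f x) (u \<phi>))"


section \<open>Fourier transform and Bessel potentials\<close>

text \<open>
  There is no factor \<open>2\<pi>\<close> in the exponent, so that \<open>- \<Delta>\<close> has Fourier symbol \<open>\<bar>\<xi>\<bar>\<^sup>2\<close>.
\<close>

definition fourier :: "(real^'n \<Rightarrow> complex) \<Rightarrow> real^'n \<Rightarrow> complex"
  where "fourier \<phi> \<xi> = (LINT x|lebesgue. exp (- \<i> * complex_of_real (x \<bullet> \<xi>)) * \<phi> x)"

definition inv_fourier :: "(real^'n \<Rightarrow> complex) \<Rightarrow> real^'n \<Rightarrow> complex"
  where "inv_fourier \<phi> x =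
    (LINT \<xi>|lebesgue. exp (\<i> * complex_of_real (x \<bullet> \<xi>)) * \<phi> \<xi>) / complex_of_real ((2 * pi) ^ CARD('n))"

definition fourier_distr :: "('n::finite, 'x::complex_banach) distribution \<Rightarrow> ('n, 'x) distribution"
  where "fourier_distr u = (\<lambda>\<phi>. u (fourier \<phi>))"

definition inv_fourier_distr :: "('n::finite, 'x::complex_banach) distribution \<Rightarrow> ('n, 'x) distribution"
  where "inv_fourier_distr u = (\<lambda>\<phi>. u (inv_fourier \<phi>))"

definition mult_distr ::
    "(real^'n \<Rightarrow> complex) \<Rightarrow> ('n::finite, 'x::complex_banach) distribution \<Rightarrow> ('n, 'x) distribution"
  where "mult_distr a u = (\<lambda>\<phi>. u (\<lambda>\<xi>. a \<xi> * \<phi> \<xi>))"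

definition bessel_potential ::
    "real \<Rightarrow> ('n::finite, 'x::complex_banach) distribution \<Rightarrow> ('n, 'x) distribution"
  where "bessel_potential s u =
    inv_fourier_distr
      (mult_distr (\<lambda>\<xi>. complex_of_real ((1 + (norm \<xi>)\<^sup>2) powr (- s / 2))) (fourier_distr u))"

text \<open>
  \<open>T\<close>, given on tempered distributions, is bounded from \<open>L\<^sup>p(w)\<close> to \<open>L\<^sup>q(v)\<close>, both spaces being
  identified with spaces of tempered distributions.
\<close>

definition Lp_bounded ::
    "(('n::finite, 'x::complex_banach) distribution \<Rightarrow> ('n, 'x) distribution) \<Rightarrow>
      real \<Rightarrow> (real^'n \<Rightarrow> real) \<Rightarrow> real \<Rightarrow> (real^'n \<Rightarrow> real) \<Rightarrow> bool"
  where "Lp_bounded T p w q v \<longleftrightarrow>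
    (\<exists>C. \<forall>f\<in>Lp_space p w. \<exists>u. is_distribution_of f u \<and>
      (\<exists>g\<in>Lp_space q v. is_distribution_of g (T u) \<and> Lp_norm q v g \<le> C * Lp_norm p w f))"

end

theory Submission
  imports Defs "HOL-Probability.Probability"
begin

text \<open>
  On test functions the Bessel potential is convolution with the kernel
  \<open>G = \<Gamma>(s/2)\<^bsup>-1\<^esup> \<integral> t\<^bsup>s/2-1\<^esup> e\<^bsup>-t\<^esup> h\<^sub>t dt\<close>, where \<open>h\<^sub>t\<close> is the heat kernel.  It is
  bounded by a sum of averages over cubes: \<open>2\<^bsup>-\<nu>s\<^esup>\<close> times the average over cubes of side \<open>2\<^bsup>-\<nu>\<^esup>\<close>, plus
  averages over cubes of side \<open>2\<^sup>i\<close> with rapidly decaying coefficients; the one-third trick replaces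
  these cubes by the cells of finitely many nested grids.  In one grid the two-weight estimate
  reduces to a Carleson-type sum over stopping cells, and the \<open>A\<^sub>p\<close> conditions make these cells
  carry geometrically decaying mass for both weights.  Cubes of side at least \<open>1\<close> and shifted
  cubes are compared with the cubes \<open>Q\<^sub>\<nu>\<^sub>,\<^sub>m\<close> by doubling.

  Conversely, for \<open>f = \<chi>\<^sub>Q x\<close> with \<open>Q = Q\<^sub>\<nu>\<^sub>,\<^sub>m\<close>, the lower bound \<open>G \<ge> c 2\<^bsup>\<nu>(d-s)\<^esup>\<close> on \<open>Q - Q\<close>
  is tested against a Gaussian adapted to \<open>Q\<close>.
\<close>

section \<open>Vector-valued integrals\<close>

text \<open>The space X is arbitrary, so vector values are removed at the outset: f is an absolutely
  convergent series of vectors times indicators of Borel sets, the norms adding up to at most 3 |f|.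
  The potential is formed term by term, and positivity of G leaves an estimate for nonnegative
  scalar functions.

  The gain is r = 2^(-s) < 1 per level: averages staying within a factor 2 of the last stopping
  average add up like a geometric series, which leaves the stopping levels. The estimates over these
  bound a quantity by a fraction of itself plus the desired bound. Absorbing the fraction needs
  finite quantities; therefore everything is first proved for finitely many cells of finitely many
  levels, with constants independent of the truncation, and monotone convergence follows.

  The condition says nothing about cubes of side 2^i > 1. Comparison with unit cubes costs a power
  of the volume, 2^(i d), which the rapid decay of G outweighs.

  In the converse the pairing must be with a Schwartz function, which has a tail off Q. Doubling of
  the dual weight w1^(-1/(p1-1)) makes the tail harmless, and the A_p condition of w1 then trades
  this weight for w1.\<close>

lemma bounded_linear_scaleC_right: "bounded_linear (\<lambda>x::'x::complex_banach. a *\<^sub>C x)"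
proof (rule bounded_linear_intro[where K="cmod a"])
  show "a *\<^sub>C (r *\<^sub>R x) = r *\<^sub>R (a *\<^sub>C x)" for r and x :: 'x
    by (metis scaleC_of_real scaleC_scaleC mult.commute)
qed (simp_all add: scaleC_add_right norm_scaleC mult.commute)

lemma bounded_linear_scaleC_left: "bounded_linear (\<lambda>a. a *\<^sub>C (x::'x::complex_banach))"
proof (rule bounded_linear_intro[where K="norm x"])
  show "(r *\<^sub>R a) *\<^sub>C x = r *\<^sub>R (a *\<^sub>C x)" for r and a
    by (metis scaleC_of_real scaleC_scaleC scaleR_conv_of_real)
qed (simp_all add: scaleC_add_left norm_scaleC)

lemma scaleC_zero_left [simp]: "0 *\<^sub>C (x::'x::complex_banach) = 0"
  using bounded_linear.linear[OF bounded_linear_scaleC_left] linear_0 by blast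

lemma scaleC_diff_left: "(a - b) *\<^sub>C (x::'x::complex_banach) = a *\<^sub>C x - b *\<^sub>C x"
  using bounded_linear.linear[OF bounded_linear_scaleC_left] linear_diff by blast

text \<open>The approximation by simple functions converges only off a null set. Putting everything
  to 0 on a null set \<open>N\<close> gives a limit that exists everywhere and is measurable;
  completeness of Lebesgue measure makes the values of \<open>f\<close> on \<open>N\<close>
  harmless.\<close>

lemma strongly_measurable_imp_borel_measurable:
  fixes f :: "'a::euclidean_space \<Rightarrow> 'b::real_normed_vector"
  assumes "strongly_measurable lebesgue f"
  shows "f \<in> borel_measurable lebesgue"
proof -
  obtain s where s: "\<And>i::nat. simple_function lebesgue (s i)"
      and lim: "AE x in lebesgue. (\<lambda>i. s i x) \<longlonglongrightarrow> f x"
    using assms unfolding strongly_measurable_def by auto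
  obtain N where N: "N \<in> null_sets lebesgue" "{x. \<not> (\<lambda>i. s i x) \<longlonglongrightarrow> f x} \<subseteq> N"
    using lim by (elim AE_E) (auto simp del: emeasure_completion)
  have Nm [measurable]: "N \<in> sets lebesgue" using N by auto
  have sm [measurable]: "s i \<in> borel_measurable lebesgue" for i
    by (rule borel_measurable_simple_function[OF s])
  define f' where "f' x = (if x \<in> N then 0 else f x)" for x
  have f': "f' \<in> borel_measurable lebesgue"
  proof (rule borel_measurable_LIMSEQ_metric)
    show "(\<lambda>x. if x \<in> N then 0 else s i x) \<in> borel_measurable lebesgue" for i
      by measurable
    show "(\<lambda>i. if x \<in> N then 0 else s i x) \<longlonglongrightarrow> f' x" for x
      using N(2) by (auto simp: f'_def)
  qed
  show ?thesis
  proof (rule measurableI)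
    fix A :: "'b set" assume A: "A \<in> sets borel"
    have "f -` A \<inter> space lebesgue = (f' -` A \<inter> space lebesgue - N) \<union> (f -` A \<inter> N)"
      by (auto simp: f'_def)
    moreover have "f' -` A \<inter> space lebesgue \<in> sets lebesgue"
      using f' A by (rule measurable_sets)
    moreover have "f -` A \<inter> N \<in> null_sets lebesgue"
      using N(1) by (metis Int_lower2 null_sets_completion_subset)
    ultimately show "f -` A \<inter> space lebesgue \<in> sets lebesgue" 
      using Nm by (metis null_setsD2 sets.Diff sets.Un)
  qed simp
qed

lemma AE_lebesgue_iff: "(AE x in lebesgue. P x) \<longleftrightarrow> (AE x in lborel. P (x::'a::euclidean_space))"
  by (rule AE_completion_iff)

section \<open>Absolutely convergent series of vectors with scalar coefficient functions\<close>

text \<open>A telescoping sum: at accuracy \<open>k\<close> the first point of a countable set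
  within \<open>norm (f x) / 2 ^ k\<close> of \<open>f x\<close> is chosen, so consecutive choices
  differ by at most 3/2 |f(x)| 2^(-k), and this sums to 3 |f(x)|. It reduces an operator on
  vector-valued functions to its action on indicators.\<close>

lemma strongly_measurable_series:
  fixes f :: "'a::euclidean_space \<Rightarrow> 'x::banach"
  assumes f: "strongly_measurable lebesgue f"
  obtains A :: "nat \<Rightarrow> 'a set" and v :: "nat \<Rightarrow> 'x"
  where "\<And>k. A k \<in> sets borel"
    and "AE x in lborel. summable (\<lambda>k. indicator (A k) x * norm (v k)) \<and>
          (\<Sum>k. indicator (A k) x * norm (v k)) \<le> 3 * norm (f x) \<and>
          (\<lambda>k. indicator (A k) x *\<^sub>R v k) sums f x"
proof -
  obtain s where s: "\<And>i::nat. simple_function lebesgue (s i)"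
      and lim: "AE x in lebesgue. (\<lambda>i. s i x) \<longlonglongrightarrow> f x"
    using f unfolding strongly_measurable_def by auto
  have fm [measurable]: "f \<in> borel_measurable lebesgue"
    by (rule strongly_measurable_imp_borel_measurable[OF f])
  define D where "D = (\<Union>i. range (s i))"
  have "countable D"
    unfolding D_def using s by (intro countable_UN) (auto simp: simple_function_def intro!: countable_finite)
  moreover have "D \<noteq> {}" by (auto simp: D_def)
  ultimately have D: "range (from_nat_into D) = D" by (rule range_from_nat_into[rotated])
  \<comment> \<open>The point 0 gets the index 0. It is admissible at accuracy 0, hence is the first
    choice there, and the telescoping sum starts at 0.\<close>
  define d where "d n = (case n of 0 \<Rightarrow> 0 | Suc m \<Rightarrow> from_nat_into D m)" for n
  have d0: "d 0 = 0" by (simp add: d_def)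
  have d_ex: "\<exists>n. d n = y" if "y \<in> D" for y
    using that D by (metis d_def old.nat.simps(5) rangeE)
  define close where "close k n x \<longleftrightarrow> norm (d n - f x) \<le> norm (f x) / 2 ^ k" for k n :: nat and x
  define P where "P k n x \<longleftrightarrow> close k n x \<and> (\<forall>j<n. \<not> close k j x)" for k n x
  have [measurable]: "Measurable.pred lebesgue (close k n)" for k n
  proof -
    have "(\<lambda>y. norm (d n - y)) \<in> borel_measurable borel"
      by (intro borel_measurable_continuous_onI continuous_intros)
    from measurable_compose[OF fm this] have [measurable]: "(\<lambda>x. norm (d n - f x)) \<in> borel_measurable lebesgue" .
    have "(\<lambda>y::'x. norm y) \<in> borel_measurable borel"
      by (intro borel_measurable_continuous_onI continuous_intros)
    from measurable_compose[OF fm this] have [measurable]: "(\<lambda>x. norm (f x)) \<in> borel_measurable lebesgue" .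
    show ?thesis unfolding close_def by measurable
  qed
  have [measurable]: "Measurable.pred lebesgue (P k n)" for k n
    unfolding P_def by measurable
  \<comment> \<open>The index \<open>m\<close> encodes an accuracy together with the points chosen
    at this and the next accuracy; on \<open>B m\<close> the increment is the constant
    \<open>v m\<close>.\<close>
  define B where "B m = (case prod_decode m of (k, ij) \<Rightarrow>
      case prod_decode ij of (i, j) \<Rightarrow> {x. P k i x \<and> P (Suc k) j x})" for m
  define v where "v m = (case prod_decode m of (k, ij) \<Rightarrow>
      case prod_decode ij of (i, j) \<Rightarrow> d j - d i)" for m
  have Bm: "B m \<in> sets lebesgue" for m
  proof -
    have "{x. P k i x \<and> P (Suc k) j x} \<in> sets lebesgue" for k i j
    proof -
      have "{x \<in> space lebesgue. P k i x \<and> P (Suc k) j x} \<in> sets lebesgue" by measurable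
      then show ?thesis by simp
    qed
    then show ?thesis unfolding B_def by (auto split: prod.split)
  qed
  \<comment> \<open>Borel versions are wanted because convolutions of these indicators are later
    treated by Fubini on Borel product spaces.\<close>
  have "\<exists>A. A \<in> sets borel \<and> (AE x in lborel. x \<in> A \<longleftrightarrow> x \<in> B m)" for m
  proof -
    have "(indicator (B m) :: 'a \<Rightarrow> real) \<in> borel_measurable lebesgue" using Bm by measurable
    from completion_ex_borel_measurable_real[OF this] obtain g :: "'a \<Rightarrow> real"
      where g: "g \<in> borel_measurable lborel" "AE x in lborel. indicator (B m) x = g x" by auto
    have "{x. g x = 1} \<in> sets borel" using g(1) by measurable
    moreover have "AE x in lborel. x \<in> {x. g x = 1} \<longleftrightarrow> x \<in> B m"
      using g(2) by eventually_elim (auto simp: indicator_def split: if_splits)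
    ultimately show ?thesis by blast
  qed
  then obtain A where A: "\<And>m. A m \<in> sets borel" "\<And>m. AE x in lborel. x \<in> A m \<longleftrightarrow> x \<in> B m"
    by metis
  have A': "AE x in lborel. \<forall>m. x \<in> A m \<longleftrightarrow> x \<in> B m"
    using A(2) by (simp add: AE_all_countable)
  have main: "summable (\<lambda>k. indicator (B k) x * norm (v k)) \<and>
          (\<Sum>k. indicator (B k) x * norm (v k)) \<le> 3 * norm (f x) \<and>
          (\<lambda>k. indicator (B k) x *\<^sub>R v k) sums f x" if lim: "(\<lambda>i. s i x) \<longlonglongrightarrow> f x" for x
  proof -
    have ex: "\<exists>n. close k n x" for k
    proof (cases "f x = 0")
      case True
      then show ?thesis by (intro exI[of _ 0]) (simp add: close_def d0)
    next
      case False
      then have "norm (f x) / 2 ^ k > 0" by simp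
      then obtain i where "norm (s i x - f x) < norm (f x) / 2 ^ k"
        using LIMSEQ_D[OF lim] by blast
      moreover obtain n where "d n = s i x" using d_ex[of "s i x"] by (auto simp: D_def)
      ultimately show ?thesis unfolding close_def by (metis less_imp_le)
    qed
    define n where "n k = (LEAST n. close k n x)" for k
    have n1: "close k (n k) x" for k unfolding n_def by (rule LeastI_ex[OF ex])
    have n2: "P k i x \<longleftrightarrow> i = n k" for k i
      unfolding P_def using n1[of k] not_less_Least[of _ "\<lambda>n. close k n x"] Least_le[of "\<lambda>n. close k n x"]
      unfolding n_def by (metis linorder_neqE_nat not_less)
    define t where "t k = d (n k)" for k
    have tn: "norm (t k - f x) \<le> norm (f x) / 2 ^ k" for k
      using n1[of k] by (simp add: close_def t_def)
    have "n 0 = 0" unfolding n_def by (rule Least_eq_0) (simp add: close_def d0)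
    then have t0: "t 0 = 0" by (simp add: t_def d0)
    have "(\<lambda>k. norm (f x) / 2 ^ k) \<longlonglongrightarrow> 0" by real_asymp
    then have "(\<lambda>k. t k - f x) \<longlonglongrightarrow> 0"
      by (rule Lim_null_comparison[rotated]) (simp add: tn)
    then have tl: "t \<longlonglongrightarrow> f x" by (simp add: LIM_zero_iff)
    have sumt: "(\<lambda>k. t (Suc k) - t k) sums f x"
      using telescope_sums[OF tl] t0 by simp
    have dn: "norm (t (Suc k) - t k) \<le> 3/2 * norm (f x) * (1/2) ^ k" for k
    proof -
      have "norm (t (Suc k) - t k) \<le> norm (t (Suc k) - f x) + norm (t k - f x)"
        by (metis norm_triangle_ineq4 diff_diff_eq2 diff_add_cancel)
      also have "\<dots> \<le> norm (f x) / 2 ^ Suc k + norm (f x) / 2 ^ k"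
        by (intro add_mono tn)
      finally show ?thesis by (simp add: power_one_over field_simps)
    qed
    have gs: "(\<lambda>k. 3/2 * norm (f x) * (1/2) ^ k) sums (3/2 * norm (f x) * 2)"
      using sums_mult[OF geometric_sums[of "1/2::real"], of "3/2 * norm (f x)"] by simp
    have nsum: "summable (\<lambda>k. norm (t (Suc k) - t k))"
      by (rule summable_comparison_test'[OF sums_summable[OF gs], of 0]) (use dn in simp)
    define h where "h k = prod_encode (k, prod_encode (n k, n (Suc k)))" for k
    have inj: "inj h" by (rule injI) (simp add: h_def)
    have z: "indicator (B m) x = (0::real)" if "m \<notin> range h" for m
    proof -
      obtain k i j where m: "m = prod_encode (k, prod_encode (i, j))"
        by (metis prod_decode_inverse surj_pair)
      then have "\<not> (i = n k \<and> j = n (Suc k))" using that by (auto simp: h_def)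
      then show ?thesis by (auto simp: m B_def n2 indicator_def)
    qed
    have hB: "indicator (B (h k)) x = (1::real)" "v (h k) = t (Suc k) - t k" for k
      by (auto simp: h_def B_def v_def n2 t_def)
    \<comment> \<open>At a fixed point only the indices \<open>h k\<close> contribute; absolute
      convergence permits passing from the order in \<open>k\<close> to the enumeration by
      \<open>m\<close>.\<close>
    have transfer: "(\<lambda>m. indicator (B m) x *\<^sub>R u m) sums S"
      if "(\<lambda>k. u (h k)) sums S" "summable (\<lambda>k. norm (u (h k)))"
      for u :: "nat \<Rightarrow> 'c::banach" and S
    proof -
      have "((\<lambda>k. u (h k)) has_sum S) UNIV" by (rule norm_summable_imp_has_sum[OF that(2,1)])
      then have "((\<lambda>m. indicator (B m) x *\<^sub>R u m) has_sum S) (range h)"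
        by (subst has_sum_reindex[OF inj]) (simp add: o_def hB)
      then have "((\<lambda>m. indicator (B m) x *\<^sub>R u m) has_sum S) UNIV"
        by (subst (asm) has_sum_cong_neutral[of UNIV "range h" _ "\<lambda>m. indicator (B m) x *\<^sub>R u m"])
          (auto simp: z)
      then show ?thesis by (rule has_sum_imp_sums)
    qed
    have 1: "(\<lambda>k. indicator (B k) x *\<^sub>R v k) sums f x"
      by (rule transfer) (use sumt nsum hB in simp_all)
    have 2: "(\<lambda>k. indicator (B k) x *\<^sub>R norm (v k)) sums (\<Sum>k. norm (t (Suc k) - t k))"
      by (rule transfer) (use nsum hB in \<open>simp_all add: summable_sums\<close>)
    have "(\<Sum>k. norm (t (Suc k) - t k)) \<le> 3/2 * norm (f x) * 2"
      using suminf_le[OF dn nsum sums_summable[OF gs]] sums_unique[OF gs] by simp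
    then show ?thesis using 1 2 by (auto simp: sums_iff)
  qed
  have "AE x in lborel. summable (\<lambda>k. indicator (A k) x * norm (v k)) \<and>
          (\<Sum>k. indicator (A k) x * norm (v k)) \<le> 3 * norm (f x) \<and>
          (\<lambda>k. indicator (A k) x *\<^sub>R v k) sums f x"
    using A' lim[unfolded AE_lebesgue_iff]
  proof eventually_elim
    case (elim x)
    then have "indicator (A k) x = (indicator (B k) x :: real)" for k by (simp add: indicator_def)
    then show ?case using main[OF elim(2)] by simp
  qed
  then show thesis using that A(1) by blast
qed

text \<open>The partial sum of length \<open>i\<close>, with each coefficient replaced by its
  \<open>i\<close>-th simple approximation, is a simple function. The approximations are dominated
  by \<open>2 * norm (d k x)\<close>, so Tannery's theorem handles both limits at once.\<close>

lemma strongly_measurable_suminf: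
  fixes d :: "nat \<Rightarrow> 'a \<Rightarrow> complex" and v :: "nat \<Rightarrow> 'x::complex_banach"
  assumes d: "\<And>k. d k \<in> borel_measurable M"
    and s: "AE x in M. summable (\<lambda>k. norm (d k x) * norm (v k))"
    and h: "AE x in M. (\<lambda>k. d k x *\<^sub>C v k) sums h x"
  shows "strongly_measurable M h"
proof -
  have "\<forall>k. \<exists>s. (\<forall>i. simple_function M (s i)) \<and> (\<forall>x\<in>space M. (\<lambda>i. s i x) \<longlonglongrightarrow> d k x) \<and>
    (\<forall>i. \<forall>x\<in>space M. dist (s i x) 0 \<le> 2 * dist (d k x) 0)"
    using borel_measurable_implies_sequence_metric[OF d] by blast
  then obtain s where s1: "\<And>k i. simple_function M (s k i)"
    and s2: "\<And>k x. x \<in> space M \<Longrightarrow> (\<lambda>i. s k i x) \<longlonglongrightarrow> d k x"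
    and s3: "\<And>k i x. x \<in> space M \<Longrightarrow> norm (s k i x) \<le> 2 * norm (d k x)"
    by (metis dist_0_norm dist_commute)
  define S where "S i x = (\<Sum>k<i. s k i x *\<^sub>C v k)" for i x
  have "simple_function M (S i)" for i
    unfolding S_def by (intro simple_function_sum simple_function_compose1[OF s1])
  moreover have "AE x in M. (\<lambda>i. S i x) \<longlonglongrightarrow> h x"
    using s h AE_space
  proof eventually_elim
    case (elim x)
    define a where "a k i = (if k < i then norm ((s k i x - d k x) *\<^sub>C v k) else 0)" for k i
    have "((\<lambda>i. suminf (\<lambda>k. a k i)) \<longlongrightarrow> suminf (\<lambda>k. 0)) sequentially"
    proof (rule tannerys_theorem[THEN conjunct2, THEN conjunct2])
      show "(\<lambda>i. a k i) \<longlonglongrightarrow> 0" for k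
      proof (rule Lim_null_comparison)
        show "\<forall>\<^sub>F i in sequentially. norm (a k i) \<le> norm (s k i x - d k x) * norm (v k)"
          by (simp add: a_def norm_scaleC)
        have "(\<lambda>i. s k i x - d k x) \<longlonglongrightarrow> 0" using s2[OF elim(3)] by (simp add: LIM_zero)
        then show "(\<lambda>i. norm (s k i x - d k x) * norm (v k)) \<longlonglongrightarrow> 0"
          by (intro tendsto_mult_left_zero tendsto_norm_zero)
      qed
      have "norm (s k i x - d k x) \<le> 3 * norm (d k x)" for k i
        using s3[OF elim(3), of k i] norm_triangle_ineq4[of "s k i x" "d k x"] by linarith
      then have "norm (a k i) \<le> 3 * (norm (d k x) * norm (v k))" for k i
        using mult_right_mono[of _ _ "norm (v k)"] by (fastforce simp: a_def norm_scaleC mult.assoc)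
      then show "\<forall>\<^sub>F (k, i) in sequentially \<times>\<^sub>F sequentially. norm (a k i) \<le> 3 * (norm (d k x) * norm (v k))"
        by (intro always_eventually) auto
      show "summable (\<lambda>k. 3 * (norm (d k x) * norm (v k)))"
        using elim(1) by (rule summable_mult)
    qed simp
    then have lim1: "(\<lambda>i. \<Sum>k. a k i) \<longlonglongrightarrow> 0" by simp
    have "(\<Sum>k. a k i) = (\<Sum>k<i. norm ((s k i x - d k x) *\<^sub>C v k))" for i
      by (subst suminf_finite[of "{..<i}"]) (auto simp: a_def)
    then have "norm (S i x - (\<Sum>k<i. d k x *\<^sub>C v k)) \<le> (\<Sum>k. a k i)" for i
      unfolding S_def by (simp add: sum_subtractf[symmetric] scaleC_diff_left[symmetric] norm_sum)
    then have "(\<lambda>i. S i x - (\<Sum>k<i. d k x *\<^sub>C v k)) \<longlonglongrightarrow> 0"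
      by (intro Lim_null_comparison[OF _ lim1]) auto
    from tendsto_add[OF this elim(2)[unfolded sums_def]] show ?case by simp
  qed
  ultimately show ?thesis unfolding strongly_measurable_def by blast
qed

lemma simple_bochner_integral_sum:
  assumes "finite I" "\<And>i. i \<in> I \<Longrightarrow> Bochner_Integration.simple_bochner_integrable M (f i)"
  shows "Bochner_Integration.simple_bochner_integrable M (\<lambda>x. \<Sum>i\<in>I. f i x)"
    and "Bochner_Integration.simple_bochner_integral M (\<lambda>x. \<Sum>i\<in>I. f i x) =
      (\<Sum>i\<in>I. Bochner_Integration.simple_bochner_integral M (f i))"
proof -
  have "Bochner_Integration.simple_bochner_integrable M (\<lambda>x. \<Sum>i\<in>I. f i x) \<and>
    Bochner_Integration.simple_bochner_integral M (\<lambda>x. \<Sum>i\<in>I. f i x) =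
      (\<Sum>i\<in>I. Bochner_Integration.simple_bochner_integral M (f i))"
    using assms
  proof (induction I)
    case empty
    show ?case
      by (auto intro!: Bochner_Integration.simple_bochner_integrable.intros
          simp: Bochner_Integration.simple_bochner_integral_def intro!: sum.neutral)
  next
    case (insert i I)
    then show ?case
      by (auto simp: Bochner_Integration.simple_bochner_integral_add
          intro: Bochner_Integration.simple_bochner_integrable_compose2[where p="(+)"])
  qed
  then show "Bochner_Integration.simple_bochner_integrable M (\<lambda>x. \<Sum>i\<in>I. f i x)"
    "Bochner_Integration.simple_bochner_integral M (\<lambda>x. \<Sum>i\<in>I. f i x) =
      (\<Sum>i\<in>I. Bochner_Integration.simple_bochner_integral M (f i))" by auto
qed

text \<open>The approximating simple functions are assembled from scalar ones, so no separability of
  the range is involved: finitely many coefficients are approximated in L^1, and the remaining terms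
  form the tail of a convergent series.\<close>

lemma has_bochner_integral_ban_suminf:
  fixes d :: "nat \<Rightarrow> 'a::euclidean_space \<Rightarrow> complex" and v :: "nat \<Rightarrow> 'x::complex_banach"
  assumes d: "\<And>k. integrable lebesgue (d k)"
    and s: "summable (\<lambda>k. (LINT x|lebesgue. norm (d k x)) * norm (v k))"
    and h: "AE x in lebesgue. (\<lambda>k. d k x *\<^sub>C v k) sums h x"
  shows "has_bochner_integral_ban lebesgue h (\<Sum>k. (LINT x|lebesgue. d k x) *\<^sub>C v k)"
proof -
  let ?L = "lebesgue :: 'a measure"
  have nint: "(\<integral>\<^sup>+x. ennreal (norm (d k x) * norm (v k)) \<partial>?L)
      = ennreal ((LINT x|lebesgue. norm (d k x)) * norm (v k))" for k
    by (subst nn_integral_eq_integral) (auto intro: d)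
  have "(\<integral>\<^sup>+x. (\<Sum>k. ennreal (norm (d k x) * norm (v k))) \<partial>?L)
      = (\<Sum>k. \<integral>\<^sup>+x. ennreal (norm (d k x) * norm (v k)) \<partial>?L)"
    by (rule nn_integral_suminf) (use d in auto)
  also have "\<dots> = ennreal (\<Sum>k. (LINT x|lebesgue. norm (d k x)) * norm (v k))"
    unfolding nint by (rule suminf_ennreal_eq) (use s in auto)
  finally have fin: "(\<integral>\<^sup>+x. (\<Sum>k. ennreal (norm (d k x) * norm (v k))) \<partial>?L) \<noteq> \<infinity>" by simp
  have "AE x in ?L. (\<Sum>k. ennreal (norm (d k x) * norm (v k))) \<noteq> \<infinity>"
    by (rule nn_integral_PInf_AE[OF _ fin]) (use d in auto)
  then have smb: "AE x in ?L. summable (\<lambda>k. norm (d k x) * norm (v k))"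
    by eventually_elim (auto intro: summable_suminf_not_top)
  have hm: "h \<in> borel_measurable ?L"
    by (rule strongly_measurable_imp_borel_measurable, rule strongly_measurable_suminf[OF _ smb h])
      (use d in auto)
  \<comment> \<open>Dividing the tolerance by \<open>1 + norm (v k)\<close> and by
    \<open>2 ^ k\<close> makes the errors, after multiplication by \<open>v k\<close>, add up to at
    most \<open>2 * (1/2)^n\<close>.\<close>
  define R where "R k n s \<longleftrightarrow> Bochner_Integration.simple_bochner_integrable ?L s \<and>
     (\<integral>\<^sup>+x. norm (d k x - s x) \<partial>?L) \<le> ennreal ((1/2)^n / ((1 + norm (v k)) * 2^k)) \<and>
     norm (Bochner_Integration.simple_bochner_integral ?L s - (LINT x|lebesgue. d k x))
        \<le> (1/2)^n / ((1 + norm (v k)) * 2^k)" for k n s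
  have "\<forall>k n. \<exists>s. R k n s"
  proof (intro allI)
    fix k n
    let ?e = "(1/2)^n / ((1 + norm (v k)) * 2^k) :: real"
    have e: "0 < ?e" by (simp add: add_pos_nonneg)
    obtain s where s: "\<And>i. Bochner_Integration.simple_bochner_integrable ?L (s i)"
      "(\<lambda>i. \<integral>\<^sup>+x. norm (d k x - s i x) \<partial>?L) \<longlonglongrightarrow> 0"
      "(\<lambda>i. Bochner_Integration.simple_bochner_integral ?L (s i)) \<longlonglongrightarrow> (LINT x|lebesgue. d k x)"
      using has_bochner_integral_integrable[OF d[of k]]
      by (auto elim!: has_bochner_integral.cases)
    have "\<forall>\<^sub>F i in sequentially. (\<integral>\<^sup>+x. norm (d k x - s i x) \<partial>?L) < ennreal ?e"
      by (rule order_tendstoD(2)[OF s(2)]) (use e in simp)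
    moreover have "\<forall>\<^sub>F i in sequentially.
       dist (Bochner_Integration.simple_bochner_integral ?L (s i)) (LINT x|lebesgue. d k x) < ?e"
      by (rule tendstoD[OF s(3) e])
    ultimately have "\<forall>\<^sub>F i in sequentially. (\<integral>\<^sup>+x. norm (d k x - s i x) \<partial>?L) \<le> ennreal ?e \<and>
       norm (Bochner_Integration.simple_bochner_integral ?L (s i) - (LINT x|lebesgue. d k x)) \<le> ?e"
      by eventually_elim (auto simp: dist_norm)
    then obtain i where "(\<integral>\<^sup>+x. norm (d k x - s i x) \<partial>?L) \<le> ennreal ?e \<and>
       norm (Bochner_Integration.simple_bochner_integral ?L (s i) - (LINT x|lebesgue. d k x)) \<le> ?e"
      using eventually_happens'[OF sequentially_bot] by blast
    then show "\<exists>s. R k n s"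
      unfolding R_def using s(1) by blast
  qed
  then obtain s where "\<And>k n. R k n (s k n)" by metis
  then obtain s where s1: "\<And>k n. Bochner_Integration.simple_bochner_integrable ?L (s k n)"
    and s2: "\<And>k n. (\<integral>\<^sup>+x. norm (d k x - s k n x) \<partial>?L) \<le> ennreal ((1/2)^n / ((1 + norm (v k)) * 2^k))"
    and s3: "\<And>k n. norm (Bochner_Integration.simple_bochner_integral ?L (s k n) - (LINT x|lebesgue. d k x))
        \<le> (1/2)^n / ((1 + norm (v k)) * 2^k)"
    unfolding R_def by blast
  have sm [measurable]: "s k n \<in> borel_measurable ?L" for k n
    using s1[of k n] by (auto elim!: simple_bochner_integrable.cases intro: borel_measurable_simple_function)
  have dm [measurable]: "d k \<in> borel_measurable ?L" for k using d[of k] by auto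
  have small: "(1/2)^n / ((1 + norm (v k)) * 2^k) * norm (v k) \<le> (1/2)^n * (1/2)^k" for k n
  proof -
    have "norm (v k) / (1 + norm (v k)) \<le> 1" by (simp add: divide_le_eq_1 add_pos_nonneg)
    then have "norm (v k) / (1 + norm (v k)) * ((1/2)^n * (1/2)^k) \<le> 1 * ((1/2)^n * (1/2)^k)"
      by (intro mult_right_mono) auto
    then show ?thesis by (simp add: power_one_over field_simps)
  qed
  have geo: "(\<Sum>k<n. (1/2)^n * (1/2)^k) \<le> 2 * (1/2::real)^n" for n :: nat
  proof -
    have "(\<Sum>k<n. (1/2::real)^k) \<le> 2"
      by (subst sum_gp_strict) (simp add: power_one_over field_simps)
    then show ?thesis unfolding sum_distrib_left[symmetric]
      by (metis mult.commute mult_left_mono zero_le_divide_1_iff zero_le_numeral zero_le_power)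
  qed
  define S where "S n x = (\<Sum>k<n. s k n x *\<^sub>C v k)" for n x
  have term1: "Bochner_Integration.simple_bochner_integrable ?L (\<lambda>x. s k n x *\<^sub>C v k)" for k n
    by (rule simple_bochner_integrable_compose2[where p="\<lambda>a b. a *\<^sub>C v k", OF _ s1 s1]) simp
  have Sint: "Bochner_Integration.simple_bochner_integrable ?L (S n)" for n
    unfolding S_def by (rule simple_bochner_integral_sum(1)) (auto intro: term1)
  have Sval: "Bochner_Integration.simple_bochner_integral ?L (S n) =
      (\<Sum>k<n. Bochner_Integration.simple_bochner_integral ?L (s k n) *\<^sub>C v k)" for n
    unfolding S_def
    by (subst simple_bochner_integral_sum(2)) (auto intro!: term1 sum.cong
      simple_bochner_integral_linear[OF bounded_linear.linear[OF bounded_linear_scaleC_left] s1])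
  define T where "T n = (\<Sum>k. (LINT x|lebesgue. norm (d (k+n) x)) * norm (v (k+n)))" for n
  have T: "T \<longlonglongrightarrow> 0"
    unfolding T_def using suminf_exist_split2[OF s] by (simp add: o_def)
  have bound: "(\<integral>\<^sup>+x. norm (h x - S n x) \<partial>?L) \<le> ennreal (T n + 2 * (1/2)^n)" for n
  proof -
    have "AE x in ?L. ennreal (norm (h x - S n x)) \<le> (\<Sum>k. ennreal (norm (d (k+n) x) * norm (v (k+n))))
       + (\<Sum>k<n. ennreal (norm (d k x - s k n x)) * ennreal (norm (v k)))"
      using smb h
    proof eventually_elim
      case (elim x)
      have sn: "summable (\<lambda>k. norm (d (k+n) x *\<^sub>C v (k+n)))"
        using summable_ignore_initial_segment[OF elim(1), of n] by (simp add: norm_scaleC)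
      have "h x - S n x = (\<Sum>k. d (k+n) x *\<^sub>C v (k+n)) + (\<Sum>k<n. (d k x - s k n x) *\<^sub>C v k)"
        using suminf_minus_initial_segment[OF sums_summable[OF elim(2)], of n] sums_unique[OF elim(2)]
        by (simp add: S_def scaleC_diff_left sum_subtractf)
      then have "norm (h x - S n x) \<le> norm (\<Sum>k. d (k+n) x *\<^sub>C v (k+n)) + norm (\<Sum>k<n. (d k x - s k n x) *\<^sub>C v k)"
        by (simp only: norm_triangle_ineq)
      also have "\<dots> \<le> (\<Sum>k. norm (d (k+n) x) * norm (v (k+n))) + (\<Sum>k<n. norm (d k x - s k n x) * norm (v k))"
        using summable_norm[OF sn] norm_sum[of "\<lambda>k. (d k x - s k n x) *\<^sub>C v k" "{..<n}"]
        by (simp add: norm_scaleC)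
      finally have "ennreal (norm (h x - S n x)) \<le> ennreal \<dots>" by (rule ennreal_leI)
      also have "\<dots> = (\<Sum>k. ennreal (norm (d (k+n) x) * norm (v (k+n))))
       + (\<Sum>k<n. ennreal (norm (d k x - s k n x)) * ennreal (norm (v k)))"
        using sn by (subst ennreal_plus)
          (auto simp: norm_scaleC suminf_nonneg sum_nonneg suminf_ennreal2 ennreal_mult[symmetric])
      finally show ?case .
    qed
    then have "(\<integral>\<^sup>+x. norm (h x - S n x) \<partial>?L) \<le>
      (\<integral>\<^sup>+x. (\<Sum>k. ennreal (norm (d (k+n) x) * norm (v (k+n))))
       + (\<Sum>k<n. ennreal (norm (d k x - s k n x)) * ennreal (norm (v k))) \<partial>?L)"
      by (rule nn_integral_mono_AE)
    also have "\<dots> = (\<Sum>k. \<integral>\<^sup>+x. ennreal (norm (d (k+n) x) * norm (v (k+n))) \<partial>?L)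
       + (\<Sum>k<n. (\<integral>\<^sup>+x. ennreal (norm (d k x - s k n x)) \<partial>?L) * ennreal (norm (v k)))"
      by (simp add: nn_integral_add nn_integral_suminf nn_integral_sum nn_integral_multc)
    also have "\<dots> \<le> ennreal (T n) + ennreal (2 * (1/2)^n)"
    proof (rule add_mono)
      show "(\<Sum>k. \<integral>\<^sup>+x. ennreal (norm (d (k+n) x) * norm (v (k+n))) \<partial>?L) \<le> ennreal (T n)"
        unfolding nint T_def
        by (subst suminf_ennreal2) (use summable_ignore_initial_segment[OF s, of n] in auto)
      have "(\<Sum>k<n. (\<integral>\<^sup>+x. ennreal (norm (d k x - s k n x)) \<partial>?L) * ennreal (norm (v k)))
        \<le> (\<Sum>k<n. ennreal ((1/2)^n / ((1 + norm (v k)) * 2^k)) * ennreal (norm (v k)))"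
        by (intro sum_mono mult_right_mono s2) auto
      also have "\<dots> \<le> (\<Sum>k<n. ennreal ((1/2)^n * (1/2)^k))"
        by (intro sum_mono) (use small in \<open>auto simp: ennreal_mult[symmetric] intro!: ennreal_leI\<close>)
      also have "\<dots> \<le> ennreal (2 * (1/2)^n)"
        using geo[of n] by (subst sum_ennreal) (auto intro: ennreal_leI)
      finally show "(\<Sum>k<n. (\<integral>\<^sup>+x. ennreal (norm (d k x - s k n x)) \<partial>?L) * ennreal (norm (v k)))
        \<le> ennreal (2 * (1/2)^n)" .
    qed
    also have "\<dots> = ennreal (T n + 2 * (1/2)^n)"
      by (subst ennreal_plus) (auto simp: T_def intro!: suminf_nonneg summable_ignore_initial_segment[OF s])
    finally show ?thesis .
  qed
  have "(\<lambda>n. 2 * (1/2)^n) \<longlonglongrightarrow> (0::real)" by real_asymp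
  from tendsto_add[OF T this] have "(\<lambda>n. ennreal (T n + 2 * (1/2)^n)) \<longlonglongrightarrow> 0"
    by (metis add.right_neutral ennreal_0 tendsto_ennrealI)
  then have lim1: "(\<lambda>n. \<integral>\<^sup>+x. ennreal (norm (h x - S n x)) \<partial>?L) \<longlonglongrightarrow> 0"
    by (rule tendsto_sandwich[OF _ _ tendsto_const, rotated 2]) (use bound in auto)
  have sI: "summable (\<lambda>k. norm ((LINT x|lebesgue. d k x) *\<^sub>C v k))"
    by (rule summable_comparison_test'[OF s, of 0]) (auto simp: norm_scaleC intro!: mult_right_mono integral_norm_bound)
  have sums: "(\<lambda>n. \<Sum>k<n. (LINT x|lebesgue. d k x) *\<^sub>C v k) \<longlonglongrightarrow> (\<Sum>k. (LINT x|lebesgue. d k x) *\<^sub>C v k)"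
    using summable_LIMSEQ[OF summable_norm_cancel[OF sI]] .
  have "(\<lambda>n. Bochner_Integration.simple_bochner_integral ?L (S n) - (\<Sum>k<n. (LINT x|lebesgue. d k x) *\<^sub>C v k)) \<longlonglongrightarrow> 0"
  proof (rule Lim_null_comparison)
    have "norm (Bochner_Integration.simple_bochner_integral ?L (S n) - (\<Sum>k<n. (LINT x|lebesgue. d k x) *\<^sub>C v k)) \<le> 2 * (1/2)^n" for n
    proof -
      have "norm (Bochner_Integration.simple_bochner_integral ?L (S n) - (\<Sum>k<n. (LINT x|lebesgue. d k x) *\<^sub>C v k))
        \<le> (\<Sum>k<n. norm (Bochner_Integration.simple_bochner_integral ?L (s k n) - (LINT x|lebesgue. d k x)) * norm (v k))"
        unfolding Sval sum_subtractf[symmetric] scaleC_diff_left[symmetric] norm_scaleC[symmetric] by (rule norm_sum)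
      also have "\<dots> \<le> (\<Sum>k<n. (1/2)^n / ((1 + norm (v k)) * 2^k) * norm (v k))"
        by (intro sum_mono mult_right_mono s3) auto
      also have "\<dots> \<le> (\<Sum>k<n. (1/2)^n * (1/2)^k)" by (intro sum_mono small)
      also have "\<dots> \<le> 2 * (1/2)^n" by (rule geo)
      finally show ?thesis .
    qed
    then show "\<forall>\<^sub>F n in sequentially. norm (Bochner_Integration.simple_bochner_integral ?L (S n) - (\<Sum>k<n. (LINT x|lebesgue. d k x) *\<^sub>C v k)) \<le> 2 * (1/2)^n"
      by simp
    show "(\<lambda>n. 2 * (1/2)^n) \<longlonglongrightarrow> (0::real)" by real_asymp
  qed
  from tendsto_add[OF this sums]
  have lim2: "(\<lambda>n. Bochner_Integration.simple_bochner_integral ?L (S n)) \<longlonglongrightarrow> (\<Sum>k. (LINT x|lebesgue. d k x) *\<^sub>C v k)"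
    by simp
  show ?thesis unfolding has_bochner_integral_ban_def using hm Sint lim1 lim2 by blast
qed

section \<open>Uniqueness and norm bound of the Banach-valued integral\<close>

text \<open>In a non-separable space a difference of measurable functions need not be measurable;
  here \<open>f - s\<close> is, because \<open>s\<close> has finitely many values and subtracting a
  constant is continuous. Two approximating sequences give uniqueness of the integral, and
  \<open>t = 0\<close> gives the norm bound.\<close>

lemma simple_bochner_integral_dist_le:
  fixes f :: "'a \<Rightarrow> 'b::real_normed_vector"
  assumes f: "f \<in> borel_measurable M"
    and s: "Bochner_Integration.simple_bochner_integrable M s"
    and t: "Bochner_Integration.simple_bochner_integrable M t"
  shows "ennreal (norm (Bochner_Integration.simple_bochner_integral M s -
      Bochner_Integration.simple_bochner_integral M t)) \<le>
    (\<integral>\<^sup>+x. norm (f x - s x) \<partial>M) + (\<integral>\<^sup>+x. norm (f x - t x) \<partial>M)"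
proof -
  have m: "(\<lambda>x. ennreal (norm (f x - u x))) \<in> borel_measurable M"
    if "Bochner_Integration.simple_bochner_integrable M u" for u
  proof (rule measurable_compose_countable'[where I="u ` space M" and g=u])
    have sf: "simple_function M u" using that by (auto elim: simple_bochner_integrable.cases)
    show c: "countable (u ` space M)" using sf by (auto simp: simple_function_def countable_finite)
    show "u \<in> M \<rightarrow>\<^sub>M count_space (u ` space M)"
      using sf c by (auto simp: measurable_count_space_eq_countable simple_function_def)
    show "(\<lambda>x. ennreal (norm (f x - i))) \<in> borel_measurable M" for i
    proof -
      have "(\<lambda>y. norm (y - i)) \<in> borel_measurable borel"
        by (intro borel_measurable_continuous_onI continuous_intros)
      from measurable_compose[OF f this] show ?thesis by measurable
    qed
  qed
  have st: "Bochner_Integration.simple_bochner_integrable M (\<lambda>x. s x - t x)"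
    by (rule simple_bochner_integrable_compose2[where p="(-)", OF _ s t]) simp
  have "norm (Bochner_Integration.simple_bochner_integral M s - Bochner_Integration.simple_bochner_integral M t)
     \<le> Bochner_Integration.simple_bochner_integral M (\<lambda>x. norm (s x - t x))"
    using simple_bochner_integral_norm_bound[OF st] simple_bochner_integral_diff[OF s t] by simp
  then have "ennreal (norm (Bochner_Integration.simple_bochner_integral M s - Bochner_Integration.simple_bochner_integral M t))
     \<le> ennreal (Bochner_Integration.simple_bochner_integral M (\<lambda>x. norm (s x - t x)))"
    by (rule ennreal_leI)
  also have "\<dots> = (\<integral>\<^sup>+x. norm (s x - t x) \<partial>M)"
    by (rule simple_bochner_integral_eq_nn_integral)
      (auto intro: simple_bochner_integrable_compose2[where p="\<lambda>a b. norm a", OF _ st st])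
  also have "\<dots> \<le> (\<integral>\<^sup>+x. ennreal (norm (f x - s x)) + ennreal (norm (f x - t x)) \<partial>M)"
  proof (intro nn_integral_mono)
    fix x
    have "norm (s x - t x) \<le> norm (f x - s x) + norm (f x - t x)"
      using norm_triangle_ineq4[of "f x - t x" "f x - s x"] by (simp add: algebra_simps)
    then show "ennreal (norm (s x - t x)) \<le> ennreal (norm (f x - s x)) + ennreal (norm (f x - t x))"
      by (metis ennreal_leI ennreal_plus norm_ge_zero)
  qed
  also have "\<dots> = (\<integral>\<^sup>+x. norm (f x - s x) \<partial>M) + (\<integral>\<^sup>+x. norm (f x - t x) \<partial>M)"
    by (intro nn_integral_add m s t)
  finally show ?thesis .
qed

lemma has_bochner_integral_ban_unique:
  fixes f :: "'a \<Rightarrow> 'b::real_normed_vector"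
  assumes "has_bochner_integral_ban M f I" "has_bochner_integral_ban M f J"
  shows "I = J"
proof -
  have fm: "f \<in> borel_measurable M" using assms unfolding has_bochner_integral_ban_def by auto
  obtain s where s: "\<And>i. Bochner_Integration.simple_bochner_integrable M (s i)"
    "(\<lambda>i::nat. \<integral>\<^sup>+x. norm (f x - s i x) \<partial>M) \<longlonglongrightarrow> 0"
    "(\<lambda>i. Bochner_Integration.simple_bochner_integral M (s i)) \<longlonglongrightarrow> I"
    using assms(1) unfolding has_bochner_integral_ban_def by auto
  obtain t where t: "\<And>i. Bochner_Integration.simple_bochner_integrable M (t i)"
    "(\<lambda>i::nat. \<integral>\<^sup>+x. norm (f x - t i x) \<partial>M) \<longlonglongrightarrow> 0"
    "(\<lambda>i. Bochner_Integration.simple_bochner_integral M (t i)) \<longlonglongrightarrow> J"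
    using assms(2) unfolding has_bochner_integral_ban_def by auto
  have "ennreal (norm (I - J)) \<le> 0"
  proof (rule LIMSEQ_le)
    let ?a = "\<lambda>i. Bochner_Integration.simple_bochner_integral M (s i) - Bochner_Integration.simple_bochner_integral M (t i)"
    show "(\<lambda>i. ennreal (norm (?a i))) \<longlonglongrightarrow> ennreal (norm (I - J))"
      by (intro tendsto_intros s t)
    show "(\<lambda>i. (\<integral>\<^sup>+x. norm (f x - s i x) \<partial>M) + (\<integral>\<^sup>+x. norm (f x - t i x) \<partial>M)) \<longlonglongrightarrow> 0"
      using tendsto_add[OF s(2) t(2)] by simp
  qed (use simple_bochner_integral_dist_le[OF fm s(1) t(1)] in blast)
  then show ?thesis by simp
qed

lemma has_bochner_integral_ban_norm_le:
  fixes f :: "'a \<Rightarrow> 'b::real_normed_vector"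
  assumes "has_bochner_integral_ban M f I"
  shows "ennreal (norm I) \<le> (\<integral>\<^sup>+x. norm (f x) \<partial>M)"
proof -
  have fm: "f \<in> borel_measurable M" using assms unfolding has_bochner_integral_ban_def by auto
  obtain s where s: "\<And>i. Bochner_Integration.simple_bochner_integrable M (s i)"
    "(\<lambda>i::nat. \<integral>\<^sup>+x. norm (f x - s i x) \<partial>M) \<longlonglongrightarrow> 0"
    "(\<lambda>i. Bochner_Integration.simple_bochner_integral M (s i)) \<longlonglongrightarrow> I"
    using assms(1) unfolding has_bochner_integral_ban_def by auto
  have z: "Bochner_Integration.simple_bochner_integrable M (\<lambda>x. 0 :: 'b)"
    "Bochner_Integration.simple_bochner_integral M (\<lambda>x. 0 :: 'b) = 0"
    using simple_bochner_integral_sum[of "{}" M] by auto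
  show ?thesis
  proof (rule LIMSEQ_le)
    show "(\<lambda>i. ennreal (norm (Bochner_Integration.simple_bochner_integral M (s i)))) \<longlonglongrightarrow> ennreal (norm I)"
      by (intro tendsto_intros s)
    show "(\<lambda>i. (\<integral>\<^sup>+x. norm (f x - s i x) \<partial>M) + (\<integral>\<^sup>+x. norm (f x) \<partial>M)) \<longlonglongrightarrow> (\<integral>\<^sup>+x. norm (f x) \<partial>M)"
      using tendsto_add[OF s(2) tendsto_const, of "\<integral>\<^sup>+x. norm (f x) \<partial>M"] by simp
  qed (use simple_bochner_integral_dist_le[OF fm s(1) z(1)] z(2) in auto)
qed

section \<open>Sparse domination along a finite filtration\<close>

text \<open>The constant of \<open>sparse_powr_sum\<close>. With \<eta> determined by (1 + \<eta>)^p
  = 1 + \<kappa>/2 it equals (2/\<kappa>) (1 + 1/\<eta>)^p: the second factor comes from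
  \<open>powr_add_le\<close>, the first from absorbing a term.\<close>

definition carleson_const :: "real \<Rightarrow> real \<Rightarrow> real" where
  "carleson_const p \<kappa> = (2 / \<kappa>) * (1 + 1 / ((1 + \<kappa>/2) powr (1/p) - 1)) powr p"

text \<open>Distinguishes whether c is at most \<eta> X, where (1 + \<eta>)^p = 1 + \<kappa>/2. The
  point is that the factor of \<open>X powr p\<close> is close to 1, which makes absorption possible
  in \<open>sparse_powr_sum\<close>.\<close>

lemma powr_add_le:
  fixes p \<kappa> X c :: real
  assumes p: "1 \<le> p" and \<kappa>: "0 < \<kappa>" and X: "0 \<le> X" "0 \<le> c"
  shows "(X + c) powr p \<le> (1 + \<kappa>/2) * X powr p + (1 + 1 / ((1 + \<kappa>/2) powr (1/p) - 1)) powr p * c powr p"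
proof -
  define \<eta> where "\<eta> = (1 + \<kappa>/2) powr (1/p) - 1"
  have "1 < (1 + \<kappa>/2) powr (1/p)" using p \<kappa> by (intro gr_one_powr) auto
  then have \<eta>: "0 < \<eta>" by (simp add: \<eta>_def)
  have e: "(1 + \<eta>) powr p = 1 + \<kappa>/2" using p \<kappa> by (simp add: \<eta>_def powr_powr)
  show ?thesis
  proof (cases "c \<le> \<eta> * X")
    case True
    then have "(X + c) powr p \<le> ((1 + \<eta>) * X) powr p"
      using X p by (intro powr_mono2) (auto simp: algebra_simps)
    also have "\<dots> = (1 + \<kappa>/2) * X powr p" using X \<eta> e by (simp add: powr_mult)
    finally show ?thesis unfolding \<eta>_def[symmetric] by (simp add: add_increasing2)
  next
    case False
    then have "X \<le> c / \<eta>" using \<eta> by (simp add: field_simps)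
    then have "(X + c) powr p \<le> ((1 + 1/\<eta>) * c) powr p"
      using X p by (intro powr_mono2) (auto simp: algebra_simps)
    also have "\<dots> = (1 + 1/\<eta>) powr p * c powr p" using X \<eta> by (simp add: powr_mult)
    finally show ?thesis unfolding \<eta>_def[symmetric] using \<kappa> by (simp add: add_increasing)
  qed
qed

section \<open>Finite filtrations and sums over sparse families of cells\<close>

text \<open>A point of \<open>Om\<close> stands for a grid cell of the finest level
  \<open>N\<close>, and \<open>idx \<nu> x\<close> names the cell of level \<nu> containing it.
  Nestedness says that a finer name determines the coarser ones.\<close>

locale finite_filtration =
  fixes Om :: "'k set" and idx :: "nat \<Rightarrow> 'k \<Rightarrow> 'c" and N :: nat
  assumes fin: "finite Om"
    and nested: "\<And>\<nu> x y. x \<in> Om \<Longrightarrow> y \<in> Om \<Longrightarrow> idx (Suc \<nu>) x = idx (Suc \<nu>) y \<Longrightarrow> idx \<nu> x = idx \<nu> y"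
begin

definition cell :: "nat \<Rightarrow> 'k \<Rightarrow> 'k set" where
  "cell \<nu> x = {y \<in> Om. idx \<nu> y = idx \<nu> x}"

definition adapted :: "nat \<Rightarrow> ('k \<Rightarrow> 'd) \<Rightarrow> bool" where
  "adapted \<nu> h \<longleftrightarrow> (\<forall>x\<in>Om. \<forall>y\<in>Om. idx \<nu> x = idx \<nu> y \<longrightarrow> h x = h y)"

lemma nested_le:
  assumes "\<nu> \<le> \<mu>" "x \<in> Om" "y \<in> Om" "idx \<mu> x = idx \<mu> y"
  shows "idx \<nu> x = idx \<nu> y"
  using assms(1,4)
proof (induction \<mu> rule: dec_induct)
  case (step n)
  then show ?case using nested[OF assms(2,3), of n] by simp
qed

lemma adapted_mono: "adapted \<nu> h \<Longrightarrow> \<nu> \<le> \<mu> \<Longrightarrow> adapted \<mu> h"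
  unfolding adapted_def
proof (intro ballI impI)
  fix x y assume h: "\<forall>x\<in>Om. \<forall>y\<in>Om. idx \<nu> x = idx \<nu> y \<longrightarrow> h x = h y" and le: "\<nu> \<le> \<mu>"
    and xy: "x \<in> Om" "y \<in> Om" "idx \<mu> x = idx \<mu> y"
  show "h x = h y" using h[rule_format, OF xy(1,2) nested_le[OF le xy]] .
qed

lemma adaptedD:
  assumes "adapted \<nu> h" "x \<in> Om" "y \<in> cell \<nu> x"
  shows "h y = h x"
  by (rule assms(1)[unfolded adapted_def, rule_format]) (use assms(2,3) in \<open>auto simp: cell_def\<close>)

lemma finite_cell [simp]: "finite (cell \<nu> x)"
  using fin by (simp add: cell_def)

lemma cell_subset: "cell \<nu> x \<subseteq> Om" by (auto simp: cell_def)

lemma cell_self: "x \<in> Om \<Longrightarrow> x \<in> cell \<nu> x" by (simp add: cell_def)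

lemma cell_cong: "idx \<nu> x = idx \<nu> y \<Longrightarrow> cell \<nu> x = cell \<nu> y" by (simp add: cell_def)

text \<open>The cells of one level partition \<open>Om\<close>, so inequalities may be checked on a
  single cell, where adapted functions are constant.\<close>

lemma sum_cell_mono:
  fixes f g :: "'k \<Rightarrow> real"
  assumes "\<And>x. x \<in> Om \<Longrightarrow> sum f (cell \<nu> x) \<le> sum g (cell \<nu> x)"
  shows "sum f Om \<le> sum g Om"
proof -
  have "(\<Sum>q\<in>idx \<nu> ` Om. sum f {x\<in>Om. idx \<nu> x = q}) \<le> (\<Sum>q\<in>idx \<nu> ` Om. sum g {x\<in>Om. idx \<nu> x = q})"
    by (rule sum_mono) (use assms in \<open>auto simp: cell_def\<close>)
  then show ?thesis
    using sum.image_gen[OF fin, of f "idx \<nu>"] sum.image_gen[OF fin, of g "idx \<nu>"] by linarith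
qed

lemma sum_cell_adapted:
  fixes f :: "'k \<Rightarrow> real"
  assumes "adapted \<nu> h" "x \<in> Om"
  shows "(\<Sum>y\<in>cell \<nu> x. f y * h y) = sum f (cell \<nu> x) * h x"
proof -
  have "(\<Sum>y\<in>cell \<nu> x. f y * h y) = (\<Sum>y\<in>cell \<nu> x. f y * h x)"
    by (rule sum.cong) (auto simp: adaptedD[OF assms])
  then show ?thesis by (simp add: sum_distrib_right)
qed

text \<open>Stopping cells carry geometrically decaying mass, so the layers of the sum over the stopping
  cells containing a point behave like a lacunary series in \<open>L\<^sup>p\<close>: the \<open>p\<close>-th power of the sum is
  controlled by the sum of the \<open>p\<close>-th powers.\<close>

lemma sparse_powr_sum:
  fixes w :: "'k \<Rightarrow> real" and c :: "nat \<Rightarrow> 'k \<Rightarrow> real"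
  assumes p: "1 \<le> p" and \<kappa>: "0 < \<kappa>" "\<kappa> \<le> 1"
    and w: "\<And>x. x \<in> Om \<Longrightarrow> 0 \<le> w x" and c: "\<And>\<nu> x. 0 \<le> c \<nu> x"
    and S: "\<And>\<nu>. adapted \<nu> (S \<nu>)" and ca: "\<And>\<nu>. adapted \<nu> (c \<nu>)"
    and sparse: "\<And>\<nu> x. \<nu> \<le> N \<Longrightarrow> x \<in> Om \<Longrightarrow> S \<nu> x \<Longrightarrow>
      \<kappa> * sum w (cell \<nu> x) \<le> sum w {y\<in>cell \<nu> x. \<forall>k\<in>{\<nu><..N}. \<not> S k y}"
  shows "(\<Sum>x\<in>Om. w x * (\<Sum>\<nu>\<le>N. of_bool (S \<nu> x) * c \<nu> x) powr p)
    \<le> carleson_const p \<kappa> * (\<Sum>\<nu>\<le>N. \<Sum>x\<in>Om. w x * (of_bool (S \<nu> x) * c \<nu> x powr p))"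
proof -
  note [simp del] = sum_mult_of_bool_eq sum_of_bool_mult_eq
  define \<theta> where "\<theta> = 1 + \<kappa>/2"
  define C where "C = (1 + 1 / ((1 + \<kappa>/2) powr (1/p) - 1)) powr p"
  have pw: "(X + c) powr p \<le> \<theta> * X powr p + C * c powr p" if "0 \<le> X" "0 \<le> c" for X c
    unfolding \<theta>_def C_def using powr_add_le[OF p \<kappa>(1) that] .
  have C1: "1 \<le> C" using pw[of 0 1] by simp
  define X where "X n x = (\<Sum>\<nu>\<le>n. of_bool (S \<nu> x) * c \<nu> x)" for n x
  have X0: "0 \<le> X n x" for n x unfolding X_def using c by (intro sum_nonneg) auto
  have Xad: "adapted n (X n)" for n
    unfolding adapted_def X_def
  proof (intro ballI impI sum.cong refl)
    fix x y \<nu> assume a: "x \<in> Om" "y \<in> Om" "idx n x = idx n y" "\<nu> \<in> {..n}"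
    have "idx \<nu> x = idx \<nu> y" by (rule nested_le[of \<nu> n x y]) (use a in auto)
    then show "of_bool (S \<nu> x) * c \<nu> x = of_bool (S \<nu> y) * c \<nu> y"
      using S[of \<nu>, unfolded adapted_def, rule_format, OF a(1,2)] ca[of \<nu>, unfolded adapted_def, rule_format, OF a(1,2)]
      by simp
  qed
  define nostop where "nostop \<nu> n y \<longleftrightarrow> (\<forall>k\<in>{\<nu><..n}. \<not> S k y)" for \<nu> n y
  \<comment> \<open>\<open>X\<close> changes only at stopping levels and keeps its value until the
    next stop. The values right after the stops and those right before them therefore agree up to
    the last one, \<open>X n x\<close>.\<close>
  have id: "(\<Sum>\<nu>\<le>n. of_bool (S \<nu> x) * X \<nu> x powr p)
      = X n x powr p + (\<Sum>\<nu><n. of_bool (S (Suc \<nu>) x) * X \<nu> x powr p)" for n x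
    by (induction n) (auto simp: X_def)
  \<comment> \<open>Only the last stopping level satisfies \<open>nostop\<close>, and there
    \<open>X \<nu> x\<close> equals \<open>X n x\<close>.\<close>
  have last: "(\<Sum>\<nu>\<le>n. of_bool (S \<nu> x \<and> nostop \<nu> n x) * X \<nu> x powr p) \<le> X n x powr p" for n x
  proof (induction n)
    case 0
    then show ?case by simp
  next
    case (Suc n)
    show ?case
    proof (cases "S (Suc n) x")
      case True
      then have "\<not> nostop \<nu> (Suc n) x" if "\<nu> \<le> n" for \<nu> using that by (auto simp: nostop_def)
      then have "(\<Sum>\<nu>\<le>n. of_bool (S \<nu> x \<and> nostop \<nu> (Suc n) x) * X \<nu> x powr p) = 0"
        by (intro sum.neutral) auto
      then show ?thesis by simp
    next
      case False
      then have "nostop \<nu> (Suc n) x \<longleftrightarrow> nostop \<nu> n x" for \<nu>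
        unfolding nostop_def by (auto simp: le_Suc_eq)
      moreover have "X (Suc n) x = X n x" using False by (simp add: X_def)
      ultimately show ?thesis using Suc False by simp
    qed
  qed
  define D where "D = (\<Sum>x\<in>Om. w x * (\<Sum>\<nu>\<le>N. of_bool (S \<nu> x) * X \<nu> x powr p))"
  define H where "H = (\<Sum>x\<in>Om. w x * (\<Sum>\<nu><N. of_bool (S (Suc \<nu>) x) * X \<nu> x powr p))"
  define E where "E = (\<Sum>x\<in>Om. w x * X N x powr p)"
  define Z where "Z = (\<Sum>x\<in>Om. w x * (\<Sum>\<nu>\<le>N. of_bool (S \<nu> x) * c \<nu> x powr p))"
  have DEH: "D = E + H" unfolding D_def E_def H_def id by (simp add: sum.distrib distrib_left)
  have H0: "0 \<le> H" unfolding H_def using w by (intro sum_nonneg mult_nonneg_nonneg) auto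
  have E0: "0 \<le> E" unfolding E_def using w by (intro sum_nonneg mult_nonneg_nonneg) auto
  have step: "(\<Sum>\<nu>\<le>n. of_bool (S \<nu> x) * X \<nu> x powr p)
      \<le> \<theta> * (\<Sum>\<nu><n. of_bool (S (Suc \<nu>) x) * X \<nu> x powr p) + C * (\<Sum>\<nu>\<le>n. of_bool (S \<nu> x) * c \<nu> x powr p)" for n x
  proof (induction n)
    case 0
    have "X 0 x powr p \<le> C * c 0 x powr p" if "S 0 x"
      using that C1 mult_right_mono[OF C1, of "c 0 x powr p"] by (simp add: X_def)
    then show ?case by auto
  next
    case (Suc n)
    have "X (Suc n) x powr p \<le> \<theta> * X n x powr p + C * c (Suc n) x powr p" if "S (Suc n) x"
      using pw[OF X0[of n x] c[of "Suc n" x]] that by (simp add: X_def)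
    then have "of_bool (S (Suc n) x) * X (Suc n) x powr p \<le>
       \<theta> * (of_bool (S (Suc n) x) * X n x powr p) + C * (of_bool (S (Suc n) x) * c (Suc n) x powr p)" by auto
    then show ?case using Suc by (simp add: algebra_simps)
  qed
  have DH: "D \<le> \<theta> * H + C * Z"
  proof -
    have "D \<le> (\<Sum>x\<in>Om. w x * (\<theta> * (\<Sum>\<nu><N. of_bool (S (Suc \<nu>) x) * X \<nu> x powr p) + C * (\<Sum>\<nu>\<le>N. of_bool (S \<nu> x) * c \<nu> x powr p)))"
      unfolding D_def using w step by (intro sum_mono mult_left_mono)
    also have "\<dots> = \<theta> * H + C * Z"
      unfolding H_def Z_def by (simp add: sum_distrib_left sum.distrib distrib_left mult_ac)
    finally show ?thesis .
  qed
  \<comment> \<open>In each stopping cell a fraction \<kappa> of the mass meets no later stop.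
    \<open>X \<nu>\<close> is constant on the cell, and on that part it is the final value.\<close>
  have kD: "\<kappa> * D \<le> E"
  proof -
    have lev: "(\<Sum>x\<in>Om. w x * (\<kappa> * (of_bool (S \<nu> x) * X \<nu> x powr p)))
       \<le> (\<Sum>x\<in>Om. w x * (of_bool (S \<nu> x \<and> nostop \<nu> N x) * X \<nu> x powr p))" if \<nu>: "\<nu> \<le> N" for \<nu>
    proof (rule sum_cell_mono[of _ \<nu>])
      fix x assume x: "x \<in> Om"
      have ad: "adapted \<nu> (\<lambda>x. of_bool (S \<nu> x) * X \<nu> x powr p)"
        unfolding adapted_def
      proof (intro ballI impI)
        fix x y assume a: "x \<in> Om" "y \<in> Om" "idx \<nu> x = idx \<nu> y"
        show "of_bool (S \<nu> x) * X \<nu> x powr p = of_bool (S \<nu> y) * X \<nu> y powr p"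
          using S[of \<nu>, unfolded adapted_def, rule_format, of x y] Xad[of \<nu>, unfolded adapted_def, rule_format, of x y] a
          by simp
      qed
      have "(\<Sum>y\<in>cell \<nu> x. w y * (\<kappa> * (of_bool (S \<nu> y) * X \<nu> y powr p)))
         = \<kappa> * sum w (cell \<nu> x) * (of_bool (S \<nu> x) * X \<nu> x powr p)"
        using sum_cell_adapted[OF ad x, of "\<lambda>y. w y * \<kappa>"] by (simp add: sum_distrib_left[symmetric] sum_distrib_right[symmetric] mult_ac)
      also have "\<dots> \<le> sum w {y\<in>cell \<nu> x. nostop \<nu> N y} * (of_bool (S \<nu> x) * X \<nu> x powr p)"
        using sparse[OF \<nu> x] by (cases "S \<nu> x") (auto simp: nostop_def intro!: mult_right_mono)
      also have "\<dots> = (\<Sum>y\<in>cell \<nu> x. (w y * of_bool (nostop \<nu> N y)) * (of_bool (S \<nu> y) * X \<nu> y powr p))"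
      proof -
        have "sum w {y\<in>cell \<nu> x. nostop \<nu> N y} = (\<Sum>y\<in>cell \<nu> x. w y * of_bool (nostop \<nu> N y))"
          by (subst sum.inter_filter) (auto intro!: sum.cong)
        then show ?thesis using sum_cell_adapted[OF ad x, of "\<lambda>y. w y * of_bool (nostop \<nu> N y)"] by simp
      qed
      also have "\<dots> = (\<Sum>y\<in>cell \<nu> x. w y * (of_bool (S \<nu> y \<and> nostop \<nu> N y) * X \<nu> y powr p))"
        by (intro sum.cong) auto
      finally show "(\<Sum>y\<in>cell \<nu> x. w y * (\<kappa> * (of_bool (S \<nu> y) * X \<nu> y powr p)))
         \<le> (\<Sum>y\<in>cell \<nu> x. w y * (of_bool (S \<nu> y \<and> nostop \<nu> N y) * X \<nu> y powr p))" .
    qed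
    have "\<kappa> * D = (\<Sum>\<nu>\<le>N. \<Sum>x\<in>Om. w x * (\<kappa> * (of_bool (S \<nu> x) * X \<nu> x powr p)))"
      unfolding D_def sum_distrib_left by (subst sum.swap) (simp add: mult_ac)
    also have "\<dots> \<le> (\<Sum>\<nu>\<le>N. \<Sum>x\<in>Om. w x * (of_bool (S \<nu> x \<and> nostop \<nu> N x) * X \<nu> x powr p))"
      by (intro sum_mono lev) auto
    also have "\<dots> = (\<Sum>x\<in>Om. w x * (\<Sum>\<nu>\<le>N. of_bool (S \<nu> x \<and> nostop \<nu> N x) * X \<nu> x powr p))"
      unfolding sum_distrib_left by (rule sum.swap)
    also have "\<dots> \<le> E"
      unfolding E_def using w last by (intro sum_mono mult_left_mono)
    finally show ?thesis .
  qed
  have D0: "0 \<le> D" using DEH H0 E0 by simp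
  \<comment> \<open>Since \<open>H\<close> is \<open>D - E\<close> and \<open>E\<close> is at least
    \<open>\<kappa> * D\<close>, the term with \<open>H\<close> is at most
    \<open>(1 - \<kappa>/2) * D\<close>. It is absorbed into \<open>D\<close>, a finite sum.\<close>
  have "\<theta> * H \<le> \<theta> * ((1 - \<kappa>) * D)"
    using kD DEH \<kappa> by (intro mult_left_mono) (auto simp: \<theta>_def algebra_simps)
  also have "\<dots> \<le> (1 - \<kappa>/2) * D"
  proof -
    have "\<theta> * (1 - \<kappa>) \<le> 1 - \<kappa>/2" using \<kappa> by (simp add: \<theta>_def algebra_simps)
    then show ?thesis using D0 by (metis mult.assoc mult_right_mono)
  qed
  finally have "\<kappa>/2 * D \<le> C * Z" using DH by (simp add: algebra_simps)
  then have "D \<le> 2 / \<kappa> * C * Z" using \<kappa> by (simp add: field_simps)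
  moreover have "E \<le> D" using DEH H0 by simp
  ultimately have "E \<le> carleson_const p \<kappa> * Z" unfolding carleson_const_def C_def by linarith
  moreover have "Z = (\<Sum>\<nu>\<le>N. \<Sum>x\<in>Om. w x * (of_bool (S \<nu> x) * c \<nu> x powr p))"
    unfolding Z_def sum_distrib_left by (rule sum.swap)
  ultimately show ?thesis unfolding E_def X_def by simp
qed

end

lemma carleson_const_pos: 
  assumes "1 \<le> p" "0 < \<kappa>"
  shows "0 < carleson_const p \<kappa>"
proof -
  have "1 < (1 + \<kappa>/2) powr (1/p)" using assms by (intro gr_one_powr) auto
  then have "0 < 1 + 1 / ((1 + \<kappa>/2) powr (1/p) - 1)" by (simp add: add_pos_pos)
  then show ?thesis using assms by (simp add: carleson_const_def)
qed

section \<open>Stopping cells and weighted estimates over them\<close>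

text \<open>\<open>F\<close> and \<open>m\<close> play the roles of the integral of a nonnegative
  function over a finest cell and of the volume of that cell.\<close>

locale finite_stopping = finite_filtration Om idx N for Om :: "'k set" and idx :: "nat \<Rightarrow> 'k \<Rightarrow> 'c" and N +
  fixes F m :: "'k \<Rightarrow> real"
  assumes F: "\<And>x. x \<in> Om \<Longrightarrow> 0 \<le> F x" and m: "\<And>x. x \<in> Om \<Longrightarrow> 0 < m x"
begin

definition avg :: "nat \<Rightarrow> 'k \<Rightarrow> real" where
  "avg \<nu> x = sum F (cell \<nu> x) / sum m (cell \<nu> x)"

text \<open>The average over the last stopping cell that contains \<open>x\<close>. A cell stops
  when its average exceeds twice this value; the cells of level 0 always stop.\<close>

primrec top_avg :: "nat \<Rightarrow> 'k \<Rightarrow> real" where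
  "top_avg 0 x = avg 0 x"
| "top_avg (Suc \<nu>) x = (if 2 * top_avg \<nu> x < avg (Suc \<nu>) x then avg (Suc \<nu>) x else top_avg \<nu> x)"

definition stop :: "nat \<Rightarrow> 'k \<Rightarrow> bool" where
  "stop \<nu> x \<longleftrightarrow> (case \<nu> of 0 \<Rightarrow> True | Suc k \<Rightarrow> 2 * top_avg k x < avg (Suc k) x)"

lemma sum_cell_pos: "(\<And>x. x \<in> Om \<Longrightarrow> 0 < (w x :: real)) \<Longrightarrow> x \<in> Om \<Longrightarrow> 0 < sum w (cell \<nu> x)"
  using cell_self[of x \<nu>] cell_subset[of \<nu> x] by (intro sum_pos) auto

lemma sum_m_pos: "x \<in> Om \<Longrightarrow> 0 < sum m (cell \<nu> x)"
  by (rule sum_cell_pos) (use m in auto)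

lemma avg_nonneg: "0 \<le> avg \<nu> x"
  unfolding avg_def using F m cell_subset[of \<nu> x]
  by (intro divide_nonneg_nonneg sum_nonneg) (auto intro: less_imp_le)

lemma top_avg_nonneg: "0 \<le> top_avg \<nu> x"
  by (induction \<nu>) (auto simp: avg_nonneg)

lemma adapted_avg: "adapted \<nu> (avg \<nu>)"
  unfolding adapted_def avg_def by (intro ballI impI) (drule cell_cong, simp)

lemma adapted_top_avg: "adapted \<nu> (top_avg \<nu>)"
proof (induction \<nu>)
  case 0
  have "top_avg 0 = avg 0" by (rule ext) simp
  then show ?case using adapted_avg[of 0] by simp
next
  case (Suc \<nu>)
  have "adapted (Suc \<nu>) (top_avg \<nu>)" by (rule adapted_mono[OF Suc]) simp
  show ?case
    unfolding adapted_def
  proof (intro ballI impI)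
    fix x y assume a: "x \<in> Om" "y \<in> Om" "idx (Suc \<nu>) x = idx (Suc \<nu>) y"
    show "top_avg (Suc \<nu>) x = top_avg (Suc \<nu>) y"
      using adapted_avg[of "Suc \<nu>", unfolded adapted_def, rule_format, OF a]
        \<open>adapted (Suc \<nu>) (top_avg \<nu>)\<close>[unfolded adapted_def, rule_format, OF a] by simp
  qed
qed

lemma adapted_stop: "adapted \<nu> (stop \<nu>)"
proof (cases \<nu>)
  case 0
  then show ?thesis by (simp add: adapted_def stop_def)
next
  case (Suc k)
  have "adapted (Suc k) (top_avg k)" by (rule adapted_mono[OF adapted_top_avg]) simp
  show ?thesis
    unfolding adapted_def Suc
  proof (intro ballI impI)
    fix x y assume a: "x \<in> Om" "y \<in> Om" "idx (Suc k) x = idx (Suc k) y"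
    show "stop (Suc k) x = stop (Suc k) y"
      using adapted_avg[of "Suc k", unfolded adapted_def, rule_format, OF a]
        \<open>adapted (Suc k) (top_avg k)\<close>[unfolded adapted_def, rule_format, OF a] by (simp add: stop_def)
  qed
qed

lemma stop_top_avg: "stop \<nu> x \<Longrightarrow> top_avg \<nu> x = avg \<nu> x"
  by (cases \<nu>) (auto simp: stop_def)

text \<open>Each average is at most twice the last stopping average. The latter is constant between
  stops, so the weights \<open>r ^ \<nu>\<close> add up to at most 1/(1 - r) times the weight at the
  stop.\<close>

lemma sum_avg_le_stop:
  assumes r: "0 < r" "r < 1"
  shows "(\<Sum>\<nu>\<le>n. r ^ \<nu> * avg \<nu> x) \<le> 2 / (1 - r) * (\<Sum>\<nu>\<le>n. of_bool (stop \<nu> x) * (r ^ \<nu> * avg \<nu> x))"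
proof -
  note [simp del] = sum_mult_of_bool_eq sum_of_bool_mult_eq
  have le: "avg \<nu> x \<le> 2 * top_avg \<nu> x" for \<nu>
    using top_avg_nonneg[of \<nu> x] avg_nonneg[of \<nu> x] by (cases \<nu>) auto
  \<comment> \<open>The extra summand on the left is the geometric tail that would follow if no
    further stop occurred: it pays for the next level when there is no stop and is dropped when
    there is one.\<close>
  have "(\<Sum>\<nu>\<le>n. r ^ \<nu> * top_avg \<nu> x) + r / (1 - r) * (r ^ n * top_avg n x)
      \<le> 1 / (1 - r) * (\<Sum>\<nu>\<le>n. of_bool (stop \<nu> x) * (r ^ \<nu> * avg \<nu> x))"
  proof (induction n)
    case 0
    have "avg 0 x + r / (1 - r) * avg 0 x = 1 / (1 - r) * avg 0 x" using r by (simp add: field_simps)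
    then show ?case by (simp add: stop_def)
  next
    case (Suc n)
    let ?R = "r ^ Suc n * top_avg (Suc n) x"
    have s: "?R + r / (1 - r) * ?R = 1 / (1 - r) * ?R" using r by (simp add: field_simps)
    show ?case
    proof (cases "stop (Suc n) x")
      case True
      have "0 \<le> r / (1 - r) * (r ^ n * top_avg n x)" using r top_avg_nonneg[of n x] by simp
      then have "(\<Sum>\<nu>\<le>n. r ^ \<nu> * top_avg \<nu> x) \<le> 1 / (1 - r) * (\<Sum>\<nu>\<le>n. of_bool (stop \<nu> x) * (r ^ \<nu> * avg \<nu> x))"
        using Suc by linarith
      moreover have "of_bool (stop (Suc n) x) * (r ^ Suc n * avg (Suc n) x) = ?R"
        using stop_top_avg[OF True] True by (simp del: top_avg.simps)
      ultimately show ?thesis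
        unfolding sum.atMost_Suc distrib_left add.assoc s by (simp only: add_right_mono)
    next
      case False
      then have "top_avg (Suc n) x = top_avg n x" by (simp add: stop_def)
      then have "?R + r / (1 - r) * ?R = r / (1 - r) * (r ^ n * top_avg n x)"
        unfolding s by simp
      then show ?thesis using False Suc by simp
    qed
  qed
  moreover have "0 \<le> r / (1 - r) * (r ^ n * top_avg n x)" using r top_avg_nonneg[of n x] by simp
  moreover have "(\<Sum>\<nu>\<le>n. r ^ \<nu> * avg \<nu> x) \<le> 2 * (\<Sum>\<nu>\<le>n. r ^ \<nu> * top_avg \<nu> x)"
    unfolding sum_distrib_left
  proof (rule sum_mono)
    show "r ^ \<nu> * avg \<nu> x \<le> 2 * (r ^ \<nu> * top_avg \<nu> x)" for \<nu>
      using mult_left_mono[OF le[of \<nu>], of "r ^ \<nu>"] r by simp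
  qed
  ultimately show ?thesis by simp
qed

lemma sum_avg_saturated:
  assumes V: "V \<subseteq> Om" "\<And>y z. y \<in> V \<Longrightarrow> z \<in> Om \<Longrightarrow> idx n z = idx n y \<Longrightarrow> z \<in> V"
  shows "(\<Sum>y\<in>V. m y * avg n y) = sum F V"
proof -
  have finV: "finite V" using V(1) fin finite_subset by blast
  have "(\<Sum>q\<in>idx n ` V. \<Sum>y\<in>{y\<in>V. idx n y = q}. m y * avg n y) = (\<Sum>q\<in>idx n ` V. sum F {y\<in>V. idx n y = q})"
  proof (rule sum.cong[OF refl])
    fix q assume "q \<in> idx n ` V"
    then obtain y where y: "y \<in> V" "q = idx n y" by auto
    then have c: "{z\<in>V. idx n z = q} = cell n y" using V by (auto simp: cell_def)
    have yO: "y \<in> Om" using y V by auto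
    have "(\<Sum>z\<in>cell n y. m z * avg n z) = sum m (cell n y) * avg n y"
      by (rule sum_cell_adapted[OF adapted_avg yO])
    also have "\<dots> = sum F (cell n y)" using sum_m_pos[OF yO, of n] by (simp add: avg_def)
    finally show "(\<Sum>y\<in>{y\<in>V. idx n y = q}. m y * avg n y) = sum F {y\<in>V. idx n y = q}" using c by simp
  qed
  then show ?thesis
    using sum.image_gen[OF finV, of "\<lambda>y. m y * avg n y" "idx n"] sum.image_gen[OF finV, of F "idx n"] by linarith
qed

text \<open>A weak-type count: on the cells of the next stop the average is more than twice that of
  the given cell, while the total of \<open>F\<close> is at most the total over the given cell.
  These cells therefore fill at most half of its measure.\<close>

lemma stop_sparse:
  assumes x: "x \<in> Om" and s: "stop \<nu> x"
  shows "sum m (cell \<nu> x) / 2 \<le> sum m {y\<in>cell \<nu> x. \<forall>k\<in>{\<nu><..N}. \<not> stop k y}"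
proof -
  \<comment> \<open>Decomposition by the first stop after level \<nu>; since stopping is adapted,
    each part is a union of cells of level \<open>n\<close>.\<close>
  define V where "V n = {y\<in>cell \<nu> x. stop n y \<and> (\<forall>k\<in>{\<nu><..<n}. \<not> stop k y)}" for n
  have sub: "V n \<subseteq> cell \<nu> x" for n by (auto simp: V_def)
  have top: "top_avg n y = avg \<nu> x" if "y \<in> cell \<nu> x" "\<nu> \<le> n" "\<forall>k\<in>{\<nu><..n}. \<not> stop k y" for n y
    using that(2,3)
  proof (induction n rule: dec_induct)
    case base
    then show ?case using adaptedD[OF adapted_top_avg x that(1)] stop_top_avg[OF s] by simp
  next
    case (step n)
    then have "\<not> stop (Suc n) y" by auto
    then show ?case using step by (auto simp: stop_def)
  qed
  \<comment> \<open>The second claim covers average 0, where the average cannot be cancelled: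
    \<open>F\<close> then vanishes on the cell, and no later average can exceed 0.\<close>
  have lev: "2 * avg \<nu> x * sum m (V n) \<le> sum F (V n)" "avg \<nu> x = 0 \<Longrightarrow> V n = {}" if n: "n \<in> {\<nu><..N}" for n
  proof -
    have big: "2 * avg \<nu> x < avg n y" if y: "y \<in> V n" for y
    proof -
      obtain k where k: "n = Suc k" "\<nu> \<le> k" using n by (cases n) auto
      have "top_avg k y = avg \<nu> x" using y k by (intro top) (auto simp: V_def)
      moreover have "stop (Suc k) y" using y k by (simp add: V_def)
      ultimately show ?thesis using k by (simp add: stop_def)
    qed
    have eq: "(\<Sum>y\<in>V n. m y * avg n y) = sum F (V n)"
    proof (rule sum_avg_saturated)
      show "V n \<subseteq> Om" using sub cell_subset by blast
      fix y z assume yz: "y \<in> V n" "z \<in> Om" "idx n z = idx n y"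
      have yO: "y \<in> Om" using yz sub cell_subset by blast
      have *: "idx k z = idx k y" if "k \<le> n" for k by (rule nested_le[OF that yz(2) yO yz(3)])
      have st: "stop k z = stop k y" if "k \<le> n" for k
        using adapted_stop[of k, unfolded adapted_def, rule_format, OF yz(2) yO *[OF that]] .
      have "z \<in> cell \<nu> x" using *[of \<nu>] n yz(1,2) by (auto simp: V_def cell_def)
      then show "z \<in> V n" using st yz(1) by (auto simp: V_def)
    qed
    have "2 * avg \<nu> x * sum m (V n) = (\<Sum>y\<in>V n. m y * (2 * avg \<nu> x))"
      unfolding sum_distrib_right[symmetric] by (simp only: mult_ac)
    also have "\<dots> \<le> (\<Sum>y\<in>V n. m y * avg n y)"
      using big m sub cell_subset by (intro sum_mono mult_left_mono) (fastforce intro: less_imp_le)+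
    finally show "2 * avg \<nu> x * sum m (V n) \<le> sum F (V n)" using eq by simp
    show "V n = {}" if z: "avg \<nu> x = 0"
    proof (rule ccontr)
      assume "V n \<noteq> {}"
      then obtain y where y: "y \<in> V n" by auto
      then have yc: "y \<in> cell \<nu> x" using sub by auto
      have "sum F (cell \<nu> x) = 0" using z sum_m_pos[OF x, of \<nu>] by (simp add: avg_def)
      then have F0: "\<forall>z\<in>cell \<nu> x. F z = 0"
        using F cell_subset by (subst (asm) sum_nonneg_eq_0_iff) (auto simp: subset_iff)
      have "cell n y \<subseteq> cell \<nu> x"
      proof
        fix z assume z: "z \<in> cell n y"
        have "idx \<nu> z = idx \<nu> y" by (rule nested_le[of \<nu> n]) (use z yc n in \<open>auto simp: cell_def\<close>)
        then show "z \<in> cell \<nu> x" using z yc by (simp add: cell_def)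
      qed
      then have "avg n y = 0" unfolding avg_def using F0 by (auto intro!: sum.neutral)
      then show False using big[OF y] z by simp
    qed
  qed
  have disj: "V i \<inter> V j = {}" if "i \<in> {\<nu><..N}" "j \<in> {\<nu><..N}" "i \<noteq> j" for i j
    using that by (cases i j rule: linorder_cases) (auto simp: V_def)
  have un: "{y\<in>cell \<nu> x. \<exists>k\<in>{\<nu><..N}. stop k y} = (\<Union>n\<in>{\<nu><..N}. V n)"
  proof (intro equalityI subsetI)
    fix y assume y: "y \<in> {y\<in>cell \<nu> x. \<exists>k\<in>{\<nu><..N}. stop k y}"
    define n where "n = (LEAST k. \<nu> < k \<and> k \<le> N \<and> stop k y)"
    have n: "\<nu> < n \<and> n \<le> N \<and> stop n y" unfolding n_def by (rule LeastI_ex) (use y in auto)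
    moreover have "\<not> stop k y" if "k \<in> {\<nu><..<n}" for k
      using not_less_Least[of k "\<lambda>k. \<nu> < k \<and> k \<le> N \<and> stop k y"] that n unfolding n_def[symmetric] by auto
    ultimately show "y \<in> (\<Union>n\<in>{\<nu><..N}. V n)" using y by (auto simp: V_def)
  qed (auto simp: V_def)
  let ?G = "{y\<in>cell \<nu> x. \<forall>k\<in>{\<nu><..N}. \<not> stop k y}"
  let ?B = "{y\<in>cell \<nu> x. \<exists>k\<in>{\<nu><..N}. stop k y}"
  have split: "sum m (cell \<nu> x) = sum m ?G + sum m ?B"
    by (subst sum.union_disjoint[symmetric]) (auto intro!: sum.cong)
  have "sum m ?B \<le> sum m (cell \<nu> x) / 2"
  proof (cases "avg \<nu> x = 0")
    case True
    then have "?B = {}" unfolding un using lev(2) by auto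
    then have "sum m ?B = 0" by (simp only: sum.empty)
    then show ?thesis using sum_m_pos[OF x, of \<nu>] by simp
  next
    case False
    then have a: "0 < avg \<nu> x" using avg_nonneg[of \<nu> x] by simp
    have "2 * avg \<nu> x * sum m ?B = (\<Sum>n\<in>{\<nu><..N}. 2 * avg \<nu> x * sum m (V n))"
      unfolding un by (subst sum.UNION_disjoint) (auto simp: disj sum_distrib_left intro: finite_subset[OF sub])
    also have "\<dots> \<le> (\<Sum>n\<in>{\<nu><..N}. sum F (V n))" by (intro sum_mono lev)
    also have "\<dots> = sum F ?B"
      unfolding un by (subst sum.UNION_disjoint) (auto simp: disj intro: finite_subset[OF sub])
    also have "\<dots> \<le> sum F (cell \<nu> x)"
      using F cell_subset by (intro sum_mono2) auto
    also have "\<dots> = avg \<nu> x * sum m (cell \<nu> x)" using sum_m_pos[OF x, of \<nu>] by (simp add: avg_def)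
    finally have "avg \<nu> x * (2 * sum m ?B) \<le> avg \<nu> x * sum m (cell \<nu> x)" by (simp only: mult_ac)
    then show ?thesis using a by (simp add: mult_le_cancel_left)
  qed
  then show ?thesis using split by linarith
qed


text \<open>A Carleson embedding for \<sigma>, proved by duality. The left side \<open>Z\<close> is
  at most the pairing of \<open>F\<close> with \<open>U\<close>, and \<open>sparse_powr_sum\<close>
  with the conjugate exponent bounds the L^q(\<sigma>) norm of \<open>U\<close> by \<open>Z\<close>
  again; half of \<open>Z\<close> is absorbed.\<close>

lemma weighted_stopping_sum_le:
  fixes \<sigma> :: "'k \<Rightarrow> real"
  assumes p: "1 < p" and \<kappa>: "0 < \<kappa>" "\<kappa> \<le> 1"
    and \<sigma>: "\<And>x. x \<in> Om \<Longrightarrow> 0 < \<sigma> x"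
    and big: "\<And>\<nu> x E. \<nu> \<le> N \<Longrightarrow> x \<in> Om \<Longrightarrow> E \<subseteq> cell \<nu> x \<Longrightarrow> sum m (cell \<nu> x) / 2 \<le> sum m E \<Longrightarrow>
      \<kappa> * sum \<sigma> (cell \<nu> x) \<le> sum \<sigma> E"
  shows "(\<Sum>\<nu>\<le>N. \<Sum>x\<in>Om. \<sigma> x * (of_bool (stop \<nu> x) * (sum F (cell \<nu> x) / sum \<sigma> (cell \<nu> x)) powr p))
    \<le> 2 * (1 / (2 * carleson_const (p/(p-1)) \<kappa>)) powr (- (p - 1)) * (\<Sum>x\<in>Om. F x powr p * \<sigma> x powr (1 - p))"
proof -
  note [simp del] = sum_mult_of_bool_eq sum_of_bool_mult_eq
  define q where "q = p / (p - 1)"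
  have q: "1 < q" "1/p + 1/q = 1" "(p - 1) * q = p" using p by (auto simp: q_def field_simps)
  define L where "L = carleson_const q \<kappa>"
  have L: "0 < L" unfolding L_def using q \<kappa> by (intro carleson_const_pos) auto
  \<comment> \<open>Parameter of Young's inequality, chosen so that the term returning
    \<open>Z\<close> has the factor 1/2.\<close>
  define t where "t = (1 / (2 * L)) powr (1 / q)"
  have t: "0 < t" "t powr q = 1 / (2 * L)" using L q by (auto simp: t_def powr_powr)
  have tp: "t powr (- p) = (1 / (2 * L)) powr (- (p - 1))"
    using p by (simp add: t_def powr_powr q_def)
  define A where "A \<nu> x = sum F (cell \<nu> x) / sum \<sigma> (cell \<nu> x)" for \<nu> x
  have A0: "0 \<le> A \<nu> x" for \<nu> x
    unfolding A_def using F \<sigma> cell_subset[of \<nu> x]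
    by (intro divide_nonneg_nonneg sum_nonneg) (auto intro: less_imp_le)
  have Aad: "adapted \<nu> (A \<nu>)" for \<nu>
    unfolding adapted_def A_def by (intro ballI impI) (drule cell_cong, simp)
  have SAad: "adapted \<nu> (\<lambda>x. of_bool (stop \<nu> x) * A \<nu> x powr e)" for \<nu> e
    unfolding adapted_def
  proof (intro ballI impI)
    fix x y assume a: "x \<in> Om" "y \<in> Om" "idx \<nu> x = idx \<nu> y"
    show "of_bool (stop \<nu> x) * A \<nu> x powr e = of_bool (stop \<nu> y) * A \<nu> y powr e"
      using adapted_stop[of \<nu>, unfolded adapted_def, rule_format, OF a] Aad[of \<nu>, unfolded adapted_def, rule_format, OF a]
      by simp
  qed
  define U where "U x = (\<Sum>\<nu>\<le>N. of_bool (stop \<nu> x) * A \<nu> x powr (p - 1))" for x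
  have U0: "0 \<le> U x" for x unfolding U_def by (intro sum_nonneg) auto
  define Z where "Z = (\<Sum>\<nu>\<le>N. \<Sum>x\<in>Om. \<sigma> x * (of_bool (stop \<nu> x) * A \<nu> x powr p))"
  define I where "I = (\<Sum>x\<in>Om. F x powr p * \<sigma> x powr (1 - p))"
  have "Z \<le> (\<Sum>\<nu>\<le>N. \<Sum>x\<in>Om. F x * (of_bool (stop \<nu> x) * A \<nu> x powr (p - 1)))"
    unfolding Z_def
  proof (rule sum_mono, rule sum_cell_mono)
    fix \<nu> x assume x: "x \<in> Om"
    have s: "0 < sum \<sigma> (cell \<nu> x)" by (rule sum_cell_pos[OF \<sigma> x])
    have "sum \<sigma> (cell \<nu> x) * A \<nu> x powr p = sum F (cell \<nu> x) * A \<nu> x powr (p - 1)"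
    proof -
      have "sum \<sigma> (cell \<nu> x) * A \<nu> x = sum F (cell \<nu> x)" using s by (simp add: A_def)
      moreover have "A \<nu> x powr p = A \<nu> x * A \<nu> x powr (p - 1)"
        using A0[of \<nu> x] p powr_mult_base[of "A \<nu> x" "p - 1"] by (cases "A \<nu> x = 0") auto
      ultimately show ?thesis by (metis mult.assoc)
    qed
    then show "(\<Sum>y\<in>cell \<nu> x. \<sigma> y * (of_bool (stop \<nu> y) * A \<nu> y powr p))
      \<le> (\<Sum>y\<in>cell \<nu> x. F y * (of_bool (stop \<nu> y) * A \<nu> y powr (p - 1)))"
      unfolding sum_cell_adapted[OF SAad x] by simp
  qed
  also have "\<dots> = (\<Sum>x\<in>Om. F x * U x)"
    unfolding U_def sum_distrib_left by (rule sum.swap)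
  also have "\<dots> \<le> (\<Sum>x\<in>Om. t powr (- p) * (F x powr p * \<sigma> x powr (1 - p)) + t powr q * (\<sigma> x * U x powr q))"
  proof (rule sum_mono)
    fix x assume x: "x \<in> Om"
    let ?a = "F x / (\<sigma> x * t)" and ?b = "t * U x"
    have "?a * ?b \<le> ?a powr p / p + ?b powr q / q"
      using p q F[OF x] \<sigma>[OF x] t U0 by (intro Youngs_inequality) (auto simp: less_imp_le)
    also have "\<dots> \<le> ?a powr p + ?b powr q"
      using p q by (intro add_mono) (auto simp: divide_le_eq mult_le_cancel_left1)
    finally have "\<sigma> x * (?a * ?b) \<le> \<sigma> x * (?a powr p + ?b powr q)"
      using \<sigma>[OF x] by (simp add: mult_left_mono)
    moreover have "\<sigma> x * (?a * ?b) = F x * U x" using \<sigma>[OF x] t by simp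
    moreover have "\<sigma> x * ?a powr p = t powr (- p) * (F x powr p * \<sigma> x powr (1 - p))"
      using \<sigma>[OF x] t F[OF x] by (simp add: powr_divide powr_mult powr_minus powr_diff field_simps)
    moreover have "\<sigma> x * ?b powr q = t powr q * (\<sigma> x * U x powr q)"
      using t U0 by (simp add: powr_mult)
    ultimately show "F x * U x \<le> t powr (- p) * (F x powr p * \<sigma> x powr (1 - p)) + t powr q * (\<sigma> x * U x powr q)"
      by (simp only: distrib_left)
  qed
  also have "\<dots> = t powr (- p) * I + t powr q * (\<Sum>x\<in>Om. \<sigma> x * U x powr q)"
    by (simp add: sum.distrib sum_distrib_left I_def)
  also have "(\<Sum>x\<in>Om. \<sigma> x * U x powr q) \<le> L * Z"
  proof -
    have "(\<Sum>x\<in>Om. \<sigma> x * U x powr q) \<le> L *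
       (\<Sum>\<nu>\<le>N. \<Sum>x\<in>Om. \<sigma> x * (of_bool (stop \<nu> x) * (A \<nu> x powr (p - 1)) powr q))"
      unfolding U_def L_def
    proof (rule sparse_powr_sum)
      show "adapted \<nu> (\<lambda>x. A \<nu> x powr (p - 1))" for \<nu>
        unfolding adapted_def
      proof (intro ballI impI)
        fix x y assume a: "x \<in> Om" "y \<in> Om" "idx \<nu> x = idx \<nu> y"
        show "A \<nu> x powr (p - 1) = A \<nu> y powr (p - 1)"
          using Aad[of \<nu>, unfolded adapted_def, rule_format, OF a] by simp
      qed
      show "\<kappa> * sum \<sigma> (cell \<nu> x) \<le> sum \<sigma> {y \<in> cell \<nu> x. \<forall>k\<in>{\<nu><..N}. \<not> stop k y}"
        if "\<nu> \<le> N" "x \<in> Om" "stop \<nu> x" for \<nu> x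
        by (rule big[OF that(1,2) _ stop_sparse[OF that(2,3)]]) auto
    qed (use q \<kappa> \<sigma> adapted_stop in \<open>auto simp: less_imp_le\<close>)
    then show ?thesis using A0 q by (simp add: Z_def powr_powr)
  qed
  finally have "Z \<le> t powr (- p) * I + t powr q * (L * Z)" using t L by (simp add: divide_right_mono)
  also have "t powr q * (L * Z) = Z / 2" using t L by simp
  finally have "Z \<le> 2 * t powr (- p) * I" by simp
  then show ?thesis unfolding Z_def A_def I_def tp L_def q_def .
qed

text \<open>The sum over all levels is first dominated by the stopping levels (this is where \<open>r < 1\<close>
  enters); then \<open>two_weight\<close> turns \<open>w\<^sub>1\<close> into \<open>w\<^sub>0\<close> cell by cell, and \<open>p\<^sub>0 \<le> p\<^sub>1\<close> allows to
  compare the resulting \<open>\<ell>\<close>-norms over the stopping cells.\<close>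

theorem two_weight_avg_sum:
  fixes \<sigma> w0 w1 :: "'k \<Rightarrow> real"
  assumes p: "1 < p0" "p0 \<le> p1" and \<kappa>: "0 < \<kappa>" "\<kappa> \<le> 1" and r: "0 < r" "r < 1" and B: "0 \<le> B" and K: "0 \<le> K"
    and w: "\<And>x. x \<in> Om \<Longrightarrow> 0 < \<sigma> x" "\<And>x. x \<in> Om \<Longrightarrow> 0 < w0 x" "\<And>x. x \<in> Om \<Longrightarrow> 0 < w1 x"
    and Ap: "\<And>\<nu> x. \<nu> \<le> N \<Longrightarrow> x \<in> Om \<Longrightarrow>
      sum w0 (cell \<nu> x) * sum \<sigma> (cell \<nu> x) powr (p0 - 1) \<le> B * sum m (cell \<nu> x) powr p0"
    and big: "\<And>\<nu> x E. \<nu> \<le> N \<Longrightarrow> x \<in> Om \<Longrightarrow> E \<subseteq> cell \<nu> x \<Longrightarrow> sum m (cell \<nu> x) / 2 \<le> sum m E \<Longrightarrow>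
      \<kappa> * sum \<sigma> (cell \<nu> x) \<le> sum \<sigma> E"
    and big1: "\<And>\<nu> x E. \<nu> \<le> N \<Longrightarrow> x \<in> Om \<Longrightarrow> E \<subseteq> cell \<nu> x \<Longrightarrow> sum m (cell \<nu> x) / 2 \<le> sum m E \<Longrightarrow>
      \<kappa> * sum w1 (cell \<nu> x) \<le> sum w1 E"
    and two_weight: "\<And>\<nu> x. \<nu> \<le> N \<Longrightarrow> x \<in> Om \<Longrightarrow>
      r ^ \<nu> * sum w1 (cell \<nu> x) powr (1 / p1) \<le> K * sum w0 (cell \<nu> x) powr (1 / p0)"
  shows "(\<Sum>x\<in>Om. w1 x * (\<Sum>\<nu>\<le>N. r ^ \<nu> * avg \<nu> x) powr p1)
    \<le> (2 / (1 - r)) powr p1 * carleson_const p1 \<kappa> * K powr p1 *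
      (B * (2 * (1 / (2 * carleson_const (p0/(p0-1)) \<kappa>)) powr (- (p0 - 1)))
        * (\<Sum>x\<in>Om. F x powr p0 * \<sigma> x powr (1 - p0))) powr (p1 / p0)"
proof -
  note [simp del] = sum_mult_of_bool_eq sum_of_bool_mult_eq
  have p1: "1 < p1" using p by simp
  define C2 where "C2 = 2 * (1 / (2 * carleson_const (p0/(p0-1)) \<kappa>)) powr (- (p0 - 1))"
  define I where "I = (\<Sum>x\<in>Om. F x powr p0 * \<sigma> x powr (1 - p0))"
  define L where "L = carleson_const p1 \<kappa>"
  have L: "0 < L" unfolding L_def using p1 \<kappa> by (intro carleson_const_pos) auto
  define Z where "Z = (\<Sum>\<nu>\<le>N. \<Sum>x\<in>Om. w0 x * (of_bool (stop \<nu> x) * avg \<nu> x powr p0))"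
  have Sad: "adapted \<nu> (\<lambda>x. of_bool (stop \<nu> x) * G (avg \<nu> x))" for \<nu> and G :: "real \<Rightarrow> real"
    unfolding adapted_def
  proof (intro ballI impI)
    fix x y assume a: "x \<in> Om" "y \<in> Om" "idx \<nu> x = idx \<nu> y"
    show "of_bool (stop \<nu> x) * G (avg \<nu> x) = of_bool (stop \<nu> y) * G (avg \<nu> y)"
      using adapted_stop[of \<nu>, unfolded adapted_def, rule_format, OF a] adapted_avg[of \<nu>, unfolded adapted_def, rule_format, OF a]
      by simp
  qed
  have Z0: "0 \<le> Z" unfolding Z_def using w by (intro sum_nonneg mult_nonneg_nonneg) (auto simp: less_imp_le)
  \<comment> \<open>On each cell the A_p bound \<open>Ap\<close> turns the \<open>m\<close>-average
    weighted by \<open>w0\<close> into the average relative to \<sigma>, to which the embedding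
    applies.\<close>
  have ZI: "Z \<le> B * C2 * I"
  proof -
    have "Z \<le> (\<Sum>\<nu>\<le>N. \<Sum>x\<in>Om. B * (\<sigma> x * (of_bool (stop \<nu> x) * (sum F (cell \<nu> x) / sum \<sigma> (cell \<nu> x)) powr p0)))"
      unfolding Z_def
    proof (rule sum_mono, rule sum_cell_mono)
      fix \<nu> x assume \<nu>: "\<nu> \<in> {..N}" and x: "x \<in> Om"
      let ?F = "sum F (cell \<nu> x)" and ?s = "sum \<sigma> (cell \<nu> x)" and ?w = "sum w0 (cell \<nu> x)" and ?m = "sum m (cell \<nu> x)"
      have pos: "0 < ?s" "0 < ?w" "0 < ?m" using sum_cell_pos[OF _ x] w m by auto
      have F0: "0 \<le> ?F" using F cell_subset by (intro sum_nonneg) auto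
      have ad: "adapted \<nu> (\<lambda>y. of_bool (stop \<nu> y) * (sum F (cell \<nu> y) / sum \<sigma> (cell \<nu> y)) powr p0)"
        unfolding adapted_def
      proof (intro ballI impI)
        fix x y assume a: "x \<in> Om" "y \<in> Om" "idx \<nu> x = idx \<nu> y"
        show "of_bool (stop \<nu> x) * (sum F (cell \<nu> x) / sum \<sigma> (cell \<nu> x)) powr p0 =
          of_bool (stop \<nu> y) * (sum F (cell \<nu> y) / sum \<sigma> (cell \<nu> y)) powr p0"
          using adapted_stop[of \<nu>, unfolded adapted_def, rule_format, OF a] cell_cong[OF a(3)] by simp
      qed
      have "?w * avg \<nu> x powr p0 \<le> B * ?s * (?F / ?s) powr p0"
      proof -
        have "?w * ?s powr (p0 - 1) \<le> B * ?m powr p0" using Ap \<nu> x by simp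
        then have "?w * ?s powr (p0 - 1) * (?F powr p0 / (?m powr p0 * ?s powr (p0 - 1)))
            \<le> B * ?m powr p0 * (?F powr p0 / (?m powr p0 * ?s powr (p0 - 1)))"
          by (intro mult_right_mono) auto
        moreover have "?w * ?s powr (p0 - 1) * (?F powr p0 / (?m powr p0 * ?s powr (p0 - 1))) = ?w * avg \<nu> x powr p0"
          using pos F0 by (simp add: avg_def powr_divide)
        moreover have "B * ?m powr p0 * (?F powr p0 / (?m powr p0 * ?s powr (p0 - 1))) = B * ?s * (?F / ?s) powr p0"
          using pos F0 by (simp add: powr_divide powr_diff)
        ultimately show ?thesis by simp
      qed
      then have "?w * (of_bool (stop \<nu> x) * avg \<nu> x powr p0) \<le> B * (?s * (of_bool (stop \<nu> x) * (?F / ?s) powr p0))"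
        by (cases "stop \<nu> x") (auto simp: mult.assoc)
      then show "(\<Sum>y\<in>cell \<nu> x. w0 y * (of_bool (stop \<nu> y) * avg \<nu> y powr p0))
        \<le> (\<Sum>y\<in>cell \<nu> x. B * (\<sigma> y * (of_bool (stop \<nu> y) * (sum F (cell \<nu> y) / sum \<sigma> (cell \<nu> y)) powr p0)))"
        unfolding sum_distrib_left[symmetric] sum_cell_adapted[OF Sad[of _ "\<lambda>u. u powr p0"] x] sum_cell_adapted[OF ad x] .
    qed
    also have "\<dots> \<le> B * (C2 * I)"
      unfolding sum_distrib_left[symmetric] C2_def I_def
      using weighted_stopping_sum_le[OF p(1) \<kappa> w(1) big] B by (simp add: mult_left_mono)
    finally show ?thesis by (simp add: mult.assoc)
  qed
  \<comment> \<open>A single stopping cell contributes at most the whole sum \<open>Z\<close>.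
    Raised to the power \<open>p1/p0 - 1\<close>, which is nonnegative, this turns a sum of
    \<open>p1/p0\<close>-th powers into a sum of first powers.\<close>
  have part: "sum w0 (cell \<nu> x) * avg \<nu> x powr p0 \<le> Z" if "\<nu> \<le> N" "x \<in> Om" "stop \<nu> x" for \<nu> x
  proof -
    have "sum w0 (cell \<nu> x) * avg \<nu> x powr p0 = (\<Sum>y\<in>cell \<nu> x. w0 y * (of_bool (stop \<nu> y) * avg \<nu> y powr p0))"
      unfolding sum_cell_adapted[OF Sad[of _ "\<lambda>u. u powr p0"] that(2)] using that(3) by simp
    also have "\<dots> \<le> (\<Sum>y\<in>Om. w0 y * (of_bool (stop \<nu> y) * avg \<nu> y powr p0))"
      using w cell_subset fin by (intro sum_mono2) (auto simp: less_imp_le)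
    also have "\<dots> \<le> Z"
      unfolding Z_def using that(1) w
      by (intro member_le_sum[of \<nu> _ "\<lambda>\<nu>. \<Sum>y\<in>Om. w0 y * (of_bool (stop \<nu> y) * avg \<nu> y powr p0)"])
        (auto intro!: sum_nonneg mult_nonneg_nonneg simp: less_imp_le)
    finally show ?thesis .
  qed
  have "(\<Sum>x\<in>Om. w1 x * (\<Sum>\<nu>\<le>N. r ^ \<nu> * avg \<nu> x) powr p1)
    \<le> (\<Sum>x\<in>Om. (2 / (1 - r)) powr p1 * (w1 x * (\<Sum>\<nu>\<le>N. of_bool (stop \<nu> x) * (r ^ \<nu> * avg \<nu> x)) powr p1))"
  proof (rule sum_mono)
    fix x assume x: "x \<in> Om"
    have "(\<Sum>\<nu>\<le>N. r ^ \<nu> * avg \<nu> x) powr p1 \<le> (2 / (1 - r) * (\<Sum>\<nu>\<le>N. of_bool (stop \<nu> x) * (r ^ \<nu> * avg \<nu> x))) powr p1"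
      using r p1 avg_nonneg by (intro powr_mono2 sum_avg_le_stop sum_nonneg) auto
    also have "\<dots> = (2 / (1 - r)) powr p1 * (\<Sum>\<nu>\<le>N. of_bool (stop \<nu> x) * (r ^ \<nu> * avg \<nu> x)) powr p1"
      by (rule powr_mult)
    finally show "w1 x * (\<Sum>\<nu>\<le>N. r ^ \<nu> * avg \<nu> x) powr p1
        \<le> (2 / (1 - r)) powr p1 * (w1 x * (\<Sum>\<nu>\<le>N. of_bool (stop \<nu> x) * (r ^ \<nu> * avg \<nu> x)) powr p1)"
      using mult_left_mono[of _ _ "w1 x"] w(3)[OF x] by (simp add: mult.left_commute)
  qed
  also have "\<dots> = (2 / (1 - r)) powr p1 * (\<Sum>x\<in>Om. w1 x * (\<Sum>\<nu>\<le>N. of_bool (stop \<nu> x) * (r ^ \<nu> * avg \<nu> x)) powr p1)"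
    by (simp only: sum_distrib_left)
  also have "(\<Sum>x\<in>Om. w1 x * (\<Sum>\<nu>\<le>N. of_bool (stop \<nu> x) * (r ^ \<nu> * avg \<nu> x)) powr p1)
     \<le> L * (\<Sum>\<nu>\<le>N. \<Sum>x\<in>Om. w1 x * (of_bool (stop \<nu> x) * (r ^ \<nu> * avg \<nu> x) powr p1))"
    unfolding L_def
  proof (rule sparse_powr_sum)
    show "adapted \<nu> (\<lambda>x. r ^ \<nu> * avg \<nu> x)" for \<nu>
      unfolding adapted_def
    proof (intro ballI impI)
      fix x y assume a: "x \<in> Om" "y \<in> Om" "idx \<nu> x = idx \<nu> y"
      show "r ^ \<nu> * avg \<nu> x = r ^ \<nu> * avg \<nu> y"
        using adapted_avg[of \<nu>, unfolded adapted_def, rule_format, OF a] by simp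
    qed
    show "\<kappa> * sum w1 (cell \<nu> x) \<le> sum w1 {y \<in> cell \<nu> x. \<forall>k\<in>{\<nu><..N}. \<not> stop k y}"
      if "\<nu> \<le> N" "x \<in> Om" "stop \<nu> x" for \<nu> x
      by (rule big1[OF that(1,2) _ stop_sparse[OF that(2,3)]]) auto
  qed (use p1 \<kappa> w r adapted_stop avg_nonneg in \<open>auto simp: less_imp_le\<close>)
  also have "(\<Sum>\<nu>\<le>N. \<Sum>x\<in>Om. w1 x * (of_bool (stop \<nu> x) * (r ^ \<nu> * avg \<nu> x) powr p1))
     \<le> (\<Sum>\<nu>\<le>N. \<Sum>x\<in>Om. (K powr p1 * Z powr (p1/p0 - 1)) * (w0 x * (of_bool (stop \<nu> x) * avg \<nu> x powr p0)))"
  proof (rule sum_mono, rule sum_cell_mono)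
    fix \<nu> x assume \<nu>: "\<nu> \<in> {..N}" and x: "x \<in> Om"
    let ?w1 = "sum w1 (cell \<nu> x)" and ?w0 = "sum w0 (cell \<nu> x)"
    have pos: "0 < ?w1" "0 < ?w0" using sum_cell_pos[OF _ x] w by auto
    have "?w1 * (r ^ \<nu> * avg \<nu> x) powr p1 \<le> K powr p1 * Z powr (p1/p0 - 1) * (?w0 * avg \<nu> x powr p0)" if st: "stop \<nu> x"
    proof -
      let ?y = "?w0 * avg \<nu> x powr p0"
      have y0: "0 \<le> ?y" using pos by simp
      have "(r ^ \<nu> * ?w1 powr (1/p1)) powr p1 \<le> (K * ?w0 powr (1/p0)) powr p1"
        using two_weight[of \<nu> x] \<nu> x r p1 by (intro powr_mono2) auto
      then have "(r ^ \<nu>) powr p1 * ?w1 \<le> K powr p1 * ?w0 powr (p1/p0)"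
        using pos r p1 K by (simp add: powr_mult powr_powr)
      then have "(r ^ \<nu>) powr p1 * ?w1 * avg \<nu> x powr p1 \<le> K powr p1 * ?w0 powr (p1/p0) * avg \<nu> x powr p1"
        by (rule mult_right_mono) simp
      moreover have "?w1 * (r ^ \<nu> * avg \<nu> x) powr p1 = (r ^ \<nu>) powr p1 * ?w1 * avg \<nu> x powr p1"
        using r avg_nonneg by (simp add: powr_mult)
      moreover have "?w0 powr (p1/p0) * avg \<nu> x powr p1 = ?y powr (p1/p0)"
        using pos p by (simp add: powr_mult powr_powr)
      moreover have "?y powr (p1/p0) \<le> Z powr (p1/p0 - 1) * ?y"
      proof (cases "?y = 0")
        case True
        then show ?thesis by (simp only: True)  simp
      next
        case False
        then have "?y powr (p1/p0) = ?y powr (p1/p0 - 1) * ?y"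
          using y0 by (simp add: powr_diff)
        also have "\<dots> \<le> Z powr (p1/p0 - 1) * ?y"
          using part[of \<nu> x] \<nu> x st y0 p by (intro mult_right_mono powr_mono2) auto
        finally show ?thesis .
      qed
      then have "K powr p1 * ?y powr (p1/p0) \<le> K powr p1 * (Z powr (p1/p0 - 1) * ?y)"
        by (rule mult_left_mono) simp
      ultimately show ?thesis by (simp only: mult.assoc)
    qed
    then have "?w1 * (of_bool (stop \<nu> x) * (r ^ \<nu> * avg \<nu> x) powr p1)
      \<le> K powr p1 * Z powr (p1/p0 - 1) * (?w0 * (of_bool (stop \<nu> x) * avg \<nu> x powr p0))"
      by (cases "stop \<nu> x") auto
    then show "(\<Sum>y\<in>cell \<nu> x. w1 y * (of_bool (stop \<nu> y) * (r ^ \<nu> * avg \<nu> y) powr p1))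
      \<le> (\<Sum>y\<in>cell \<nu> x. K powr p1 * Z powr (p1/p0 - 1) * (w0 y * (of_bool (stop \<nu> y) * avg \<nu> y powr p0)))"
      unfolding sum_distrib_left[symmetric] sum_cell_adapted[OF Sad[of _ "\<lambda>u. u powr p0"] x]
        sum_cell_adapted[OF Sad[of _ "\<lambda>u. (r ^ \<nu> * u) powr p1"] x] .
  qed
  also have "\<dots> = K powr p1 * Z powr (p1/p0 - 1) * Z"
    unfolding Z_def by (simp only: sum_distrib_left)
  also have "\<dots> = K powr p1 * Z powr (p1/p0)"
    using Z0 p by (cases "Z = 0") (auto simp: powr_diff)
  also have "\<dots> \<le> K powr p1 * (B * C2 * I) powr (p1/p0)"
    using ZI Z0 p by (intro mult_left_mono powr_mono2) auto
  finally show ?thesis using L r unfolding L_def[symmetric] C2_def[symmetric] I_def[symmetric]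
    by (simp add: mult_left_mono mult.assoc)
qed

end

section \<open>Muckenhoupt weights on cubes\<close>

lemma mem_cube: "x \<in> cube c l \<longleftrightarrow> (\<forall>i. \<bar>x $ i - c $ i\<bar> \<le> l / 2)"
proof -
  have "c $ i - l / 2 \<le> x $ i \<and> x $ i \<le> c $ i + l / 2 \<longleftrightarrow> \<bar>x $ i - c $ i\<bar> \<le> l / 2" for i
    by linarith
  then show ?thesis by (simp add: cube_def mem_box_cart)
qed

lemma cube_sets [measurable, simp]: "cube c l \<in> sets lebesgue" "cube c l \<in> sets borel"
  by (simp_all add: cube_def)

lemma compact_cube [simp]: "compact (cube c l)"
  by (simp add: cube_def)

lemma measure_cube:
  assumes "0 \<le> l"
  shows "measure lebesgue (cube (c::real^'n) l) = l ^ CARD('n)" "measure lborel (cube (c::real^'n) l) = l ^ CARD('n)"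
  using assms unfolding cube_def by (simp_all add: content_cbox_cart interval_ne_empty_cart)

text \<open>The weight conjugate to \<open>w\<close>, that is w^(1-p') with p' = p/(p-1).\<close>

definition dual_weight :: "real \<Rightarrow> (real^'n \<Rightarrow> real) \<Rightarrow> real^'n \<Rightarrow> real" where
  "dual_weight p w x = w x powr (- 1 / (p - 1))"

lemma weight_measure_nn_integral:
  assumes "set_integrable lebesgue E u" "\<And>x. 0 \<le> u x"
  shows "(\<integral>\<^sup>+x\<in>E. ennreal (u x) \<partial>lebesgue) = ennreal (weight_measure u E)"
proof -
  have "(\<integral>\<^sup>+x\<in>E. ennreal (u x) \<partial>lebesgue) = (\<integral>\<^sup>+x. ennreal (indicator E x *\<^sub>R u x) \<partial>lebesgue)"
    by (intro nn_integral_cong) (auto simp: indicator_def)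
  also have "\<dots> = ennreal (weight_measure u E)"
    using assms unfolding weight_measure_def set_lebesgue_integral_def set_integrable_def
    by (intro nn_integral_eq_integral) (auto simp: indicator_def)
  finally show ?thesis .
qed

lemma weight_measure_mono:
  assumes "set_integrable lebesgue F u" "\<And>x. 0 \<le> u x" "E \<subseteq> F" "E \<in> sets lebesgue"
  shows "weight_measure u E \<le> weight_measure u F"
  unfolding weight_measure_def set_lebesgue_integral_def
  using set_integrable_subset[OF assms(1,4,3)] assms(1-3)
  by (intro integral_mono) (auto simp: set_integrable_def indicator_def)

lemma weight_measure_nonneg: "(\<And>x. 0 \<le> u x) \<Longrightarrow> 0 \<le> weight_measure u E"
  unfolding weight_measure_def set_lebesgue_integral_def
  by (intro integral_nonneg_AE) (auto simp: indicator_def)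

lemma weight_measure_pos:
  fixes u :: "real^'n \<Rightarrow> real"
  assumes "set_integrable lebesgue E u" "\<And>x. 0 \<le> u x" "AE x in lebesgue. 0 < u x"
    and E: "E \<in> sets lebesgue" "0 < measure lebesgue E"
  shows "0 < weight_measure u E"
proof -
  have "weight_measure u E \<noteq> 0"
  proof
    assume "weight_measure u E = 0"
    then have "AE x in lebesgue. indicator E x *\<^sub>R u x = 0"
      using assms(1,2) unfolding weight_measure_def set_lebesgue_integral_def set_integrable_def
      by (subst (asm) integral_nonneg_eq_0_iff_AE) auto
    then have "AE x in lebesgue. x \<notin> E"
      using assms(3) by eventually_elim (auto simp: indicator_def split: if_splits)
    then have "E \<in> null_sets lebesgue" using E(1) by (simp add: AE_iff_null_sets)
    then show False using E(2) by (simp add: measure_eq_0_null_sets)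
  qed
  then show ?thesis using weight_measure_nonneg[of u E] assms(2) by simp
qed

lemma weight_borel_measurable:
  fixes w :: "real^'n \<Rightarrow> real"
  assumes "weight w" shows "w \<in> borel_measurable lebesgue"
proof (rule borel_measurable_LIMSEQ_real)
  show "(\<lambda>x. indicator (cube 0 (real n)) x *\<^sub>R w x) \<in> borel_measurable lebesgue" for n
    using assms compact_cube[of "0 :: real^'n" "real n"] unfolding weight_def set_integrable_def
    by (blast intro: borel_measurable_integrable)
  fix x :: "real^'n"
  obtain n where n: "2 * norm x \<le> real n" using real_arch_simple by blast
  have "indicator (cube 0 (real k)) x *\<^sub>R w x = w x" if "k \<ge> n" for k
  proof -
    have "\<bar>x $ i\<bar> \<le> real k / 2" for i
      using component_le_norm_cart[of x i] n that by linarith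
    then show ?thesis by (simp add: mem_cube)
  qed
  then have "\<forall>\<^sub>F k in sequentially. indicator (cube 0 (real k)) x *\<^sub>R w x = w x"
    by (auto simp: eventually_sequentially)
  then show "(\<lambda>k. indicator (cube 0 (real k)) x *\<^sub>R w x) \<longlonglongrightarrow> w x"
    by (rule tendsto_eventually)
qed

lemma ennreal_lincomb:
  "0 \<le> a \<Longrightarrow> 0 \<le> x \<Longrightarrow> 0 \<le> b \<Longrightarrow> 0 \<le> y \<Longrightarrow>
    ennreal (a * x + b * y) = ennreal a * ennreal x + ennreal b * ennreal y"
  by (simp add: ennreal_mult)

section \<open>Hoelder's inequality and the charging property of A_p weights\<close>

text \<open>Splits \<open>f\<close> into f w^(1/p) times w^(-1/p) and integrates Young's inequality
  after normalising both factors by strictly positive bounds. Letting these bounds decrease to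
  \<open>A\<close> and \<open>S\<close> covers the value 0.\<close>

lemma Hoelder_weight:
  fixes w f :: "real^'n \<Rightarrow> real"
  assumes p: "1 < p" and w: "w \<in> borel_measurable lebesgue" "AE x in lebesgue. 0 < w x" "\<And>x. 0 \<le> w x"
    and f: "f \<in> borel_measurable lebesgue" "\<And>x. 0 \<le> f x" and E: "E \<in> sets lebesgue"
    and A: "0 \<le> A" "(\<integral>\<^sup>+x\<in>E. ennreal (f x powr p * w x) \<partial>lebesgue) \<le> ennreal A"
    and S: "0 \<le> S" "(\<integral>\<^sup>+x\<in>E. ennreal (dual_weight p w x) \<partial>lebesgue) \<le> ennreal S"
  shows "(\<integral>\<^sup>+x\<in>E. ennreal (f x) \<partial>lebesgue) \<le> ennreal (A powr (1/p) * S powr (1 - 1/p))"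
proof -
  note [measurable] = w(1) f(1) E
  define q where "q = p / (p - 1)"
  have q: "1 < q" "1/p + 1/q = 1" "1/q = 1 - 1/p" using p by (auto simp: q_def field_simps)
  have pos: "(\<integral>\<^sup>+x\<in>E. ennreal (f x) \<partial>lebesgue) \<le> ennreal (a powr (1/p) * s powr (1 - 1/p))"
    if a: "0 < a" "A \<le> a" and s: "0 < s" "S \<le> s" for a s
  proof -
    define \<alpha> where "\<alpha> = a powr (1/p)"
    define \<beta> where "\<beta> = s powr (1/q)"
    have ab: "0 < \<alpha>" "0 < \<beta>" using a s by (auto simp: \<alpha>_def \<beta>_def)
    have ab': "\<alpha> powr p = a" "\<beta> powr q = s"
      using a s p q(1) by (auto simp: \<alpha>_def \<beta>_def powr_powr)
    have ineq: "f x \<le> \<alpha> * \<beta> / (p * a) * (f x powr p * w x) + \<alpha> * \<beta> / (q * s) * dual_weight p w x"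
      if wx: "0 < w x" for x
    proof -
      let ?a = "f x * w x powr (1/p) / \<alpha>" and ?b = "w x powr (- (1/p)) / \<beta>"
      have y: "?a * ?b \<le> ?a powr p / p + ?b powr q / q"
        using p q f(2)[of x] ab by (intro Youngs_inequality) auto
      have e1: "?a powr p = f x powr p * w x / a"
        using p f(2)[of x] ab wx ab' by (simp add: powr_divide powr_mult powr_powr)
      have e2: "?b powr q = dual_weight p w x / s"
      proof -
        have "(w x powr (- (1/p))) powr q = dual_weight p w x"
          using p by (simp add: powr_powr dual_weight_def q_def)
        then show ?thesis using ab ab' by (simp add: powr_divide)
      qed
      have e3: "?a * ?b = f x / (\<alpha> * \<beta>)"
      proof -
        have "w x powr (1/p) * w x powr (- (1/p)) = 1" using wx by (simp add: powr_add[symmetric])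
        then have "f x * (w x powr (1/p) * w x powr (- (1/p))) / (\<alpha> * \<beta>) = f x / (\<alpha> * \<beta>)" by (simp only: mult_1_right)
        then show ?thesis by (simp only: mult.assoc times_divide_times_eq)
      qed
      have "f x / (\<alpha> * \<beta>) \<le> f x powr p * w x / a / p + dual_weight p w x / s / q" using y unfolding e1 e2 e3 .
      then have "(f x / (\<alpha> * \<beta>)) * (\<alpha> * \<beta>) \<le> (f x powr p * w x / a / p + dual_weight p w x / s / q) * (\<alpha> * \<beta>)"
        using ab by (intro mult_right_mono) auto
      then show ?thesis using ab by (simp add: algebra_simps)
    qed
    have "(\<integral>\<^sup>+x\<in>E. ennreal (f x) \<partial>lebesgue) \<le>
       (\<integral>\<^sup>+x. ennreal (\<alpha> * \<beta> / (p * a)) * (ennreal (f x powr p * w x) * indicator E x)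
          + ennreal (\<alpha> * \<beta> / (q * s)) * (ennreal (dual_weight p w x) * indicator E x) \<partial>lebesgue)"
    proof (rule nn_integral_mono_AE)
      show "AE x in lebesgue. ennreal (f x) * indicator E x \<le>
        ennreal (\<alpha> * \<beta> / (p * a)) * (ennreal (f x powr p * w x) * indicator E x)
          + ennreal (\<alpha> * \<beta> / (q * s)) * (ennreal (dual_weight p w x) * indicator E x)"
        using w(2)
      proof eventually_elim
        case (elim x)
        have "ennreal (f x) \<le> ennreal (\<alpha> * \<beta> / (p * a)) * ennreal (f x powr p * w x)
          + ennreal (\<alpha> * \<beta> / (q * s)) * ennreal (dual_weight p w x)"
          using ennreal_leI[OF ineq[OF elim]] ab p q a s elim
          by (subst (asm) ennreal_lincomb) (auto simp: dual_weight_def)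
        then show ?case by (auto simp: indicator_def)
      qed
    qed
    also have "\<dots> = ennreal (\<alpha> * \<beta> / (p * a)) * (\<integral>\<^sup>+x\<in>E. ennreal (f x powr p * w x) \<partial>lebesgue)
       + ennreal (\<alpha> * \<beta> / (q * s)) * (\<integral>\<^sup>+x\<in>E. ennreal (dual_weight p w x) \<partial>lebesgue)"
      unfolding dual_weight_def by (subst nn_integral_add) (auto simp: nn_integral_cmult)
    also have "\<dots> \<le> ennreal (\<alpha> * \<beta> / (p * a)) * ennreal a + ennreal (\<alpha> * \<beta> / (q * s)) * ennreal s"
      using A(2) S(2) a s by (intro add_mono mult_left_mono) (auto elim!: order_trans intro: ennreal_leI)
    also have "\<dots> = ennreal (\<alpha> * \<beta> / p + \<alpha> * \<beta> / q)"
      using a s p q ab by (simp add: ennreal_mult[symmetric] ennreal_plus[symmetric] del: ennreal_plus)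
    also have "\<alpha> * \<beta> / p + \<alpha> * \<beta> / q = \<alpha> * \<beta>"
    proof -
      have "\<alpha> * \<beta> / p + \<alpha> * \<beta> / q = \<alpha> * \<beta> * (1/p + 1/q)" by (simp add: algebra_simps)
      then show ?thesis using q(2) by simp
    qed
    finally show ?thesis by (simp add: \<alpha>_def \<beta>_def q(3))
  qed
  have "(\<lambda>n. ennreal ((A + inverse (real (Suc n))) powr (1/p) * (S + inverse (real (Suc n))) powr (1 - 1/p)))
     \<longlonglongrightarrow> ennreal ((A + 0) powr (1/p) * (S + 0) powr (1 - 1/p))"
    using p A(1) S(1)
    by (intro tendsto_ennrealI tendsto_mult tendsto_powr' tendsto_add tendsto_const LIMSEQ_inverse_real_of_nat)
      (auto simp del: of_nat_Suc)
  then have "(\<integral>\<^sup>+x\<in>E. ennreal (f x) \<partial>lebesgue) \<le> ennreal ((A + 0) powr (1/p) * (S + 0) powr (1 - 1/p))"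
    by (rule LIMSEQ_le_const) (use A(1) S(1) in \<open>auto intro!: pos simp: add_nonneg_pos simp del: of_nat_Suc\<close>)
  then show ?thesis by simp
qed

text \<open>A quantitative \<open>A\<^sub>\<infinity>\<close> property on cubes.\<close>

definition fat_sets_charged :: "(real^'n \<Rightarrow> real) \<Rightarrow> real \<Rightarrow> real \<Rightarrow> bool" where
  "fat_sets_charged u e B \<longleftrightarrow> u \<in> borel_measurable lebesgue \<and> (\<forall>x. 0 \<le> u x) \<and> (AE x in lebesgue. 0 < u x) \<and>
    (\<forall>c l. 0 < l \<longrightarrow> set_integrable lebesgue (cube c l) u) \<and>
    (\<forall>c l E. 0 < l \<longrightarrow> E \<in> sets lebesgue \<longrightarrow> E \<subseteq> cube c l \<longrightarrow>
      (measure lebesgue E / measure lebesgue (cube c l)) powr e * weight_measure u (cube c l) \<le> B * weight_measure u E)"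

text \<open>Hoelder for the constant 1 bounds |E| by w(E)^(1/p) \<sigma>(E)^(1-1/p). Enlarging E to
  the cube in one of the two factors and inserting the A_p bound leaves the other factor; this
  yields the charging property for \<open>w\<close> with exponent p and for the dual weight with
  exponent p/(p-1).\<close>

lemma MuckenhouptE:
  fixes w :: "real^'n \<Rightarrow> real"
  assumes w: "w \<in> Muckenhoupt p" and p: "1 < p"
  obtains B where "0 < B"
    and "\<And>c l. 0 < l \<Longrightarrow> weight_measure w (cube c l) * weight_measure (dual_weight p w) (cube c l) powr (p - 1)
      \<le> B * measure lebesgue (cube c l) powr p"
    and "fat_sets_charged w p B"
    and "fat_sets_charged (dual_weight p w) (p / (p - 1)) (B powr (1 / (p - 1)))"
proof -
  let ?\<sigma> = "dual_weight p w"
  have deq: "?\<sigma> = (\<lambda>x. w x powr (- 1 / (p - 1)))" by (simp add: fun_eq_iff dual_weight_def)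
  have w0: "weight w" and \<sigma>i: "\<And>c l. 0 < l \<Longrightarrow> set_integrable lebesgue (cube c l) ?\<sigma>"
    using w unfolding Muckenhoupt_def deq by auto
  have wn: "\<And>x. 0 \<le> w x" and wp: "AE x in lebesgue. 0 < w x" and wi: "\<And>c l. set_integrable lebesgue (cube c l) w"
    using w0 by (auto simp: weight_def)
  have wm [measurable]: "w \<in> borel_measurable lebesgue" by (rule weight_borel_measurable[OF w0])
  have \<sigma>m [measurable]: "?\<sigma> \<in> borel_measurable lebesgue" unfolding dual_weight_def by measurable
  have \<sigma>n: "\<And>x. 0 \<le> ?\<sigma> x" by (simp add: dual_weight_def)
  have \<sigma>p: "AE x in lebesgue. 0 < ?\<sigma> x" using wp by eventually_elim (simp add: dual_weight_def)
  obtain B0 where B0: "\<And>c l. 0 < l \<Longrightarrow> average (cube c l) w * average (cube c l) ?\<sigma> powr (p - 1) \<le> B0"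
    using w unfolding Muckenhoupt_def bdd_above_def deq by blast
  define B where "B = max 1 B0"
  have B: "0 < B" by (simp add: B_def)
  have Ap: "weight_measure w (cube c l) * weight_measure ?\<sigma> (cube c l) powr (p - 1) \<le> B * measure lebesgue (cube c l) powr p"
    if l: "0 < l" for c l
  proof -
    let ?W = "weight_measure w (cube c l)" and ?S = "weight_measure ?\<sigma> (cube c l)" and ?M = "measure lebesgue (cube c l)"
    have M: "0 < ?M" using l by (simp add: measure_cube)
    have S: "0 \<le> ?S" by (rule weight_measure_nonneg[OF \<sigma>n])
    have "(?W / ?M) * (?S / ?M) powr (p - 1) \<le> B"
      using B0[OF l, of c] unfolding average_def weight_measure_def B_def by simp
    then have "(?W / ?M) * (?S / ?M) powr (p - 1) * ?M powr p \<le> B * ?M powr p" by (rule mult_right_mono) simp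
    moreover have "(?W / ?M) * (?S / ?M) powr (p - 1) * ?M powr p = ?W * ?S powr (p - 1)"
    proof -
      have "?M powr p = ?M * ?M powr (p - 1)" using powr_mult_base[of ?M "p - 1"] M by simp
      then show ?thesis using M S by (simp add: powr_divide)
    qed
    ultimately show ?thesis by simp
  qed
  have hol: "measure lebesgue E \<le> weight_measure w E powr (1/p) * weight_measure ?\<sigma> E powr (1 - 1/p)"
    if l: "0 < l" and E: "E \<in> sets lebesgue" "E \<subseteq> cube c l" for c l and E :: "(real^'n) set"
  proof -
    have i: "set_integrable lebesgue E w" "set_integrable lebesgue E ?\<sigma>"
      using set_integrable_subset[OF wi E] set_integrable_subset[OF \<sigma>i[OF l] E] by auto
    have fm: "E \<in> lmeasurable"
      by (rule fmeasurableI2[OF _ E(2,1)]) (simp add: cube_def)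
    have "(\<integral>\<^sup>+x\<in>E. ennreal 1 \<partial>lebesgue) \<le> ennreal (weight_measure w E powr (1/p) * weight_measure ?\<sigma> E powr (1 - 1/p))"
    proof (rule Hoelder_weight[OF p wm wp wn])
      show "(\<integral>\<^sup>+x\<in>E. ennreal (1 powr p * w x) \<partial>lebesgue) \<le> ennreal (weight_measure w E)"
        using weight_measure_nn_integral[OF i(1) wn] by simp
      show "(\<integral>\<^sup>+x\<in>E. ennreal (?\<sigma> x) \<partial>lebesgue) \<le> ennreal (weight_measure ?\<sigma> E)"
        using weight_measure_nn_integral[OF i(2) \<sigma>n] by simp
    qed (use E weight_measure_nonneg wn \<sigma>n in auto)
    then have "emeasure lebesgue E \<le> ennreal (weight_measure w E powr (1/p) * weight_measure ?\<sigma> E powr (1 - 1/p))"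
      using E by simp
    then show ?thesis
      using fm by (simp add: emeasure_eq_measure2 fmeasurableD2 emeasure_eq_ennreal_measure)
  qed
  have fw: "fat_sets_charged w p B"
    unfolding fat_sets_charged_def
  proof (intro conjI allI impI)
    fix c :: "real^'n" and l :: real and E :: "(real^'n) set"
    assume l: "0 < l" and E: "E \<in> sets lebesgue" "E \<subseteq> cube c l"
    let ?W = "weight_measure w (cube c l)" and ?S = "weight_measure ?\<sigma> (cube c l)" and ?M = "measure lebesgue (cube c l)"
    have M: "0 < ?M" using l by (simp add: measure_cube)
    have SE: "weight_measure ?\<sigma> E \<le> ?S" by (rule weight_measure_mono[OF \<sigma>i[OF l] \<sigma>n E(2,1)])
    have nn: "0 \<le> weight_measure w E" "0 \<le> weight_measure ?\<sigma> E" "0 \<le> ?W"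
      using weight_measure_nonneg wn \<sigma>n by auto
    have "measure lebesgue E powr p \<le> (weight_measure w E powr (1/p) * weight_measure ?\<sigma> E powr (1 - 1/p)) powr p"
      using hol[OF l E] p by (intro powr_mono2) auto
    also have "\<dots> = weight_measure w E * weight_measure ?\<sigma> E powr (p - 1)"
      using nn p by (simp add: powr_mult powr_powr algebra_simps)
    also have "\<dots> \<le> weight_measure w E * ?S powr (p - 1)"
      using nn SE p by (intro mult_left_mono powr_mono2) auto
    finally have "measure lebesgue E powr p * ?W \<le> weight_measure w E * ?S powr (p - 1) * ?W"
      using nn by (intro mult_right_mono)
    also have "\<dots> = weight_measure w E * (?W * ?S powr (p - 1))" by simp
    also have "\<dots> \<le> weight_measure w E * (B * ?M powr p)"
      using Ap[OF l, of c] nn by (intro mult_left_mono)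
    finally show "(measure lebesgue E / ?M) powr p * ?W \<le> B * weight_measure w E"
      using M by (simp add: powr_divide field_simps)
  qed (use wn wp wi in auto)
  have fs: "fat_sets_charged ?\<sigma> (p / (p - 1)) (B powr (1 / (p - 1)))"
    unfolding fat_sets_charged_def
  proof (intro conjI allI impI)
    fix c :: "real^'n" and l :: real and E :: "(real^'n) set"
    assume l: "0 < l" and E: "E \<in> sets lebesgue" "E \<subseteq> cube c l"
    let ?W = "weight_measure w (cube c l)" and ?S = "weight_measure ?\<sigma> (cube c l)" and ?M = "measure lebesgue (cube c l)"
    have M: "0 < ?M" using l by (simp add: measure_cube)
    have WE: "weight_measure w E \<le> ?W" by (rule weight_measure_mono[OF wi wn E(2,1)])
    have nn: "0 \<le> weight_measure w E" "0 \<le> weight_measure ?\<sigma> E" "0 \<le> ?W" "0 \<le> ?S"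
      using weight_measure_nonneg wn \<sigma>n by auto
    define q where "q = p / (p - 1)"
    have q: "0 < q" "(1/p) * q = 1 / (p - 1)" "(1 - 1/p) * q = 1" using p by (auto simp: q_def field_simps)
    have "measure lebesgue E powr q \<le> (weight_measure w E powr (1/p) * weight_measure ?\<sigma> E powr (1 - 1/p)) powr q"
      using hol[OF l E] q by (intro powr_mono2) auto
    also have "\<dots> = weight_measure w E powr (1 / (p - 1)) * weight_measure ?\<sigma> E"
      using nn by (simp add: powr_mult powr_powr q(2,3) del: times_divide_eq_left)
    also have "\<dots> \<le> ?W powr (1 / (p - 1)) * weight_measure ?\<sigma> E"
      using nn WE p by (intro mult_right_mono powr_mono2) auto
    finally have "measure lebesgue E powr q * ?S \<le> ?W powr (1 / (p - 1)) * weight_measure ?\<sigma> E * ?S"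
      using nn by (intro mult_right_mono)
    also have "\<dots> = (?W powr (1 / (p - 1)) * ?S) * weight_measure ?\<sigma> E" by simp
    also have "?W powr (1 / (p - 1)) * ?S = (?W * ?S powr (p - 1)) powr (1 / (p - 1))"
      using nn p by (simp add: powr_mult powr_powr)
    also have "(?W * ?S powr (p - 1)) powr (1 / (p - 1)) * weight_measure ?\<sigma> E
        \<le> (B * ?M powr p) powr (1 / (p - 1)) * weight_measure ?\<sigma> E"
      using Ap[OF l, of c] nn p by (intro mult_right_mono powr_mono2) auto
    also have "(B * ?M powr p) powr (1 / (p - 1)) = B powr (1 / (p - 1)) * ?M powr q"
      by (simp add: powr_mult powr_powr q_def)
    finally show "(measure lebesgue E / ?M) powr (p / (p - 1)) * ?S \<le> B powr (1 / (p - 1)) * weight_measure ?\<sigma> E"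
      using M by (simp add: powr_divide field_simps q_def)
  qed (use \<sigma>n \<sigma>p \<sigma>i in auto)
  show thesis by (rule that[OF B Ap fw fs])
qed

section \<open>Doubling and integrability against polynomial tails\<close>

text \<open>Doubling: the small cube is taken as the charged subset of the large one, and its
  relative volume is (l/L)^d.\<close>

lemma fat_sets_charged_cube:
  fixes u :: "real^'n \<Rightarrow> real" and e :: real
  assumes u: "fat_sets_charged u e B" and l: "0 < l" "l \<le> L" and sub: "cube c l \<subseteq> cube c' L" and B: "0 < B"
  shows "weight_measure u (cube c' L) \<le> B * (L / l) powr (CARD('n) * e) * weight_measure u (cube c l)"
proof -
  have L: "0 < L" using l by simp
  have "(measure lebesgue (cube c l) / measure lebesgue (cube c' L)) powr e * weight_measure u (cube c' L) \<le> B * weight_measure u (cube c l)"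
    using u L sub cube_sets(1) unfolding fat_sets_charged_def by blast
  then have *: "(l ^ CARD('n) / L ^ CARD('n)) powr e * weight_measure u (cube c' L) \<le> B * weight_measure u (cube c l)"
    using l L by (simp add: measure_cube)
  have eq: "(l ^ CARD('n) / L ^ CARD('n)) powr e = (l / L) powr (CARD('n) * e)"
  proof -
    have "l ^ CARD('n) / L ^ CARD('n) = (l / L) powr (real CARD('n))"
      using l L by (simp add: powr_realpow power_divide)
    then show ?thesis by (simp add: powr_powr)
  qed
  have "(L / l) powr (CARD('n) * e) * ((l / L) powr (CARD('n) * e) * weight_measure u (cube c' L))
    \<le> (L / l) powr (CARD('n) * e) * (B * weight_measure u (cube c l))"
    using * unfolding eq by (intro mult_left_mono) auto
  also have "\<dots> = B * (L / l) powr (CARD('n) * e) * weight_measure u (cube c l)"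
    by (simp only: mult.assoc mult.left_commute[of B])
  also have "(L / l) powr (CARD('n) * e) * ((l / L) powr (CARD('n) * e) * weight_measure u (cube c' L)) = weight_measure u (cube c' L)"
  proof -
    have "(L / l) powr (CARD('n) * e) * (l / L) powr (CARD('n) * e) = 1"
      using l L by (simp add: powr_mult[symmetric])
    then show ?thesis by (simp only: mult.assoc[symmetric] mult_1)
  qed
  finally show ?thesis .
qed

text \<open>Let \<open>j\<close> be least such that the cube of side \<open>2 ^ j * l\<close>
  contains \<open>x\<close>. If it is positive, \<open>x\<close> lies outside the previous cube, so
  \<open>norm (x - c) / l\<close> exceeds \<open>2 ^ j / 4\<close>.\<close>

lemma polynomial_tail_le_cubes:
  fixes x c :: "real^'n"
  assumes l: "0 < l"
  shows "ennreal (1 / (1 + norm (x - c) / l) ^ k) \<le> (\<Sum>j. ennreal ((4 / 2 ^ j) ^ k) * indicator (cube c (2 ^ j * l)) x)"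
proof -
  have "\<exists>j. x \<in> cube c (2 ^ j * l)"
  proof -
    obtain j where j: "2 * norm (x - c) / l < 2 ^ j" using real_arch_pow[of 2] by auto
    have "\<bar>x $ i - c $ i\<bar> \<le> 2 ^ j * l / 2" for i
      using component_le_norm_cart[of "x - c" i] j l by (simp add: field_simps)
    then show ?thesis by (auto simp: mem_cube)
  qed
  define j where "j = (LEAST j. x \<in> cube c (2 ^ j * l))"
  have xj: "x \<in> cube c (2 ^ j * l)" unfolding j_def by (rule LeastI_ex) fact
  have "1 / (1 + norm (x - c) / l) ^ k \<le> (4 / 2 ^ j) ^ k"
  proof (cases j)
    case 0
    have "1 \<le> (1 + norm (x - c) / l) ^ k" using l by (intro one_le_power) auto
    then have "1 / (1 + norm (x - c) / l) ^ k \<le> 1" by (simp add: divide_le_eq_1)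
    also have "\<dots> \<le> (4 / 2 ^ j) ^ k" using 0 by (intro one_le_power) auto
    finally show ?thesis .
  next
    case (Suc m)
    then have "x \<notin> cube c (2 ^ m * l)" using not_less_Least[of m "\<lambda>j. x \<in> cube c (2 ^ j * l)"] by (simp add: j_def[symmetric])
    then obtain i where "2 ^ m * l / 2 < \<bar>x $ i - c $ i\<bar>" by (auto simp: mem_cube not_le)
    then have "2 ^ m * l / 2 < norm (x - c)" using component_le_norm_cart[of "x - c" i] by simp
    then have "2 ^ j / 4 \<le> 1 + norm (x - c) / l" using l Suc by (simp add: field_simps)
    then have "(2 ^ j / 4) ^ k \<le> (1 + norm (x - c) / l) ^ k" by (intro power_mono) auto
    then have "1 / (1 + norm (x - c) / l) ^ k \<le> 1 / (2 ^ j / 4) ^ k"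
      using l by (intro divide_left_mono mult_pos_pos zero_less_power) (auto simp: add_pos_nonneg)
    then show ?thesis by (simp add: power_divide)
  qed
  then have "ennreal (1 / (1 + norm (x - c) / l) ^ k) \<le> ennreal ((4 / 2 ^ j) ^ k) * indicator (cube c (2 ^ j * l)) x"
    using xj by (simp add: ennreal_leI)
  also have "\<dots> \<le> (\<Sum>j. ennreal ((4 / 2 ^ j) ^ k) * indicator (cube c (2 ^ j * l)) x)"
  proof -
    have "g j \<le> suminf g" for g :: "nat \<Rightarrow> ennreal" using sum_le_suminf[of g "{j}"] by simp
    then show ?thesis .
  qed
  finally show ?thesis .
qed

text \<open>On the cube of side \<open>2 ^ j * l\<close>, Hoelder and doubling of the dual weight
  cost \<open>2 ^ (j * CARD('n))\<close>, since the doubling exponent times \<open>1 - 1/p\<close>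
  is exactly the dimension. One more power of decay leaves 2^(-j). The lemma makes weighted L^p
  functions tempered and controls Gaussian tails in the necessity part.\<close>

lemma Lp_polynomial_tail:
  fixes w :: "real^'n \<Rightarrow> real"
  assumes w: "w \<in> Muckenhoupt p" and p: "1 < p"
  obtains C where "0 < C" and "\<And>c l f A. 0 < l \<Longrightarrow> f \<in> borel_measurable lebesgue \<Longrightarrow> (\<And>x. 0 \<le> f x) \<Longrightarrow> 0 \<le> A \<Longrightarrow>
    (\<integral>\<^sup>+x. ennreal (f x powr p * w x) \<partial>lebesgue) \<le> ennreal A \<Longrightarrow>
    (\<integral>\<^sup>+x. ennreal (f x / (1 + norm (x - c) / l) ^ (CARD('n) + 1)) \<partial>lebesgue)
      \<le> ennreal (C * A powr (1/p) * weight_measure (dual_weight p w) (cube c l) powr (1 - 1/p))"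
proof -
  obtain B where B: "0 < B" and fw: "fat_sets_charged w p B"
    and fs: "fat_sets_charged (dual_weight p w) (p / (p - 1)) (B powr (1 / (p - 1)))"
    by (rule MuckenhouptE[OF w p]) auto
  let ?\<sigma> = "dual_weight p w" and ?k = "CARD('n) + 1"
  define B' where "B' = B powr (1 / (p - 1))"
  have B': "0 < B'" using B by (simp add: B'_def)
  define C where "C = 4 ^ ?k * B' powr (1 - 1/p) * 2"
  have C: "0 < C" using B' by (simp add: C_def)
  have wm [measurable]: "w \<in> borel_measurable lebesgue" and wp: "AE x in lebesgue. 0 < w x" and wn: "\<And>x. 0 \<le> w x"
    using fw by (auto simp: fat_sets_charged_def)
  have \<sigma>n: "\<And>x. 0 \<le> ?\<sigma> x" by (simp add: dual_weight_def)
  have main: "(\<integral>\<^sup>+x. ennreal (f x / (1 + norm (x - c) / l) ^ ?k) \<partial>lebesgue)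
      \<le> ennreal (C * A powr (1/p) * weight_measure ?\<sigma> (cube c l) powr (1 - 1/p))"
    if l: "0 < l" and f [measurable]: "f \<in> borel_measurable lebesgue" and f0: "\<And>x. 0 \<le> f x" and A: "0 \<le> A"
      "(\<integral>\<^sup>+x. ennreal (f x powr p * w x) \<partial>lebesgue) \<le> ennreal A" for c l f A
  proof -
    let ?S = "weight_measure ?\<sigma> (cube c l)"
    have S0: "0 \<le> ?S" by (rule weight_measure_nonneg[OF \<sigma>n])
    define D where "D = 4 ^ ?k * B' powr (1 - 1/p) * A powr (1/p) * ?S powr (1 - 1/p)"
    have D: "0 \<le> D" by (simp add: D_def)
    have cubej: "ennreal ((4 / 2 ^ j) ^ ?k) * (\<integral>\<^sup>+x\<in>cube c (2 ^ j * l). ennreal (f x) \<partial>lebesgue) \<le> ennreal (D * (1/2) ^ j)" for j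
    proof -
      have lj: "0 < 2 ^ j * l" using l by simp
      have si: "set_integrable lebesgue (cube c (2 ^ j * l)) ?\<sigma>"
        using fs lj unfolding fat_sets_charged_def by blast
      have "(\<integral>\<^sup>+x\<in>cube c (2 ^ j * l). ennreal (f x) \<partial>lebesgue)
        \<le> ennreal (A powr (1/p) * weight_measure ?\<sigma> (cube c (2 ^ j * l)) powr (1 - 1/p))"
      proof (rule Hoelder_weight[OF p wm wp wn f f0 _ A(1)])
        have "(\<integral>\<^sup>+x\<in>cube c (2 ^ j * l). ennreal (f x powr p * w x) \<partial>lebesgue) \<le> (\<integral>\<^sup>+x. ennreal (f x powr p * w x) \<partial>lebesgue)"
          by (intro nn_integral_mono) (auto simp: indicator_def)
        then show "(\<integral>\<^sup>+x\<in>cube c (2 ^ j * l). ennreal (f x powr p * w x) \<partial>lebesgue) \<le> ennreal A" using A(2) by simp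
        show "(\<integral>\<^sup>+x\<in>cube c (2 ^ j * l). ennreal (?\<sigma> x) \<partial>lebesgue) \<le> ennreal (weight_measure ?\<sigma> (cube c (2 ^ j * l)))"
          using weight_measure_nn_integral[OF si \<sigma>n] by simp
      qed (auto simp: weight_measure_nonneg \<sigma>n)
      also have "\<dots> \<le> ennreal (A powr (1/p) * (B' * (2 ^ j) powr (CARD('n) * (p / (p - 1))) * ?S) powr (1 - 1/p))"
      proof (intro ennreal_leI mult_left_mono powr_mono2)
        have "weight_measure ?\<sigma> (cube c (2 ^ j * l)) \<le> B' * (2 ^ j * l / l) powr (CARD('n) * (p / (p - 1))) * ?S"
        proof (rule fat_sets_charged_cube[OF fs[folded B'_def] l])
          show "l \<le> 2 ^ j * l" using l by simp
          have "l / 2 \<le> 2 ^ j * l / 2" using l by simp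
          then show "cube c l \<subseteq> cube c (2 ^ j * l)" unfolding subset_iff mem_cube by (blast intro: order_trans)
        qed (rule B')
        then show "weight_measure ?\<sigma> (cube c (2 ^ j * l)) \<le> B' * (2 ^ j) powr (CARD('n) * (p / (p - 1))) * ?S"
          using l by simp
      qed (use p \<sigma>n weight_measure_nonneg in auto)
      also have "A powr (1/p) * (B' * (2 ^ j) powr (CARD('n) * (p / (p - 1))) * ?S) powr (1 - 1/p)
        = A powr (1/p) * B' powr (1 - 1/p) * 2 ^ (j * CARD('n)) * ?S powr (1 - 1/p)"
      proof -
        have "CARD('n) * (p / (p - 1)) * (1 - 1/p) = real CARD('n)" using p by (simp add: field_simps)
        then have "((2::real) ^ j) powr (CARD('n) * (p / (p - 1)) * (1 - 1/p)) = 2 ^ (j * CARD('n))"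
          by (simp add: powr_realpow power_mult)
        then show ?thesis by (simp add: powr_mult powr_powr)
      qed
      finally have "ennreal ((4 / 2 ^ j) ^ ?k) * (\<integral>\<^sup>+x\<in>cube c (2 ^ j * l). ennreal (f x) \<partial>lebesgue)
         \<le> ennreal ((4 / 2 ^ j) ^ ?k) * ennreal (A powr (1/p) * B' powr (1 - 1/p) * 2 ^ (j * CARD('n)) * ?S powr (1 - 1/p))"
        by (rule mult_left_mono) simp
      also have "\<dots> = ennreal ((4 / 2 ^ j) ^ ?k * (A powr (1/p) * B' powr (1 - 1/p) * 2 ^ (j * CARD('n)) * ?S powr (1 - 1/p)))"
        by (rule ennreal_mult[symmetric]) auto
      also have "(4 / 2 ^ j) ^ ?k * (A powr (1/p) * B' powr (1 - 1/p) * 2 ^ (j * CARD('n)) * ?S powr (1 - 1/p)) = D * (1/2) ^ j"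
      proof -
        have "(4 / 2 ^ j) ^ ?k * 2 ^ (j * CARD('n)) = (4::real) ^ ?k * (1/2) ^ j"
          by (simp add: power_divide power_mult power_one_over field_simps)
        then have "(4 / 2 ^ j) ^ ?k * 2 ^ (j * CARD('n)) * (A powr (1/p) * B' powr (1 - 1/p) * ?S powr (1 - 1/p))
          = (4::real) ^ ?k * (1/2) ^ j * (A powr (1/p) * B' powr (1 - 1/p) * ?S powr (1 - 1/p))" by (simp only:)
        then show ?thesis unfolding D_def by (simp only: mult_ac)
      qed
      finally show ?thesis .
    qed
    have "(\<integral>\<^sup>+x. ennreal (f x / (1 + norm (x - c) / l) ^ ?k) \<partial>lebesgue) \<le>
      (\<integral>\<^sup>+x. (\<Sum>j. ennreal ((4 / 2 ^ j) ^ ?k) * (ennreal (f x) * indicator (cube c (2 ^ j * l)) x)) \<partial>lebesgue)"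
    proof (rule nn_integral_mono)
      fix x
      have "ennreal (f x / (1 + norm (x - c) / l) ^ ?k) = ennreal (f x) * ennreal (1 / (1 + norm (x - c) / l) ^ ?k)"
        using f0[of x] l by (subst ennreal_mult[symmetric]) auto
      also have "\<dots> \<le> ennreal (f x) * (\<Sum>j. ennreal ((4 / 2 ^ j) ^ ?k) * indicator (cube c (2 ^ j * l)) x)"
        by (intro mult_left_mono polynomial_tail_le_cubes[OF l]) auto
      also have "\<dots> = (\<Sum>j. ennreal ((4 / 2 ^ j) ^ ?k) * (ennreal (f x) * indicator (cube c (2 ^ j * l)) x))"
        unfolding ennreal_suminf_cmult[symmetric] by (simp only: mult_ac)
      finally show "ennreal (f x / (1 + norm (x - c) / l) ^ ?k)
        \<le> (\<Sum>j. ennreal ((4 / 2 ^ j) ^ ?k) * (ennreal (f x) * indicator (cube c (2 ^ j * l)) x))" .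
    qed
    also have "\<dots> = (\<Sum>j. ennreal ((4 / 2 ^ j) ^ ?k) * (\<integral>\<^sup>+x\<in>cube c (2 ^ j * l). ennreal (f x) \<partial>lebesgue))"
      by (subst nn_integral_suminf) (auto intro!: suminf_cong nn_integral_cmult)
    also have "\<dots> \<le> (\<Sum>j. ennreal (D * (1/2) ^ j))"
      by (intro suminf_le cubej) auto
    also have "\<dots> = ennreal (D * 2)"
      using D sums_mult[OF geometric_sums[of "1/2::real"], of D]
      by (subst suminf_ennreal2) (auto simp: sums_iff)
    also have "D * 2 = C * A powr (1/p) * ?S powr (1 - 1/p)" by (simp add: D_def C_def)
    finally show ?thesis .
  qed
  show thesis by (rule that[OF C main])
qed

section \<open>Shifted dyadic grids\<close>

text \<open>The side of the cells is \<open>L\<close>, and the shift \<theta> is measured in units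
  of \<open>L\<close>. The floor makes cells half-open, so that they partition the space.\<close>

definition grid_index :: "real \<Rightarrow> real^'n \<Rightarrow> real^'n \<Rightarrow> int^'n" where
  "grid_index L \<theta> x = (\<chi> i. \<lfloor>x $ i / L - \<theta> $ i\<rfloor>)"

definition grid_cell :: "real \<Rightarrow> real^'n \<Rightarrow> int^'n \<Rightarrow> (real^'n) set" where
  "grid_cell L \<theta> k = {x. grid_index L \<theta> x = k}"

lemma mem_grid_cell:
  assumes "0 < L"
  shows "x \<in> grid_cell L \<theta> k \<longleftrightarrow>
    (\<forall>i. L * (of_int (k $ i) + \<theta> $ i) \<le> x $ i \<and> x $ i < L * (of_int (k $ i) + \<theta> $ i + 1))"
proof -
  have "\<lfloor>x $ i / L - \<theta> $ i\<rfloor> = k $ i \<longleftrightarrow>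
    L * (of_int (k $ i) + \<theta> $ i) \<le> x $ i \<and> x $ i < L * (of_int (k $ i) + \<theta> $ i + 1)" for i
    unfolding floor_eq_iff using assms by (simp add: field_simps)
  then show ?thesis by (simp add: grid_cell_def grid_index_def vec_eq_iff)
qed

definition grid_center :: "real \<Rightarrow> real^'n \<Rightarrow> int^'n \<Rightarrow> real^'n" where
  "grid_center L \<theta> k = (\<chi> i. L * (of_int (k $ i) + \<theta> $ i + 1/2))"

lemma grid_cell_subset_cube: "0 < L \<Longrightarrow> grid_cell L \<theta> k \<subseteq> cube (grid_center L \<theta> k) L"
proof
  fix x assume L: "0 < L" and "x \<in> grid_cell L \<theta> k"
  then have x: "L * (of_int (k $ i) + \<theta> $ i) \<le> x $ i \<and> x $ i < L * (of_int (k $ i) + \<theta> $ i + 1)" for i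
    by (simp add: mem_grid_cell)
  have "\<bar>x $ i - L * (of_int (k $ i) + \<theta> $ i + 1/2)\<bar> \<le> L / 2" for i
    using x[of i] unfolding distrib_left abs_le_iff by linarith
  then show "x \<in> cube (grid_center L \<theta> k) L" by (simp add: mem_cube grid_center_def)
qed

lemma box_subset_grid_cell:
  "0 < L \<Longrightarrow> box (\<chi> i. L * (of_int (k $ i) + \<theta> $ i)) (\<chi> i. L * (of_int (k $ i) + \<theta> $ i + 1)) \<subseteq> grid_cell L \<theta> k"
  by (auto simp: mem_grid_cell mem_box_cart less_imp_le)

lemma grid_cell_borel [measurable]: "grid_cell L \<theta> k \<in> sets borel"
proof -
  have "grid_cell L \<theta> k = (\<Inter>i. {x. \<lfloor>x $ i / L - \<theta> $ i\<rfloor> = k $ i})"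
    by (auto simp: grid_cell_def grid_index_def vec_eq_iff)
  also have "\<dots> \<in> sets borel" by measurable
  finally show ?thesis .
qed

lemma grid_cell_lebesgue [measurable]: "grid_cell L \<theta> k \<in> sets lebesgue"
  using grid_cell_borel by simp

lemma grid_cell_lmeasurable: "0 < L \<Longrightarrow> grid_cell L \<theta> k \<in> lmeasurable"
  by (rule fmeasurableI2[OF _ grid_cell_subset_cube grid_cell_lebesgue]) (auto simp: cube_def)

text \<open>The half-open cell lies between an open box and a closed cube of equal volume.\<close>

lemma measure_grid_cell:
  fixes \<theta> :: "real^'n"
  assumes L: "0 < L"
  shows "measure lebesgue (grid_cell L \<theta> k) = L ^ CARD('n)"
proof (rule antisym)
  show "measure lebesgue (grid_cell L \<theta> k) \<le> L ^ CARD('n)"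
  proof -
    have "measure lebesgue (grid_cell L \<theta> k) \<le> measure lebesgue (cube (grid_center L \<theta> k) L)"
      by (rule measure_mono_fmeasurable[OF grid_cell_subset_cube[OF L] grid_cell_lebesgue]) (simp add: cube_def)
    then show ?thesis unfolding measure_cube(1)[OF less_imp_le[OF L]] .
  qed
  let ?B = "box (\<chi> i. L * (of_int (k $ i) + \<theta> $ i)) (\<chi> i. L * (of_int (k $ i) + \<theta> $ i + 1))"
  have "L ^ CARD('n) = measure lebesgue ?B"
  proof -
    have "measure lebesgue ?B = measure lborel (cbox (\<chi> i. L * (of_int (k $ i) + \<theta> $ i)) (\<chi> i. L * (of_int (k $ i) + \<theta> $ i + 1)))"
      using L by (simp add: measure_lborel_box_eq measure_lborel_cbox_eq)
    also have "\<dots> = L ^ CARD('n)"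
      using L by (subst content_cbox_cart) (auto simp: interval_ne_empty_cart algebra_simps)
    finally show ?thesis by simp
  qed
  also have "\<dots> \<le> measure lebesgue (grid_cell L \<theta> k)"
    by (rule measure_mono_fmeasurable[OF box_subset_grid_cell[OF L] _ grid_cell_lmeasurable[OF L]]) simp
  finally show "L ^ CARD('n) \<le> measure lebesgue (grid_cell L \<theta> k)" .
qed

lemma fat_sets_charged_grid_cell:
  fixes u :: "real^'n \<Rightarrow> real"
  assumes u: "fat_sets_charged u e B" and L: "0 < L" and E: "E \<in> sets lebesgue" "E \<subseteq> grid_cell L \<theta> k"
  shows "(measure lebesgue E / measure lebesgue (grid_cell L \<theta> k)) powr e * weight_measure u (grid_cell L \<theta> k) \<le> B * weight_measure u E"
proof -
  let ?Q = "cube (grid_center L \<theta> k) L"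
  have sub: "grid_cell L \<theta> k \<subseteq> ?Q" by (rule grid_cell_subset_cube[OF L])
  have si: "set_integrable lebesgue ?Q u" and n: "\<And>x. 0 \<le> u x" using u L by (auto simp: fat_sets_charged_def)
  have 1: "(measure lebesgue E / measure lebesgue ?Q) powr e * weight_measure u ?Q \<le> B * weight_measure u E"
    using u L E sub unfolding fat_sets_charged_def by blast
  have 2: "measure lebesgue ?Q = measure lebesgue (grid_cell L \<theta> k)"
    unfolding measure_grid_cell[OF L] using L by (intro measure_cube) simp
  have "(measure lebesgue E / measure lebesgue (grid_cell L \<theta> k)) powr e * weight_measure u (grid_cell L \<theta> k)
      \<le> (measure lebesgue E / measure lebesgue (grid_cell L \<theta> k)) powr e * weight_measure u ?Q"
    by (intro mult_left_mono weight_measure_mono[OF si n sub grid_cell_lebesgue]) auto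
  also note 1[unfolded 2]
  finally show ?thesis .
qed

lemma fat_sets_charged_integrable_grid_cell:
  assumes u: "fat_sets_charged u e B" and L: "0 < L"
  shows "set_integrable lebesgue (grid_cell L \<theta> k) u"
  using u L set_integrable_subset[OF _ grid_cell_lebesgue grid_cell_subset_cube[OF L]]
  unfolding fat_sets_charged_def by blast

text \<open>The dyadic cube centred at the lattice point nearest to the centre of the cell lies,
  like the cell, in the concentric cube of triple side. Doubling relates all three; the ratio
  \<open>L * 2 ^ \<nu>\<close> of the sides enters only through \<open>w1\<close>, and the two
  comparisons with the triple cube cost 3^d each.\<close>

lemma two_weight_grid_cell:
  fixes w0 w1 :: "real^'n \<Rightarrow> real"
  assumes w0: "fat_sets_charged w0 p0 B0" and w1: "fat_sets_charged w1 p1 B1"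
    and p: "0 < p0" "0 < p1" and B: "0 < B0" "0 < B1" and K: "0 \<le> K"
    and dyadic: "\<And>\<nu> m. 2 powr (- real \<nu> * s) * weight_measure w1 (dyadic_cube \<nu> m) powr (1 / p1)
      \<le> K * weight_measure w0 (dyadic_cube \<nu> m) powr (1 / p0)"
    and L: "0 < L" "1 / 2 ^ \<nu> \<le> L"
  shows "weight_measure w1 (grid_cell L \<theta> k) powr (1 / p1)
    \<le> B1 powr (1/p1) * B0 powr (1/p0) * 9 ^ CARD('n) * K * (L * 2 ^ \<nu>) ^ CARD('n) * 2 powr (real \<nu> * s)
      * weight_measure w0 (grid_cell L \<theta> k) powr (1 / p0)"
proof -
  let ?n = "CARD('n)"
  let ?g = "grid_cell L \<theta> k" and ?c = "grid_center L \<theta> k"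
  let ?Q = "cube ?c (3 * L)"
  define m :: "int^'n" where "m = (\<chi> i. round (?c $ i * 2 ^ \<nu>))"
  let ?D = "dyadic_cube \<nu> m"
  have DQ: "?D \<subseteq> ?Q"
  proof
    fix x assume "x \<in> ?D"
    then have x: "\<bar>x $ i - of_int (m $ i) / 2 ^ \<nu>\<bar> \<le> (1 / 2 ^ \<nu>) / 2" for i
      by (simp add: dyadic_cube_def mem_cube)
    have c: "\<bar>of_int (m $ i) / 2 ^ \<nu> - ?c $ i\<bar> \<le> (1 / 2 ^ \<nu>) / 2" for i
    proof -
      have "\<bar>of_int (m $ i) - ?c $ i * 2 ^ \<nu>\<bar> \<le> 1 / 2"
        unfolding m_def using of_int_round_abs_le[of "?c $ i * 2 ^ \<nu>"] by simp
      then have "\<bar>of_int (m $ i) - ?c $ i * 2 ^ \<nu>\<bar> / 2 ^ \<nu> \<le> (1 / 2) / 2 ^ \<nu>" by (rule divide_right_mono) simp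
      moreover have "\<bar>of_int (m $ i) - ?c $ i * 2 ^ \<nu>\<bar> / 2 ^ \<nu> = \<bar>of_int (m $ i) / 2 ^ \<nu> - ?c $ i\<bar>"
      proof -
        have "of_int (m $ i) / 2 ^ \<nu> - ?c $ i = (of_int (m $ i) - ?c $ i * 2 ^ \<nu>) / 2 ^ \<nu>"
          by (simp add: diff_divide_distrib)
        then show ?thesis by (simp only: abs_divide) simp
      qed
      ultimately show ?thesis by simp
    qed
    have "\<bar>x $ i - ?c $ i\<bar> \<le> 3 * L / 2" for i using x[of i] c[of i] L unfolding abs_le_iff by linarith
    then show "x \<in> ?Q" by (simp add: mem_cube)
  qed
  have gQ: "?g \<subseteq> ?Q"
  proof
    fix x assume "x \<in> ?g"
    then have "\<bar>x $ i - ?c $ i\<bar> \<le> L / 2" for i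
      using grid_cell_subset_cube[OF L(1), of \<theta> k] by (auto simp: mem_cube)
    then have "\<bar>x $ i - ?c $ i\<bar> \<le> 3 * L / 2" for i by (rule order_trans) (use L(1) in simp)
    then show "x \<in> ?Q" by (simp add: mem_cube)
  qed
  have L3: "0 < 3 * L" using L by simp
  have n: "\<And>x. 0 \<le> w0 x" "\<And>x. 0 \<le> w1 x" and si: "set_integrable lebesgue ?Q w0" "set_integrable lebesgue ?Q w1"
    using w0 w1 L3 by (auto simp: fat_sets_charged_def)
  have Dm: "?D \<in> sets lebesgue" by (simp add: dyadic_cube_def)
  have "weight_measure w1 ?g \<le> weight_measure w1 ?Q"
    by (rule weight_measure_mono[OF si(2) n(2) gQ grid_cell_lebesgue])
  also have "\<dots> \<le> B1 * (3 * L / (1 / 2 ^ \<nu>)) powr (?n * p1) * weight_measure w1 ?D"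
    unfolding dyadic_cube_def by (rule fat_sets_charged_cube[OF w1 _ _ DQ[unfolded dyadic_cube_def] B(2)]) (use L in auto)
  finally have "weight_measure w1 ?g powr (1/p1) \<le> (B1 * (3 * L * 2 ^ \<nu>) powr (?n * p1) * weight_measure w1 ?D) powr (1/p1)"
    using p weight_measure_nonneg[of w1] n by (intro powr_mono2) auto
  also have "\<dots> = B1 powr (1/p1) * (3 * L * 2 ^ \<nu>) ^ ?n * weight_measure w1 ?D powr (1/p1)"
  proof -
    have "((3 * L * 2 ^ \<nu>) powr (?n * p1)) powr (1/p1) = (3 * L * 2 ^ \<nu>) ^ ?n"
      using p L by (simp only: powr_powr) (simp add: powr_realpow)
    then show ?thesis by (simp only: powr_mult)
  qed
  also have "weight_measure w1 ?D powr (1/p1) \<le> 2 powr (real \<nu> * s) * (K * weight_measure w0 ?D powr (1/p0))"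
  proof -
    have "2 powr (real \<nu> * s) * (2 powr (- real \<nu> * s) * weight_measure w1 ?D powr (1/p1))
      \<le> 2 powr (real \<nu> * s) * (K * weight_measure w0 ?D powr (1/p0))"
      by (intro mult_left_mono dyadic) auto
    moreover have "2 powr (real \<nu> * s) * 2 powr (- real \<nu> * s) = 1" by (simp add: powr_minus)
    then have "2 powr (real \<nu> * s) * (2 powr (- real \<nu> * s) * weight_measure w1 ?D powr (1/p1)) = weight_measure w1 ?D powr (1/p1)"
      by (simp only: mult.assoc[symmetric] mult_1)
    ultimately show ?thesis by linarith
  qed
  also have "weight_measure w0 ?D powr (1/p0) \<le> (B0 * 3 powr (?n * p0) * weight_measure w0 ?g) powr (1/p0)"
  proof (intro powr_mono2)
    have "weight_measure w0 ?D \<le> weight_measure w0 ?Q"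
      by (rule weight_measure_mono[OF si(1) n(1) DQ Dm])
    also have "\<dots> \<le> B0 * 3 powr (?n * p0) * weight_measure w0 ?g"
    proof -
      have "(measure lebesgue ?g / measure lebesgue ?Q) powr p0 * weight_measure w0 ?Q \<le> B0 * weight_measure w0 ?g"
        using w0 L3 grid_cell_lebesgue[of L \<theta> k] gQ unfolding fat_sets_charged_def by blast
      moreover have "measure lebesgue ?Q = (3 * L) ^ ?n" by (rule measure_cube) (use L in simp)
      then have "measure lebesgue ?g / measure lebesgue ?Q = (1 / 3) powr ?n"
        unfolding measure_grid_cell[OF L(1)] using L by (simp add: power_mult_distrib powr_realpow power_divide)
      ultimately have "((1 / 3) powr ?n) powr p0 * weight_measure w0 ?Q \<le> B0 * weight_measure w0 ?g" by simp
      then have "3 powr (?n * p0) * (((1 / 3) powr ?n) powr p0 * weight_measure w0 ?Q) \<le> 3 powr (?n * p0) * (B0 * weight_measure w0 ?g)"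
        by (rule mult_left_mono) simp
      moreover have "3 powr (?n * p0) * ((1 / 3) powr ?n) powr p0 = (1::real)"
        by (simp add: powr_powr powr_mult[symmetric])
      then have "3 powr (?n * p0) * (((1 / 3) powr ?n) powr p0 * weight_measure w0 ?Q) = weight_measure w0 ?Q"
        by (simp only: mult.assoc[symmetric] mult_1)
      ultimately show ?thesis by (simp only: mult.assoc mult.left_commute[of B0])
    qed
    finally show "weight_measure w0 ?D \<le> B0 * 3 powr (?n * p0) * weight_measure w0 ?g" .
  qed (use p weight_measure_nonneg[of w0] n in auto)
  also have "(B0 * 3 powr (?n * p0) * weight_measure w0 ?g) powr (1/p0) = B0 powr (1/p0) * 3 ^ ?n * weight_measure w0 ?g powr (1/p0)"
  proof -
    have "((3::real) powr (?n * p0)) powr (1/p0) = 3 ^ ?n"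
      using p by (simp only: powr_powr) (simp add: powr_realpow)
    then show ?thesis by (simp only: powr_mult)
  qed
  finally have "weight_measure w1 ?g powr (1/p1) \<le> B1 powr (1/p1) * (3 * L * 2 ^ \<nu>) ^ ?n *
     (2 powr (real \<nu> * s) * (K * (B0 powr (1/p0) * 3 ^ ?n * weight_measure w0 ?g powr (1/p0))))"
    using K L B by (simp add: mult_left_mono)
  also have "\<dots> = B1 powr (1/p1) * B0 powr (1/p0) * ((3 * L * 2 ^ \<nu>) ^ ?n * 3 ^ ?n) * K * 2 powr (real \<nu> * s)
      * weight_measure w0 ?g powr (1/p0)" by (simp only: mult_ac)
  also have "(3 * L * 2 ^ \<nu>) ^ ?n * 3 ^ ?n = (9 * (L * 2 ^ \<nu>)) ^ ?n"
    unfolding power_mult_distrib[symmetric] by (simp add: mult_ac)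
  also have "\<dots> = 9 ^ ?n * (L * 2 ^ \<nu>) ^ ?n" by (rule power_mult_distrib)
  finally show ?thesis by (simp only: mult_ac)
qed

section \<open>The one-third trick and nested shifted grids\<close>

definition third_shifts :: "(real^'n) set" where
  "third_shifts = {a. \<forall>i. a $ i = 0 \<or> a $ i = 1/3}"

lemma finite_vec_components:
  assumes "finite S" shows "finite {x :: 'a^'n. \<forall>i. x $ i \<in> S}"
proof -
  have "{x :: 'a^'n. \<forall>i. x $ i \<in> S} = vec_lambda ` (PiE UNIV (\<lambda>_. S))"
  proof (intro equalityI subsetI)
    fix x :: "'a^'n" assume "x \<in> {x. \<forall>i. x $ i \<in> S}"
    then have "x = vec_lambda (\<lambda>i. x $ i)" "(\<lambda>i. x $ i) \<in> PiE UNIV (\<lambda>_. S)" by (auto simp: PiE_def)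
    then show "x \<in> vec_lambda ` (PiE UNIV (\<lambda>_. S))" by (rule image_eqI)
  qed (auto simp: PiE_def Pi_def)
  then show ?thesis using assms by (simp add: finite_PiE)
qed

lemma finite_third_shifts: "finite (third_shifts :: (real^'n) set)"
  using finite_vec_components[of "{0, 1/3 :: real}"] by (simp add: third_shifts_def)

text \<open>Otherwise an integer and an integer shifted by e/3 would both lie between
  \<open>u\<close> and \<open>v\<close>, hence at distance less than 1/3 from each other, which is
  impossible.\<close>

lemma floor_third_less:
  fixes u v e :: real
  assumes uv: "u < v" "v - u < 1/3" and e: "e = 1 \<or> e = -1" and ne: "\<lfloor>u\<rfloor> \<noteq> \<lfloor>v\<rfloor>"
  shows "\<lfloor>u - e / 3\<rfloor> = \<lfloor>v - e / 3\<rfloor>"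
proof (rule ccontr)
  assume ne': "\<lfloor>u - e / 3\<rfloor> \<noteq> \<lfloor>v - e / 3\<rfloor>"
  define n m where "n = \<lfloor>v\<rfloor>" and "m = \<lfloor>v - e / 3\<rfloor>"
  have "\<lfloor>u\<rfloor> < n" using floor_mono[of u v] uv ne by (simp add: n_def)
  then have n: "u < of_int n" "of_int n \<le> v" by (simp_all add: floor_less_iff) (simp add: n_def)
  have "\<lfloor>u - e / 3\<rfloor> < m" using floor_mono[of "u - e / 3" "v - e / 3"] uv ne' by (simp add: m_def)
  then have m: "u - e / 3 < of_int m" "of_int m \<le> v - e / 3" by (simp_all add: floor_less_iff) (simp add: m_def)
  show False
    using e
  proof
    assume "e = 1"
    then have "0 < real_of_int (n - m)" "real_of_int (n - m) < 1" using n m uv by simp_all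
    then show False by (simp del: of_int_diff)
  next
    assume "e = -1"
    then have "0 < real_of_int (m - n)" "real_of_int (m - n) < 1" using n m uv by simp_all
    then show False by (simp del: of_int_diff)
  qed
qed

lemma floor_third:
  fixes u v e :: real
  assumes uv: "\<bar>u - v\<bar> < 1/3" and e: "e = 1 \<or> e = -1" and ne: "\<lfloor>u\<rfloor> \<noteq> \<lfloor>v\<rfloor>"
  shows "\<lfloor>u - e / 3\<rfloor> = \<lfloor>v - e / 3\<rfloor>"
proof (cases u v rule: linorder_cases)
  case less
  then show ?thesis using floor_third_less[OF less _ e ne] uv by simp
next
  case greater
  then show ?thesis using floor_third_less[OF greater _ e ne[symmetric]] uv by simp
qed (use ne in simp)

text \<open>The shift is chosen coordinate by coordinate: 0 where the unshifted grid does not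
  separate the points, 1/3 elsewhere.\<close>

lemma third_shift_exists:
  fixes x y :: "real^'n"
  assumes L: "0 < L" and xy: "\<And>i. \<bar>x $ i - y $ i\<bar> < L / 3" and e: "e = 1 \<or> e = (-1::real)"
  shows "\<exists>a\<in>third_shifts. grid_index L (e *\<^sub>R a) x = grid_index L (e *\<^sub>R a) y"
proof
  define a :: "real^'n" where "a = (\<chi> i. if \<lfloor>x $ i / L\<rfloor> = \<lfloor>y $ i / L\<rfloor> then 0 else 1/3)"
  show "a \<in> third_shifts" by (simp add: a_def third_shifts_def)
  have "\<lfloor>x $ i / L - e * a $ i\<rfloor> = \<lfloor>y $ i / L - e * a $ i\<rfloor>" for i
  proof (cases "\<lfloor>x $ i / L\<rfloor> = \<lfloor>y $ i / L\<rfloor>")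
    case False
    have "\<bar>x $ i / L - y $ i / L\<bar> < 1/3" using xy[of i] L by (simp add: diff_divide_distrib[symmetric] field_simps)
    from floor_third[OF this e False] show ?thesis using False by (simp add: a_def)
  qed (simp add: a_def)
  then show "grid_index L (e *\<^sub>R a) x = grid_index L (e *\<^sub>R a) y" by (simp add: grid_index_def vec_eq_iff)
qed

definition level_index :: "real \<Rightarrow> real^'n \<Rightarrow> nat \<Rightarrow> real^'n \<Rightarrow> int^'n" where
  "level_index L a \<nu> x = grid_index (L / 2 ^ \<nu>) ((-1) ^ \<nu> *\<^sub>R a) x"

definition level_cell :: "real \<Rightarrow> real^'n \<Rightarrow> nat \<Rightarrow> int^'n \<Rightarrow> (real^'n) set" where
  "level_cell L a \<nu> k = grid_cell (L / 2 ^ \<nu>) ((-1) ^ \<nu> *\<^sub>R a) k"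

lemma mem_level_cell: "x \<in> level_cell L a \<nu> k \<longleftrightarrow> level_index L a \<nu> x = k"
  by (simp add: level_cell_def level_index_def grid_cell_def)

text \<open>The shifts alternate in sign because halving the mesh replaces a shift by \<open>e/3\<close> of the
  parent by \<open>2e/3 = e - e/3\<close>, which is \<open>- e/3\<close> up to an integer; so the shifted grids are nested.\<close>

lemma level_index_nested:
  fixes a :: "real^'n"
  assumes L: "0 < L" and a: "a \<in> third_shifts"
    and eq: "level_index L a (Suc \<nu>) x = level_index L a (Suc \<nu>) y"
  shows "level_index L a \<nu> x = level_index L a \<nu> y"
proof -
  define e :: real where "e = (-1) ^ \<nu>"
  have e: "e = 1 \<or> e = -1" unfolding e_def by (metis neg_one_even_power neg_one_odd_power)
  \<comment> \<open>The parent index is a function of the child index: the integer \<open>j\<close>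
    is twice the shift of the parent minus the shift of the child.\<close>
  have par: "level_index L a \<nu> x $ i = (level_index L a (Suc \<nu>) x $ i - (if a $ i = 0 then 0 else if e = 1 then 1 else -1)) div 2" for x i
  proof -
    define u where "u = x $ i / (L / 2 ^ Suc \<nu>) + e * a $ i"
    define j :: int where "j = (if a $ i = 0 then 0 else if e = 1 then 1 else -1)"
    have "level_index L a (Suc \<nu>) x $ i = \<lfloor>u\<rfloor>"
      by (simp add: level_index_def grid_index_def u_def e_def)
    moreover have "level_index L a \<nu> x $ i = \<lfloor>(u - of_int j) / 2\<rfloor>"
    proof -
      have "x $ i / (L / 2 ^ \<nu>) - e * a $ i = (u - of_int j) / 2"
        using a e L unfolding u_def j_def third_shifts_def by (auto simp: field_simps)
      moreover have "level_index L a \<nu> x $ i = \<lfloor>x $ i / (L / 2 ^ \<nu>) - e * a $ i\<rfloor>"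
        by (simp add: level_index_def grid_index_def e_def)
      ultimately show ?thesis by (simp only:)
    qed
    moreover have "\<lfloor>(u - of_int j) / 2\<rfloor> = (\<lfloor>u\<rfloor> - j) div 2"
      using floor_divide_real_eq_div[of 2 "u - of_int j"] by simp
    ultimately show ?thesis by (simp add: j_def)
  qed
  show ?thesis unfolding vec_eq_iff par eq by simp
qed

lemma level_index_nested_le:
  assumes L: "0 < L" and a: "a \<in> third_shifts" and "\<nu> \<le> \<mu>"
    and eq: "level_index L a \<mu> x = level_index L a \<mu> y"
  shows "level_index L a \<nu> x = level_index L a \<nu> y"
  using assms(3,4)
proof (induction \<mu> rule: dec_induct)
  case (step n)
  then show ?case using level_index_nested[OF L a, of n x y] by simp
qed

lemma weight_measure_finite_UN:
  assumes "finite I" "\<And>i. i \<in> I \<Longrightarrow> set_integrable lebesgue (A i) u" "\<And>i. i \<in> I \<Longrightarrow> A i \<in> sets lebesgue"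
    "disjoint_family_on A I"
  shows "weight_measure u (\<Union>i\<in>I. A i) = (\<Sum>i\<in>I. weight_measure u (A i))"
  using assms unfolding weight_measure_def
  by (intro set_integral_finite_Union) auto

lemma level_cell_lebesgue [measurable]: "level_cell L a \<nu> k \<in> sets lebesgue"
  by (simp add: level_cell_def grid_cell_lebesgue)

lemma integrable_indicator_fmeasurable:
  "A \<in> fmeasurable M \<Longrightarrow> integrable M (indicator A :: 'a \<Rightarrow> real)"
  by (rule integrable_real_indicator) (auto simp: fmeasurable_def)

section \<open>Transfer of the finite estimate to functions on space\<close>

locale muckenhoupt_pair =
  fixes w0 w1 :: "real^'n \<Rightarrow> real" and p0 p1 B0 Bs B1 :: real
  assumes p: "1 < p0" "p0 \<le> p1" and B: "0 < B0" "0 < Bs" "0 < B1"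
    and w0: "fat_sets_charged w0 p0 B0" and w1: "fat_sets_charged w1 p1 B1"
    and dual: "fat_sets_charged (dual_weight p0 w0) (p0 / (p0 - 1)) Bs"
    and Ap: "\<And>c l. 0 < l \<Longrightarrow> weight_measure w0 (cube c l) * weight_measure (dual_weight p0 w0) (cube c l) powr (p0 - 1)
      \<le> B0 * measure lebesgue (cube c l) powr p0"
begin

abbreviation "\<sigma> \<equiv> dual_weight p0 w0"

text \<open>A part of a cell with at least half of its volume carries at least this fraction of the
  mass of \<open>w1\<close> and of the dual weight; hence the powers of 1/2. The Carleson estimates
  ask for a fraction not above 1.\<close>

definition kap :: real where
  "kap = min 1 (min ((1/2) powr p1 / B1) ((1/2) powr (p0 / (p0 - 1)) / Bs))"

text \<open>The constant of \<open>two_weight_avg_sum\<close> with \<open>kap\<close> and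
  \<open>B0\<close> inserted, after splitting off the powers of \<open>K\<close> and of the norm
  bound \<open>A\<close>.\<close>

definition bridge_const :: "real \<Rightarrow> real" where
  "bridge_const r = (2 / (1 - r)) powr p1 * carleson_const p1 kap *
    (B0 * (2 * (1 / (2 * carleson_const (p0/(p0-1)) kap)) powr (- (p0 - 1)))) powr (p1 / p0)"

lemma kap: "0 < kap" "kap \<le> 1"
  using B by (auto simp: kap_def)

lemma w_facts:
  "w0 \<in> borel_measurable lebesgue" "w1 \<in> borel_measurable lebesgue" "\<sigma> \<in> borel_measurable lebesgue"
  "\<And>x. 0 \<le> w0 x" "\<And>x. 0 \<le> w1 x" "\<And>x. 0 \<le> \<sigma> x"
  "AE x in lebesgue. 0 < w0 x" "AE x in lebesgue. 0 < w1 x" "AE x in lebesgue. 0 < \<sigma> x"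
  using w0 w1 dual by (auto simp: fat_sets_charged_def)

lemma w_integrable:
  assumes "0 < L"
  shows "set_integrable lebesgue (level_cell L a \<nu> k) w0" "set_integrable lebesgue (level_cell L a \<nu> k) w1"
    "set_integrable lebesgue (level_cell L a \<nu> k) \<sigma>"
  unfolding level_cell_def
  using assms fat_sets_charged_integrable_grid_cell[OF w0] fat_sets_charged_integrable_grid_cell[OF w1]
    fat_sets_charged_integrable_grid_cell[OF dual] by auto

lemma measure_level_cell_pos: "0 < L \<Longrightarrow> 0 < measure lebesgue (level_cell L a \<nu> k)"
  unfolding level_cell_def by (subst measure_grid_cell) auto

definition level_avg :: "(real^'n \<Rightarrow> real) \<Rightarrow> real \<Rightarrow> real^'n \<Rightarrow> nat \<Rightarrow> real^'n \<Rightarrow> real" where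
  "level_avg f L a \<nu> x = weight_measure f (level_cell L a \<nu> (level_index L a \<nu> x)) /
     measure lebesgue (level_cell L a \<nu> (level_index L a \<nu> x))"

text \<open>Hoelder on one cell. The second form can be summed over disjoint cells, so that the
  discrete norm of the finite model is at most the p0-th power of the weighted norm of
  \<open>f\<close>.\<close>

lemma Lp_integrable_cell:
  assumes L: "0 < L" and f [measurable]: "f \<in> borel_measurable lebesgue" "\<And>x. 0 \<le> f x"
    and A: "0 \<le> A" "(\<integral>\<^sup>+x. ennreal (f x powr p0 * w0 x) \<partial>lebesgue) \<le> ennreal A"
  shows "set_integrable lebesgue (level_cell L a \<nu> k) f"
    and "ennreal (weight_measure f (level_cell L a \<nu> k) powr p0 * weight_measure \<sigma> (level_cell L a \<nu> k) powr (1 - p0))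
      \<le> (\<integral>\<^sup>+x\<in>level_cell L a \<nu> k. ennreal (f x powr p0 * w0 x) \<partial>lebesgue)"
proof -
  let ?Q = "level_cell L a \<nu> k"
  let ?I = "\<integral>\<^sup>+x\<in>?Q. ennreal (f x powr p0 * w0 x) \<partial>lebesgue"
  have "?I \<le> (\<integral>\<^sup>+x. ennreal (f x powr p0 * w0 x) \<partial>lebesgue)"
    by (intro nn_integral_mono) (auto simp: indicator_def)
  then have "?I \<le> ennreal A" using A(2) by simp
  then have fin: "?I < top" by (rule order_le_less_trans) simp
  define I where "I = enn2real ?I"
  have I: "0 \<le> I" "?I = ennreal I" using fin by (auto simp: I_def)
  have S: "0 < weight_measure \<sigma> ?Q"
    using w_facts measure_level_cell_pos[OF L] by (intro weight_measure_pos w_integrable(3)[OF L]) auto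
  have hol: "(\<integral>\<^sup>+x\<in>?Q. ennreal (f x) \<partial>lebesgue) \<le> ennreal (I powr (1/p0) * weight_measure \<sigma> ?Q powr (1 - 1/p0))"
    by (rule Hoelder_weight[OF p(1) w_facts(1) w_facts(7) w_facts(4) f])
      (use I S weight_measure_nn_integral[OF w_integrable(3)[OF L] w_facts(6)] in auto)
  show si: "set_integrable lebesgue ?Q f"
    unfolding set_integrable_def
  proof (rule integrableI_bounded)
    have "(\<integral>\<^sup>+x. ennreal (norm (indicator ?Q x *\<^sub>R f x)) \<partial>lebesgue) = (\<integral>\<^sup>+x\<in>?Q. ennreal (f x) \<partial>lebesgue)"
      using f(2) by (intro nn_integral_cong) (auto simp: indicator_def)
    also have "\<dots> < \<infinity>" using hol by (simp add: order_le_less_trans)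
    finally show "(\<integral>\<^sup>+x. ennreal (norm (indicator ?Q x *\<^sub>R f x)) \<partial>lebesgue) < \<infinity>" .
  qed measurable
  have "ennreal (weight_measure f ?Q) \<le> ennreal (I powr (1/p0) * weight_measure \<sigma> ?Q powr (1 - 1/p0))"
    using hol weight_measure_nn_integral[OF si f(2)] by simp
  then have "weight_measure f ?Q \<le> I powr (1/p0) * weight_measure \<sigma> ?Q powr (1 - 1/p0)" by simp
  then have "weight_measure f ?Q powr p0 \<le> (I powr (1/p0) * weight_measure \<sigma> ?Q powr (1 - 1/p0)) powr p0"
    using p weight_measure_nonneg[of f] f(2) by (intro powr_mono2) auto
  also have "\<dots> = I * weight_measure \<sigma> ?Q powr (p0 - 1)"
    using I p by (simp add: powr_mult powr_powr algebra_simps)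
  finally have "weight_measure f ?Q powr p0 * weight_measure \<sigma> ?Q powr (1 - p0)
     \<le> I * weight_measure \<sigma> ?Q powr (p0 - 1) * weight_measure \<sigma> ?Q powr (1 - p0)"
    by (intro mult_right_mono) auto
  also have "\<dots> = I" using S by (simp add: mult.assoc powr_add[symmetric])
  finally show "ennreal (weight_measure f ?Q powr p0 * weight_measure \<sigma> ?Q powr (1 - p0)) \<le> ?I"
    using I(2) by (simp add: ennreal_leI)
qed

text \<open>Applies \<open>two_weight_avg_sum\<close> with the cells of level \<open>N\<close> as
  points. Bounding the index of the ancestor at level 0 by \<open>R\<close> keeps their number
  finite; the bound involves neither \<open>N\<close> nor \<open>R\<close>, so both truncations can
  be removed later.\<close>

theorem level_avg_sum_bound:
  fixes R :: int
  assumes L: "0 < L" and a: "a \<in> third_shifts" and r: "0 < r" "r < 1" and K: "0 \<le> K"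
    and f [measurable]: "f \<in> borel_measurable lebesgue" and f0: "\<And>x. 0 \<le> f x"
    and A: "0 \<le> A" "(\<integral>\<^sup>+x. ennreal (f x powr p0 * w0 x) \<partial>lebesgue) \<le> ennreal A"
    and tw: "\<And>\<nu> k. \<nu> \<le> N \<Longrightarrow> r ^ \<nu> * weight_measure w1 (level_cell L a \<nu> k) powr (1 / p1)
      \<le> K * weight_measure w0 (level_cell L a \<nu> k) powr (1 / p0)"
  shows "(\<integral>\<^sup>+x. ennreal ((\<Sum>\<nu>\<le>N. r ^ \<nu> * level_avg f L a \<nu> x) powr p1 * w1 x)
       * indicator {x. \<forall>i. \<bar>level_index L a 0 x $ i\<bar> \<le> R} x \<partial>lebesgue)
    \<le> ennreal (bridge_const r * K powr p1 * A powr (p1 / p0))"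
proof -
  \<comment> \<open>The lower corner represents the cell \<open>k\<close> of level \<open>N\<close>;
    by nestedness its coarser indices are those of every point of the cell.\<close>
  define pt :: "int^'n \<Rightarrow> real^'n" where "pt k = (\<chi> i. (L / 2 ^ N) * (of_int (k $ i) + (-1) ^ N * a $ i))" for k
  have pt: "level_index L a N (pt k) = k" for k
    using L by (simp add: level_index_def grid_index_def pt_def vec_eq_iff)
  define idx where "idx \<nu> k = level_index L a \<nu> (pt k)" for \<nu> k
  define Om where "Om = {k. \<forall>i. \<bar>idx 0 k $ i\<bar> \<le> R}"
  have same: "level_index L a \<nu> x = idx \<nu> (level_index L a N x)" if "\<nu> \<le> N" for \<nu> x
    unfolding idx_def by (rule level_index_nested_le[OF L a that]) (simp add: pt)
  have "finite Om"
  proof -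
    define M where "M = (2::int) ^ N * (\<bar>R\<bar> + 2) + 1"
    have "\<bar>k $ i\<bar> \<le> M" if k: "k \<in> Om" for k i
    proof -
      define t where "t = pt k $ i / L"
      have "\<bar>\<lfloor>t - a $ i\<rfloor>\<bar> \<le> R"
        using k by (simp add: Om_def idx_def level_index_def grid_index_def t_def)
      then have "real_of_int \<bar>\<lfloor>t - a $ i\<rfloor>\<bar> \<le> of_int \<bar>R\<bar>" by linarith
      then have "\<bar>t - a $ i\<bar> \<le> of_int \<bar>R\<bar> + 1" by linarith
      moreover have ai: "\<bar>a $ i\<bar> \<le> 1" using a[unfolded third_shifts_def] by (auto elim: allE[of _ i])
      ultimately have "\<bar>t\<bar> \<le> of_int \<bar>R\<bar> + 2" by linarith
      then have "2 ^ N * \<bar>t\<bar> \<le> 2 ^ N * (of_int \<bar>R\<bar> + 2)" by (intro mult_left_mono) auto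
      moreover have "2 ^ N * t = of_int (k $ i) + (-1) ^ N * a $ i"
        using L by (simp add: t_def pt_def)
      then have "2 ^ N * \<bar>t\<bar> = \<bar>of_int (k $ i) + (-1) ^ N * a $ i\<bar>"
        by (metis abs_mult abs_numeral power_abs)
      moreover have "\<bar>(-1) ^ N * a $ i\<bar> \<le> 1" using ai by (simp add: abs_mult power_abs)
      ultimately have "\<bar>real_of_int (k $ i)\<bar> \<le> 2 ^ N * (of_int \<bar>R\<bar> + 2) + 1" by linarith
      then have "real_of_int \<bar>k $ i\<bar> \<le> real_of_int M" by (simp add: M_def)
      then show ?thesis by linarith
    qed
    then have "Om \<subseteq> {k. \<forall>i. k $ i \<in> {-M..M}}" by (auto simp: abs_le_iff) (metis minus_le_iff)
    then show ?thesis by (rule finite_subset) (rule finite_vec_components, simp)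
  qed
  let ?C = "level_cell L a N"
  have ff: "finite_filtration Om idx"
  proof
    fix \<nu> x y assume "idx (Suc \<nu>) x = idx (Suc \<nu>) y"
    then show "idx \<nu> x = idx \<nu> y" unfolding idx_def by (rule level_index_nested[OF L a])
  qed fact
  define F where "F k = weight_measure f (?C k)" for k
  define m where "m k = measure lebesgue (?C k)" for k
  interpret finite_stopping Om idx N F m
  proof (intro finite_stopping.intro ff finite_stopping_axioms.intro)
    show "0 \<le> F k" for k unfolding F_def by (rule weight_measure_nonneg[OF f0])
    show "0 < m k" for k unfolding m_def by (rule measure_level_cell_pos[OF L])
  qed
  have disj: "disjoint_family_on ?C E" for E
    by (auto simp: disjoint_family_on_def mem_level_cell)
  have sumE: "(\<Sum>k\<in>E. weight_measure u (?C k)) = weight_measure u (\<Union>k\<in>E. ?C k)"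
    if "E \<subseteq> Om" "\<And>k. set_integrable lebesgue (?C k) u" for u E
    using finite_subset[OF that(1) \<open>finite Om\<close>] that(2) disj
    by (intro weight_measure_finite_UN[symmetric] level_cell_lebesgue) auto
  have cellU: "(\<Union>k'\<in>cell \<nu> k. ?C k') = level_cell L a \<nu> (idx \<nu> k)" if "\<nu> \<le> N" "k \<in> Om" for \<nu> k
  proof (intro equalityI subsetI)
    fix x assume "x \<in> (\<Union>k'\<in>cell \<nu> k. ?C k')"
    then show "x \<in> level_cell L a \<nu> (idx \<nu> k)" using same[OF that(1)] by (auto simp: cell_def mem_level_cell)
  next
    fix x assume x: "x \<in> level_cell L a \<nu> (idx \<nu> k)"
    define k' where "k' = level_index L a N x"
    have e: "idx \<nu> k' = idx \<nu> k" using x same[OF that(1), of x] by (simp add: mem_level_cell k'_def)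
    then have "idx 0 k' = idx 0 k" unfolding idx_def by (rule level_index_nested_le[OF L a, rotated]) simp
    then have "k' \<in> Om" using that(2) by (simp add: Om_def)
    then show "x \<in> (\<Union>k'\<in>cell \<nu> k. ?C k')" using e by (auto simp: cell_def mem_level_cell k'_def)
  qed
  have sum_cell: "(\<Sum>k'\<in>cell \<nu> k. weight_measure u (?C k')) = weight_measure u (level_cell L a \<nu> (idx \<nu> k))"
    if "\<nu> \<le> N" "k \<in> Om" "\<And>k. set_integrable lebesgue (?C k) u" for u \<nu> k
    using sumE[OF cell_subset that(3)] cellU[OF that(1,2)] by simp
  have one: "measure lebesgue S = weight_measure (\<lambda>_. 1) S" for S :: "(real^'n) set"
    by (simp add: weight_measure_def set_lebesgue_integral_def)
  have onei: "set_integrable lebesgue (?C k) (\<lambda>_. 1::real)" for k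
  proof -
    have "?C k \<in> lmeasurable" unfolding level_cell_def using L by (intro grid_cell_lmeasurable) simp
    then have "integrable lebesgue (indicator (?C k) :: real^'n \<Rightarrow> real)"
      by (rule integrable_indicator_fmeasurable)
    then show ?thesis by (simp add: set_integrable_def)
  qed
  have fi: "set_integrable lebesgue (?C k) f" for k by (rule Lp_integrable_cell(1)[OF L f f0 A])
  have mE: "sum m E = measure lebesgue (\<Union>k\<in>E. ?C k)" if "E \<subseteq> Om" for E
    unfolding m_def one using sumE[OF that onei] .
  have mcell: "sum m (cell \<nu> k) = measure lebesgue (level_cell L a \<nu> (idx \<nu> k))" if "\<nu> \<le> N" "k \<in> Om" for \<nu> k
    using mE[OF cell_subset] cellU[OF that] by simp
  have Fcell: "sum F (cell \<nu> k) = weight_measure f (level_cell L a \<nu> (idx \<nu> k))" if "\<nu> \<le> N" "k \<in> Om" for \<nu> k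
    unfolding F_def by (rule sum_cell[OF that fi])
  define S where "S k = weight_measure \<sigma> (?C k)" for k
  define W0 where "W0 k = weight_measure w0 (?C k)" for k
  define W1 where "W1 k = weight_measure w1 (?C k)" for k
  have Scell: "sum S (cell \<nu> k) = weight_measure \<sigma> (level_cell L a \<nu> (idx \<nu> k))"
    and W0cell: "sum W0 (cell \<nu> k) = weight_measure w0 (level_cell L a \<nu> (idx \<nu> k))"
    and W1cell: "sum W1 (cell \<nu> k) = weight_measure w1 (level_cell L a \<nu> (idx \<nu> k))" if "\<nu> \<le> N" "k \<in> Om" for \<nu> k
    unfolding S_def W0_def W1_def by (rule sum_cell[OF that], rule w_integrable[OF L])+
  have pos: "0 < S k" "0 < W0 k" "0 < W1 k" for k
    unfolding S_def W0_def W1_def using w_facts measure_level_cell_pos[OF L]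
    by (auto intro!: weight_measure_pos w_integrable[OF L])
  have fat: "kap * sum U (cell \<nu> k) \<le> sum U E"
    if u: "fat_sets_charged u e Bu" and Bu: "0 < Bu" and k1: "kap \<le> (1/2) powr e / Bu" and e: "0 < e"
      and U: "U = (\<lambda>k. weight_measure u (?C k))"
      and E: "\<nu> \<le> N" "k \<in> Om" "E \<subseteq> cell \<nu> k" "sum m (cell \<nu> k) / 2 \<le> sum m E"
    for u e Bu U \<nu> k E
  proof -
    let ?Q = "level_cell L a \<nu> (idx \<nu> k)" and ?E = "\<Union>k\<in>E. ?C k"
    have EO: "E \<subseteq> Om" using E(3) cell_subset by blast
    have ui: "set_integrable lebesgue (?C k) u" for k
      unfolding level_cell_def using L by (intro fat_sets_charged_integrable_grid_cell[OF u]) simp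
    have EQ: "?E \<subseteq> ?Q" unfolding cellU[OF E(1,2), symmetric] using E(3) by blast
    have Em: "?E \<in> sets lebesgue"
      using finite_subset[OF EO \<open>finite Om\<close>] by (intro sets.finite_UN level_cell_lebesgue)
    have Q0: "0 < measure lebesgue ?Q" by (rule measure_level_cell_pos[OF L])
    have uQ: "0 \<le> weight_measure u ?Q" using u by (intro weight_measure_nonneg) (simp add: fat_sets_charged_def)
    have "(measure lebesgue ?E / measure lebesgue ?Q) powr e * weight_measure u ?Q \<le> Bu * weight_measure u ?E"
      using L EQ Em unfolding level_cell_def by (intro fat_sets_charged_grid_cell[OF u]) auto
    moreover have "(1/2) powr e \<le> (measure lebesgue ?E / measure lebesgue ?Q) powr e"
      using E(4) e Q0 unfolding mE[OF EO] mcell[OF E(1,2)] by (intro powr_mono2) (auto simp: field_simps)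
    then have "(1/2) powr e * weight_measure u ?Q \<le> (measure lebesgue ?E / measure lebesgue ?Q) powr e * weight_measure u ?Q"
      using uQ by (rule mult_right_mono)
    ultimately have "(1/2) powr e * weight_measure u ?Q \<le> Bu * weight_measure u ?E" by linarith
    then have "(1/2) powr e / Bu * weight_measure u ?Q \<le> weight_measure u ?E" using Bu by (simp add: field_simps)
    moreover have "kap * weight_measure u ?Q \<le> (1/2) powr e / Bu * weight_measure u ?Q"
      by (rule mult_right_mono[OF k1 uQ])
    ultimately have "kap * weight_measure u ?Q \<le> weight_measure u ?E" by linarith
    then show ?thesis unfolding U using sum_cell[OF E(1,2) ui] sumE[OF EO ui] by simp
  qed
  have main: "(\<Sum>k\<in>Om. W1 k * (\<Sum>\<nu>\<le>N. r ^ \<nu> * avg \<nu> k) powr p1)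
    \<le> (2 / (1 - r)) powr p1 * carleson_const p1 kap * K powr p1 *
      (B0 * (2 * (1 / (2 * carleson_const (p0/(p0-1)) kap)) powr (- (p0 - 1)))
        * (\<Sum>k\<in>Om. F k powr p0 * S k powr (1 - p0))) powr (p1 / p0)"
  proof (rule two_weight_avg_sum[OF p kap r less_imp_le[OF B(1)] K pos])
    fix \<nu> k assume k: "\<nu> \<le> N" "k \<in> Om"
    let ?Q = "level_cell L a \<nu> (idx \<nu> k)" and ?D = "cube (grid_center (L / 2 ^ \<nu>) ((-1) ^ \<nu> *\<^sub>R a) (idx \<nu> k)) (L / 2 ^ \<nu>)"
    have l: "0 < L / 2 ^ \<nu>" using L by simp
    have QD: "?Q \<subseteq> ?D" unfolding level_cell_def by (rule grid_cell_subset_cube[OF l])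
    have i: "set_integrable lebesgue ?D w0" "set_integrable lebesgue ?D \<sigma>"
      using w0 dual l unfolding fat_sets_charged_def by blast+
    \<comment> \<open>The closed cube around a half-open cell has the same volume, so the A_p bound
      passes from cubes to cells.\<close>
    have "weight_measure w0 ?Q * weight_measure \<sigma> ?Q powr (p0 - 1) \<le> weight_measure w0 ?D * weight_measure \<sigma> ?D powr (p0 - 1)"
      using p w_facts weight_measure_nonneg[OF w_facts(4)] weight_measure_nonneg[OF w_facts(6)]
      by (intro mult_mono powr_mono2 weight_measure_mono[OF i(1) _ QD] weight_measure_mono[OF i(2) _ QD]) auto
    also have "\<dots> \<le> B0 * measure lebesgue ?D powr p0" by (rule Ap[OF l])
    also have "measure lebesgue ?D = measure lebesgue ?Q"
      unfolding level_cell_def measure_grid_cell[OF l] using l by (intro measure_cube) simp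
    finally show "sum W0 (cell \<nu> k) * sum S (cell \<nu> k) powr (p0 - 1) \<le> B0 * sum m (cell \<nu> k) powr p0"
      unfolding W0cell[OF k] Scell[OF k] mcell[OF k] .
    show "r ^ \<nu> * sum W1 (cell \<nu> k) powr (1 / p1) \<le> K * sum W0 (cell \<nu> k) powr (1 / p0)"
      unfolding W0cell[OF k] W1cell[OF k] by (rule tw[OF k(1)])
    fix E assume E: "E \<subseteq> cell \<nu> k" "sum m (cell \<nu> k) / 2 \<le> sum m E"
    show "kap * sum S (cell \<nu> k) \<le> sum S E"
      by (rule fat[OF dual B(2) _ _ _ k E]) (use p in \<open>auto simp: kap_def S_def fun_eq_iff\<close>)
    show "kap * sum W1 (cell \<nu> k) \<le> sum W1 E"
      by (rule fat[OF w1 B(3) _ _ _ k E]) (use p in \<open>auto simp: kap_def W1_def fun_eq_iff\<close>)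
  qed
  have IA: "(\<Sum>k\<in>Om. F k powr p0 * S k powr (1 - p0)) \<le> A"
  proof -
    have "ennreal (\<Sum>k\<in>Om. F k powr p0 * S k powr (1 - p0)) = (\<Sum>k\<in>Om. ennreal (F k powr p0 * S k powr (1 - p0)))"
      by (rule sum_ennreal[symmetric]) auto
    also have "\<dots> \<le> (\<Sum>k\<in>Om. \<integral>\<^sup>+x\<in>?C k. ennreal (f x powr p0 * w0 x) \<partial>lebesgue)"
      unfolding F_def S_def by (intro sum_mono Lp_integrable_cell(2)[OF L f f0 A])
    also have "\<dots> = (\<integral>\<^sup>+x. (\<Sum>k\<in>Om. ennreal (f x powr p0 * w0 x) * indicator (?C k) x) \<partial>lebesgue)"
      using w_facts(1) level_cell_lebesgue by (intro nn_integral_sum[symmetric]) auto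
    also have "\<dots> \<le> (\<integral>\<^sup>+x. ennreal (f x powr p0 * w0 x) \<partial>lebesgue)"
    proof (rule nn_integral_mono)
      fix x
      have "(\<Sum>k\<in>Om. ennreal (f x powr p0 * w0 x) * indicator (?C k) x)
        = (\<Sum>k\<in>Om. if k = level_index L a N x then ennreal (f x powr p0 * w0 x) else 0)"
        by (intro sum.cong) (auto simp: indicator_def mem_level_cell)
      also have "\<dots> \<le> ennreal (f x powr p0 * w0 x)" using \<open>finite Om\<close> by (simp add: sum.delta)
      finally show "(\<Sum>k\<in>Om. ennreal (f x powr p0 * w0 x) * indicator (?C k) x) \<le> ennreal (f x powr p0 * w0 x)" .
    qed
    also have "\<dots> \<le> ennreal A" by (rule A(2))
    finally show ?thesis using A(1) by simp
  qed
  have avg_eq: "avg \<nu> (level_index L a N x) = level_avg f L a \<nu> x" if "\<nu> \<le> N" "level_index L a N x \<in> Om" for \<nu> x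
    unfolding avg_def Fcell[OF that] mcell[OF that] level_avg_def same[OF that(1), of x] ..
  have Omx: "level_index L a N x \<in> Om \<longleftrightarrow> (\<forall>i. \<bar>level_index L a 0 x $ i\<bar> \<le> R)" for x
    using same[of 0 x] by (simp add: Om_def)
  define T where "T k = (\<Sum>\<nu>\<le>N. r ^ \<nu> * avg \<nu> k) powr p1" for k
  have "(\<integral>\<^sup>+x. ennreal ((\<Sum>\<nu>\<le>N. r ^ \<nu> * level_avg f L a \<nu> x) powr p1 * w1 x)
       * indicator {x. \<forall>i. \<bar>level_index L a 0 x $ i\<bar> \<le> R} x \<partial>lebesgue)
     = (\<integral>\<^sup>+x. (\<Sum>k\<in>Om. ennreal (T k) * (ennreal (w1 x) * indicator (?C k) x)) \<partial>lebesgue)"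
  proof (rule nn_integral_cong)
    fix x
    let ?k = "level_index L a N x"
    have "(\<Sum>k\<in>Om. ennreal (T k) * (ennreal (w1 x) * indicator (?C k) x))
        = (\<Sum>k\<in>Om. if k = ?k then ennreal (T k) * ennreal (w1 x) else 0)"
      by (intro sum.cong) (auto simp: indicator_def mem_level_cell)
    also have "\<dots> = (if ?k \<in> Om then ennreal (T ?k) * ennreal (w1 x) else 0)"
      using \<open>finite Om\<close> by (simp add: sum.delta)
    also have "\<dots> = ennreal ((\<Sum>\<nu>\<le>N. r ^ \<nu> * level_avg f L a \<nu> x) powr p1 * w1 x)
       * indicator {x. \<forall>i. \<bar>level_index L a 0 x $ i\<bar> \<le> R} x"
    proof (cases "?k \<in> Om")
      case True
      then have "T ?k = (\<Sum>\<nu>\<le>N. r ^ \<nu> * level_avg f L a \<nu> x) powr p1"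
        unfolding T_def by (simp add: avg_eq)
      then show ?thesis using True Omx[of x] w_facts(5)[of x] by (simp add: ennreal_mult)
    next
      case False
      have "indicator {x. \<forall>i. \<bar>level_index L a 0 x $ i\<bar> \<le> R} x = (0::ennreal)"
        by (rule indicator_simps(2)) (use False Omx[of x] in blast)
      then show ?thesis using False by simp
    qed
    finally show "ennreal ((\<Sum>\<nu>\<le>N. r ^ \<nu> * level_avg f L a \<nu> x) powr p1 * w1 x)
       * indicator {x. \<forall>i. \<bar>level_index L a 0 x $ i\<bar> \<le> R} x
       = (\<Sum>k\<in>Om. ennreal (T k) * (ennreal (w1 x) * indicator (?C k) x))" by simp
  qed
  also have "\<dots> = (\<Sum>k\<in>Om. ennreal (T k) * (\<integral>\<^sup>+x\<in>?C k. ennreal (w1 x) \<partial>lebesgue))"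
    using w_facts(2) level_cell_lebesgue by (subst nn_integral_sum) (auto intro!: sum.cong nn_integral_cmult)
  also have "\<dots> = (\<Sum>k\<in>Om. ennreal (W1 k * T k))"
    unfolding weight_measure_nn_integral[OF w_integrable(2)[OF L] w_facts(5)] W1_def
    using weight_measure_nonneg[of w1, OF w_facts(5)] by (intro sum.cong) (auto simp: ennreal_mult T_def mult.commute)
  also have "\<dots> = ennreal (\<Sum>k\<in>Om. W1 k * T k)"
    using pos(3) by (intro sum_ennreal) (auto simp: T_def less_imp_le)
  also have "\<dots> \<le> ennreal (bridge_const r * K powr p1 * A powr (p1 / p0))"
  proof (rule ennreal_leI)
    have c0: "0 \<le> carleson_const p1 kap" using p kap by (intro less_imp_le carleson_const_pos) auto
    have "(\<Sum>k\<in>Om. W1 k * T k) \<le> (2 / (1 - r)) powr p1 * carleson_const p1 kap * K powr p1 *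
      (B0 * (2 * (1 / (2 * carleson_const (p0/(p0-1)) kap)) powr (- (p0 - 1))) * A) powr (p1 / p0)"
      using main unfolding T_def
      by (rule order_trans) (use IA B c0 p in \<open>auto intro!: mult_left_mono powr_mono2 mult_nonneg_nonneg sum_nonneg\<close>)
    also have "\<dots> = bridge_const r * K powr p1 * A powr (p1 / p0)"
      unfolding bridge_const_def powr_mult by (simp only: mult_ac)
    finally show "(\<Sum>k\<in>Om. W1 k * T k) \<le> bridge_const r * K powr p1 * A powr (p1 / p0)" .
  qed
  finally show ?thesis .
qed

end

section \<open>Operators with lattice kernels\<close>

declare finite_third_shifts [simp]

text \<open>Every \<open>u j\<close> is at most \<open>l j\<close> times the largest ratio, and the
  power of that ratio is one term of the last sum. This simple bound takes the place of the triangle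
  inequality in L^p.\<close>

lemma sum_powr_weighted_le:
  fixes u l :: "'j \<Rightarrow> real"
  assumes J: "finite J" and p: "1 \<le> p" and l: "\<And>j. j \<in> J \<Longrightarrow> 0 < l j" and u: "\<And>j. j \<in> J \<Longrightarrow> 0 \<le> u j"
  shows "(\<Sum>j\<in>J. u j) powr p \<le> (\<Sum>j\<in>J. l j) powr p * (\<Sum>j\<in>J. (u j / l j) powr p)"
proof (cases "J = {}")
  case False
  define M where "M = Max ((\<lambda>j. u j / l j) ` J)"
  have M: "u j / l j \<le> M" if "j \<in> J" for j unfolding M_def using J that by (intro Max_ge) auto
  have "M \<in> (\<lambda>j. u j / l j) ` J" unfolding M_def using J False by (intro Max_in) auto
  then obtain j0 where j0: "j0 \<in> J" "M = u j0 / l j0" by auto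
  have M0: "0 \<le> M" using j0 u[of j0] l[of j0] by simp
  have "(\<Sum>j\<in>J. u j) \<le> (\<Sum>j\<in>J. l j * M)"
    using M l by (intro sum_mono) (simp add: field_simps)
  also have "\<dots> = (\<Sum>j\<in>J. l j) * M" by (simp add: sum_distrib_right)
  finally have "(\<Sum>j\<in>J. u j) powr p \<le> ((\<Sum>j\<in>J. l j) * M) powr p"
    using p u by (intro powr_mono2) (auto intro: sum_nonneg)
  also have "\<dots> = (\<Sum>j\<in>J. l j) powr p * M powr p" by (rule powr_mult)
  also have "M powr p \<le> (\<Sum>j\<in>J. (u j / l j) powr p)"
    unfolding j0(2) using J j0(1) by (intro member_le_sum[of j0 J "\<lambda>j. (u j / l j) powr p"]) auto
  finally show ?thesis by (simp add: mult_left_mono)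
qed simp

text \<open>The near part has the size of r^n times an average at scale 2^(-n). The far coefficient
  4^(-n(d+1)) offsets the volume 2^(nd) and a loss 2^(nd) in comparing the two weights at scale 2^n,
  and a factor 4^(-n) remains. The divisor 3 is what the shifted grids require.\<close>

definition lattice_kernel :: "real \<Rightarrow> real^'n \<Rightarrow> ennreal" where
  "lattice_kernel r z = (\<Sum>n. ennreal (r ^ n * 2 ^ (n * CARD('n))) * indicator {z. \<forall>i. \<bar>z $ i\<bar> < 1 / 2 ^ n / 3} z +
     ennreal (1 / 4 ^ (n * (CARD('n) + 1))) * indicator {z. \<forall>i. \<bar>z $ i\<bar> < 2 ^ n / 3} z)"

lemma level_index_measurable [measurable]:
  "level_index L (a :: real^'n) \<nu> \<in> lebesgue \<rightarrow>\<^sub>M count_space UNIV"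
proof -
  have v: "level_index L a \<nu> -` {k} \<inter> space lebesgue = level_cell L a \<nu> k" for k
    by (auto simp: mem_level_cell)
  show ?thesis
    unfolding measurable_count_space_eq2_countable v using level_cell_lebesgue[of L a \<nu>] by simp
qed

lemma near_indicator_le:
  fixes x y :: "real^'n"
  assumes L: "0 < L"
  shows "indicator {z. \<forall>i. \<bar>z $ i\<bar> < L / 2 ^ \<nu> / 3} (x - y)
    \<le> (\<Sum>a\<in>third_shifts. indicator (level_cell L a \<nu> (level_index L a \<nu> x)) y :: ennreal)"
proof (cases "\<forall>i. \<bar>(x - y) $ i\<bar> < L / 2 ^ \<nu> / 3")
  case True
  have "(-1) ^ \<nu> = (1::real) \<or> (-1) ^ \<nu> = (-1::real)" by (metis neg_one_even_power neg_one_odd_power)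
  then obtain a :: "real^'n" where a: "a \<in> third_shifts" "level_index L a \<nu> x = level_index L a \<nu> y"
    using third_shift_exists[of "L / 2 ^ \<nu>" x y "(-1) ^ \<nu>"] L True unfolding level_index_def by auto
  have "indicator {z. \<forall>i. \<bar>z $ i\<bar> < L / 2 ^ \<nu> / 3} (x - y) \<le> (1::ennreal)" by (auto simp: indicator_def)
  also have "\<dots> = indicator (level_cell L a \<nu> (level_index L a \<nu> x)) y"
    using a(2) by (simp add: indicator_def mem_level_cell)
  also have "\<dots> \<le> (\<Sum>a\<in>third_shifts. indicator (level_cell L a \<nu> (level_index L a \<nu> x)) y)"
    using a(1) finite_third_shifts by (intro member_le_sum) auto
  finally show ?thesis .
next
  case False
  then have "x - y \<notin> {z. \<forall>i. \<bar>z $ i\<bar> < L / 2 ^ \<nu> / 3}" by blast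
  then have "indicator {z. \<forall>i. \<bar>z $ i\<bar> < L / 2 ^ \<nu> / 3} (x - y) = (0::ennreal)" by (rule indicator_simps(2))
  then show ?thesis by simp
qed

lemma measure_level_cell:
  "0 < L \<Longrightarrow> measure lebesgue (level_cell L a \<nu> (k::int^'n)) = (L / 2 ^ \<nu>) ^ CARD('n)"
  unfolding level_cell_def by (subst measure_grid_cell) auto

lemma near_set_borel [measurable]: "{z::real^'n. \<forall>i. \<bar>z $ i\<bar> < c} \<in> sets borel"
proof -
  have "{z::real^'n. \<forall>i. \<bar>z $ i\<bar> < c} = (\<Inter>i. {z. \<bar>z $ i\<bar> < c})" by auto
  also have "\<dots> \<in> sets borel" by measurable
  finally show ?thesis .
qed

lemma sets_lebesgue_reflect:
  assumes "A \<in> sets borel" shows "{y. x - y \<in> A} \<in> sets (lebesgue :: (real^'n) measure)"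
proof -
  have "(\<lambda>y. x - y) \<in> borel_measurable (borel :: (real^'n) measure)" by measurable
  from measurable_sets[OF this assms] have "{y. x - y \<in> A} \<in> sets borel" by (simp add: vimage_def)
  then show ?thesis by simp
qed

lemma near_indicator_measurable:
  "(\<lambda>y. indicator {z. \<forall>i. \<bar>z $ i\<bar> < c} (x - y) :: ennreal) \<in> borel_measurable (lebesgue :: (real^'n) measure)"
proof -
  have "(\<lambda>y. indicator {z. \<forall>i. \<bar>z $ i\<bar> < c} (x - y) :: ennreal) = indicator {y. x - y \<in> {z. \<forall>i. \<bar>z $ i\<bar> < c}}"
    by (auto simp: indicator_def)
  also have "\<dots> \<in> borel_measurable lebesgue"
    by (rule borel_measurable_indicator, rule sets_lebesgue_reflect[OF near_set_borel])
  finally show ?thesis .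
qed

context muckenhoupt_pair
begin

lemma level_avg_measurable [measurable]: "level_avg f L a \<nu> \<in> borel_measurable lebesgue"
proof -
  have "(\<lambda>k. weight_measure f (level_cell L a \<nu> k) / measure lebesgue (level_cell L a \<nu> k)) \<in> count_space UNIV \<rightarrow>\<^sub>M borel" by simp
  from measurable_compose[OF level_index_measurable this] show ?thesis unfolding level_avg_def .
qed

lemma level_avg_nonneg: "(\<And>x. 0 \<le> f x) \<Longrightarrow> 0 \<le> level_avg f L a \<nu> x"
  unfolding level_avg_def using weight_measure_nonneg[of f] by simp

lemma near_average_le:
  fixes f :: "real^'n \<Rightarrow> real"
  assumes L: "0 < L" and c: "0 \<le> c" and f [measurable]: "f \<in> borel_measurable lebesgue" and f0: "\<And>x. 0 \<le> f x"
    and A: "0 \<le> A" "(\<integral>\<^sup>+x. ennreal (f x powr p0 * w0 x) \<partial>lebesgue) \<le> ennreal A"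
  shows "(\<integral>\<^sup>+y. ennreal c * indicator {z. \<forall>i. \<bar>z $ i\<bar> < L / 2 ^ \<nu> / 3} (x - y) * ennreal (f y) \<partial>lebesgue)
    \<le> ennreal (\<Sum>a\<in>third_shifts. c * (L / 2 ^ \<nu>) ^ CARD('n) * level_avg f L a \<nu> x)"
proof -
  let ?Q = "\<lambda>a. level_cell L a \<nu> (level_index L a \<nu> x)"
  have "(\<integral>\<^sup>+y. ennreal c * indicator {z. \<forall>i. \<bar>z $ i\<bar> < L / 2 ^ \<nu> / 3} (x - y) * ennreal (f y) \<partial>lebesgue)
    \<le> (\<integral>\<^sup>+y. (\<Sum>a\<in>third_shifts. ennreal c * (ennreal (f y) * indicator (?Q a) y)) \<partial>lebesgue)"
  proof (rule nn_integral_mono)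
    fix y
    have "ennreal c * indicator {z. \<forall>i. \<bar>z $ i\<bar> < L / 2 ^ \<nu> / 3} (x - y) * ennreal (f y)
      \<le> ennreal c * (\<Sum>a\<in>third_shifts. indicator (?Q a) y) * ennreal (f y)"
      by (intro mult_right_mono mult_left_mono near_indicator_le[OF L]) auto
    also have "\<dots> = (\<Sum>a\<in>third_shifts. ennreal c * (ennreal (f y) * indicator (?Q a) y))"
      by (simp only: sum_distrib_left sum_distrib_right mult_ac)
    finally show "ennreal c * indicator {z. \<forall>i. \<bar>z $ i\<bar> < L / 2 ^ \<nu> / 3} (x - y) * ennreal (f y)
      \<le> (\<Sum>a\<in>third_shifts. ennreal c * (ennreal (f y) * indicator (?Q a) y))" .
  qed
  also have "\<dots> = (\<Sum>a\<in>third_shifts. ennreal c * (\<integral>\<^sup>+y\<in>?Q a. ennreal (f y) \<partial>lebesgue))"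
    using level_cell_lebesgue by (subst nn_integral_sum) (auto intro!: sum.cong nn_integral_cmult)
  also have "\<dots> = (\<Sum>a\<in>third_shifts. ennreal (c * (L / 2 ^ \<nu>) ^ CARD('n) * level_avg f L a \<nu> x))"
  proof (rule sum.cong[OF refl])
    fix a :: "real^'n"
    have "(\<integral>\<^sup>+y\<in>?Q a. ennreal (f y) \<partial>lebesgue) = ennreal (weight_measure f (?Q a))"
      by (rule weight_measure_nn_integral[OF Lp_integrable_cell(1)[OF L f f0 A] f0])
    also have "weight_measure f (?Q a) = (L / 2 ^ \<nu>) ^ CARD('n) * level_avg f L a \<nu> x"
      unfolding level_avg_def measure_level_cell[OF L] using L by simp
    finally show "ennreal c * (\<integral>\<^sup>+y\<in>?Q a. ennreal (f y) \<partial>lebesgue) = ennreal (c * (L / 2 ^ \<nu>) ^ CARD('n) * level_avg f L a \<nu> x)"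
      using c L level_avg_nonneg[of f, OF f0] by (simp add: ennreal_mult mult.assoc)
  qed
  also have "\<dots> = ennreal (\<Sum>a\<in>third_shifts. c * (L / 2 ^ \<nu>) ^ CARD('n) * level_avg f L a \<nu> x)"
    using c L level_avg_nonneg[of f, OF f0] by (intro sum_ennreal) auto
  finally show ?thesis .
qed

section \<open>Truncated pieces of the lattice operator\<close>

text \<open>The index 0 collects all small scales in one shifted grid; \<open>Suc k\<close> is the
  single large scale \<open>2 ^ k\<close>, its factor being kernel coefficient times volume. One
  parameter \<open>N\<close> truncates both the levels and the region, so the pieces increase with
  it.\<close>

definition piece :: "real \<Rightarrow> (real^'n \<Rightarrow> real) \<Rightarrow> real^'n \<Rightarrow> nat \<Rightarrow> nat \<Rightarrow> real^'n \<Rightarrow> real" where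
  "piece r f a j N x = (case j of
      0 \<Rightarrow> (\<Sum>\<nu>\<le>N. r ^ \<nu> * level_avg f 1 a \<nu> x) * indicator {x. \<forall>i. \<bar>level_index 1 a 0 x $ i\<bar> \<le> int N} x
    | Suc k \<Rightarrow> 1 / (4 ^ k * 2 ^ (k * CARD('n))) * level_avg f (2 ^ k) a 0 x
        * indicator {x. \<forall>i. \<bar>level_index (2 ^ k) a 0 x $ i\<bar> \<le> int N} x)"

lemma piece_nonneg: "(\<And>x. 0 \<le> f x) \<Longrightarrow> 0 < r \<Longrightarrow> 0 \<le> piece r f a j N x"
  unfolding piece_def by (auto split: nat.split intro!: mult_nonneg_nonneg divide_nonneg_nonneg sum_nonneg level_avg_nonneg)

lemma level_box_measurable [measurable]:
  "{x::real^'n. \<forall>i. \<bar>level_index L a \<nu> x $ i\<bar> \<le> M} \<in> sets lebesgue"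
proof -
  have "{x::real^'n. \<forall>i. \<bar>level_index L a \<nu> x $ i\<bar> \<le> M} = level_index L a \<nu> -` {k. \<forall>i. \<bar>k $ i\<bar> \<le> M} \<inter> space lebesgue" by auto
  also have "\<dots> \<in> sets lebesgue" by (rule measurable_sets[OF level_index_measurable]) simp
  finally show ?thesis .
qed

lemma piece_measurable [measurable]: "piece r f a j N \<in> borel_measurable lebesgue"
  unfolding piece_def[abs_def] by (cases j) (simp_all, measurable)

lemma piece_mono:
  assumes "\<And>x. 0 \<le> f x" "0 < r" "M \<le> N"
  shows "piece r f a j M x \<le> piece r f a j N x"
proof (cases j)
  case 0
  have "(\<Sum>\<nu>\<le>M. r ^ \<nu> * level_avg f 1 a \<nu> x) \<le> (\<Sum>\<nu>\<le>N. r ^ \<nu> * level_avg f 1 a \<nu> x)"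
    using assms level_avg_nonneg[of f, OF assms(1)] by (intro sum_mono2) auto
  moreover have "indicator {x. \<forall>i. \<bar>level_index 1 a 0 x $ i\<bar> \<le> int M} x \<le> (indicator {x. \<forall>i. \<bar>level_index 1 a 0 x $ i\<bar> \<le> int N} x :: real)"
    using of_nat_mono[OF assms(3), where 'a=int] by (auto simp: indicator_def intro: order_trans)
  ultimately show ?thesis
    unfolding piece_def 0 using assms level_avg_nonneg[of f, OF assms(1)] by (auto intro!: mult_mono sum_nonneg)
next
  case (Suc k)
  have "indicator {x. \<forall>i. \<bar>level_index (2 ^ k) a 0 x $ i\<bar> \<le> int M} x \<le> (indicator {x. \<forall>i. \<bar>level_index (2 ^ k) a 0 x $ i\<bar> \<le> int N} x :: real)"
    using of_nat_mono[OF assms(3), where 'a=int] by (auto simp: indicator_def intro: order_trans)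
  then show ?thesis
    unfolding piece_def Suc using level_avg_nonneg[of f, OF assms(1)] by (auto intro!: divide_right_mono mult_left_mono)
qed

text \<open>A large scale is an instance of \<open>level_avg_sum_bound\<close> with level 0 only.
  The loss \<open>2 ^ (k * CARD('n))\<close> of \<open>tw2\<close> cancels against the coefficient
  of the piece and leaves \<open>4 / 4 ^ j\<close>; for \<open>j = 0\<close> this is a harmless
  factor 4.\<close>

lemma piece_norm_le:
  assumes r: "0 < r" "r < 1" and D: "0 \<le> D" and a: "a \<in> third_shifts"
    and tw1: "\<And>\<nu> \<theta> k. r ^ \<nu> * weight_measure w1 (grid_cell (1 / 2 ^ \<nu>) \<theta> k) powr (1 / p1)
      \<le> D * weight_measure w0 (grid_cell (1 / 2 ^ \<nu>) \<theta> k) powr (1 / p0)"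
    and tw2: "\<And>i \<theta> k. weight_measure w1 (grid_cell (2 ^ i) \<theta> k) powr (1 / p1)
      \<le> D * 2 ^ (i * CARD('n)) * weight_measure w0 (grid_cell (2 ^ i) \<theta> k) powr (1 / p0)"
    and f [measurable]: "f \<in> borel_measurable lebesgue" and f0: "\<And>x. 0 \<le> f x"
    and A: "0 \<le> A" "(\<integral>\<^sup>+x. ennreal (f x powr p0 * w0 x) \<partial>lebesgue) \<le> ennreal A"
  shows "(\<integral>\<^sup>+x. ennreal (piece r f a j N x powr p1 * w1 x) \<partial>lebesgue)
    \<le> ennreal (bridge_const r * D powr p1 * A powr (p1 / p0) * (4 / 4 ^ j) powr p1)"
proof (cases j)
  case 0
  have "(\<integral>\<^sup>+x. ennreal (piece r f a j N x powr p1 * w1 x) \<partial>lebesgue) =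
    (\<integral>\<^sup>+x. ennreal ((\<Sum>\<nu>\<le>N. r ^ \<nu> * level_avg f 1 a \<nu> x) powr p1 * w1 x)
       * indicator {x. \<forall>i. \<bar>level_index 1 a 0 x $ i\<bar> \<le> int N} x \<partial>lebesgue)"
    using p by (intro nn_integral_cong) (auto simp: piece_def 0 indicator_def)
  also have "\<dots> \<le> ennreal (bridge_const r * D powr p1 * A powr (p1 / p0))"
    by (rule level_avg_sum_bound[OF _ a r D f f0 A]) (use tw1 in \<open>auto simp: level_cell_def\<close>)
  also have "\<dots> \<le> ennreal (bridge_const r * D powr p1 * A powr (p1 / p0) * (4 / 4 ^ j) powr p1)"
  proof (rule ennreal_leI)
    have c0: "0 \<le> bridge_const r"
      unfolding bridge_const_def using p kap carleson_const_pos[of p1 kap] by simp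
    have "1 \<le> (4::real) powr p1" using p by (intro ge_one_powr_ge_zero) auto
    then show "bridge_const r * D powr p1 * A powr (p1 / p0) \<le> bridge_const r * D powr p1 * A powr (p1 / p0) * (4 / 4 ^ j) powr p1"
      using 0 c0 mult_left_mono[of 1 "4 powr p1" "bridge_const r * D powr p1 * A powr (p1 / p0)"] by simp
  qed
  finally show ?thesis .
next
  case (Suc k)
  define c where "c = 1 / (4 ^ k * 2 ^ (k * CARD('n)) :: real)"
  have c: "0 < c" by (simp add: c_def)
  have K: "0 \<le> D * 2 ^ (k * CARD('n))" using D by simp
  have "(\<integral>\<^sup>+x. ennreal (piece r f a j N x powr p1 * w1 x) \<partial>lebesgue) =
    (\<integral>\<^sup>+x. ennreal (c powr p1) * (ennreal ((\<Sum>\<nu>\<le>0. r ^ \<nu> * level_avg f (2 ^ k) a \<nu> x) powr p1 * w1 x)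
       * indicator {x. \<forall>i. \<bar>level_index (2 ^ k) a 0 x $ i\<bar> \<le> int N} x) \<partial>lebesgue)"
  proof (intro nn_integral_cong)
    fix x
    let ?B = "{x. \<forall>i. \<bar>level_index (2 ^ k) a 0 x $ i\<bar> \<le> int N}"
    show "ennreal (piece r f a j N x powr p1 * w1 x) = ennreal (c powr p1) * (ennreal ((\<Sum>\<nu>\<le>0. r ^ \<nu> * level_avg f (2 ^ k) a \<nu> x) powr p1 * w1 x) * indicator ?B x)"
    proof (cases "x \<in> ?B")
      case True
      then have "piece r f a j N x = c * level_avg f (2 ^ k) a 0 x"
        unfolding piece_def Suc c_def nat.case indicator_simps(1)[OF True] by simp
      then show ?thesis unfolding indicator_simps(1)[OF True] by (simp add: powr_mult ennreal_mult' mult.assoc)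
    next
      case False
      then have "piece r f a j N x = 0"
        unfolding piece_def Suc nat.case indicator_simps(2)[OF False] by simp
      then show ?thesis unfolding indicator_simps(2)[OF False] by simp
    qed
  qed
  also have "\<dots> = ennreal (c powr p1) * (\<integral>\<^sup>+x. ennreal ((\<Sum>\<nu>\<le>0. r ^ \<nu> * level_avg f (2 ^ k) a \<nu> x) powr p1 * w1 x)
       * indicator {x. \<forall>i. \<bar>level_index (2 ^ k) a 0 x $ i\<bar> \<le> int N} x \<partial>lebesgue)"
    using w_facts(2) level_box_measurable by (intro nn_integral_cmult) auto
  also have "\<dots> \<le> ennreal (c powr p1) * ennreal (bridge_const r * (D * 2 ^ (k * CARD('n))) powr p1 * A powr (p1 / p0))"
  proof (intro mult_left_mono level_avg_sum_bound[OF _ a r K f f0 A])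
    fix \<nu> :: nat and q :: "int^'n" assume "\<nu> \<le> 0"
    then show "r ^ \<nu> * weight_measure w1 (level_cell (2 ^ k) a \<nu> q) powr (1 / p1)
      \<le> D * 2 ^ (k * CARD('n)) * weight_measure w0 (level_cell (2 ^ k) a \<nu> q) powr (1 / p0)"
      using tw2[of k "(-1) ^ \<nu> *\<^sub>R a" q] by (simp add: level_cell_def)
  qed auto
  also have "\<dots> = ennreal (c powr p1 * (bridge_const r * (D * 2 ^ (k * CARD('n))) powr p1 * A powr (p1 / p0)))"
    by (rule ennreal_mult'[symmetric]) simp
  also have "c powr p1 * (bridge_const r * (D * 2 ^ (k * CARD('n))) powr p1 * A powr (p1 / p0))
     = bridge_const r * D powr p1 * A powr (p1 / p0) * (c * 2 ^ (k * CARD('n))) powr p1"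
    by (simp only: powr_mult mult_ac)
  also have "c * 2 ^ (k * CARD('n)) = 4 / 4 ^ j" by (simp add: c_def Suc)
  finally show ?thesis .
qed

text \<open>The geometric factors \<open>4\<^sup>-\<^sup>j\<close> gained above allow to sum the pieces with the weights \<open>2\<^sup>-\<^sup>j\<close>.\<close>

lemma pieces_sum_norm_le:
  assumes r: "0 < r" "r < 1" and D: "0 \<le> D"
    and tw1: "\<And>\<nu> \<theta> k. r ^ \<nu> * weight_measure w1 (grid_cell (1 / 2 ^ \<nu>) \<theta> k) powr (1 / p1)
      \<le> D * weight_measure w0 (grid_cell (1 / 2 ^ \<nu>) \<theta> k) powr (1 / p0)"
    and tw2: "\<And>i \<theta> k. weight_measure w1 (grid_cell (2 ^ i) \<theta> k) powr (1 / p1)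
      \<le> D * 2 ^ (i * CARD('n)) * weight_measure w0 (grid_cell (2 ^ i) \<theta> k) powr (1 / p0)"
    and f [measurable]: "f \<in> borel_measurable lebesgue" and f0: "\<And>x. 0 \<le> f x"
    and A: "0 \<le> A" "(\<integral>\<^sup>+x. ennreal (f x powr p0 * w0 x) \<partial>lebesgue) \<le> ennreal A"
  shows "(\<integral>\<^sup>+x. ennreal ((\<Sum>(a, j)\<in>third_shifts \<times> {..Suc N}. piece r f a j N x) powr p1 * w1 x) \<partial>lebesgue)
    \<le> ennreal ((2 * card (third_shifts :: (real^'n) set)) powr p1 * (2 * card (third_shifts :: (real^'n) set))
        * bridge_const r * D powr p1 * 4 powr p1 * A powr (p1 / p0))"
proof -
  let ?S = "third_shifts :: (real^'n) set" and ?J = "(third_shifts :: (real^'n) set) \<times> {..Suc N}"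
  have J: "finite ?J" by simp
  define l where "l = (\<lambda>(a :: real^'n, j :: nat). (1/2::real) ^ j)"
  have geo: "(\<Sum>j\<le>n. (1/2::real) ^ j) \<le> 2" for n by (subst sum_gp0) (simp add: field_simps)
  have suml: "(\<Sum>aj\<in>?J. l aj) \<le> 2 * card ?S"
  proof -
    have "(\<Sum>aj\<in>?J. l aj) = (\<Sum>a\<in>?S. \<Sum>j\<le>Suc N. (1/2::real) ^ j)"
      unfolding l_def by (simp only: sum.cartesian_product)
    also have "\<dots> \<le> (\<Sum>a\<in>?S. 2)" by (intro sum_mono geo)
    finally show ?thesis by simp
  qed
  define c where "c = (2 * card ?S) powr p1"
  define E where "E = bridge_const r * D powr p1 * A powr (p1 / p0) * 4 powr p1"
  have c0: "0 \<le> bridge_const r"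
    unfolding bridge_const_def using p kap carleson_const_pos[of p1 kap] by simp
  have E0: "0 \<le> E" using c0 by (simp add: E_def)
  have pw: "(\<Sum>(a, j)\<in>?J. piece r f a j N x) powr p1 \<le> c * (\<Sum>(a, j)\<in>?J. (2 ^ j) powr p1 * piece r f a j N x powr p1)" for x
  proof -
    have "(\<Sum>aj\<in>?J. (\<lambda>(a, j). piece r f a j N x) aj) powr p1 \<le> (\<Sum>aj\<in>?J. l aj) powr p1 * (\<Sum>aj\<in>?J. ((\<lambda>(a, j). piece r f a j N x) aj / l aj) powr p1)"
      by (rule sum_powr_weighted_le[OF J]) (use p piece_nonneg[of f, OF f0 r(1)] in \<open>auto simp: l_def\<close>)
    also have "\<dots> \<le> c * (\<Sum>aj\<in>?J. ((\<lambda>(a, j). piece r f a j N x) aj / l aj) powr p1)"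
      unfolding c_def using suml p by (intro mult_right_mono powr_mono2 sum_nonneg) (auto simp: l_def)
    also have "(\<Sum>aj\<in>?J. ((\<lambda>(a, j). piece r f a j N x) aj / l aj) powr p1) = (\<Sum>(a, j)\<in>?J. (2 ^ j) powr p1 * piece r f a j N x powr p1)"
      by (intro sum.cong refl) (auto simp: l_def power_one_over powr_mult[symmetric] mult.commute)
    finally show ?thesis by (simp add: case_prod_unfold)
  qed
  have "(\<integral>\<^sup>+x. ennreal ((\<Sum>(a, j)\<in>?J. piece r f a j N x) powr p1 * w1 x) \<partial>lebesgue)
    \<le> (\<integral>\<^sup>+x. ennreal c * (\<Sum>(a, j)\<in>?J. ennreal ((2 ^ j) powr p1) * ennreal (piece r f a j N x powr p1 * w1 x)) \<partial>lebesgue)"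
  proof (rule nn_integral_mono)
    fix x
    have "(\<Sum>(a, j)\<in>?J. piece r f a j N x) powr p1 * w1 x \<le> c * (\<Sum>(a, j)\<in>?J. (2 ^ j) powr p1 * piece r f a j N x powr p1) * w1 x"
      by (intro mult_right_mono pw w_facts(5))
    also have "\<dots> = c * (\<Sum>(a, j)\<in>?J. (2 ^ j) powr p1 * (piece r f a j N x powr p1 * w1 x))"
      by (simp add: sum_distrib_right case_prod_unfold mult.assoc)
    finally have "ennreal ((\<Sum>(a, j)\<in>?J. piece r f a j N x) powr p1 * w1 x) \<le> ennreal (c * (\<Sum>(a, j)\<in>?J. (2 ^ j) powr p1 * (piece r f a j N x powr p1 * w1 x)))"
      by (rule ennreal_leI)
    also have "\<dots> = ennreal c * (\<Sum>(a, j)\<in>?J. ennreal ((2 ^ j) powr p1) * ennreal (piece r f a j N x powr p1 * w1 x))"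
      using w_facts(5)[of x] unfolding case_prod_unfold
      by (subst ennreal_mult') (auto simp: c_def sum_ennreal[symmetric] ennreal_mult' intro!: sum_nonneg)
    finally show "ennreal ((\<Sum>(a, j)\<in>?J. piece r f a j N x) powr p1 * w1 x)
       \<le> ennreal c * (\<Sum>(a, j)\<in>?J. ennreal ((2 ^ j) powr p1) * ennreal (piece r f a j N x powr p1 * w1 x))" .
  qed
  also have "\<dots> = ennreal c * (\<Sum>(a, j)\<in>?J. ennreal ((2 ^ j) powr p1) * (\<integral>\<^sup>+x. ennreal (piece r f a j N x powr p1 * w1 x) \<partial>lebesgue))"
    using w_facts(2) unfolding case_prod_unfold
    by (subst nn_integral_cmult, measurable, subst nn_integral_sum, measurable)
      (auto intro!: arg_cong[where f="\<lambda>u. ennreal c * u"] sum.cong nn_integral_cmult)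
  also have "\<dots> \<le> ennreal c * (\<Sum>(a, j)\<in>?J. ennreal (E * (1/2) ^ j))"
  proof (intro mult_left_mono sum_mono)
    fix aj assume "aj \<in> ?J"
    then obtain a j where aj: "aj = (a, j)" "a \<in> ?S" by auto
    have "ennreal ((2 ^ j) powr p1) * (\<integral>\<^sup>+x. ennreal (piece r f a j N x powr p1 * w1 x) \<partial>lebesgue)
       \<le> ennreal ((2 ^ j) powr p1) * ennreal (bridge_const r * D powr p1 * A powr (p1 / p0) * (4 / 4 ^ j) powr p1)"
      by (intro mult_left_mono piece_norm_le[OF r D aj(2) tw1 tw2 f f0 A]) auto
    also have "\<dots> = ennreal ((2 ^ j) powr p1 * (bridge_const r * D powr p1 * A powr (p1 / p0) * (4 / 4 ^ j) powr p1))"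
      by (rule ennreal_mult'[symmetric]) simp
    also have "\<dots> \<le> ennreal (E * (1/2) ^ j)"
    proof (rule ennreal_leI)
      have "(2 ^ j) powr p1 * (4 / 4 ^ j) powr p1 = 4 powr p1 * ((1/2) ^ j) powr p1"
      proof -
        have "(2::real) ^ j * (4 / 4 ^ j) = 4 * (1/2) ^ j"
          using power_mult_distrib[of "2::real" 2 j] by (simp add: power_one_over field_simps)
        then show ?thesis by (simp only: powr_mult[symmetric])
      qed
      also have "((1/2::real) ^ j) powr p1 \<le> (1/2) ^ j"
        using p powr_mono_both'[of 1 p1 "(1/2::real) ^ j" "(1/2) ^ j"] by (simp add: power_le_one powr_mono')
      finally have "(bridge_const r * D powr p1 * A powr (p1 / p0)) * ((2 ^ j) powr p1 * (4 / 4 ^ j) powr p1)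
          \<le> (bridge_const r * D powr p1 * A powr (p1 / p0)) * (4 powr p1 * (1/2) ^ j)"
        using c0 by (intro mult_left_mono) auto
      then show "(2 ^ j) powr p1 * (bridge_const r * D powr p1 * A powr (p1 / p0) * (4 / 4 ^ j) powr p1) \<le> E * (1/2) ^ j"
        unfolding E_def by (simp only: mult_ac)
    qed
    finally show "(case aj of (a, j) \<Rightarrow> ennreal ((2 ^ j) powr p1) * (\<integral>\<^sup>+x. ennreal (piece r f a j N x powr p1 * w1 x) \<partial>lebesgue))
       \<le> (case aj of (a, j) \<Rightarrow> ennreal (E * (1/2) ^ j))" by (simp add: aj(1))
  qed auto
  also have "(\<Sum>(a, j)\<in>?J. ennreal (E * (1/2) ^ j)) = ennreal (\<Sum>(a, j)\<in>?J. E * (1/2) ^ j)"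
    unfolding case_prod_unfold using E0 by (intro sum_ennreal) auto
  also have "ennreal c * ennreal (\<Sum>(a, j)\<in>?J. E * (1/2) ^ j) \<le> ennreal c * ennreal (E * (2 * card ?S))"
  proof (intro mult_left_mono ennreal_leI)
    have "(\<Sum>(a, j)\<in>?J. E * (1/2) ^ j) = E * (\<Sum>aj\<in>?J. l aj)"
      by (simp add: l_def sum_distrib_left case_prod_unfold)
    then show "(\<Sum>(a, j)\<in>?J. E * (1/2) ^ j) \<le> E * (2 * card ?S)" using suml E0 by (simp add: mult_left_mono)
  qed auto
  also have "\<dots> = ennreal (c * (E * (2 * card ?S)))"
    by (rule ennreal_mult'[symmetric]) (simp add: c_def)
  also have "c * (E * (2 * card ?S)) = (2 * card ?S) powr p1 * (2 * card ?S) * bridge_const r * D powr p1 * 4 powr p1 * A powr (p1 / p0)"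
    unfolding c_def E_def by (simp only: mult_ac)
  finally show ?thesis .
qed


text \<open>At each scale the kernel is dominated by the cells around \<open>x\<close> in all
  shifted grids, which gives averages. For fixed \<open>x\<close>, any finite set of scales is
  contained in the pieces with large \<open>N\<close>, whence the supremum.\<close>

lemma lattice_kernel_partial_le:
  fixes f :: "real^'n \<Rightarrow> real"
  assumes r: "0 < r" "r < 1" and f [measurable]: "f \<in> borel_measurable lebesgue" and f0: "\<And>x. 0 \<le> f x"
    and A: "0 \<le> A" "(\<integral>\<^sup>+x. ennreal (f x powr p0 * w0 x) \<partial>lebesgue) \<le> ennreal A"
  shows "(\<integral>\<^sup>+y. lattice_kernel r (x - y) * ennreal (f y) \<partial>lebesgue)
    \<le> (SUP N. ennreal (\<Sum>(a, j)\<in>third_shifts \<times> {..Suc N}. piece r f a j N x))"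
proof -
  let ?S = "third_shifts :: (real^'n) set"
  let ?n = "CARD('n)"
  let ?t = "\<lambda>N. \<Sum>(a, j)\<in>?S \<times> {..Suc N}. piece r f a j N x"
  define h1 where "h1 n = (\<Sum>a\<in>?S. r ^ n * level_avg f 1 a n x)" for n
  define h2 where "h2 n = (\<Sum>a\<in>?S. 1 / (4 ^ n * 2 ^ (n * ?n)) * level_avg f (2 ^ n) a 0 x)" for n
  have h0: "0 \<le> h1 n" "0 \<le> h2 n" for n
    unfolding h1_def h2_def using r level_avg_nonneg[of f, OF f0] by (auto intro!: sum_nonneg)
  have trm: "(\<integral>\<^sup>+y. (ennreal (r ^ n * 2 ^ (n * ?n)) * indicator {z. \<forall>i. \<bar>z $ i\<bar> < 1 / 2 ^ n / 3} (x - y) +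
     ennreal (1 / 4 ^ (n * (?n + 1))) * indicator {z. \<forall>i. \<bar>z $ i\<bar> < 2 ^ n / 3} (x - y)) * ennreal (f y) \<partial>lebesgue)
     \<le> ennreal (h1 n + h2 n)" for n
  proof -
    have "(\<integral>\<^sup>+y. (ennreal (r ^ n * 2 ^ (n * ?n)) * indicator {z. \<forall>i. \<bar>z $ i\<bar> < 1 / 2 ^ n / 3} (x - y) +
     ennreal (1 / 4 ^ (n * (?n + 1))) * indicator {z. \<forall>i. \<bar>z $ i\<bar> < 2 ^ n / 3} (x - y)) * ennreal (f y) \<partial>lebesgue)
     = (\<integral>\<^sup>+y. ennreal (r ^ n * 2 ^ (n * ?n)) * indicator {z. \<forall>i. \<bar>z $ i\<bar> < 1 / 2 ^ n / 3} (x - y) * ennreal (f y) \<partial>lebesgue) +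
     (\<integral>\<^sup>+y. ennreal (1 / 4 ^ (n * (?n + 1))) * indicator {z. \<forall>i. \<bar>z $ i\<bar> < 2 ^ n / 2 ^ 0 / 3} (x - y) * ennreal (f y) \<partial>lebesgue)"
      unfolding distrib_right power_0 div_by_1
      by (rule nn_integral_add; intro borel_measurable_times_ennreal near_indicator_measurable borel_measurable_const measurable_compose[OF f measurable_ennreal])
    also have "\<dots> \<le> ennreal (\<Sum>a\<in>?S. r ^ n * 2 ^ (n * ?n) * (1 / 2 ^ n) ^ ?n * level_avg f 1 a n x)
       + ennreal (\<Sum>a\<in>?S. 1 / 4 ^ (n * (?n + 1)) * (2 ^ n / 2 ^ 0) ^ ?n * level_avg f (2 ^ n) a 0 x)"
      using r by (intro add_mono near_average_le[OF _ _ f f0 A]) auto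
    also have "(\<Sum>a\<in>?S. r ^ n * 2 ^ (n * ?n) * (1 / 2 ^ n) ^ ?n * level_avg f 1 a n x) = h1 n"
      unfolding h1_def by (simp add: power_one_over power_mult power_divide)
    also have "(\<Sum>a\<in>?S. 1 / 4 ^ (n * (?n + 1)) * (2 ^ n / 2 ^ 0) ^ ?n * level_avg f (2 ^ n) a 0 x) = h2 n"
    proof -
      have "1 / 4 ^ (n * (?n + 1)) * (2 ^ n / 2 ^ 0) ^ ?n = 1 / (4 ^ n * 2 ^ (n * ?n) :: real)"
      proof -
        have "(4::real) ^ (n * (?n + 1)) = 4 ^ n * (2 ^ (n * ?n) * 2 ^ (n * ?n))"
          using power_mult_distrib[of "2::real" 2 "n * ?n"] by (simp add: power_add)
        then show ?thesis by (simp add: power_mult)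
      qed
      then show ?thesis unfolding h2_def by (simp only:)
    qed
    also have "ennreal (h1 n) + ennreal (h2 n) = ennreal (h1 n + h2 n)" using h0 by simp
    finally show ?thesis .
  qed
  have m: "(\<lambda>y. (ennreal (r ^ n * 2 ^ (n * ?n)) * indicator {z. \<forall>i. \<bar>z $ i\<bar> < 1 / 2 ^ n / 3} (x - y) +
     ennreal (1 / 4 ^ (n * (?n + 1))) * indicator {z. \<forall>i. \<bar>z $ i\<bar> < 2 ^ n / 3} (x - y)) * ennreal (f y)) \<in> borel_measurable lebesgue" for n
    by (intro borel_measurable_times_ennreal borel_measurable_add borel_measurable_const near_indicator_measurable
        measurable_compose[OF f measurable_ennreal])
  have "(\<integral>\<^sup>+y. lattice_kernel r (x - y) * ennreal (f y) \<partial>lebesgue) =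
    (\<Sum>n. \<integral>\<^sup>+y. (ennreal (r ^ n * 2 ^ (n * ?n)) * indicator {z. \<forall>i. \<bar>z $ i\<bar> < 1 / 2 ^ n / 3} (x - y) +
     ennreal (1 / 4 ^ (n * (?n + 1))) * indicator {z. \<forall>i. \<bar>z $ i\<bar> < 2 ^ n / 3} (x - y)) * ennreal (f y) \<partial>lebesgue)"
    unfolding lattice_kernel_def ennreal_suminf_multc[symmetric] by (rule nn_integral_suminf[OF m])
  also have "\<dots> \<le> (\<Sum>n. ennreal (h1 n + h2 n))"
    by (intro suminf_le trm) auto
  also have "\<dots> \<le> (SUP N. ennreal (?t N))"
  proof (rule suminf_le_const)
    fix M
    \<comment> \<open>Large enough for \<open>x\<close> to lie in the truncation region at every
      scale \<open>2 ^ k\<close> and for every shift: a shift and a floor move an index by at most 1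
      each.\<close>
    obtain N0 where N0: "norm x + 3 \<le> real N0" using real_arch_simple by blast
    define N where "N = max N0 M"
    have box: "x \<in> {x. \<forall>i. \<bar>level_index (2 ^ k) a 0 x $ i\<bar> \<le> int N}" if a: "a \<in> ?S" for a k
    proof -
      have "\<bar>level_index (2 ^ k) a 0 x $ i\<bar> \<le> int N" for i
      proof -
        have "\<bar>x $ i / 2 ^ k\<bar> \<le> norm x"
        proof -
          have "\<bar>x $ i / 2 ^ k\<bar> \<le> \<bar>x $ i\<bar> / 1" unfolding abs_divide by (intro divide_left_mono) auto
          then show ?thesis using component_le_norm_cart[of x i] by simp
        qed
        moreover have "\<bar>a $ i\<bar> \<le> 1" using a[unfolded third_shifts_def] by (auto elim: allE[of _ i])
        moreover have "real N0 \<le> real N" by (simp add: N_def)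
        ultimately have "\<bar>x $ i / 2 ^ k - a $ i\<bar> + 1 \<le> real N" using N0 by linarith
        then have "\<bar>\<lfloor>x $ i / 2 ^ k - a $ i\<rfloor>\<bar> \<le> int N" by linarith
        then show ?thesis by (simp add: level_index_def grid_index_def)
      qed
      then show ?thesis by simp
    qed
    have p0: "piece r f a 0 N x = (\<Sum>\<nu>\<le>N. r ^ \<nu> * level_avg f 1 a \<nu> x)" if "a \<in> ?S" for a
      unfolding piece_def nat.case indicator_simps(1)[OF box[OF that, of 0, unfolded power_0]] by simp
    have pS: "piece r f a (Suc k) N x = 1 / (4 ^ k * 2 ^ (k * ?n)) * level_avg f (2 ^ k) a 0 x" if "a \<in> ?S" for a k
      unfolding piece_def nat.case indicator_simps(1)[OF box[OF that, of k]] by simp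
    have "(\<Sum>n<M. h1 n + h2 n) \<le> (\<Sum>n\<le>N. h1 n) + (\<Sum>n\<le>N. h2 n)"
      unfolding sum.distrib using h0 by (intro add_mono sum_mono2) (auto simp: N_def)
    also have "\<dots> = (\<Sum>a\<in>?S. piece r f a 0 N x + (\<Sum>k\<le>N. piece r f a (Suc k) N x))"
    proof -
      have "(\<Sum>n\<le>N. h1 n) = (\<Sum>a\<in>?S. piece r f a 0 N x)"
        unfolding h1_def by (subst sum.swap) (auto intro!: sum.cong simp: p0)
      moreover have "(\<Sum>n\<le>N. h2 n) = (\<Sum>a\<in>?S. \<Sum>k\<le>N. piece r f a (Suc k) N x)"
        unfolding h2_def by (subst sum.swap) (auto intro!: sum.cong simp: pS)
      ultimately show ?thesis by (simp add: sum.distrib)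
    qed
    also have "\<dots> = ?t N"
      unfolding sum.cartesian_product[symmetric] sum.atMost_Suc_shift by simp
    finally have "ennreal (\<Sum>n<M. h1 n + h2 n) \<le> ennreal (?t N)" by (rule ennreal_leI)
    also have "\<dots> \<le> (SUP N. ennreal (?t N))" by (rule SUP_upper) simp
    finally show "(\<Sum>n<M. ennreal (h1 n + h2 n)) \<le> (SUP N. ennreal (?t N))"
      using h0 by (subst sum_ennreal) auto
  qed simp
  finally show ?thesis .
qed

text \<open>The majorant is defined backwards, as the p1-th root of \<open>M / w1\<close> with
  \<open>M\<close> the supremum of the truncated integrands. Monotone convergence bounds the
  integral of \<open>M\<close>, so finiteness almost everywhere and the norm bound come from the
  same estimate.\<close>

theorem lattice_kernel_bounded:
  assumes r: "0 < r" "r < 1" and D: "0 \<le> D"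
    and tw1: "\<And>\<nu> \<theta> k. r ^ \<nu> * weight_measure w1 (grid_cell (1 / 2 ^ \<nu>) \<theta> k) powr (1 / p1)
      \<le> D * weight_measure w0 (grid_cell (1 / 2 ^ \<nu>) \<theta> k) powr (1 / p0)"
    and tw2: "\<And>i \<theta> k. weight_measure w1 (grid_cell (2 ^ i) \<theta> k) powr (1 / p1)
      \<le> D * 2 ^ (i * CARD('n)) * weight_measure w0 (grid_cell (2 ^ i) \<theta> k) powr (1 / p0)"
  obtains C where "0 \<le> C"
    and "\<And>f A. f \<in> borel_measurable lebesgue \<Longrightarrow> (\<And>x. 0 \<le> f x) \<Longrightarrow> 0 \<le> A \<Longrightarrow>
      (\<integral>\<^sup>+x. ennreal (f x powr p0 * w0 x) \<partial>lebesgue) \<le> ennreal A \<Longrightarrow>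
      \<exists>T. T \<in> borel_measurable lebesgue \<and> (\<forall>x. 0 \<le> T x) \<and>
        (AE x in lebesgue. (\<integral>\<^sup>+y. lattice_kernel r (x - y) * ennreal (f y) \<partial>lebesgue) \<le> ennreal (T x)) \<and>
        (\<integral>\<^sup>+x. ennreal (T x powr p1 * w1 x) \<partial>lebesgue) \<le> ennreal (C * A powr (p1 / p0))"
proof -
  let ?S = "third_shifts :: (real^'n) set"
  define C where "C = (2 * card ?S) powr p1 * (2 * card ?S) * bridge_const r * D powr p1 * 4 powr p1"
  have c0: "0 \<le> bridge_const r"
    unfolding bridge_const_def using p kap carleson_const_pos[of p1 kap] by simp
  have C: "0 \<le> C" unfolding C_def using c0 by simp
  show thesis
  proof (rule that[OF C])
    fix f A assume f [measurable]: "f \<in> borel_measurable lebesgue" and f0: "\<And>x. 0 \<le> f x"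
    and A: "0 \<le> A" "(\<integral>\<^sup>+x. ennreal (f x powr p0 * w0 x) \<partial>lebesgue) \<le> ennreal A"
    have w1m [measurable]: "w1 \<in> borel_measurable lebesgue" by (rule w_facts)
    define t where "t N x = (\<Sum>(a, j)\<in>?S \<times> {..Suc N}. piece r f a j N x)" for N x
    have tm [measurable]: "t N \<in> borel_measurable lebesgue" for N
      unfolding t_def[abs_def] case_prod_unfold by measurable
    have t0: "0 \<le> t N x" for N x
      unfolding t_def using piece_nonneg[of f, OF f0 r(1)] by (auto intro!: sum_nonneg)
    have tmono: "t M x \<le> t N x" if "M \<le> N" for M N x
    proof -
      have "t M x \<le> (\<Sum>(a, j)\<in>?S \<times> {..Suc M}. piece r f a j N x)"
        unfolding t_def case_prod_unfold by (intro sum_mono piece_mono f0 r(1) that)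
      also have "\<dots> \<le> t N x"
        unfolding t_def using that piece_nonneg[of f, OF f0 r(1)] by (intro sum_mono2) auto
      finally show ?thesis .
    qed
    define M where "M x = (SUP N. ennreal (t N x powr p1 * w1 x))" for x
    have Mm [measurable]: "M \<in> borel_measurable lebesgue" unfolding M_def[abs_def] by measurable
    have "(\<integral>\<^sup>+x. M x \<partial>lebesgue) = (SUP N. \<integral>\<^sup>+x. ennreal (t N x powr p1 * w1 x) \<partial>lebesgue)"
      unfolding M_def
    proof (rule nn_integral_monotone_convergence_SUP)
      show "incseq (\<lambda>N x. ennreal (t N x powr p1 * w1 x))"
        using tmono t0 w_facts(5) p by (auto simp: incseq_def le_fun_def intro!: ennreal_leI mult_right_mono powr_mono2)
    qed measurable
    also have "\<dots> \<le> ennreal (C * A powr (p1 / p0))"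
      unfolding t_def C_def by (intro SUP_least pieces_sum_norm_le[OF r D tw1 tw2 f f0 A])
    finally have MI: "(\<integral>\<^sup>+x. M x \<partial>lebesgue) \<le> ennreal (C * A powr (p1 / p0))" .
    have "AE x in lebesgue. M x \<noteq> \<infinity>"
      by (rule nn_integral_PInf_AE) (use MI in \<open>auto simp: top_unique\<close>)
    define T where "T x = (enn2real (M x) / w1 x) powr (1 / p1)" for x
    have tT: "AE x in lebesgue. (\<integral>\<^sup>+y. lattice_kernel r (x - y) * ennreal (f y) \<partial>lebesgue) \<le> ennreal (T x)"
      using \<open>AE x in lebesgue. M x \<noteq> \<infinity>\<close> w_facts(8)
    proof eventually_elim
      case (elim x)
      have "ennreal (t N x) \<le> ennreal (T x)" for N
      proof (rule ennreal_leI)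
        have "ennreal (t N x powr p1 * w1 x) \<le> M x" unfolding M_def by (rule SUP_upper) simp
        then have "t N x powr p1 * w1 x \<le> enn2real (M x)"
          using elim enn2real_mono[of "ennreal (t N x powr p1 * w1 x)" "M x"] by (simp add: less_top)
        then have "(t N x powr p1) powr (1 / p1) \<le> (enn2real (M x) / w1 x) powr (1 / p1)"
          using elim p by (intro powr_mono2) (auto simp: field_simps)
        then show "t N x \<le> T x" using t0[of N x] p by (simp add: T_def powr_powr)
      qed
      then have "(SUP N. ennreal (t N x)) \<le> ennreal (T x)" by (rule SUP_least)
      then show ?case
        using lattice_kernel_partial_le[OF r f f0 A, of x] unfolding t_def by simp
    qed
    have "(\<integral>\<^sup>+x. ennreal (T x powr p1 * w1 x) \<partial>lebesgue) \<le> (\<integral>\<^sup>+x. M x \<partial>lebesgue)"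
    proof (rule nn_integral_mono_AE)
      show "AE x in lebesgue. ennreal (T x powr p1 * w1 x) \<le> M x"
        using \<open>AE x in lebesgue. M x \<noteq> \<infinity>\<close> w_facts(8)
      proof eventually_elim
        case (elim x)
        then have "T x powr p1 * w1 x = enn2real (M x)" using p by (simp add: T_def powr_powr)
        then show ?case using elim by (simp add: less_top)
      qed
    qed
    also note MI
    finally show "\<exists>T. T \<in> borel_measurable lebesgue \<and> (\<forall>x. 0 \<le> T x) \<and>
        (AE x in lebesgue. (\<integral>\<^sup>+y. lattice_kernel r (x - y) * ennreal (f y) \<partial>lebesgue) \<le> ennreal (T x)) \<and>
        (\<integral>\<^sup>+x. ennreal (T x powr p1 * w1 x) \<partial>lebesgue) \<le> ennreal (C * A powr (p1 / p0))"
      using tT by (intro exI[of _ T]) (auto simp: T_def[abs_def])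
  qed
qed

end

section \<open>The Bessel kernel\<close>

lemma lborel_distr_reflect: "distr lborel borel (\<lambda>y. x - y) = (lborel :: 'a::euclidean_space measure)"
  using lborel_affine[of "-1" x] by (simp add: density_1)

lemma nn_integral_lborel_reflect:
  fixes f :: "'a::euclidean_space \<Rightarrow> ennreal"
  assumes "f \<in> borel_measurable borel"
  shows "(\<integral>\<^sup>+y. f (x - y) \<partial>lborel) = (\<integral>\<^sup>+y. f y \<partial>lborel)"
  using nn_integral_distr[of "\<lambda>y. x - y" lborel borel f] assms by (simp add: lborel_distr_reflect)

lemma lborel_integral_reflect:
  fixes f :: "'a::euclidean_space \<Rightarrow> 'b::{banach, second_countable_topology}"
  assumes "f \<in> borel_measurable borel"
  shows "(LINT y|lborel. f (x - y)) = (LINT y|lborel. f y)"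
  using integral_distr[of "\<lambda>y. x - y" lborel borel f] assms by (simp add: lborel_distr_reflect)

lemma lborel_integrable_reflect:
  fixes f :: "'a::euclidean_space \<Rightarrow> 'b::{banach, second_countable_topology}"
  assumes "f \<in> borel_measurable borel"
  shows "integrable lborel (\<lambda>y. f (x - y)) \<longleftrightarrow> integrable lborel f"
  using integrable_distr_eq[of "\<lambda>y. x - y" lborel borel f] assms by (simp add: lborel_distr_reflect)

section \<open>Gaussian integrals and moments of the heat kernel\<close>

lemma lborel_prod_integral:
  fixes f :: "'a::euclidean_space \<Rightarrow> real \<Rightarrow> 'b::{real_normed_field, banach, second_countable_topology}"
  assumes f: "\<And>b. b \<in> Basis \<Longrightarrow> integrable lborel (f b)"
  shows "integrable lborel (\<lambda>x. \<Prod>b\<in>Basis. f b (x \<bullet> b))"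
    and "(LINT x|lborel. (\<Prod>b\<in>Basis. f b (x \<bullet> b))) = (\<Prod>b\<in>Basis. (LINT t|lborel. f b t))"
proof -
  interpret P: product_sigma_finite "\<lambda>_::'a. lborel :: real measure" ..
  have [measurable]: "f b \<in> borel_measurable borel" if "b \<in> Basis" for b
    using borel_measurable_integrable[OF f[OF that]] by simp
  have T [measurable]: "(\<lambda>g. \<Sum>b\<in>Basis. g b *\<^sub>R b) \<in> (\<Pi>\<^sub>M b\<in>(Basis :: 'a set). lborel :: real measure) \<rightarrow>\<^sub>M borel"
    by measurable
  have F [measurable]: "(\<lambda>x::'a. \<Prod>b\<in>Basis. f b (x \<bullet> b)) \<in> borel_measurable borel"
    by (intro borel_measurable_prod) measurable
  have eq: "(\<Prod>b\<in>Basis. f b ((\<Sum>b\<in>Basis. g b *\<^sub>R b) \<bullet> b)) = (\<Prod>b\<in>Basis. f b (g b))" for g :: "'a \<Rightarrow> real"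
    by (intro prod.cong) auto
  have "integrable (distr (\<Pi>\<^sub>M b\<in>(Basis :: 'a set). lborel) borel (\<lambda>g. \<Sum>b\<in>Basis. g b *\<^sub>R b)) (\<lambda>x. \<Prod>b\<in>Basis. f b (x \<bullet> b))"
    unfolding integrable_distr_eq[OF T F] eq by (intro P.product_integrable_prod f) auto
  then show "integrable lborel (\<lambda>x::'a. \<Prod>b\<in>Basis. f b (x \<bullet> b))" unfolding lborel_eq[symmetric] .
  have "integral\<^sup>L (distr (\<Pi>\<^sub>M b\<in>(Basis :: 'a set). lborel) borel (\<lambda>g. \<Sum>b\<in>Basis. g b *\<^sub>R b)) (\<lambda>x. \<Prod>b\<in>Basis. f b (x \<bullet> b))
    = (\<Prod>b\<in>Basis. (LINT t|lborel. f b t))"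
    unfolding integral_distr[OF T F] eq by (intro P.product_integral_prod f) auto
  then show "(LINT x|lborel. (\<Prod>b\<in>Basis. f b (x \<bullet> b))) = (\<Prod>b\<in>Basis. (LINT t|lborel. f b t))"
    unfolding lborel_eq[symmetric] .
qed

text \<open>The characteristic function of the standard normal law, rescaled by
  \<open>c = sqrt (2 * t)\<close>.\<close>

lemma gaussian_fourier_real:
  fixes t z :: real
  assumes t: "0 < t"
  shows "integrable lborel (\<lambda>x::real. exp (- \<i> * complex_of_real (z * x)) * complex_of_real (exp (- t * x\<^sup>2)))"
    and "(LINT x|lborel. exp (- \<i> * complex_of_real (z * x)) * complex_of_real (exp (- t * x\<^sup>2)))
      = complex_of_real (sqrt (pi / t) * exp (- z\<^sup>2 / (4 * t)))"
proof -
  define c where "c = sqrt (2 * t)"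
  have c: "0 < c" "c\<^sup>2 = 2 * t" using t by (auto simp: c_def)
  define h :: "real \<Rightarrow> complex" where "h x = std_normal_density x *\<^sub>R exp (\<i> * complex_of_real (- z / c * x))" for x
  have ih: "integrable lborel h"
    unfolding h_def
  proof (rule Bochner_Integration.integrable_bound[of lborel "std_normal_density"])
    show "integrable lborel std_normal_density" by simp
  qed (auto simp: norm_mult)
  have "(LINT x|lborel. h x) = char std_normal_distribution (- z / c)"
    unfolding char_def h_def by (subst integral_density) (auto simp: mult_ac)
  also have "\<dots> = complex_of_real (exp (- z\<^sup>2 / (4 * t)))"
    unfolding char_std_normal_distribution using c by (simp add: power_divide)
  finally have vh: "(LINT x|lborel. h x) = complex_of_real (exp (- z\<^sup>2 / (4 * t)))" .
  have hc: "h (0 + c * x) = (1 / sqrt (2 * pi)) *\<^sub>R (exp (- \<i> * complex_of_real (z * x)) * complex_of_real (exp (- t * x\<^sup>2)))" for x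
  proof -
    have "exp (- (c * x)\<^sup>2 / 2) = exp (- t * x\<^sup>2)" using c by (simp add: power_mult_distrib)
    moreover have "exp (\<i> * complex_of_real (- z / c * (c * x))) = exp (- \<i> * complex_of_real (z * x))" using c by simp
    ultimately show ?thesis
      unfolding h_def std_normal_density_def by (simp add: scaleR_conv_of_real mult_ac)
  qed
  have "integrable lborel (\<lambda>x. h (0 + c * x))" by (rule lborel_integrable_real_affine[OF ih]) (use c in simp)
  then have "integrable lborel (\<lambda>x. sqrt (2 * pi) *\<^sub>R h (0 + c * x))" by simp
  then show "integrable lborel (\<lambda>x::real. exp (- \<i> * complex_of_real (z * x)) * complex_of_real (exp (- t * x\<^sup>2)))"
    unfolding hc by simp
  have "(LINT x|lborel. h x) = \<bar>c\<bar> *\<^sub>R (LINT x|lborel. h (0 + c * x))"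
    by (rule lborel_integral_real_affine) (use c in simp)
  then have "complex_of_real (exp (- z\<^sup>2 / (4 * t))) = (c / sqrt (2 * pi)) *\<^sub>R
      (LINT x|lborel. exp (- \<i> * complex_of_real (z * x)) * complex_of_real (exp (- t * x\<^sup>2)))"
    unfolding vh hc using c by simp
  then have "(sqrt (2 * pi) / c) *\<^sub>R complex_of_real (exp (- z\<^sup>2 / (4 * t))) =
      (LINT x|lborel. exp (- \<i> * complex_of_real (z * x)) * complex_of_real (exp (- t * x\<^sup>2)))"
    using c by simp
  moreover have "sqrt (2 * pi) / c = sqrt (pi / t)" using t by (simp add: c_def real_sqrt_divide[symmetric])
  ultimately show "(LINT x|lborel. exp (- \<i> * complex_of_real (z * x)) * complex_of_real (exp (- t * x\<^sup>2)))
      = complex_of_real (sqrt (pi / t) * exp (- z\<^sup>2 / (4 * t)))"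
    by (simp add: scaleR_conv_of_real)
qed

lemma gaussian_fourier:
  fixes z :: "real^'n"
  assumes t: "0 < t"
  shows "integrable lborel (\<lambda>x::real^'n. exp (- \<i> * complex_of_real (x \<bullet> z)) * complex_of_real (exp (- t * (norm x)\<^sup>2)))"
    and "(LINT x|lborel. exp (- \<i> * complex_of_real (x \<bullet> z)) * complex_of_real (exp (- t * (norm x)\<^sup>2)))
      = complex_of_real (sqrt (pi / t) ^ CARD('n) * exp (- (norm z)\<^sup>2 / (4 * t)))"
proof -
  have prod: "exp (- \<i> * complex_of_real (x \<bullet> z)) * complex_of_real (exp (- t * (norm x)\<^sup>2)) =
    (\<Prod>b\<in>Basis. exp (- \<i> * complex_of_real (z \<bullet> b * (x \<bullet> b))) * complex_of_real (exp (- t * (x \<bullet> b)\<^sup>2)))" for x :: "real^'n"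
  proof -
    have "x \<bullet> z = (\<Sum>b\<in>Basis. z \<bullet> b * (x \<bullet> b))" by (subst euclidean_inner) (simp add: mult.commute)
    moreover have "(norm x)\<^sup>2 = (\<Sum>b\<in>Basis. (x \<bullet> b)\<^sup>2)"
      unfolding power2_norm_eq_inner by (subst euclidean_inner) (simp add: power2_eq_square)
    moreover have "exp (- \<i> * complex_of_real (\<Sum>b\<in>Basis. z \<bullet> b * (x \<bullet> b))) = (\<Prod>b\<in>Basis. exp (- \<i> * complex_of_real (z \<bullet> b * (x \<bullet> b))))"
      by (simp add: exp_sum[symmetric] sum_distrib_left sum_negf)
    moreover have "exp (- t * (\<Sum>b\<in>Basis. (x \<bullet> b)\<^sup>2)) = (\<Prod>b\<in>Basis. exp (- t * (x \<bullet> b)\<^sup>2))"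
      by (simp add: exp_sum[symmetric] sum_distrib_left sum_negf)
    ultimately show ?thesis by (simp only: prod.distrib of_real_prod)
  qed
  show "integrable lborel (\<lambda>x::real^'n. exp (- \<i> * complex_of_real (x \<bullet> z)) * complex_of_real (exp (- t * (norm x)\<^sup>2)))"
    unfolding prod by (rule lborel_prod_integral(1)) (rule gaussian_fourier_real(1)[OF t])
  have "(norm z)\<^sup>2 = (\<Sum>b\<in>Basis. (z \<bullet> b)\<^sup>2)"
    unfolding power2_norm_eq_inner by (subst euclidean_inner) (simp add: power2_eq_square)
  then have "(\<Prod>b\<in>(Basis :: (real^'n) set). complex_of_real (sqrt (pi / t) * exp (- (z \<bullet> b)\<^sup>2 / (4 * t))))
      = complex_of_real (sqrt (pi / t) ^ CARD('n) * exp (- (norm z)\<^sup>2 / (4 * t)))"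
  proof -
    have "(\<Prod>b\<in>(Basis :: (real^'n) set). exp (- (z \<bullet> b)\<^sup>2 / (4 * t))) = exp (\<Sum>b\<in>(Basis :: (real^'n) set). - (z \<bullet> b)\<^sup>2 / (4 * t))"
      by (rule exp_sum[symmetric]) simp
    moreover assume "(norm z)\<^sup>2 = (\<Sum>b\<in>Basis. (z \<bullet> b)\<^sup>2)"
    then have "- (norm z)\<^sup>2 / (4 * t) = (\<Sum>b\<in>(Basis :: (real^'n) set). - (z \<bullet> b)\<^sup>2 / (4 * t))"
      by (simp only: sum_divide_distrib[symmetric] sum_negf)
    ultimately show ?thesis by (simp only: of_real_prod[symmetric] prod.distrib prod_constant) simp
  qed
  then show "(LINT x|lborel. exp (- \<i> * complex_of_real (x \<bullet> z)) * complex_of_real (exp (- t * (norm x)\<^sup>2)))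
      = complex_of_real (sqrt (pi / t) ^ CARD('n) * exp (- (norm z)\<^sup>2 / (4 * t)))"
    unfolding prod by (subst lborel_prod_integral(2)) (use gaussian_fourier_real[OF t] in auto)
qed

lemma nn_integral_gaussian:
  assumes t: "0 < t"
  shows "(\<integral>\<^sup>+x. ennreal (exp (- t * (norm x)\<^sup>2)) \<partial>(lborel :: (real^'n) measure)) = ennreal (sqrt (pi / t) ^ CARD('n))"
proof -
  have i: "integrable lborel (\<lambda>x::real^'n. complex_of_real (exp (- t * (norm x)\<^sup>2)))"
    using gaussian_fourier(1)[OF t, of "0 :: real^'n"] by simp
  have v: "(LINT x|lborel. complex_of_real (exp (- t * (norm (x::real^'n))\<^sup>2))) = complex_of_real (sqrt (pi / t) ^ CARD('n))"
    using gaussian_fourier(2)[OF t, of "0 :: real^'n"] by simp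
  have "integrable lborel (\<lambda>x::real^'n. exp (- t * (norm x)\<^sup>2))" using integrable_norm[OF i] by simp
  moreover have "(LINT x|lborel. exp (- t * (norm (x::real^'n))\<^sup>2)) = sqrt (pi / t) ^ CARD('n)"
    using v by (simp only: integral_complex_of_real of_real_eq_iff)
  ultimately show ?thesis by (subst nn_integral_eq_integral) auto
qed

definition heat :: "real \<Rightarrow> real^'n \<Rightarrow> real" where
  "heat t y = exp (- (norm y)\<^sup>2 / (4 * t)) / sqrt (4 * pi * t) ^ CARD('n)"

lemma heat_measurable [measurable]: "(\<lambda>(t, y). heat t y) \<in> borel_measurable (borel \<Otimes>\<^sub>M (borel :: (real^'n) measure))"
  unfolding heat_def by measurable

lemma heat_nonneg: "0 \<le> t \<Longrightarrow> 0 \<le> heat t y"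
  by (simp add: heat_def)

lemma nn_integral_heat:
  assumes t: "0 < t" shows "(\<integral>\<^sup>+y. ennreal (heat t y) \<partial>(lborel :: (real^'n) measure)) = 1"
proof -
  have t4: "0 < 1 / (4 * t)" using t by simp
  have "ennreal (heat t y) = ennreal (1 / sqrt (4 * pi * t) ^ CARD('n)) * ennreal (exp (- (1 / (4 * t)) * (norm y)\<^sup>2))" for y :: "real^'n"
    using t by (subst ennreal_mult[symmetric]) (auto simp: heat_def)
  then have "(\<integral>\<^sup>+y. ennreal (heat t y) \<partial>(lborel :: (real^'n) measure))
    = ennreal (1 / sqrt (4 * pi * t) ^ CARD('n)) * ennreal (sqrt (pi / (1 / (4 * t))) ^ CARD('n))"
    by (simp only: nn_integral_cmult[OF measurable_compose[OF _ measurable_ennreal]] nn_integral_gaussian[OF t4])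
      (subst nn_integral_cmult, measurable, simp only: nn_integral_gaussian[OF t4])
  also have "pi / (1 / (4 * t)) = 4 * pi * t" using t by simp
  also have "ennreal (1 / sqrt (4 * pi * t) ^ CARD('n)) * ennreal (sqrt (4 * pi * t) ^ CARD('n)) = 1"
    using t by (subst ennreal_mult[symmetric]) auto
  finally show ?thesis .
qed

lemma power_le_fact_exp:
  fixes x :: real assumes "0 \<le> x" shows "x ^ k \<le> fact k * exp x"
proof -
  have "(\<Sum>n\<in>{k}. x ^ n /\<^sub>R fact n) \<le> (\<Sum>n. x ^ n /\<^sub>R fact n)"
    using assms by (intro sum_le_suminf[OF summable_exp_generic]) auto
  then have "x ^ k /\<^sub>R fact k \<le> exp x" by (simp add: exp_def)
  then show ?thesis by (simp add: field_simps)
qed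

text \<open>Half of the Gaussian exponent is spent. With u = |y| / sqrt t the polynomial is at most
  a multiple of exp(1 + u), and 1 + u is at most 3 + u^2/8; what remains is a multiple of
  \<open>heat (2 * t)\<close>, of total mass 1. The factor \<open>sqrt 2 ^ CARD('n)\<close> is the
  ratio of the normalisations.\<close>

lemma heat_moment:
  assumes t: "0 < t"
  shows "(\<integral>\<^sup>+y. ennreal (heat t y * (1 + norm y) ^ k) \<partial>(lborel :: (real^'n) measure))
    \<le> ennreal (fact k * exp 3 * sqrt 2 ^ CARD('n) * (2 + t) ^ k)"
proof -
  have le: "heat t y * (1 + norm y) ^ k \<le> fact k * exp 3 * sqrt 2 ^ CARD('n) * (2 + t) ^ k * heat (2 * t) y" for y :: "real^'n"
  proof -
    define u where "u = norm y / sqrt t"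
    have u: "0 \<le> u" "norm y = sqrt t * u" "(norm y)\<^sup>2 = t * u\<^sup>2"
      using t by (auto simp: u_def power_divide)
    have st: "sqrt t \<le> 1 + t"
    proof -
      have "0 \<le> (sqrt t - 1)\<^sup>2" by simp
      then have "2 * sqrt t \<le> 1 + t" using t by (simp add: power2_diff)
      moreover have "0 \<le> sqrt t" using t by simp
      ultimately show ?thesis by linarith
    qed
    have "1 + norm y \<le> (2 + t) * (1 + u)"
    proof -
      have "sqrt t * u \<le> (1 + t) * u" by (rule mult_right_mono[OF st u(1)])
      then show ?thesis using t u by (simp add: algebra_simps)
    qed
    then have "(1 + norm y) ^ k \<le> ((2 + t) * (1 + u)) ^ k" by (intro power_mono) auto
    also have "\<dots> = (2 + t) ^ k * (1 + u) ^ k" by (rule power_mult_distrib)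
    also have "(1 + u) ^ k \<le> fact k * exp (1 + u)" using u by (intro power_le_fact_exp) simp
    also have "exp (1 + u) \<le> exp (3 + u\<^sup>2 / 8)"
    proof -
      have "0 \<le> (u - 4)\<^sup>2" by simp
      then have "8 * u \<le> u\<^sup>2 + 16" by (simp add: power2_diff)
      then show ?thesis by simp
    qed
    finally have b: "(1 + norm y) ^ k \<le> (2 + t) ^ k * (fact k * exp (3 + u\<^sup>2 / 8))"
      using t by (simp add: mult_left_mono)
    have "heat t y * (1 + norm y) ^ k \<le> heat t y * ((2 + t) ^ k * (fact k * exp (3 + u\<^sup>2 / 8)))"
      using b heat_nonneg[of t y] t by (intro mult_left_mono) auto
    also have "\<dots> = fact k * exp 3 * sqrt 2 ^ CARD('n) * (2 + t) ^ k * heat (2 * t) y"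
    proof -
      have "exp (- (norm y)\<^sup>2 / (4 * t)) * exp (3 + u\<^sup>2 / 8) = exp 3 * exp (- (norm y)\<^sup>2 / (4 * (2 * t)))"
        unfolding u(3) exp_add[symmetric] using t by (simp add: field_simps)
      moreover have "sqrt (4 * pi * (2 * t)) ^ CARD('n) = sqrt 2 ^ CARD('n) * sqrt (4 * pi * t) ^ CARD('n)"
        by (simp add: power_mult_distrib[symmetric] real_sqrt_mult[symmetric] mult_ac)
      ultimately show ?thesis unfolding heat_def using t by (simp add: field_simps)
    qed
    finally show ?thesis .
  qed
  let ?c = "fact k * exp 3 * sqrt 2 ^ CARD('n) * (2 + t) ^ k"
  have "(\<integral>\<^sup>+y. ennreal (heat t y * (1 + norm y) ^ k) \<partial>(lborel :: (real^'n) measure))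
    \<le> (\<integral>\<^sup>+y. ennreal ?c * ennreal (heat (2 * t) y) \<partial>(lborel :: (real^'n) measure))"
  proof (rule nn_integral_mono)
    fix y :: "real^'n"
    show "ennreal (heat t y * (1 + norm y) ^ k) \<le> ennreal ?c * ennreal (heat (2 * t) y)"
      using ennreal_leI[OF le[of y]] t by (subst ennreal_mult[symmetric]) (auto simp: heat_nonneg)
  qed
  also have "\<dots> = ennreal ?c"
    using nn_integral_heat[of "2 * t", where 'n='n] t by (subst nn_integral_cmult) auto
  finally show ?thesis .
qed

lemma nn_integral_Gamma:
  assumes x: "0 < x" and c: "0 < c"
  shows "(\<integral>\<^sup>+t. ennreal (indicator {0<..} t * (t powr (x - 1) * exp (- c * t))) \<partial>lborel) = ennreal (Gamma x * c powr (- x))"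
proof -
  let ?f = "\<lambda>t::real. ennreal (indicator {0<..} t * (t powr (x - 1) * exp (- t)))"
  have 1: "(\<integral>\<^sup>+t. ?f t \<partial>lborel) = ennreal (Gamma x)"
  proof -
    have "((\<lambda>t. indicator {0..} t *\<^sub>R (t powr (x - 1) / exp t)) has_integral Gamma x) UNIV"
      using Gamma_integral_real[OF x] has_integral_restrict_UNIV[of "{0..}" "\<lambda>t. t powr (x - 1) / exp t"]
      by (simp add: indicator_def of_bool_def if_distrib if_distribR cong: if_cong)
    then have "(\<integral>\<^sup>+t. ennreal (indicator {0..} t *\<^sub>R (t powr (x - 1) / exp t)) \<partial>lborel) = ennreal (Gamma x)"
      by (intro nn_integral_has_integral_lborel) (auto simp: indicator_def)
    moreover have "indicator {0..} t *\<^sub>R (t powr (x - 1) / exp t) = indicator {0<..} t * (t powr (x - 1) * exp (- t))" for t :: real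
      by (cases "t = 0") (auto simp: indicator_def exp_minus field_simps)
    ultimately show ?thesis by simp
  qed
  have "(\<integral>\<^sup>+t. ?f t \<partial>lborel) = \<bar>c\<bar> * (\<integral>\<^sup>+t. ?f (0 + c * t) \<partial>lborel)"
    by (rule nn_integral_real_affine) (use c in auto)
  also have "(\<integral>\<^sup>+t. ?f (0 + c * t) \<partial>lborel) = (\<integral>\<^sup>+t. ennreal (c powr (x - 1)) * ennreal (indicator {0<..} t * (t powr (x - 1) * exp (- c * t))) \<partial>lborel)"
  proof (rule nn_integral_cong)
    fix t :: real
    have eq: "indicator {0<..} (0 + c * t) * ((0 + c * t) powr (x - 1) * exp (- (0 + c * t)))
      = c powr (x - 1) * (indicator {0<..} t * (t powr (x - 1) * exp (- c * t)))"
      using c by (auto simp: indicator_def powr_mult zero_less_mult_iff)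
    show "?f (0 + c * t) = ennreal (c powr (x - 1)) * ennreal (indicator {0<..} t * (t powr (x - 1) * exp (- c * t)))"
      unfolding eq by (rule ennreal_mult') simp
  qed
  also have "\<dots> = ennreal (c powr (x - 1)) * (\<integral>\<^sup>+t. ennreal (indicator {0<..} t * (t powr (x - 1) * exp (- c * t))) \<partial>lborel)"
    by (rule nn_integral_cmult) measurable
  finally have "ennreal (Gamma x) = ennreal (c powr x) * (\<integral>\<^sup>+t. ennreal (indicator {0<..} t * (t powr (x - 1) * exp (- c * t))) \<partial>lborel)"
    using 1 c powr_mult_base[of c "x - 1"] by (simp add: mult.assoc[symmetric] ennreal_mult[symmetric])
  then have "ennreal (c powr (- x)) * ennreal (Gamma x) = ennreal (c powr (- x)) * ennreal (c powr x) * (\<integral>\<^sup>+t. ennreal (indicator {0<..} t * (t powr (x - 1) * exp (- c * t))) \<partial>lborel)"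
    by (simp only: mult.assoc)
  also have "ennreal (c powr (- x)) * ennreal (c powr x) = 1"
    using c by (subst ennreal_mult[symmetric]) (auto simp: powr_minus)
  finally show ?thesis using x Gamma_real_pos[OF x] by (simp add: ennreal_mult mult.commute)
qed

section \<open>The Bessel kernel as a mixture of heat kernels\<close>

text \<open>The density of the Gamma law of shape s/2; averaging exp(-t |\<xi>|^2) over it gives the
  Bessel symbol.\<close>

definition bessel_density :: "real \<Rightarrow> real \<Rightarrow> real" where
  "bessel_density s t = indicator {0<..} t * (t powr (s/2 - 1) * exp (- t)) / Gamma (s/2)"

text \<open>Extended-valued because the integral can diverge at the origin. The real version
  \<open>bessel_kernel\<close> takes the value 0 there, and agrees almost everywhere.\<close>

definition bessel_nn :: "real \<Rightarrow> real^'n \<Rightarrow> ennreal" where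
  "bessel_nn s y = (\<integral>\<^sup>+t. ennreal (bessel_density s t * heat t y) \<partial>lborel)"

definition bessel_kernel :: "real \<Rightarrow> real^'n \<Rightarrow> real" where
  "bessel_kernel s y = enn2real (bessel_nn s y)"

lemma bessel_density_measurable [measurable]: "bessel_density s \<in> borel_measurable borel"
  unfolding bessel_density_def[abs_def] by measurable

lemma bessel_density_nonneg: "0 < s \<Longrightarrow> 0 \<le> bessel_density s t"
  unfolding bessel_density_def using Gamma_real_pos[of "s/2"] by (auto simp: indicator_def)

lemma bessel_density_eq_0: "t \<le> 0 \<Longrightarrow> bessel_density s t = 0"
  by (simp add: bessel_density_def)

lemma bessel_density_heat_nonneg: "0 < s \<Longrightarrow> 0 \<le> bessel_density s t * heat t y"
  using bessel_density_nonneg[of s t] bessel_density_eq_0[of t s] heat_nonneg[of t y] by (cases "t \<le> 0") auto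

lemma bessel_nn_measurable [measurable]: "bessel_nn s \<in> borel_measurable (borel :: (real^'n) measure)"
proof -
  have "(\<lambda>(y, t). ennreal (bessel_density s t * heat t y)) \<in> borel_measurable ((borel :: (real^'n) measure) \<Otimes>\<^sub>M lborel)"
  proof -
    have "(\<lambda>(y :: real^'n, t). heat t y) \<in> borel_measurable (borel \<Otimes>\<^sub>M lborel)"
      unfolding heat_def by measurable
    then show ?thesis by measurable
  qed
  from lborel.borel_measurable_nn_integral[OF this] show ?thesis unfolding bessel_nn_def[abs_def] .
qed

lemma bessel_kernel_measurable [measurable]: "bessel_kernel s \<in> borel_measurable borel"
  unfolding bessel_kernel_def[abs_def] by measurable

lemma bessel_kernel_nonneg: "0 \<le> bessel_kernel s y"
  by (simp add: bessel_kernel_def)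

lemma heat_minus: "heat t (- y) = heat t y"
  by (simp add: heat_def)

lemma bessel_kernel_minus: "bessel_kernel s (- y) = bessel_kernel s y"
  by (simp add: bessel_kernel_def bessel_nn_def heat_minus)

lemma bessel_kernel_commute: "bessel_kernel s (x - y) = bessel_kernel s (y - x)"
  using bessel_kernel_minus[of s "y - x"] by simp

text \<open>After Fubini, the moments of \<open>heat t\<close> grow only polynomially in
  \<open>t\<close>, and \<open>(2 + t) ^ k\<close> costs at most a multiple of
  \<open>exp (t / 2)\<close>, half of the decay of the density.\<close>

lemma bessel_moment_finite:
  assumes s: "0 < s"
  shows "(\<integral>\<^sup>+y. bessel_nn s y * ennreal ((1 + norm y) ^ k) \<partial>(lborel :: (real^'n) measure)) < \<infinity>"
proof -
  define c where "c = fact k * exp 3 * sqrt 2 ^ CARD('n) * (2 ^ k * fact k * exp 1) / Gamma (s/2)"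
  have G: "0 < Gamma (s/2)" using s by (intro Gamma_real_pos) simp
  have c: "0 \<le> c" using G by (simp add: c_def)
  have m: "(\<lambda>(y, t). ennreal (bessel_density s t * heat t y) * ennreal ((1 + norm y) ^ k)) \<in> borel_measurable ((lborel :: (real^'n) measure) \<Otimes>\<^sub>M lborel)"
  proof -
    have "(\<lambda>(y :: real^'n, t). heat t y) \<in> borel_measurable (lborel \<Otimes>\<^sub>M lborel)"
      unfolding heat_def by measurable
    then show ?thesis by measurable
  qed
  have "(\<integral>\<^sup>+y. bessel_nn s y * ennreal ((1 + norm y) ^ k) \<partial>(lborel :: (real^'n) measure))
    = (\<integral>\<^sup>+y. (\<integral>\<^sup>+t. ennreal (bessel_density s t * heat t y) * ennreal ((1 + norm y) ^ k) \<partial>lborel) \<partial>(lborel :: (real^'n) measure))"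
    unfolding bessel_nn_def
  proof (intro nn_integral_cong nn_integral_multc[symmetric])
    fix y :: "real^'n"
    have "(\<lambda>t. heat t y) \<in> borel_measurable lborel" unfolding heat_def by measurable
    then show "(\<lambda>t. ennreal (bessel_density s t * heat t y)) \<in> borel_measurable lborel" by measurable
  qed
  also have "\<dots> = (\<integral>\<^sup>+t. (\<integral>\<^sup>+y. ennreal (bessel_density s t * heat t y) * ennreal ((1 + norm y) ^ k) \<partial>(lborel :: (real^'n) measure)) \<partial>lborel)"
    by (rule lborel_pair.Fubini'[OF m, symmetric])
  also have "\<dots> \<le> (\<integral>\<^sup>+t. ennreal c * ennreal (indicator {0<..} t * (t powr (s/2 - 1) * exp (- (1/2) * t))) \<partial>lborel)"
  proof (rule nn_integral_mono)
    fix t :: real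
    show "(\<integral>\<^sup>+y. ennreal (bessel_density s t * heat t y) * ennreal ((1 + norm y) ^ k) \<partial>(lborel :: (real^'n) measure))
      \<le> ennreal c * ennreal (indicator {0<..} t * (t powr (s/2 - 1) * exp (- (1/2) * t)))"
    proof (cases "t \<le> 0")
      case True
      then show ?thesis by (simp add: bessel_density_eq_0)
    next
      case False
      then have t: "0 < t" by simp
      have "(\<integral>\<^sup>+y. ennreal (bessel_density s t * heat t y) * ennreal ((1 + norm y) ^ k) \<partial>(lborel :: (real^'n) measure))
        = (\<integral>\<^sup>+y. ennreal (bessel_density s t) * ennreal (heat t y * (1 + norm y) ^ k) \<partial>(lborel :: (real^'n) measure))"
      proof (intro nn_integral_cong)
        fix y :: "real^'n"
        show "ennreal (bessel_density s t * heat t y) * ennreal ((1 + norm y) ^ k) = ennreal (bessel_density s t) * ennreal (heat t y * (1 + norm y) ^ k)"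
          using ennreal_mult[of "bessel_density s t" "heat t y * (1 + norm y) ^ k"]
            ennreal_mult[of "bessel_density s t * heat t y" "(1 + norm y) ^ k"]
            bessel_density_nonneg[OF s, of t] heat_nonneg[of t y] t by (simp add: mult.assoc)
      qed
      also have "\<dots> = ennreal (bessel_density s t) * (\<integral>\<^sup>+y. ennreal (heat t y * (1 + norm y) ^ k) \<partial>(lborel :: (real^'n) measure))"
        by (rule nn_integral_cmult) measurable
      also have "\<dots> \<le> ennreal (bessel_density s t) * ennreal (fact k * exp 3 * sqrt 2 ^ CARD('n) * (2 + t) ^ k)"
        by (intro mult_left_mono heat_moment[OF t]) simp
      also have "\<dots> = ennreal (bessel_density s t * (fact k * exp 3 * sqrt 2 ^ CARD('n) * (2 + t) ^ k))"
        using bessel_density_nonneg[OF s, of t] by (simp add: ennreal_mult')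
      also have "\<dots> \<le> ennreal (c * (indicator {0<..} t * (t powr (s/2 - 1) * exp (- (1/2) * t))))"
      proof (rule ennreal_leI)
        have "((2 + t) / 2) ^ k \<le> fact k * exp ((2 + t) / 2)" using t by (intro power_le_fact_exp) simp
        then have "(2 + t) ^ k \<le> 2 ^ k * fact k * exp ((2 + t) / 2)" by (simp add: power_divide field_simps)
        also have "exp ((2 + t) / 2) = exp 1 * exp (t / 2)" by (simp add: exp_add[symmetric] add_divide_distrib)
        finally have b: "(2 + t) ^ k \<le> 2 ^ k * fact k * exp 1 * exp (t / 2)" by (simp add: mult.assoc)
        have "bessel_density s t * (fact k * exp 3 * sqrt 2 ^ CARD('n) * (2 + t) ^ k)
          \<le> bessel_density s t * (fact k * exp 3 * sqrt 2 ^ CARD('n) * (2 ^ k * fact k * exp 1 * exp (t / 2)))"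
          using b bessel_density_nonneg[OF s, of t] by (intro mult_left_mono) auto
        also have "\<dots> = c * (t powr (s/2 - 1) * (exp (- t) * exp (t / 2)))"
          using t by (simp add: bessel_density_def c_def)
        also have "exp (- t) * exp (t / 2) = exp (- (1/2) * t)" by (simp add: exp_add[symmetric])
        finally show "bessel_density s t * (fact k * exp 3 * sqrt 2 ^ CARD('n) * (2 + t) ^ k)
          \<le> c * (indicator {0<..} t * (t powr (s/2 - 1) * exp (- (1/2) * t)))" using t by simp
      qed
      finally show ?thesis using c by (simp add: ennreal_mult')
    qed
  qed
  also have "\<dots> = ennreal c * (\<integral>\<^sup>+t. ennreal (indicator {0<..} t * (t powr (s/2 - 1) * exp (- (1/2) * t))) \<partial>lborel)"
    by (rule nn_integral_cmult) measurable
  also have "\<dots> < \<infinity>"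
    using nn_integral_Gamma[of "s/2" "1/2"] s by (simp add: ennreal_mult_less_top)
  finally show ?thesis .
qed

lemma bessel_nn_finite_AE:
  assumes s: "0 < s"
  shows "AE y in (lborel :: (real^'n) measure). ennreal (bessel_kernel s y) = bessel_nn s y"
proof -
  have "(\<integral>\<^sup>+y. bessel_nn s y \<partial>(lborel :: (real^'n) measure)) \<noteq> \<infinity>"
    using bessel_moment_finite[OF s, of 0, where 'n='n] by simp
  then have "AE y in (lborel :: (real^'n) measure). bessel_nn s y \<noteq> \<infinity>"
    by (intro nn_integral_PInf_AE) auto
  then show ?thesis by eventually_elim (simp add: bessel_kernel_def less_top)
qed

lemma bessel_kernel_integrable_moment:
  assumes s: "0 < s"
  shows "integrable lborel (\<lambda>y::real^'n. bessel_kernel s y * (1 + norm y) ^ k)"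
proof (rule integrableI_nonneg)
  have "(\<integral>\<^sup>+y. ennreal (bessel_kernel s y * (1 + norm y) ^ k) \<partial>(lborel :: (real^'n) measure))
    = (\<integral>\<^sup>+y. bessel_nn s y * ennreal ((1 + norm y) ^ k) \<partial>(lborel :: (real^'n) measure))"
  proof (rule nn_integral_cong_AE)
    show "AE y in (lborel :: (real^'n) measure). ennreal (bessel_kernel s y * (1 + norm y) ^ k) = bessel_nn s y * ennreal ((1 + norm y) ^ k)"
      using bessel_nn_finite_AE[OF s] by eventually_elim (simp add: ennreal_mult' bessel_kernel_nonneg)
  qed
  then show "(\<integral>\<^sup>+y. ennreal (bessel_kernel s y * (1 + norm y) ^ k) \<partial>(lborel :: (real^'n) measure)) < \<infinity>"
    using bessel_moment_finite[OF s, of k, where 'n='n] by simp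
qed (auto simp: bessel_kernel_nonneg)


section \<open>Pointwise upper and lower bounds for the kernel\<close>

lemma exp_neg_le_power:
  fixes x :: real assumes "0 < x" shows "exp (- x) \<le> fact k / x ^ k"
  using power_le_fact_exp[of x k] assms by (simp add: exp_minus field_simps)

lemma exists_power_scale:
  fixes \<rho> :: real
  assumes "0 < \<rho>" "\<rho> < c"
  shows "\<exists>n. c / 2 ^ Suc n \<le> \<rho> \<and> \<rho> < c / 2 ^ n"
proof -
  have ex: "\<exists>n. c / 2 ^ Suc n \<le> \<rho>"
  proof -
    obtain n where "c / \<rho> < 2 ^ n" using real_arch_pow[of 2 "c / \<rho>"] by auto
    then have "c < \<rho> * 2 ^ n" using assms by (simp add: field_simps)
    also have "\<dots> \<le> \<rho> * 2 ^ Suc n" using assms by simp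
    finally have "c \<le> \<rho> * 2 ^ Suc n" by simp
    then have "c / 2 ^ Suc n \<le> \<rho>" by (subst pos_divide_le_eq) auto
    then show ?thesis by blast
  qed
  define n where "n = (LEAST n. c / 2 ^ Suc n \<le> \<rho>)"
  have n: "c / 2 ^ Suc n \<le> \<rho>" unfolding n_def by (rule LeastI_ex[OF ex])
  moreover have "\<rho> < c / 2 ^ n"
  proof (cases n)
    case (Suc m)
    then have "\<not> c / 2 ^ Suc m \<le> \<rho>" using not_less_Least[of m "\<lambda>n. c / 2 ^ Suc n \<le> \<rho>"] n_def by simp
    then show ?thesis using Suc by simp
  qed (use assms in simp)
  ultimately show ?thesis by blast
qed

text \<open>For each \<open>t\<close> a single scale suffices: the one at which \<open>z\<close> lives if the Gaussian is small there,
  and otherwise the scale \<open>\<surd>t\<close>.\<close>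

lemma gaussian_le_scales:
  fixes z :: "real^'n"
  assumes t: "0 < t" and z: "z \<noteq> 0"
  shows "\<exists>n. exp (- (norm z)\<^sup>2 / (4 * t)) \<le> fact M * 144 ^ M *
    ((t * 4 ^ n) ^ M * of_bool (t \<le> 4 / 4 ^ n) * indicator {z. \<forall>i. \<bar>z $ i\<bar> < 1 / 2 ^ n / 3} z
      + (t / 4 ^ n) ^ M * indicator {z. \<forall>i. \<bar>z $ i\<bar> < 2 ^ n / 3} z)"
proof -
  define \<rho> where "\<rho> = Max (range (\<lambda>i. \<bar>z $ i\<bar>))"
  have \<rho>1: "\<bar>z $ i\<bar> \<le> \<rho>" for i unfolding \<rho>_def by (intro Max_ge) auto
  have "\<rho> \<in> range (\<lambda>i. \<bar>z $ i\<bar>)" unfolding \<rho>_def by (intro Max_in) auto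
  then have \<rho>2: "\<rho> \<le> norm z" using component_le_norm_cart[of z] by auto
  obtain i where "z $ i \<noteq> 0" using z by (auto simp: vec_eq_iff)
  then have \<rho>0: "0 < \<rho>" using \<rho>1[of i] by linarith
  have C1: "1 \<le> fact M * (144::real) ^ M" using mult_mono[of 1 "fact M :: real" 1 "144 ^ M"] by (simp add: fact_ge_1)
  \<comment> \<open>Here \<open>q\<close> is the square of the scale of \<open>z\<close>. The
    maximum norm is known from below up to a factor 6 (2 from the dyadic scale, 3 from the thirds),
    which gives 36; the 4 in the Gaussian exponent makes it 144.\<close>
  have far: "exp (- (norm z)\<^sup>2 / (4 * t)) \<le> fact M * 144 ^ M * (t / q) ^ M" if q: "0 < q" "q / 36 \<le> \<rho>\<^sup>2" for q
  proof -
    have "q / 36 \<le> (norm z)\<^sup>2" using q(2) \<rho>2 \<rho>0 power_mono[of \<rho> "norm z" 2] by linarith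
    then have le: "q / (144 * t) \<le> (norm z)\<^sup>2 / (4 * t)" using t by (simp add: field_simps)
    have "exp (- ((norm z)\<^sup>2 / (4 * t))) \<le> exp (- (q / (144 * t)))" using le by simp
    also have "\<dots> \<le> fact M / (q / (144 * t)) ^ M" using q t by (intro exp_neg_le_power) simp
    also have "\<dots> = fact M * 144 ^ M * (t / q) ^ M" using q t by (simp add: power_divide power_mult_distrib)
    finally show ?thesis by simp
  qed
  have e1: "exp (- (norm z)\<^sup>2 / (4 * t)) \<le> 1" using t by simp
  show ?thesis
  proof (cases "\<rho> < 1 / 3")
    case False
    define c where "c = \<rho> * 3"
    obtain n0 where n0: "c < 2 ^ n0" using real_arch_pow[of 2 c] by auto
    define n where "n = (LEAST n. c < 2 ^ n)"
    have n: "c < 2 ^ n" unfolding n_def by (rule LeastI[of "\<lambda>n. c < 2 ^ n", OF n0])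
    have "n \<noteq> 0" using n False by (cases n) (auto simp: c_def)
    then obtain m where m: "n = Suc m" by (cases n) auto
    then have "2 ^ m \<le> c" using not_less_Least[of m "\<lambda>n. c < 2 ^ n"] n_def by simp
    then have "(2 ^ n) / 6 \<le> \<rho>" by (simp add: m c_def)
    then have "((2 ^ n) / 6)\<^sup>2 \<le> \<rho>\<^sup>2" by (intro power_mono) auto
    then have "4 ^ n / 36 \<le> \<rho>\<^sup>2" by (simp add: power_divide power_mult_distrib[symmetric] power2_eq_square)
    from far[OF _ this] have f: "exp (- (norm z)\<^sup>2 / (4 * t)) \<le> fact M * 144 ^ M * (t / 4 ^ n) ^ M" by simp
    have "\<rho> < 2 ^ n / 3" using n by (simp add: c_def)
    then have "\<bar>z $ i\<bar> < 2 ^ n / 3" for i by (rule le_less_trans[OF \<rho>1])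
    then have in2: "z \<in> {z. \<forall>i. \<bar>z $ i\<bar> < 2 ^ n / 3}" by blast
    have "exp (- (norm z)\<^sup>2 / (4 * t)) \<le> fact M * 144 ^ M *
    ((t * 4 ^ n) ^ M * of_bool (t \<le> 4 / 4 ^ n) * indicator {z. \<forall>i. \<bar>z $ i\<bar> < 1 / 2 ^ n / 3} z
      + (t / 4 ^ n) ^ M * indicator {z. \<forall>i. \<bar>z $ i\<bar> < 2 ^ n / 3} z)"
      unfolding indicator_simps(1)[OF in2]
      by (rule order_trans[OF f], rule mult_left_mono) (use t in \<open>auto simp: indicator_def\<close>)
    then show ?thesis by blast
  next
    case True
    then obtain n where n: "1 / 3 / 2 ^ Suc n \<le> \<rho>" "\<rho> < 1 / 3 / 2 ^ n"
      using exists_power_scale[OF \<rho>0 True] by blast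
    have near: "z \<in> {z. \<forall>i. \<bar>z $ i\<bar> < 1 / 2 ^ k / 3}" if "k \<le> n" for k
    proof -
      have "1 / 3 / 2 ^ n \<le> 1 / 3 / (2 ^ k :: real)" using that by (intro divide_left_mono power_increasing) auto
      then have "\<rho> < 1 / 2 ^ k / 3" using n(2) by simp
      then have "\<bar>z $ i\<bar> < 1 / 2 ^ k / 3" for i by (rule le_less_trans[OF \<rho>1])
      then show ?thesis by blast
    qed
    have near0: "z \<in> {z. \<forall>i. \<bar>z $ i\<bar> < 2 ^ 0 / 3}" using near[of 0] by simp
    \<comment> \<open>For small \<open>z\<close> at scale 2^(-n) there are three regimes: the
      Gaussian decays at that scale; \<open>t\<close> is large and the far part at scale 0 beats the
      trivial bound 1; or \<open>t\<close> is comparable to 4^(-k) for a coarser scale k, which then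
      beats the trivial bound.\<close>
    consider "t \<le> 4 / 4 ^ n" | "4 < t" | "4 / 4 ^ n < t" "t \<le> 4" by linarith
    then show ?thesis
    proof cases
      case 1
      have "(1 / 3 / 2 ^ Suc n)\<^sup>2 \<le> \<rho>\<^sup>2" using n(1) by (intro power_mono) auto
      then have "1 / 4 ^ n / 36 \<le> \<rho>\<^sup>2" by (simp add: power_divide power_mult_distrib[symmetric] power2_eq_square)
      from far[OF _ this] have f: "exp (- (norm z)\<^sup>2 / (4 * t)) \<le> fact M * 144 ^ M * (t * 4 ^ n) ^ M" by simp
      have "exp (- (norm z)\<^sup>2 / (4 * t)) \<le> fact M * 144 ^ M *
        ((t * 4 ^ n) ^ M * of_bool (t \<le> 4 / 4 ^ n) * indicator {z. \<forall>i. \<bar>z $ i\<bar> < 1 / 2 ^ n / 3} z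
          + (t / 4 ^ n) ^ M * indicator {z. \<forall>i. \<bar>z $ i\<bar> < 2 ^ n / 3} z)"
        unfolding indicator_simps(1)[OF near[OF order_refl]]
        by (rule order_trans[OF f], rule mult_left_mono) (use t 1 in \<open>auto simp: indicator_def\<close>)
      then show ?thesis by blast
    next
      case 2
      have "1 \<le> (t / 4 ^ 0) ^ M" using 2 by (intro one_le_power) simp
      then have "1 \<le> fact M * 144 ^ M * (t / 4 ^ 0) ^ M" using C1 mult_mono[of 1 "fact M * (144::real) ^ M" 1 "(t / 4 ^ 0) ^ M"] by simp
      then have f: "exp (- (norm z)\<^sup>2 / (4 * t)) \<le> fact M * 144 ^ M * (t / 4 ^ 0) ^ M" using e1 by linarith
      have "exp (- (norm z)\<^sup>2 / (4 * t)) \<le> fact M * 144 ^ M *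
        ((t * 4 ^ 0) ^ M * of_bool (t \<le> 4 / 4 ^ 0) * indicator {z. \<forall>i. \<bar>z $ i\<bar> < 1 / 2 ^ 0 / 3} z
          + (t / 4 ^ 0) ^ M * indicator {z. \<forall>i. \<bar>z $ i\<bar> < 2 ^ 0 / 3} z)"
        unfolding indicator_simps(1)[OF near0]
        by (rule order_trans[OF f], rule mult_left_mono) (use t in \<open>auto simp: indicator_def\<close>)
      then show ?thesis by blast
    next
      case 3
      define k where "k = (LEAST k. 4 / 4 ^ Suc k < t)"
      have nS: "4 / 4 ^ Suc n < t"
      proof -
        have "4 / 4 ^ Suc n \<le> 4 / (4 ^ n :: real)" by (intro divide_left_mono) auto
        then show ?thesis using 3 by linarith
      qed
      have k: "4 / 4 ^ Suc k < t" unfolding k_def by (rule LeastI[of "\<lambda>k. 4 / 4 ^ Suc k < t", OF nS])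
      have kn: "k \<le> n" unfolding k_def by (rule Least_le[of "\<lambda>k. 4 / 4 ^ Suc k < t", OF nS])
      have tk: "t \<le> 4 / 4 ^ k"
      proof (cases k)
        case (Suc m)
        then show ?thesis using not_less_Least[of m "\<lambda>k. 4 / 4 ^ Suc k < t"] k_def by simp
      qed (use 3 in simp)
      have "1 \<le> t * 4 ^ k" using k by (simp add: field_simps)
      then have "1 \<le> (t * 4 ^ k) ^ M" by (rule one_le_power)
      then have "1 \<le> fact M * 144 ^ M * (t * 4 ^ k) ^ M" using C1 mult_mono[of 1 "fact M * (144::real) ^ M" 1 "(t * 4 ^ k) ^ M"] by simp
      then have f: "exp (- (norm z)\<^sup>2 / (4 * t)) \<le> fact M * 144 ^ M * (t * 4 ^ k) ^ M" using e1 by linarith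
      have "exp (- (norm z)\<^sup>2 / (4 * t)) \<le> fact M * 144 ^ M *
        ((t * 4 ^ k) ^ M * of_bool (t \<le> 4 / 4 ^ k) * indicator {z. \<forall>i. \<bar>z $ i\<bar> < 1 / 2 ^ k / 3} z
          + (t / 4 ^ k) ^ M * indicator {z. \<forall>i. \<bar>z $ i\<bar> < 2 ^ k / 3} z)"
        unfolding indicator_simps(1)[OF near[OF kn]]
        by (rule order_trans[OF f], rule mult_left_mono) (use t tk in \<open>auto simp: indicator_def\<close>)
      then show ?thesis by blast
    qed
  qed
qed

text \<open>Integrates \<open>gaussian_le_scales\<close> in \<open>t\<close>. The restriction to t
  \<le> 4 4^(-n) yields a factor 4^(-n \<alpha>), which together with 4^(nM) is 2^(-ns) 2^(nd), the
  near coefficient of the lattice kernel; the far part needs only the full Gamma integral.\<close>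

theorem bessel_nn_le_lattice_kernel:
  assumes s: "0 < s"
  obtains C where "0 < C" and "\<And>z::real^'n. z \<noteq> 0 \<Longrightarrow> bessel_nn s z \<le> ennreal C * lattice_kernel (2 powr (- s)) z"
proof -
  let ?n = "CARD('n)"
  \<comment> \<open>With this power \<alpha> is at least 1, so that the time integral converges at
    0, and the far coefficients are exactly those of \<open>lattice_kernel\<close>.\<close>
  define M where "M = ?n + 1"
  define \<alpha> where "\<alpha> = s / 2 - ?n / 2 + M"
  have \<alpha>: "1 \<le> \<alpha>" using s by (simp add: \<alpha>_def M_def)
  have G: "0 < Gamma (s/2)" "0 < Gamma \<alpha>" using s \<alpha> by (auto intro!: Gamma_real_pos)
  define D where "D = fact M * 144 ^ M / (Gamma (s/2) * sqrt (4 * pi) ^ ?n)"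
  have D: "0 < D" using G by (simp add: D_def)
  define C where "C = D * (4 powr \<alpha> + Gamma \<alpha>)"
  have C: "0 < C" using D G by (simp add: C_def add_pos_pos)
  show thesis
  proof (rule that[OF C])
    fix z :: "real^'n" assume z: "z \<noteq> 0"
    let ?I1 = "\<lambda>n. indicator {z. \<forall>i. \<bar>z $ i\<bar> < 1 / 2 ^ n / 3} z"
    let ?I2 = "\<lambda>n. indicator {z. \<forall>i. \<bar>z $ i\<bar> < 2 ^ n / 3} z"
    define g where "g t = indicator {0<..} t * (t powr (\<alpha> - 1) * exp (- t))" for t :: real
    have g0: "0 \<le> g t" for t by (simp add: g_def indicator_def)
    have gm [measurable]: "g \<in> borel_measurable borel" unfolding g_def[abs_def] by measurable
    have gG: "(\<integral>\<^sup>+t. ennreal (g t) \<partial>lborel) = ennreal (Gamma \<alpha>)"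
      using nn_integral_Gamma[of \<alpha> 1] \<alpha> unfolding g_def by simp
    have gb: "(\<integral>\<^sup>+t. ennreal (g t * of_bool (t \<le> b)) \<partial>lborel) \<le> ennreal (b powr \<alpha>)" if b: "0 < b" for b
    proof -
      have "(\<integral>\<^sup>+t. ennreal (g t * of_bool (t \<le> b)) \<partial>lborel) \<le> (\<integral>\<^sup>+t. ennreal (b powr (\<alpha> - 1)) * indicator {0..b} t \<partial>lborel)"
      proof (rule nn_integral_mono)
        fix t
        have "g t * of_bool (t \<le> b) \<le> b powr (\<alpha> - 1) * indicator {0..b} t"
        proof (cases "0 < t \<and> t \<le> b")
          case True
          then have "t powr (\<alpha> - 1) * exp (- t) \<le> b powr (\<alpha> - 1) * 1"
            using \<alpha> by (intro mult_mono powr_mono2) auto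
          then show ?thesis using True by (simp add: g_def)
        qed (auto simp: g_def indicator_def)
        then show "ennreal (g t * of_bool (t \<le> b)) \<le> ennreal (b powr (\<alpha> - 1)) * indicator {0..b} t"
          by (cases "t \<in> {0..b}") (auto intro: ennreal_leI simp: ennreal_neg)
      qed
      also have "\<dots> = ennreal (b powr (\<alpha> - 1)) * ennreal b" using b by (subst nn_integral_cmult_indicator) auto
      also have "\<dots> = ennreal (b powr \<alpha>)"
        using b powr_mult_base[of b "\<alpha> - 1"] by (simp add: ennreal_mult[symmetric] mult.commute)
      finally show ?thesis .
    qed
    \<comment> \<open>All scales are added up although each \<open>t\<close> needs only one; this
      avoids any measurability question for the choice of the scale.\<close>
    define h where "h n t = D * (g t * of_bool (t \<le> 4 / 4 ^ n)) * (4 ^ (n * M) * ?I1 n) + D * g t * (1 / 4 ^ (n * M) * ?I2 n)" for n t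
    have h0: "0 \<le> h n t" for n t
      unfolding h_def using D g0[of t] by (auto intro!: add_nonneg_nonneg mult_nonneg_nonneg)
    have pw: "ennreal (bessel_density s t * heat t z) \<le> (\<Sum>n. ennreal (h n t))" for t
    proof (cases "0 < t")
      case False
      then show ?thesis by (simp add: bessel_density_eq_0)
    next
      case True
      obtain n where n: "exp (- (norm z)\<^sup>2 / (4 * t)) \<le> fact M * 144 ^ M *
          ((t * 4 ^ n) ^ M * of_bool (t \<le> 4 / 4 ^ n) * ?I1 n + (t / 4 ^ n) ^ M * ?I2 n)"
        using gaussian_le_scales[OF True z, of M] by blast
      define c where "c = t powr (s/2 - 1) * exp (- t) / (Gamma (s/2) * sqrt (4 * pi * t) ^ ?n)"
      have c0: "0 \<le> c" using G True by (simp add: c_def)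
      have "bessel_density s t * heat t z = c * exp (- (norm z)\<^sup>2 / (4 * t))"
        using True by (simp add: bessel_density_def heat_def c_def)
      also have "\<dots> \<le> c * (fact M * 144 ^ M *
          ((t * 4 ^ n) ^ M * of_bool (t \<le> 4 / 4 ^ n) * ?I1 n + (t / 4 ^ n) ^ M * ?I2 n))"
        by (rule mult_left_mono[OF n c0])
      also have "\<dots> = h n t"
      proof -
        have "sqrt (4 * pi * t) ^ ?n = sqrt (4 * pi) ^ ?n * t powr (?n / 2)"
        proof -
          have "sqrt t ^ ?n = t powr (?n / 2)"
            using True by (simp add: powr_half_sqrt[symmetric] powr_realpow[symmetric] powr_powr)
          then show ?thesis by (simp add: real_sqrt_mult power_mult_distrib)
        qed
        moreover have "t powr (s/2 - 1) * t ^ M / t powr (?n / 2) = t powr (\<alpha> - 1)"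
          using True by (simp add: \<alpha>_def powr_add powr_diff powr_realpow)
        ultimately have "c * (fact M * 144 ^ M) * t ^ M = D * (t powr (\<alpha> - 1) * exp (- t))"
          unfolding c_def D_def using True G by (simp add: field_simps)
        then have e: "c * (fact M * 144 ^ M) * t ^ M = D * g t" using True by (simp add: g_def)
        have "c * (fact M * 144 ^ M * ((t * 4 ^ n) ^ M * of_bool (t \<le> 4 / 4 ^ n) * ?I1 n + (t / 4 ^ n) ^ M * ?I2 n))
          = (c * (fact M * 144 ^ M) * t ^ M) * of_bool (t \<le> 4 / 4 ^ n) * (4 ^ (n * M) * ?I1 n)
            + (c * (fact M * 144 ^ M) * t ^ M) * (1 / 4 ^ (n * M) * ?I2 n)"
          by (simp add: power_mult_distrib power_divide power_mult[symmetric] distrib_left mult_ac)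
        then show ?thesis unfolding e h_def by (simp only: mult.assoc)
      qed
      finally have "ennreal (bessel_density s t * heat t z) \<le> ennreal (h n t)" by (rule ennreal_leI)
      also have "\<dots> \<le> (\<Sum>n. ennreal (h n t))"
      proof -
        have "g j \<le> suminf g" for g :: "nat \<Rightarrow> ennreal" and j using sum_le_suminf[of g "{j}"] by simp
        then show ?thesis .
      qed
      finally show ?thesis .
    qed
    have hI: "(\<integral>\<^sup>+t. ennreal (h n t) \<partial>lborel) \<le> ennreal C * (ennreal ((2 powr (- s)) ^ n * 2 ^ (n * ?n)) * ?I1 n +
     ennreal (1 / 4 ^ (n * (?n + 1))) * ?I2 n)" for n
    proof -
      have "(\<integral>\<^sup>+t. ennreal (h n t) \<partial>lborel) = (\<integral>\<^sup>+t. ennreal (D * (4 ^ (n * M) * ?I1 n)) * ennreal (g t * of_bool (t \<le> 4 / 4 ^ n))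
          + ennreal (D * (1 / 4 ^ (n * M) * ?I2 n)) * ennreal (g t) \<partial>lborel)"
      proof (rule nn_integral_cong)
        fix t
        have "h n t = (D * (4 ^ (n * M) * ?I1 n)) * (g t * of_bool (t \<le> 4 / 4 ^ n)) + (D * (1 / 4 ^ (n * M) * ?I2 n)) * g t"
          unfolding h_def by (simp only: mult_ac)
        then show "ennreal (h n t) = ennreal (D * (4 ^ (n * M) * ?I1 n)) * ennreal (g t * of_bool (t \<le> 4 / 4 ^ n))
          + ennreal (D * (1 / 4 ^ (n * M) * ?I2 n)) * ennreal (g t)"
          using D g0[of t] by (simp only:) (rule ennreal_lincomb; simp)
      qed
      also have "\<dots> = ennreal (D * (4 ^ (n * M) * ?I1 n)) * (\<integral>\<^sup>+t. ennreal (g t * of_bool (t \<le> 4 / 4 ^ n)) \<partial>lborel)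
          + ennreal (D * (1 / 4 ^ (n * M) * ?I2 n)) * (\<integral>\<^sup>+t. ennreal (g t) \<partial>lborel)"
        by (subst nn_integral_add, measurable, subst nn_integral_cmult, measurable, subst nn_integral_cmult, measurable)
      also have "\<dots> \<le> ennreal (D * (4 ^ (n * M) * ?I1 n)) * ennreal ((4 / 4 ^ n) powr \<alpha>) + ennreal (D * (1 / 4 ^ (n * M) * ?I2 n)) * ennreal (Gamma \<alpha>)"
        unfolding gG by (intro add_mono mult_left_mono gb) auto
      also have "\<dots> = ennreal ((D * (4 ^ (n * M) * ?I1 n)) * (4 / 4 ^ n) powr \<alpha> + (D * (1 / 4 ^ (n * M) * ?I2 n)) * Gamma \<alpha>)"
        using D G by (intro ennreal_lincomb[symmetric]) auto
      also have "\<dots> \<le> ennreal (C * ((2 powr (- s)) ^ n * 2 ^ (n * ?n) * ?I1 n + 1 / 4 ^ (n * (?n + 1)) * ?I2 n))"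
      proof (rule ennreal_leI)
        have q: "4 ^ (n * M) * (4 / 4 ^ n) powr \<alpha> = 4 powr \<alpha> * ((2 powr (- s)) ^ n * 2 ^ (n * ?n))"
        proof -
          have "(4 / 4 ^ n) powr \<alpha> = 4 powr \<alpha> * 4 powr (- (real n * \<alpha>))"
            by (simp add: powr_divide powr_realpow[symmetric] powr_powr powr_minus field_simps)
          moreover have "(4::real) ^ (n * M) = 4 powr (real n * M)" by (simp add: powr_realpow[symmetric])
          moreover have "4 powr (real n * M) * 4 powr (- (real n * \<alpha>)) = 4 powr (real n * (?n / 2 - s / 2))"
            by (simp add: powr_add[symmetric] \<alpha>_def algebra_simps)
          moreover have "4 powr (real n * (?n / 2 - s / 2)) = 2 powr (2 * (real n * (?n / 2 - s / 2)))"
            by (simp add: powr_powr[symmetric])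
          moreover have "2 * (real n * (?n / 2 - s / 2)) = real (n * ?n) + (- s) * real n" by (simp add: algebra_simps)
          moreover have "2 powr (real (n * ?n) + (- s) * real n) = 2 ^ (n * ?n) * (2 powr (- s)) ^ n"
            by (simp only: powr_add powr_realpow[symmetric] zero_less_numeral powr_powr[symmetric] powr_gt_zero)
          ultimately show ?thesis by (simp add: mult_ac)
        qed
        have "(D * (4 ^ (n * M) * ?I1 n)) * (4 / 4 ^ n) powr \<alpha> + (D * (1 / 4 ^ (n * M) * ?I2 n)) * Gamma \<alpha>
          = D * (4 powr \<alpha>) * ((2 powr (- s)) ^ n * 2 ^ (n * ?n) * ?I1 n) + D * Gamma \<alpha> * (1 / 4 ^ (n * (?n + 1)) * ?I2 n)"
        proof -
          have "(D * (4 ^ (n * M) * ?I1 n)) * (4 / 4 ^ n) powr \<alpha> = D * ?I1 n * (4 ^ (n * M) * (4 / 4 ^ n) powr \<alpha>)" by (simp only: mult_ac)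
          then show ?thesis unfolding q unfolding M_def by (simp only: mult_ac)
        qed
        also have "\<dots> \<le> C * ((2 powr (- s)) ^ n * 2 ^ (n * ?n) * ?I1 n) + C * (1 / 4 ^ (n * (?n + 1)) * ?I2 n)"
          unfolding C_def using D G by (intro add_mono mult_right_mono) (auto simp: distrib_left)
        finally show "(D * (4 ^ (n * M) * ?I1 n)) * (4 / 4 ^ n) powr \<alpha> + (D * (1 / 4 ^ (n * M) * ?I2 n)) * Gamma \<alpha>
          \<le> C * ((2 powr (- s)) ^ n * 2 ^ (n * ?n) * ?I1 n + 1 / 4 ^ (n * (?n + 1)) * ?I2 n)"
          by (simp only: distrib_left)
      qed
      also have "\<dots> = ennreal C * (ennreal ((2 powr (- s)) ^ n * 2 ^ (n * ?n)) * ?I1 n + ennreal (1 / 4 ^ (n * (?n + 1))) * ?I2 n)"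
      proof -
        have "ennreal (a * ?I1 n + b * ?I2 n) = ennreal a * ?I1 n + ennreal b * ?I2 n" if "0 \<le> a" "0 \<le> b" for a b
          using ennreal_lincomb[OF that(1) indicator_pos_le that(2) indicator_pos_le] unfolding ennreal_indicator .
        from this[of "(2 powr (- s)) ^ n * 2 ^ (n * ?n)" "1 / 4 ^ (n * (?n + 1))"]
        have "ennreal ((2 powr (- s)) ^ n * 2 ^ (n * ?n) * ?I1 n + 1 / 4 ^ (n * (?n + 1)) * ?I2 n)
          = ennreal ((2 powr (- s)) ^ n * 2 ^ (n * ?n)) * ?I1 n + ennreal (1 / 4 ^ (n * (?n + 1))) * ?I2 n" by simp
        then show ?thesis using ennreal_mult'[of C] C by simp
      qed
      finally show ?thesis .
    qed
    have "bessel_nn s z \<le> (\<integral>\<^sup>+t. (\<Sum>n. ennreal (h n t)) \<partial>lborel)"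
      unfolding bessel_nn_def by (rule nn_integral_mono) (rule pw)
    also have "\<dots> = (\<Sum>n. \<integral>\<^sup>+t. ennreal (h n t) \<partial>lborel)"
      unfolding h_def[abs_def] by (rule nn_integral_suminf) measurable
    also have "\<dots> \<le> (\<Sum>n. ennreal C * (ennreal ((2 powr (- s)) ^ n * 2 ^ (n * ?n)) * ?I1 n + ennreal (1 / 4 ^ (n * (?n + 1))) * ?I2 n))"
      by (intro suminf_le hI) auto
    also have "\<dots> = ennreal C * lattice_kernel (2 powr (- s)) z"
      unfolding lattice_kernel_def by (rule ennreal_suminf_cmult)
    finally show "bessel_nn s z \<le> ennreal C * lattice_kernel (2 powr (- s)) z" .
  qed
qed

text \<open>Only times between 4^(-n) and 2 4^(-n) are kept, where the Gaussian is bounded below.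
  The range \<open>CARD('n) / 2 ^ n\<close> contains all differences of two points of a dyadic cube
  of level \<open>n\<close>.\<close>

theorem bessel_nn_lower_bound:
  assumes s: "0 < s"
  obtains c where "0 < c" and "\<And>(z::real^'n) n. norm z \<le> CARD('n) / 2 ^ n \<Longrightarrow>
    ennreal (c * (2 powr (- s)) ^ n * 2 ^ (n * CARD('n))) \<le> bessel_nn s z"
proof -
  let ?n = "CARD('n)"
  define \<beta> where "\<beta> = s / 2 - 1 - ?n / 2"
  \<comment> \<open>The sign of \<beta> decides at which end of the time interval
    \<open>t powr \<beta>\<close> is smallest; the minimum serves both cases.\<close>
  define c where "c = min 1 (2 powr \<beta>) * exp (- 2) * exp (- (real ?n)\<^sup>2 / 4) / (Gamma (s/2) * sqrt (4 * pi) ^ ?n)"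
  have G: "0 < Gamma (s/2)" using s by (intro Gamma_real_pos) simp
  have c: "0 < c" using G by (simp add: c_def)
  show thesis
  proof (rule that[OF c])
    fix z :: "real^'n" and n
    assume z: "norm z \<le> ?n / 2 ^ n"
    define b where "b = 1 / (4::real) ^ n"
    have b: "0 < b" "b \<le> 1" by (auto simp: b_def divide_le_eq_1)
    have pw: "c * b powr \<beta> \<le> bessel_density s t * heat t z" if t: "t \<in> {b..2 * b}" for t
    proof -
      have t0: "0 < t" using t b by auto
      have tb: "min 1 (2 powr \<beta>) * b powr \<beta> \<le> t powr \<beta>"
      proof (cases "0 \<le> \<beta>")
        case True
        have "min 1 (2 powr \<beta>) * b powr \<beta> \<le> 1 * b powr \<beta>" by (intro mult_right_mono) auto
        also have "\<dots> \<le> t powr \<beta>" using t b True by (auto intro: powr_mono2)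
        finally show ?thesis .
      next
        case False
        have "min 1 (2 powr \<beta>) * b powr \<beta> \<le> 2 powr \<beta> * b powr \<beta>" by (intro mult_right_mono) auto
        also have "\<dots> = (2 * b) powr \<beta>" by (simp add: powr_mult)
        also have "\<dots> \<le> t powr \<beta>" using t t0 False by (intro powr_mono2') auto
        finally show ?thesis .
      qed
      have e1: "exp (- 2) \<le> exp (- t)" using t b by simp
      have e2: "exp (- (real ?n)\<^sup>2 / 4) \<le> exp (- (norm z)\<^sup>2 / (4 * t))"
      proof -
        have "(norm z)\<^sup>2 \<le> (?n / 2 ^ n)\<^sup>2" using z by (intro power_mono) auto
        also have "\<dots> = (real ?n)\<^sup>2 * b" by (simp add: b_def power_divide power_mult_distrib[symmetric] power2_eq_square)
        also have "\<dots> \<le> (real ?n)\<^sup>2 * t" using t by (intro mult_left_mono) auto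
        finally have "(norm z)\<^sup>2 / (4 * t) \<le> (real ?n)\<^sup>2 / 4" using t0 by (simp add: field_simps)
        then show ?thesis by simp
      qed
      have sq: "sqrt (4 * pi * t) ^ ?n = sqrt (4 * pi) ^ ?n * t powr (?n / 2)"
      proof -
        have "sqrt t ^ ?n = t powr (?n / 2)"
          using t0 by (simp add: powr_half_sqrt[symmetric] powr_realpow[symmetric] powr_powr)
        then show ?thesis by (simp add: real_sqrt_mult power_mult_distrib)
      qed
      have tt: "t powr (s/2 - 1) / t powr (?n / 2) = t powr \<beta>" by (simp add: \<beta>_def powr_diff)
      have "min 1 (2 powr \<beta>) * b powr \<beta> * exp (- 2) * exp (- (real ?n)\<^sup>2 / 4)
        \<le> t powr \<beta> * exp (- t) * exp (- (norm z)\<^sup>2 / (4 * t))"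
        by (intro mult_mono tb e1 e2) (auto simp: min_def)
      then have "min 1 (2 powr \<beta>) * b powr \<beta> * exp (- 2) * exp (- (real ?n)\<^sup>2 / 4) / (Gamma (s/2) * sqrt (4 * pi) ^ ?n)
        \<le> t powr \<beta> * exp (- t) * exp (- (norm z)\<^sup>2 / (4 * t)) / (Gamma (s/2) * sqrt (4 * pi) ^ ?n)"
        using G by (intro divide_right_mono) auto
      also have "\<dots> = bessel_density s t * heat t z"
        unfolding tt[symmetric] bessel_density_def heat_def sq using t0 by (simp add: field_simps)
      finally show ?thesis unfolding c_def by (simp only: mult_ac times_divide_eq_left times_divide_eq_right)
    qed
    have "c * (2 powr (- s)) ^ n * 2 ^ (n * ?n) = c * b powr \<beta> * b"
    proof -
      have "b = 2 powr (- (2 * real n))"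
        using powr_realpow[of 2 "2 * n"] power_mult[of "2::real" 2 n] by (simp add: b_def powr_minus inverse_eq_divide)
      then have "b powr \<beta> * b = 2 powr (- (2 * real n) * \<beta>) * 2 powr (- (2 * real n))" by (simp only: powr_powr)
      also have "\<dots> = 2 powr ((- s) * real n + real (n * ?n))"
        by (simp add: powr_add[symmetric] \<beta>_def algebra_simps)
      also have "\<dots> = (2 powr (- s)) ^ n * 2 ^ (n * ?n)"
        by (simp only: powr_add powr_realpow[symmetric] zero_less_numeral powr_powr[symmetric] powr_gt_zero)
      finally show ?thesis by (simp add: mult.assoc)
    qed
    then have "ennreal (c * (2 powr (- s)) ^ n * 2 ^ (n * ?n)) = ennreal (c * b powr \<beta>) * ennreal b"
      using c by (simp only: ennreal_mult' mult_nonneg_nonneg powr_ge_zero less_imp_le)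
    also have "\<dots> = (\<integral>\<^sup>+t. ennreal (c * b powr \<beta>) * indicator {b..2 * b} t \<partial>lborel)"
      using b by (subst nn_integral_cmult_indicator) auto
    also have "\<dots> \<le> bessel_nn s z"
      unfolding bessel_nn_def
    proof (rule nn_integral_mono)
      fix t show "ennreal (c * b powr \<beta>) * indicator {b..2 * b} t \<le> ennreal (bessel_density s t * heat t z)"
        using pw[of t] by (cases "t \<in> {b..2 * b}") (auto intro: ennreal_leI)
    qed
    finally show "ennreal (c * (2 powr (- s)) ^ n * 2 ^ (n * ?n)) \<le> bessel_nn s z" .
  qed
qed

section \<open>Schwartz functions and convolution with the Bessel kernel\<close>

lemma iterated_deriv_Nil [simp]: "iterated_deriv [] \<phi> = \<phi>"
  by (simp add: iterated_deriv_def)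

lemma iterated_deriv_Cons [simp]: "iterated_deriv (i # is) \<phi> = partial_deriv i (iterated_deriv is \<phi>)"
  by (simp add: iterated_deriv_def)

lemma iterated_deriv_append: "iterated_deriv (is @ js) \<phi> = iterated_deriv is (iterated_deriv js \<phi>)"
  by (simp add: iterated_deriv_def)

lemma schwartz_iterated_deriv: "\<phi> \<in> schwartz_space \<Longrightarrow> iterated_deriv js \<phi> \<in> schwartz_space"
  unfolding schwartz_space_def by (auto simp flip: iterated_deriv_append)

lemma schwartz_partial_deriv: "\<phi> \<in> schwartz_space \<Longrightarrow> partial_deriv i \<phi> \<in> schwartz_space"
  using schwartz_iterated_deriv[of \<phi> "[i]"] by simp

lemma vec_eq_sum_axis: "(h :: real^'n) = (\<Sum>i\<in>UNIV. (h $ i) *\<^sub>R axis i 1)"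
  using basis_expansion[of h] by (simp add: scalar_mult_eq_scaleR)

lemma differentiable_has_partial_derivs:
  fixes \<phi> :: "real^'n \<Rightarrow> complex"
  assumes "\<phi> differentiable (at x)"
  shows "(\<phi> has_derivative (\<lambda>h. \<Sum>i\<in>UNIV. (h $ i) *\<^sub>R partial_deriv i \<phi> x)) (at x)"
proof -
  have D: "(\<phi> has_derivative frechet_derivative \<phi> (at x)) (at x)"
    using assms by (simp add: frechet_derivative_works)
  then have lin: "linear (frechet_derivative \<phi> (at x))"
    using has_derivative_linear by blast
  have "frechet_derivative \<phi> (at x) h = (\<Sum>i\<in>UNIV. (h $ i) *\<^sub>R partial_deriv i \<phi> x)" for h
  proof -
    have "frechet_derivative \<phi> (at x) h = frechet_derivative \<phi> (at x) (\<Sum>i\<in>UNIV. (h $ i) *\<^sub>R axis i 1)"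
      by (simp only: vec_eq_sum_axis[symmetric])
    then show ?thesis by (simp add: linear_sum[OF lin] linear_scale[OF lin] partial_deriv_def)
  qed
  then have "frechet_derivative \<phi> (at x) = (\<lambda>h. \<Sum>i\<in>UNIV. (h $ i) *\<^sub>R partial_deriv i \<phi> x)" by (rule ext)
  then show ?thesis using D by (simp only:)
qed

lemma partial_deriv_eq:
  fixes \<phi> :: "real^'n \<Rightarrow> complex"
  assumes "(\<phi> has_derivative (\<lambda>h. \<Sum>i\<in>UNIV. (h $ i) *\<^sub>R D i)) (at x)"
  shows "partial_deriv j \<phi> x = D j"
proof -
  have "partial_deriv j \<phi> x = (\<Sum>i\<in>UNIV. ((axis j 1 :: real^'n) $ i) *\<^sub>R D i)"
    unfolding partial_deriv_def frechet_derivative_at[OF assms, symmetric] ..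
  also have "\<dots> = (\<Sum>i\<in>UNIV. if i = j then D i else 0)"
    by (intro sum.cong) (auto simp: axis_def)
  finally show ?thesis by simp
qed

lemma schwartz_has_derivative:
  assumes "\<phi> \<in> schwartz_space"
  shows "(\<phi> has_derivative (\<lambda>h. \<Sum>i\<in>UNIV. (h $ i) *\<^sub>R partial_deriv i \<phi> x)) (at x)"
proof -
  have "iterated_deriv [] \<phi> differentiable (at x)" using assms unfolding schwartz_space_def by blast
  then show ?thesis by (intro differentiable_has_partial_derivs) simp
qed

lemma schwartz_continuous: "\<phi> \<in> schwartz_space \<Longrightarrow> continuous_on A \<phi>"
  by (intro continuous_at_imp_continuous_on ballI has_derivative_continuous[OF schwartz_has_derivative])

lemma schwartz_measurable: "\<phi> \<in> schwartz_space \<Longrightarrow> \<phi> \<in> borel_measurable borel"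
  by (rule borel_measurable_continuous_onI[OF schwartz_continuous])

lemma schwartz_bound:
  assumes "\<phi> \<in> schwartz_space"
  obtains C where "0 \<le> C" "\<And>x. (1 + norm x) ^ k * cmod (\<phi> x) \<le> C"
proof -
  have "bounded (range (\<lambda>x. (1 + norm x) ^ k *\<^sub>R iterated_deriv [] \<phi> x))"
    using assms unfolding schwartz_space_def by blast
  then obtain C where C: "\<And>x. norm ((1 + norm x) ^ k *\<^sub>R \<phi> x) \<le> C" by (auto simp: bounded_iff)
  have "0 \<le> C" by (rule order_trans[OF norm_ge_zero C[of 0]])
  then show thesis using that[of C] C by simp
qed

lemma schwartz_norm_bdd:
  fixes \<phi> :: "real^'n \<Rightarrow> complex"
  assumes "\<phi> \<in> schwartz_space"
  shows "bdd_above ((\<lambda>(is, x). (1 + norm x) ^ k * cmod (iterated_deriv is \<phi> x)) ` ({is. length is \<le> k} \<times> UNIV))"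
proof -
  have fin: "finite {is :: 'n list. length is \<le> k}"
    using finite_lists_length_le[of "UNIV :: 'n set" k] by simp
  have "\<forall>is. \<exists>C. \<forall>x. (1 + norm x) ^ k * cmod (iterated_deriv is \<phi> x) \<le> C"
    using schwartz_bound[OF schwartz_iterated_deriv[OF assms]] by metis
  then obtain C where C: "\<And>is x. (1 + norm x) ^ k * cmod (iterated_deriv is \<phi> x) \<le> C is" by metis
  show ?thesis
  proof (rule bdd_aboveI)
    fix y assume "y \<in> (\<lambda>(is, x). (1 + norm x) ^ k * cmod (iterated_deriv is \<phi> x)) ` ({is. length is \<le> k} \<times> UNIV)"
    then obtain "is" x where y: "y = (1 + norm x) ^ k * cmod (iterated_deriv is \<phi> x)" "length is \<le> k" by auto
    show "y \<le> Max (C ` {is. length is \<le> k})"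
      unfolding y(1) using y(2) fin by (intro order_trans[OF C] Max_ge) auto
  qed
qed

lemma schwartz_norm_bound:
  fixes \<phi> :: "real^'n \<Rightarrow> complex"
  assumes "\<phi> \<in> schwartz_space" "length is \<le> k"
  shows "(1 + norm x) ^ k * cmod (iterated_deriv is \<phi> x) \<le> schwartz_norm k \<phi>"
  unfolding schwartz_norm_def
  using cSUP_upper[OF _ schwartz_norm_bdd[OF assms(1), of k], of "(is, x)"] assms(2) by simp

lemma schwartz_norm_bound0:
  "\<phi> \<in> schwartz_space \<Longrightarrow> (1 + norm x) ^ k * cmod (\<phi> x) \<le> schwartz_norm k \<phi>"
  using schwartz_norm_bound[of \<phi> "[]" k x] by simp

lemma schwartz_norm_nonneg: "\<phi> \<in> schwartz_space \<Longrightarrow> 0 \<le> schwartz_norm k \<phi>"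
  by (rule order_trans[OF _ schwartz_norm_bound0[of \<phi> 0 k]]) auto

lemma schwartz_spaceI:
  fixes \<phi> :: "real^'n \<Rightarrow> complex"
  assumes D: "\<And>is x. (iterated_deriv is \<phi> has_derivative D is x) (at x)"
    and B: "\<And>is k. \<exists>C. \<forall>x. (1 + norm x) ^ k * cmod (iterated_deriv is \<phi> x) \<le> C"
  shows "\<phi> \<in> schwartz_space"
proof -
  have "bounded (range (\<lambda>x. (1 + norm x) ^ k *\<^sub>R iterated_deriv is \<phi> x))" for k "is"
  proof -
    obtain C where "\<And>x. (1 + norm x) ^ k * cmod (iterated_deriv is \<phi> x) \<le> C" using B by blast
    then show ?thesis by (intro boundedI[of _ C]) auto
  qed
  then show ?thesis unfolding schwartz_space_def using D differentiableI by blast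
qed

lemma schwartz_lincomb:
  fixes \<phi> \<psi> :: "real^'n \<Rightarrow> complex"
  assumes "\<phi> \<in> schwartz_space" "\<psi> \<in> schwartz_space"
  shows "(\<lambda>x. a * \<phi> x + b * \<psi> x) \<in> schwartz_space"
proof -
  have D: "((\<lambda>x. a * iterated_deriv is \<phi> x + b * iterated_deriv is \<psi> x) has_derivative
      (\<lambda>h. \<Sum>i\<in>UNIV. (h $ i) *\<^sub>R (a * partial_deriv i (iterated_deriv is \<phi>) x + b * partial_deriv i (iterated_deriv is \<psi>) x))) (at x)" for "is" x
  proof -
    have "((\<lambda>x. a * iterated_deriv is \<phi> x + b * iterated_deriv is \<psi> x) has_derivative
      (\<lambda>h. a * (\<Sum>i\<in>UNIV. (h $ i) *\<^sub>R partial_deriv i (iterated_deriv is \<phi>) x) + b * (\<Sum>i\<in>UNIV. (h $ i) *\<^sub>R partial_deriv i (iterated_deriv is \<psi>) x))) (at x)"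
      by (intro has_derivative_add has_derivative_mult_right schwartz_has_derivative schwartz_iterated_deriv assms)
    then show ?thesis by (simp add: sum_distrib_left sum.distrib[symmetric] scaleR_right_distrib)
  qed
  have eq: "iterated_deriv is (\<lambda>x. a * \<phi> x + b * \<psi> x) = (\<lambda>x. a * iterated_deriv is \<phi> x + b * iterated_deriv is \<psi> x)" for "is"
  proof (induction "is")
    case (Cons i "is")
    show ?case using partial_deriv_eq[OF D, of i "is"] by (simp add: Cons fun_eq_iff)
  qed simp
  show ?thesis
  proof (rule schwartz_spaceI)
    show "(iterated_deriv is (\<lambda>x. a * \<phi> x + b * \<psi> x) has_derivative
      (\<lambda>h. \<Sum>i\<in>UNIV. (h $ i) *\<^sub>R (a * partial_deriv i (iterated_deriv is \<phi>) x + b * partial_deriv i (iterated_deriv is \<psi>) x))) (at x)" for "is" x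
      unfolding eq by (rule D)
    fix "is" k
    obtain C1 where C1: "\<And>x. (1 + norm x) ^ k * cmod (iterated_deriv is \<phi> x) \<le> C1"
      using schwartz_bound[OF schwartz_iterated_deriv[OF assms(1)]] by metis
    obtain C2 where C2: "\<And>x. (1 + norm x) ^ k * cmod (iterated_deriv is \<psi> x) \<le> C2"
      using schwartz_bound[OF schwartz_iterated_deriv[OF assms(2)]] by metis
    have "(1 + norm x) ^ k * cmod (a * iterated_deriv is \<phi> x + b * iterated_deriv is \<psi> x) \<le> cmod a * C1 + cmod b * C2" for x
    proof -
      have "(1 + norm x) ^ k * cmod (a * iterated_deriv is \<phi> x + b * iterated_deriv is \<psi> x)
        \<le> (1 + norm x) ^ k * (cmod a * cmod (iterated_deriv is \<phi> x) + cmod b * cmod (iterated_deriv is \<psi> x))"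
        by (intro mult_left_mono order_trans[OF norm_triangle_ineq]) (auto simp: norm_mult)
      also have "\<dots> = cmod a * ((1 + norm x) ^ k * cmod (iterated_deriv is \<phi> x)) + cmod b * ((1 + norm x) ^ k * cmod (iterated_deriv is \<psi> x))"
        by (simp add: algebra_simps)
      also have "\<dots> \<le> cmod a * C1 + cmod b * C2" by (intro add_mono mult_left_mono C1 C2) auto
      finally show ?thesis .
    qed
    then show "\<exists>C. \<forall>x. (1 + norm x) ^ k * cmod (iterated_deriv is (\<lambda>x. a * \<phi> x + b * \<psi> x) x) \<le> C"
      unfolding eq by blast
  qed
qed

section \<open>Integrability and remainder bounds of Schwartz functions\<close>

lemma integrable_inverse_square_prod:
  "integrable lborel (\<lambda>x::real^'n. \<Prod>b\<in>Basis. inverse (1 + (x \<bullet> b)\<^sup>2))"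
proof (rule lborel_prod_integral(1))
  have "set_integrable lborel (einterval (- \<infinity>) \<infinity>) (\<lambda>x::real. inverse (1 + x\<^sup>2))"
    by (rule integrable_inverse_1_plus_square)
  then show "integrable lborel (\<lambda>x::real. inverse (1 + x\<^sup>2))" by (simp add: set_integrable_def)
qed

text \<open>Comparison with a product of the one-dimensional functions 1/(1 + t^2), each coordinate
  being at most the norm; two powers per coordinate explain the exponent.\<close>

lemma integrable_polynomial_decay:
  "integrable lborel (\<lambda>x::real^'n. 1 / (1 + norm x) ^ (2 * CARD('n)))"
proof (rule Bochner_Integration.integrable_bound[OF integrable_inverse_square_prod])
  show "AE x in (lborel :: (real^'n) measure). norm (1 / (1 + norm x) ^ (2 * CARD('n))) \<le> norm (\<Prod>b\<in>Basis. inverse (1 + (x \<bullet> b)\<^sup>2))"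
  proof (rule AE_I2)
    fix x :: "real^'n"
    have le: "1 + (x \<bullet> b)\<^sup>2 \<le> (1 + norm x)\<^sup>2" if "b \<in> Basis" for b
    proof -
      have "(x \<bullet> b)\<^sup>2 \<le> (norm x)\<^sup>2"
        using Basis_le_norm[OF that, of x] abs_le_square_iff[of "x \<bullet> b" "norm x"] by simp
      moreover have "(1 + norm x)\<^sup>2 = 1 + 2 * norm x + (norm x)\<^sup>2" by (simp add: power2_sum)
      ultimately show ?thesis using norm_ge_zero[of x] by linarith
    qed
    have "(\<Prod>b\<in>(Basis :: (real^'n) set). inverse ((1 + norm x)\<^sup>2)) \<le> (\<Prod>b\<in>(Basis :: (real^'n) set). inverse (1 + (x \<bullet> b)\<^sup>2))"
      by (intro prod_mono) (auto intro!: le_imp_inverse_le le add_pos_nonneg)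
    moreover have "(\<Prod>b\<in>(Basis :: (real^'n) set). inverse ((1 + norm x)\<^sup>2)) = 1 / (1 + norm x) ^ (2 * CARD('n))"
      by (simp add: power_mult inverse_eq_divide power_one_over)
    moreover have "0 \<le> (\<Prod>b\<in>(Basis :: (real^'n) set). inverse (1 + (x \<bullet> b)\<^sup>2))" by (intro prod_nonneg) auto
    ultimately show "norm (1 / (1 + norm x) ^ (2 * CARD('n))) \<le> norm (\<Prod>b\<in>Basis. inverse (1 + (x \<bullet> b)\<^sup>2))"
      by simp
  qed
qed measurable

lemma schwartz_integrable:
  fixes \<phi> :: "real^'n \<Rightarrow> complex"
  assumes "\<phi> \<in> schwartz_space"
  shows "integrable lborel \<phi>"
proof -
  obtain C where C: "0 \<le> C" "\<And>x. (1 + norm x) ^ (2 * CARD('n)) * cmod (\<phi> x) \<le> C"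
    using schwartz_bound[OF assms] by metis
  have i: "integrable lborel (\<lambda>x::real^'n. C * (1 / (1 + norm x) ^ (2 * CARD('n))))"
    using integrable_polynomial_decay by (rule integrable_mult_right)
  show ?thesis
  proof (rule Bochner_Integration.integrable_bound[OF i])
    show "\<phi> \<in> borel_measurable lborel" using schwartz_measurable[OF assms] by simp
    have "cmod (\<phi> x) \<le> C * (1 / (1 + norm x) ^ (2 * CARD('n)))" for x
    proof -
      have "0 < (1 + norm x) ^ (2 * CARD('n))" by (intro zero_less_power) (simp add: add_pos_nonneg)
      then show ?thesis using C(2)[of x] by (simp add: field_simps)
    qed
    then show "AE x in lborel. norm (\<phi> x) \<le> norm (C * (1 / (1 + norm x) ^ (2 * CARD('n))))"
      using C(1) by (intro AE_I2) simp
  qed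
qed

lemma onorm_partials_le:
  fixes D :: "'n::finite \<Rightarrow> complex" and B :: real
  assumes "\<And>i. cmod (D i) \<le> B"
  shows "onorm (\<lambda>h :: real^'n. \<Sum>i\<in>UNIV. (h $ i) *\<^sub>R D i) \<le> CARD('n) * B"
proof (rule onorm_le)
  fix h :: "real^'n"
  have "norm (\<Sum>i\<in>UNIV. (h $ i) *\<^sub>R D i) \<le> (\<Sum>i\<in>(UNIV :: 'n set). norm h * B)"
  proof (rule order_trans[OF norm_sum], rule sum_mono)
    fix i :: 'n
    show "norm ((h $ i) *\<^sub>R D i) \<le> norm h * B"
      unfolding norm_scaleR by (intro mult_mono component_le_norm_cart assms) auto
  qed
  then show "norm (\<Sum>i\<in>UNIV. (h $ i) *\<^sub>R D i) \<le> CARD('n) * B * norm h" by (simp add: mult_ac)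
qed

text \<open>Mean value inequality on a ball of radius at most 1, where \<open>1 + norm v\<close> is
  at least half of \<open>1 + norm x\<close>, so the decay of the derivatives survives. It provides
  the majorant for difference quotients under the Fourier integral.\<close>

lemma schwartz_difference_bound:
  fixes \<phi> :: "real^'n \<Rightarrow> complex"
  assumes "\<phi> \<in> schwartz_space"
  obtains C where "0 \<le> C" "\<And>x h. norm h \<le> 1 \<Longrightarrow> cmod (\<phi> (x + h) - \<phi> x) \<le> C / (1 + norm x) ^ k * norm h"
proof -
  define C where "C = schwartz_norm (Suc k) \<phi>"
  have C: "(1 + norm x) ^ k * cmod (partial_deriv i \<phi> x) \<le> C" for i x
  proof -
    have "(1 + norm x) ^ k * cmod (partial_deriv i \<phi> x) \<le> (1 + norm x) ^ Suc k * cmod (partial_deriv i \<phi> x)"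
      by (intro mult_right_mono power_increasing) auto
    also have "\<dots> \<le> C" unfolding C_def using schwartz_norm_bound[OF assms, of "[i]" "Suc k" x] by simp
    finally show ?thesis .
  qed
  have C0: "0 \<le> C" unfolding C_def by (rule schwartz_norm_nonneg[OF assms])
  show thesis
  proof (rule that[of "CARD('n) * (C * 2 ^ k)"])
    show "0 \<le> CARD('n) * (C * 2 ^ k)" using C0 by simp
    fix x h :: "real^'n" assume h: "norm h \<le> 1"
    have "norm (\<phi> (x + h) - \<phi> x) \<le> (CARD('n) * (C * 2 ^ k / (1 + norm x) ^ k)) * norm (x + h - x)"
    proof (rule differentiable_bound[where S="cball x (norm h)"])
      fix v assume "v \<in> cball x (norm h)"
      then have "norm (v - x) \<le> 1" using h by (simp add: dist_norm norm_minus_commute)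
      then have "norm x \<le> norm v + 1" using norm_triangle_ineq2[of x v] by (simp add: norm_minus_commute)
      then have "(1 + norm x) / 2 \<le> (2 + norm v) / 2" by (intro divide_right_mono) simp_all
      also have "\<dots> \<le> 1 + norm v" by (simp add: add_divide_distrib)
      finally have v: "(1 + norm x) / 2 \<le> 1 + norm v" .
      have p0: "0 < (1 + norm x) ^ k" by (intro zero_less_power) (simp add: add_pos_nonneg)
      have "cmod (partial_deriv i \<phi> v) \<le> C * 2 ^ k / (1 + norm x) ^ k" for i
      proof -
        have "((1 + norm x) / 2) ^ k * cmod (partial_deriv i \<phi> v) \<le> (1 + norm v) ^ k * cmod (partial_deriv i \<phi> v)"
          by (intro mult_right_mono power_mono v) auto
        also have "\<dots> \<le> C" by (rule C)
        finally show ?thesis using p0 by (simp add: power_divide field_simps)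
      qed
      then show "onorm (\<lambda>h. \<Sum>i\<in>UNIV. (h $ i) *\<^sub>R partial_deriv i \<phi> v) \<le> CARD('n) * (C * 2 ^ k / (1 + norm x) ^ k)"
        by (rule onorm_partials_le)
      show "(\<phi> has_derivative (\<lambda>h. \<Sum>i\<in>UNIV. (h $ i) *\<^sub>R partial_deriv i \<phi> v)) (at v within cball x (norm h))"
        by (rule has_derivative_at_withinI[OF schwartz_has_derivative[OF assms]])
    qed (auto simp: dist_norm)
    then show "cmod (\<phi> (x + h) - \<phi> x) \<le> CARD('n) * (C * 2 ^ k) / (1 + norm x) ^ k * norm h"
      by simp
  qed
qed

text \<open>The mean value inequality is used twice, for the partial derivatives and for \<phi>
  minus its linear part. Uniformity in \<open>x\<close> is what allows integration against the
  Bessel kernel.\<close>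

lemma schwartz_taylor:
  fixes \<phi> :: "real^'n \<Rightarrow> complex"
  assumes "\<phi> \<in> schwartz_space"
  obtains C where "0 \<le> C"
    "\<And>x h. cmod (\<phi> (x + h) - \<phi> x - (\<Sum>i\<in>UNIV. (h $ i) *\<^sub>R partial_deriv i \<phi> x)) \<le> C * (norm h)\<^sup>2"
proof -
  define L where "L = CARD('n) * schwartz_norm 2 \<phi>"
  have L0: "0 \<le> L" unfolding L_def by (intro mult_nonneg_nonneg schwartz_norm_nonneg[OF assms]) simp
  have lip: "cmod (partial_deriv i \<phi> v - partial_deriv i \<phi> x) \<le> L * norm (v - x)" for i v x
  proof (rule differentiable_bound[where S=UNIV])
    fix v :: "real^'n"
    show "(partial_deriv i \<phi> has_derivative (\<lambda>h. \<Sum>j\<in>UNIV. (h $ j) *\<^sub>R partial_deriv j (partial_deriv i \<phi>) v)) (at v within UNIV)"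
      using schwartz_has_derivative[OF schwartz_partial_deriv[OF assms]] by simp
    have "cmod (partial_deriv j (partial_deriv i \<phi>) v) \<le> schwartz_norm 2 \<phi>" for j
    proof -
      have "cmod (partial_deriv j (partial_deriv i \<phi>) v) \<le> (1 + norm v) ^ 2 * cmod (partial_deriv j (partial_deriv i \<phi>) v)"
        using mult_right_mono[OF one_le_power[of "1 + norm v" 2], of "cmod (partial_deriv j (partial_deriv i \<phi>) v)"] by simp
      also have "\<dots> \<le> schwartz_norm 2 \<phi>" using schwartz_norm_bound[OF assms, of "[j, i]" 2 v] by simp
      finally show ?thesis .
    qed
    then show "onorm (\<lambda>h. \<Sum>j\<in>UNIV. (h $ j) *\<^sub>R partial_deriv j (partial_deriv i \<phi>) v) \<le> L"
      unfolding L_def by (rule onorm_partials_le)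
  qed auto
  show thesis
  proof (rule that[of "CARD('n) * L"])
    show "0 \<le> CARD('n) * L" using L0 by simp
    fix x h :: "real^'n"
    let ?g = "\<lambda>v. \<phi> v - (\<Sum>i\<in>UNIV. (v $ i) *\<^sub>R partial_deriv i \<phi> x)"
    have "norm (?g (x + h) - ?g x) \<le> (CARD('n) * (L * norm h)) * norm (x + h - x)"
    proof (rule differentiable_bound[where S="cball x (norm h)"])
      fix v assume "v \<in> cball x (norm h)"
      then have v: "norm (v - x) \<le> norm h" by (simp add: dist_norm norm_minus_commute)
      have "cmod (partial_deriv i \<phi> v - partial_deriv i \<phi> x) \<le> L * norm h" for i
        by (rule order_trans[OF lip]) (intro mult_left_mono v L0)
      then show "onorm (\<lambda>h. \<Sum>i\<in>UNIV. (h $ i) *\<^sub>R (partial_deriv i \<phi> v - partial_deriv i \<phi> x)) \<le> CARD('n) * (L * norm h)"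
        by (rule onorm_partials_le)
      have bl: "bounded_linear (\<lambda>v::real^'n. \<Sum>i\<in>UNIV. (v $ i) *\<^sub>R partial_deriv i \<phi> x)"
        by (intro bounded_linear_sum bounded_linear_scaleR_const bounded_linear_vec_nth)
      have "(?g has_derivative (\<lambda>h. (\<Sum>i\<in>UNIV. (h $ i) *\<^sub>R partial_deriv i \<phi> v) - (\<Sum>i\<in>UNIV. (h $ i) *\<^sub>R partial_deriv i \<phi> x))) (at v)"
        by (rule has_derivative_diff[OF schwartz_has_derivative[OF assms] bounded_linear_imp_has_derivative[OF bl]])
      then show "(?g has_derivative (\<lambda>h. \<Sum>i\<in>UNIV. (h $ i) *\<^sub>R (partial_deriv i \<phi> v - partial_deriv i \<phi> x))) (at v within cball x (norm h))"
        unfolding scaleR_diff_right sum_subtractf by (rule has_derivative_at_withinI)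
    qed (auto simp: dist_norm)
    moreover have "?g (x + h) - ?g x = \<phi> (x + h) - \<phi> x - (\<Sum>i\<in>UNIV. (h $ i) *\<^sub>R partial_deriv i \<phi> x)"
      by (simp add: scaleR_left_distrib sum.distrib)
    ultimately have "cmod (\<phi> (x + h) - \<phi> x - (\<Sum>i\<in>UNIV. (h $ i) *\<^sub>R partial_deriv i \<phi> x)) \<le> (CARD('n) * (L * norm h)) * norm (x + h - x)"
      by (simp only:)
    then show "cmod (\<phi> (x + h) - \<phi> x - (\<Sum>i\<in>UNIV. (h $ i) *\<^sub>R partial_deriv i \<phi> x)) \<le> CARD('n) * L * (norm h)\<^sup>2"
      by (simp add: power2_eq_square mult_ac)
  qed
qed

section \<open>Convolution with the Bessel kernel on the Schwartz space\<close>

definition bessel_conv :: "real \<Rightarrow> (real^'n \<Rightarrow> complex) \<Rightarrow> real^'n \<Rightarrow> complex" where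
  "bessel_conv s \<phi> x = (LINT y|lborel. bessel_kernel s y *\<^sub>R \<phi> (x - y))"

lemma bessel_kernel_integrable: "0 < s \<Longrightarrow> integrable lborel (bessel_kernel s :: real^'n \<Rightarrow> real)"
  using bessel_kernel_integrable_moment[of s 0, where 'n='n] by simp

lemma bessel_conv_integrable:
  fixes \<phi> :: "real^'n \<Rightarrow> complex"
  assumes s: "0 < s" and \<phi>: "\<phi> \<in> schwartz_space"
  shows "integrable lborel (\<lambda>y. bessel_kernel s y *\<^sub>R \<phi> (x - y))"
proof -
  obtain C where C: "0 \<le> C" "\<And>x. (1 + norm x) ^ 0 * cmod (\<phi> x) \<le> C" using schwartz_bound[OF \<phi>] by metis
  have i: "integrable lborel (\<lambda>y::real^'n. C * bessel_kernel s y)" using bessel_kernel_integrable[OF s, where 'n='n] by simp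
  note schwartz_measurable[OF \<phi>, measurable]
  show ?thesis
  proof (rule Bochner_Integration.integrable_bound[OF i])
    show "AE y in lborel. norm (bessel_kernel s y *\<^sub>R \<phi> (x - y)) \<le> norm (C * bessel_kernel s y)"
    proof (rule AE_I2)
      fix y :: "real^'n"
      have "cmod (\<phi> (x - y)) \<le> C" using C(2)[of "x - y"] by simp
      then have "bessel_kernel s y * cmod (\<phi> (x - y)) \<le> bessel_kernel s y * C" by (rule mult_left_mono[OF _ bessel_kernel_nonneg])
      then show "norm (bessel_kernel s y *\<^sub>R \<phi> (x - y)) \<le> norm (C * bessel_kernel s y)"
        using C(1) by (simp add: bessel_kernel_nonneg abs_mult mult.commute)
    qed
  qed measurable
qed

text \<open>The uniform Taylor remainder of \<phi>, integrated against the integrable kernel, is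
  again of second order in \<open>h\<close>. All derivatives fall on \<phi>, none on the kernel,
  which is singular.\<close>

lemma bessel_conv_has_derivative:
  fixes \<phi> :: "real^'n \<Rightarrow> complex"
  assumes s: "0 < s" and \<phi>: "\<phi> \<in> schwartz_space"
  shows "(bessel_conv s \<phi> has_derivative (\<lambda>h. \<Sum>i\<in>UNIV. (h $ i) *\<^sub>R bessel_conv s (partial_deriv i \<phi>) x)) (at x)"
proof -
  obtain C where C: "0 \<le> C"
    "\<And>x h. cmod (\<phi> (x + h) - \<phi> x - (\<Sum>i\<in>UNIV. (h $ i) *\<^sub>R partial_deriv i \<phi> x)) \<le> C * (norm h)\<^sup>2"
    using schwartz_taylor[OF \<phi>] by blast
  note int = bessel_conv_integrable[OF s]
  define G where "G = (LINT y|lborel. bessel_kernel s (y :: real^'n))"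
  have bound: "cmod (bessel_conv s \<phi> (x + h) - bessel_conv s \<phi> x - (\<Sum>i\<in>UNIV. (h $ i) *\<^sub>R bessel_conv s (partial_deriv i \<phi>) x)) \<le> G * C * (norm h)\<^sup>2" for h
  proof -
    let ?r = "\<lambda>y. bessel_kernel s y *\<^sub>R (\<phi> (x - y + h) - \<phi> (x - y) - (\<Sum>i\<in>UNIV. (h $ i) *\<^sub>R partial_deriv i \<phi> (x - y)))"
    have ints: "integrable lborel (\<lambda>y. bessel_kernel s y *\<^sub>R \<phi> (x + h - y))" "integrable lborel (\<lambda>y. bessel_kernel s y *\<^sub>R \<phi> (x - y))"
      "\<And>i. integrable lborel (\<lambda>y. bessel_kernel s y *\<^sub>R partial_deriv i \<phi> (x - y))"
      by (intro int \<phi> schwartz_partial_deriv)+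
    have r: "?r = (\<lambda>y. bessel_kernel s y *\<^sub>R \<phi> (x + h - y) - bessel_kernel s y *\<^sub>R \<phi> (x - y) - (\<Sum>i\<in>UNIV. (h $ i) *\<^sub>R (bessel_kernel s y *\<^sub>R partial_deriv i \<phi> (x - y))))"
      by (auto simp: fun_eq_iff scaleR_diff_right scaleR_sum_right algebra_simps)
    have hbi: "has_bochner_integral lborel ?r (bessel_conv s \<phi> (x + h) - bessel_conv s \<phi> x - (\<Sum>i\<in>UNIV. (h $ i) *\<^sub>R bessel_conv s (partial_deriv i \<phi>) x))"
      unfolding r bessel_conv_def
      by (intro has_bochner_integral_diff has_bochner_integral_sum has_bochner_integral_scaleR_right has_bochner_integral_integrable ints)
    have ir: "integrable lborel ?r" using hbi by (rule integrable.intros)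
    have "cmod (bessel_conv s \<phi> (x + h) - bessel_conv s \<phi> x - (\<Sum>i\<in>UNIV. (h $ i) *\<^sub>R bessel_conv s (partial_deriv i \<phi>) x)) = cmod (LINT y|lborel. ?r y)"
      by (simp only: has_bochner_integral_integral_eq[OF hbi])
    also have "\<dots> \<le> (LINT y|lborel. norm (?r y))" by (rule integral_norm_bound)
    also have "\<dots> \<le> (LINT y|lborel. bessel_kernel s (y::real^'n) * (C * (norm h)\<^sup>2))"
    proof (rule integral_mono)
      show "integrable lborel (\<lambda>y. norm (?r y))" using ir by (rule integrable_norm)
      show "integrable lborel (\<lambda>y::real^'n. bessel_kernel s y * (C * (norm h)\<^sup>2))" using bessel_kernel_integrable[OF s, where 'n='n] by simp
      show "norm (?r y) \<le> bessel_kernel s y * (C * (norm h)\<^sup>2)" for y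
        unfolding norm_scaleR abs_of_nonneg[OF bessel_kernel_nonneg] by (intro mult_left_mono C(2) bessel_kernel_nonneg)
    qed
    also have "\<dots> = G * C * (norm h)\<^sup>2" by (simp add: G_def)
    finally show ?thesis .
  qed
  have bl: "bounded_linear (\<lambda>h::real^'n. \<Sum>i\<in>UNIV. (h $ i) *\<^sub>R bessel_conv s (partial_deriv i \<phi>) x)"
    by (intro bounded_linear_sum bounded_linear_scaleR_const bounded_linear_vec_nth)
  show ?thesis
    unfolding has_derivative_at
  proof (intro conjI bl, rule Lim_null_comparison)
    show "\<forall>\<^sub>F h in at 0. norm (norm (bessel_conv s \<phi> (x + h) - bessel_conv s \<phi> x - (\<Sum>i\<in>UNIV. (h $ i) *\<^sub>R bessel_conv s (partial_deriv i \<phi>) x)) / norm h) \<le> G * C * norm h"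
    proof (rule always_eventually, rule allI)
      fix h :: "real^'n"
      show "norm (norm (bessel_conv s \<phi> (x + h) - bessel_conv s \<phi> x - (\<Sum>i\<in>UNIV. (h $ i) *\<^sub>R bessel_conv s (partial_deriv i \<phi>) x)) / norm h) \<le> G * C * norm h"
      proof (cases "h = 0")
        case False
        then show ?thesis using bound[of h] by (simp add: divide_le_eq power2_eq_square mult_ac)
      qed simp
    qed
    show "((\<lambda>h::real^'n. G * C * norm h) \<longlongrightarrow> 0) (at 0)"
      by (auto intro!: tendsto_eq_intros)
  qed
qed

text \<open>The inequality 1 + |x| \<le> (1 + |y|) (1 + |x - y|) distributes the weight between a
  moment of the kernel and the decay of \<psi>.\<close>

lemma bessel_conv_decay:
  fixes \<psi> :: "real^'n \<Rightarrow> complex"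
  assumes s: "0 < s" and \<psi>: "\<psi> \<in> schwartz_space" and C: "\<And>x. (1 + norm x) ^ k * cmod (\<psi> x) \<le> C"
  shows "(1 + norm x) ^ k * cmod (bessel_conv s \<psi> x) \<le> (LINT y|lborel. bessel_kernel s (y::real^'n) * (1 + norm y) ^ k) * C"
proof -
  have le: "(1 + norm x) ^ k * cmod (bessel_kernel s y *\<^sub>R \<psi> (x - y)) \<le> bessel_kernel s y * (1 + norm y) ^ k * C" for y
  proof -
    have "1 + norm x \<le> (1 + norm y) * (1 + norm (x - y))"
    proof -
      have "norm x \<le> norm y + norm (x - y)" using norm_triangle_ineq[of y "x - y"] by simp
      moreover have "(1 + norm y) * (1 + norm (x - y)) = 1 + norm y + norm (x - y) + norm y * norm (x - y)" by (simp add: algebra_simps)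
      moreover have "0 \<le> norm y * norm (x - y)" by simp
      ultimately show ?thesis by linarith
    qed
    then have "(1 + norm x) ^ k \<le> (1 + norm y) ^ k * (1 + norm (x - y)) ^ k"
      unfolding power_mult_distrib[symmetric] by (intro power_mono) auto
    then have "(1 + norm x) ^ k * (bessel_kernel s y * cmod (\<psi> (x - y))) \<le> ((1 + norm y) ^ k * (1 + norm (x - y)) ^ k) * (bessel_kernel s y * cmod (\<psi> (x - y)))"
      by (intro mult_right_mono) (auto simp: bessel_kernel_nonneg)
    also have "\<dots> = bessel_kernel s y * (1 + norm y) ^ k * ((1 + norm (x - y)) ^ k * cmod (\<psi> (x - y)))" by (simp only: mult_ac)
    also have "\<dots> \<le> bessel_kernel s y * (1 + norm y) ^ k * C" by (intro mult_left_mono C) (auto simp: bessel_kernel_nonneg)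
    finally show ?thesis by (simp add: bessel_kernel_nonneg)
  qed
  have "(1 + norm x) ^ k * cmod (bessel_conv s \<psi> x) \<le> (1 + norm x) ^ k * (LINT y|lborel. cmod (bessel_kernel s y *\<^sub>R \<psi> (x - y)))"
    unfolding bessel_conv_def by (intro mult_left_mono integral_norm_bound) auto
  also have "\<dots> = (LINT y|lborel. (1 + norm x) ^ k * cmod (bessel_kernel s y *\<^sub>R \<psi> (x - y)))" by simp
  also have "\<dots> \<le> (LINT y|lborel. bessel_kernel s (y::real^'n) * (1 + norm y) ^ k * C)"
  proof (rule integral_mono)
    show "integrable lborel (\<lambda>y. (1 + norm x) ^ k * cmod (bessel_kernel s y *\<^sub>R \<psi> (x - y)))"
      by (intro integrable_mult_right integrable_norm bessel_conv_integrable[OF s \<psi>])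
    show "integrable lborel (\<lambda>y::real^'n. bessel_kernel s y * (1 + norm y) ^ k * C)"
      by (intro integrable_mult_left bessel_kernel_integrable_moment[OF s])
  qed (rule le)
  finally show ?thesis by simp
qed

lemma bessel_conv_iterated_deriv:
  fixes \<phi> :: "real^'n \<Rightarrow> complex"
  assumes s: "0 < s" and \<phi>: "\<phi> \<in> schwartz_space"
  shows "iterated_deriv is (bessel_conv s \<phi>) = bessel_conv s (iterated_deriv is \<phi>)"
proof (induction "is")
  case (Cons i "is")
  show ?case
    using partial_deriv_eq[OF bessel_conv_has_derivative[OF s schwartz_iterated_deriv[OF \<phi>, of "is"]], of i]
    by (simp add: Cons fun_eq_iff)
qed simp

lemma bessel_conv_schwartz:
  fixes \<phi> :: "real^'n \<Rightarrow> complex"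
  assumes s: "0 < s" and \<phi>: "\<phi> \<in> schwartz_space"
  shows "bessel_conv s \<phi> \<in> schwartz_space"
proof (rule schwartz_spaceI)
  show "(iterated_deriv is (bessel_conv s \<phi>) has_derivative (\<lambda>h. \<Sum>i\<in>UNIV. (h $ i) *\<^sub>R bessel_conv s (partial_deriv i (iterated_deriv is \<phi>)) x)) (at x)" for "is" x
    unfolding bessel_conv_iterated_deriv[OF s \<phi>] by (rule bessel_conv_has_derivative[OF s schwartz_iterated_deriv[OF \<phi>]])
  fix "is" k
  obtain C where "\<And>x. (1 + norm x) ^ k * cmod (iterated_deriv is \<phi> x) \<le> C"
    using schwartz_bound[OF schwartz_iterated_deriv[OF \<phi>]] by metis
  then show "\<exists>C. \<forall>x. (1 + norm x) ^ k * cmod (iterated_deriv is (bessel_conv s \<phi>) x) \<le> C"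
    unfolding bessel_conv_iterated_deriv[OF s \<phi>] using bessel_conv_decay[OF s schwartz_iterated_deriv[OF \<phi>]] by blast
qed

section \<open>The Fourier multiplier\<close>

lemma lborel_Fubini:
  fixes f :: "'a::euclidean_space \<Rightarrow> 'b::euclidean_space \<Rightarrow> 'c::{banach, second_countable_topology}"
  assumes f: "(\<lambda>(x, y). f x y) \<in> borel_measurable (borel \<Otimes>\<^sub>M borel)"
    and fin: "(\<integral>\<^sup>+x. \<integral>\<^sup>+y. ennreal (norm (f x y)) \<partial>lborel \<partial>lborel) < \<infinity>"
  shows "(LINT x|lborel. LINT y|lborel. f x y) = (LINT y|lborel. LINT x|lborel. f x y)"
proof -
  interpret pair_sigma_finite "lborel :: 'a measure" "lborel :: 'b measure" ..
  have m: "(\<lambda>(x, y). f x y) \<in> borel_measurable (lborel \<Otimes>\<^sub>M lborel)"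
    using f by (simp add: measurable_cong_sets[OF sets_pair_measure_cong[OF sets_lborel sets_lborel] refl])
  have "integrable (lborel \<Otimes>\<^sub>M lborel) (\<lambda>(x, y). f x y)"
  proof (rule integrableI_bounded[OF m])
    have mn: "(\<lambda>z. ennreal (norm (case z of (x, y) \<Rightarrow> f x y))) \<in> borel_measurable (lborel \<Otimes>\<^sub>M lborel)"
      using m by measurable
    show "(\<integral>\<^sup>+z. ennreal (norm (case z of (x, y) \<Rightarrow> f x y)) \<partial>(lborel \<Otimes>\<^sub>M lborel)) < \<infinity>"
      using fin lborel.nn_integral_fst[OF mn] by simp
  qed
  then show ?thesis by (rule lborel_pair.Fubini_integral[symmetric])
qed

text \<open>\<open>inv_fourier\<close> without its normalising constant, taken over
  \<open>lborel\<close> to suit Borel product measurability.\<close>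

definition fourier_int :: "(real^'n \<Rightarrow> complex) \<Rightarrow> real^'n \<Rightarrow> complex" where
  "fourier_int \<phi> \<xi> = (LINT y|lborel. exp (\<i> * complex_of_real (y \<bullet> \<xi>)) * \<phi> y)"

lemma integrable_oscillation:
  fixes \<phi> :: "real^'n \<Rightarrow> complex"
  assumes "integrable lborel \<phi>"
  shows "integrable lborel (\<lambda>y. exp (\<i> * complex_of_real (y \<bullet> \<xi>)) * \<phi> y)"
proof (rule Bochner_Integration.integrable_bound[OF assms])
  note borel_measurable_integrable[OF assms, measurable]
  show "(\<lambda>y. exp (\<i> * complex_of_real (y \<bullet> \<xi>)) * \<phi> y) \<in> borel_measurable lborel" by measurable
  show "AE y in lborel. norm (exp (\<i> * complex_of_real (y \<bullet> \<xi>)) * \<phi> y) \<le> norm (\<phi> y)"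
    by (intro AE_I2) (simp add: norm_mult)
qed

lemma fourier_int_bound:
  fixes \<phi> :: "real^'n \<Rightarrow> complex"
  shows "cmod (fourier_int \<phi> \<xi>) \<le> (LINT y|lborel. cmod (\<phi> y))"
  unfolding fourier_int_def by (rule order_trans[OF integral_norm_bound]) (simp add: norm_mult)

lemma fourier_int_measurable [measurable]:
  fixes \<phi> :: "real^'n \<Rightarrow> complex"
  assumes [measurable]: "\<phi> \<in> borel_measurable borel"
  shows "fourier_int \<phi> \<in> borel_measurable borel"
proof -
  have "(\<lambda>(\<xi>, y). exp (\<i> * complex_of_real (y \<bullet> \<xi>)) * \<phi> y) \<in> borel_measurable (borel \<Otimes>\<^sub>M lborel)" by measurable
  from lborel.borel_measurable_lebesgue_integral[OF this] show ?thesis unfolding fourier_int_def[abs_def] .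
qed

lemma fourier_int_translate:
  fixes \<phi> :: "real^'n \<Rightarrow> complex"
  assumes [measurable]: "\<phi> \<in> borel_measurable borel"
  shows "fourier_int (\<lambda>y. \<phi> (y + h)) \<xi> = exp (- \<i> * complex_of_real (h \<bullet> \<xi>)) * fourier_int \<phi> \<xi>"
proof -
  have "fourier_int (\<lambda>y. \<phi> (y + h)) \<xi> = (LINT y|lborel. (\<lambda>y. exp (- \<i> * complex_of_real (h \<bullet> \<xi>)) * (exp (\<i> * complex_of_real (y \<bullet> \<xi>)) * \<phi> y)) (h + y))"
    unfolding fourier_int_def
    by (intro Bochner_Integration.integral_cong refl) (simp add: inner_add_left distrib_left exp_add[symmetric] mult.assoc[symmetric] add.commute)
  also have "\<dots> = (LINT y|distr lborel borel ((+) h). exp (- \<i> * complex_of_real (h \<bullet> \<xi>)) * (exp (\<i> * complex_of_real (y \<bullet> \<xi>)) * \<phi> y))"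
    by (rule integral_distr[symmetric]) measurable
  also have "\<dots> = exp (- \<i> * complex_of_real (h \<bullet> \<xi>)) * fourier_int \<phi> \<xi>"
    by (simp add: lborel_distr_plus fourier_int_def)
  finally show ?thesis .
qed

lemma fourier_int_lincomb:
  fixes \<phi> \<psi> :: "real^'n \<Rightarrow> complex"
  assumes "integrable lborel \<phi>" "integrable lborel \<psi>"
  shows "fourier_int (\<lambda>y. a * \<phi> y + b * \<psi> y) \<xi> = a * fourier_int \<phi> \<xi> + b * fourier_int \<psi> \<xi>"
proof -
  have "fourier_int (\<lambda>y. a * \<phi> y + b * \<psi> y) \<xi>
    = (LINT y|lborel. a * (exp (\<i> * complex_of_real (y \<bullet> \<xi>)) * \<phi> y) + b * (exp (\<i> * complex_of_real (y \<bullet> \<xi>)) * \<psi> y))"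
    unfolding fourier_int_def by (intro Bochner_Integration.integral_cong refl) (simp add: algebra_simps)
  also have "\<dots> = a * fourier_int \<phi> \<xi> + b * fourier_int \<psi> \<xi>"
    unfolding fourier_int_def
    by (subst Bochner_Integration.integral_add) (auto intro!: integrable_mult_right integrable_oscillation assms)
  finally show ?thesis .
qed

text \<open>Integration by parts, by comparing the difference quotients of \<open>\<phi>\<close> with those of the exponential.\<close>

lemma fourier_int_partial_deriv:
  fixes \<phi> :: "real^'n \<Rightarrow> complex"
  assumes \<phi>: "\<phi> \<in> schwartz_space"
  shows "fourier_int (partial_deriv i \<phi>) \<xi> = - \<i> * complex_of_real (\<xi> $ i) * fourier_int \<phi> \<xi>"
proof -
  note schwartz_measurable[OF \<phi>, measurable] schwartz_measurable[OF schwartz_partial_deriv[OF \<phi>, of i], measurable]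
  define h where "h n = inverse (real (Suc n))" for n
  have h0: "0 < h n" "h n \<le> 1" for n by (auto simp: h_def inverse_le_1_iff)
  have hlim: "h \<longlonglongrightarrow> 0" unfolding h_def by (rule LIMSEQ_inverse_real_of_nat)
  define q where "q n y = (\<phi> (y + h n *\<^sub>R axis i 1) - \<phi> y) / complex_of_real (h n)" for n y
  have qm [measurable]: "q n \<in> borel_measurable borel" for n unfolding q_def by measurable
  obtain C where C: "0 \<le> C" "\<And>x k. norm k \<le> 1 \<Longrightarrow> cmod (\<phi> (x + k) - \<phi> x) \<le> C / (1 + norm x) ^ (2 * CARD('n)) * norm k"
    using schwartz_difference_bound[OF \<phi>, of "2 * CARD('n)"] by blast
  have qb: "cmod (q n y) \<le> C * (1 / (1 + norm y) ^ (2 * CARD('n)))" for n y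
  proof -
    have "cmod (\<phi> (y + h n *\<^sub>R axis i 1) - \<phi> y) \<le> C / (1 + norm y) ^ (2 * CARD('n)) * h n"
      using C(2)[of "h n *\<^sub>R axis i 1" y] h0[of n] by simp
    then show ?thesis using h0[of n] by (simp add: q_def norm_divide divide_le_eq)
  qed
  have hcomp: "((h n *\<^sub>R axis i 1 :: real^'n) $ j) = (if j = i then h n else 0)" for n j by (simp add: axis_def)
  obtain D where D: "0 \<le> D" "\<And>x k. cmod (\<phi> (x + k) - \<phi> x - (\<Sum>j\<in>UNIV. (k $ j) *\<^sub>R partial_deriv j \<phi> x)) \<le> D * (norm k)\<^sup>2"
    using schwartz_taylor[OF \<phi>] by blast
  have qlim: "(\<lambda>n. q n y) \<longlonglongrightarrow> partial_deriv i \<phi> y" for y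
  proof (rule LIM_zero_cancel, rule Lim_null_comparison)
    have "cmod (q n y - partial_deriv i \<phi> y) \<le> D * h n" for n
    proof -
      have sum: "(\<Sum>j\<in>UNIV. ((h n *\<^sub>R axis i 1 :: real^'n) $ j) *\<^sub>R partial_deriv j \<phi> y) = complex_of_real (h n) * partial_deriv i \<phi> y"
        unfolding hcomp by (simp add: if_distrib if_distribR scaleR_conv_of_real cong: if_cong)
      have "cmod (\<phi> (y + h n *\<^sub>R axis i 1) - \<phi> y - complex_of_real (h n) * partial_deriv i \<phi> y) \<le> D * (h n)\<^sup>2"
        using D(2)[of y "h n *\<^sub>R axis i 1"] unfolding sum by simp
      moreover have "q n y - partial_deriv i \<phi> y = (\<phi> (y + h n *\<^sub>R axis i 1) - \<phi> y - complex_of_real (h n) * partial_deriv i \<phi> y) / complex_of_real (h n)"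
        using h0[of n] by (simp add: q_def diff_divide_distrib)
      ultimately show ?thesis using h0[of n] by (simp add: norm_divide divide_le_eq power2_eq_square)
    qed
    then show "\<forall>\<^sub>F n in sequentially. norm (q n y - partial_deriv i \<phi> y) \<le> D * h n" by simp
    show "(\<lambda>n. D * h n) \<longlonglongrightarrow> 0" using tendsto_mult_left[OF hlim, of D] by simp
  qed
  have "(\<lambda>n. fourier_int (q n) \<xi>) \<longlonglongrightarrow> fourier_int (partial_deriv i \<phi>) \<xi>"
    unfolding fourier_int_def
  proof (rule integral_dominated_convergence)
    show "integrable lborel (\<lambda>y::real^'n. C * (1 / (1 + norm y) ^ (2 * CARD('n))))"
      using integrable_polynomial_decay by (rule integrable_mult_right)
    show "AE y in lborel. (\<lambda>n. exp (\<i> * complex_of_real (y \<bullet> \<xi>)) * q n y) \<longlonglongrightarrow> exp (\<i> * complex_of_real (y \<bullet> \<xi>)) * partial_deriv i \<phi> y"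
      by (intro AE_I2 tendsto_mult_left qlim)
    show "AE y in lborel. norm (exp (\<i> * complex_of_real (y \<bullet> \<xi>)) * q n y) \<le> C * (1 / (1 + norm y) ^ (2 * CARD('n)))" for n
      using qb by (intro AE_I2) (simp add: norm_mult)
  qed measurable
  moreover have "(\<lambda>n. fourier_int (q n) \<xi>) \<longlonglongrightarrow> - \<i> * complex_of_real (\<xi> $ i) * fourier_int \<phi> \<xi>"
  proof -
    have it: "integrable lborel (\<lambda>y. \<phi> (y + k))" for k
      using lborel_integrable_reflect[of "\<lambda>y. \<phi> (k - y)" 0] lborel_integrable_reflect[of \<phi> k] schwartz_integrable[OF \<phi>]
      by (simp add: add.commute)
    have eq: "fourier_int (q n) \<xi> = (exp (complex_of_real (h n) * (- \<i> * complex_of_real (\<xi> $ i))) - 1) / complex_of_real (h n) * fourier_int \<phi> \<xi>" for n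
    proof -
      have "q n = (\<lambda>y. (1 / complex_of_real (h n)) * \<phi> (y + h n *\<^sub>R axis i 1) + (- 1 / complex_of_real (h n)) * \<phi> y)"
        by (simp add: q_def fun_eq_iff diff_divide_distrib)
      then have "fourier_int (q n) \<xi> = (1 / complex_of_real (h n)) * (exp (- \<i> * complex_of_real ((h n *\<^sub>R axis i 1) \<bullet> \<xi>)) * fourier_int \<phi> \<xi>) + (- 1 / complex_of_real (h n)) * fourier_int \<phi> \<xi>"
        by (simp only: fourier_int_lincomb[OF it schwartz_integrable[OF \<phi>]] fourier_int_translate[OF schwartz_measurable[OF \<phi>]])
      moreover have "- \<i> * complex_of_real ((h n *\<^sub>R axis i 1) \<bullet> \<xi>) = complex_of_real (h n) * (- \<i> * complex_of_real (\<xi> $ i))"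
        by (simp add: inner_axis')
      ultimately have "fourier_int (q n) \<xi> = (1 / complex_of_real (h n)) * (exp (complex_of_real (h n) * (- \<i> * complex_of_real (\<xi> $ i))) * fourier_int \<phi> \<xi>) + (- 1 / complex_of_real (h n)) * fourier_int \<phi> \<xi>"
        by (simp only:)
      then show ?thesis by (simp add: diff_divide_distrib left_diff_distrib)
    qed
    have "((\<lambda>t. (exp (t * (- \<i> * complex_of_real (\<xi> $ i))) - 1) / t) \<longlongrightarrow> - \<i> * complex_of_real (\<xi> $ i)) (at 0)"
    proof -
      have "((\<lambda>t. exp (t * (- \<i> * complex_of_real (\<xi> $ i)))) has_field_derivative (- \<i> * complex_of_real (\<xi> $ i))) (at 0)"
        by (auto intro!: derivative_eq_intros)
      then show ?thesis by (simp add: has_field_derivative_iff)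
    qed
    moreover have "filterlim (\<lambda>n. complex_of_real (h n)) (at 0) sequentially"
    proof (rule filterlim_atI)
      show "(\<lambda>n. complex_of_real (h n)) \<longlonglongrightarrow> 0" using tendsto_of_real[OF hlim] by simp
      show "\<forall>\<^sub>F n in sequentially. complex_of_real (h n) \<noteq> 0"
        using h0(1) by (intro always_eventually allI) (metis less_irrefl of_real_eq_0_iff)
    qed
    ultimately have "(\<lambda>n. (exp (complex_of_real (h n) * (- \<i> * complex_of_real (\<xi> $ i))) - 1) / complex_of_real (h n)) \<longlonglongrightarrow> - \<i> * complex_of_real (\<xi> $ i)"
      by (rule filterlim_compose)
    from tendsto_mult_right[OF this] show ?thesis unfolding eq .
  qed
  ultimately show ?thesis by (rule LIMSEQ_unique)
qed

lemma schwartz_zero: "(\<lambda>_. 0) \<in> (schwartz_space :: (real^'n \<Rightarrow> complex) set)"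
proof (rule schwartz_spaceI)
  have "iterated_deriv is (\<lambda>_. 0) = (\<lambda>_::real^'n. 0)" for "is"
    by (induction "is") (simp_all add: partial_deriv_def)
  then show "(iterated_deriv is (\<lambda>_. 0) has_derivative (\<lambda>_. 0)) (at (x::real^'n))"
    "\<exists>C. \<forall>x::real^'n. (1 + norm x) ^ k * cmod (iterated_deriv is (\<lambda>_. 0) x) \<le> C" for "is" x k
    by (auto intro: exI[of _ 0])
qed

lemma schwartz_sum:
  fixes \<phi> :: "'i \<Rightarrow> real^'n \<Rightarrow> complex"
  assumes "finite I" "\<And>i. i \<in> I \<Longrightarrow> \<phi> i \<in> schwartz_space"
  shows "(\<lambda>x. \<Sum>i\<in>I. \<phi> i x) \<in> schwartz_space"
  using assms
proof (induction I)
  case (insert i I)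
  then show ?case using schwartz_lincomb[of "\<phi> i" "\<lambda>x. \<Sum>i\<in>I. \<phi> i x" 1 1] by simp
qed (simp add: schwartz_zero)

section \<open>Decay of the transform through powers of 1 - Laplacian\<close>

text \<open>The operator 1 - Laplacian, with symbol 1 + |\<xi>|^2.\<close>

definition helmholtz :: "(real^'n \<Rightarrow> complex) \<Rightarrow> real^'n \<Rightarrow> complex" where
  "helmholtz \<phi> x = \<phi> x - (\<Sum>i\<in>UNIV. partial_deriv i (partial_deriv i \<phi>) x)"

lemma schwartz_laplace:
  fixes \<phi> :: "real^'n \<Rightarrow> complex"
  assumes "\<phi> \<in> schwartz_space" shows "(\<lambda>x. \<Sum>i\<in>UNIV. partial_deriv i (partial_deriv i \<phi>) x) \<in> schwartz_space"
  by (rule schwartz_sum) (auto intro: schwartz_partial_deriv assms)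

lemma schwartz_helmholtz:
  fixes \<phi> :: "real^'n \<Rightarrow> complex"
  assumes "\<phi> \<in> schwartz_space" shows "helmholtz \<phi> \<in> schwartz_space"
  using schwartz_lincomb[OF assms schwartz_laplace[OF assms], of 1 "-1"] by (simp add: helmholtz_def[abs_def])

lemma fourier_int_helmholtz:
  fixes \<phi> :: "real^'n \<Rightarrow> complex"
  assumes \<phi>: "\<phi> \<in> schwartz_space"
  shows "fourier_int (helmholtz \<phi>) \<xi> = complex_of_real (1 + (norm \<xi>)\<^sup>2) * fourier_int \<phi> \<xi>"
proof -
  let ?P = "\<lambda>i. partial_deriv i (partial_deriv i \<phi>)"
  have "fourier_int (\<lambda>x. \<Sum>i\<in>UNIV. ?P i x) \<xi> = (\<Sum>i\<in>UNIV. fourier_int (?P i) \<xi>)"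
    unfolding fourier_int_def sum_distrib_left
    by (intro Bochner_Integration.integral_sum integrable_oscillation schwartz_integrable schwartz_partial_deriv \<phi>)
  also have "\<dots> = (\<Sum>i\<in>UNIV. - complex_of_real ((\<xi> $ i)\<^sup>2) * fourier_int \<phi> \<xi>)"
  proof (intro sum.cong refl)
    fix i
    have "fourier_int (?P i) \<xi> = (- \<i> * complex_of_real (\<xi> $ i)) * ((- \<i> * complex_of_real (\<xi> $ i)) * fourier_int \<phi> \<xi>)"
      by (simp only: fourier_int_partial_deriv[OF schwartz_partial_deriv[OF \<phi>]] fourier_int_partial_deriv[OF \<phi>])
    also have "\<dots> = (\<i> * \<i>) * (complex_of_real (\<xi> $ i) * complex_of_real (\<xi> $ i)) * fourier_int \<phi> \<xi>"
      by (simp only: minus_mult_left[symmetric] minus_mult_right[symmetric] minus_minus mult_ac)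
    finally show "fourier_int (?P i) \<xi> = - complex_of_real ((\<xi> $ i)\<^sup>2) * fourier_int \<phi> \<xi>"
      by (simp add: power2_eq_square)
  qed
  also have "\<dots> = - complex_of_real ((norm \<xi>)\<^sup>2) * fourier_int \<phi> \<xi>"
    unfolding power2_norm_eq_inner inner_vec_def by (simp add: sum_distrib_right sum_negf power2_eq_square)
  finally have s: "fourier_int (\<lambda>x. \<Sum>i\<in>UNIV. ?P i x) \<xi> = - complex_of_real ((norm \<xi>)\<^sup>2) * fourier_int \<phi> \<xi>" .
  have "helmholtz \<phi> = (\<lambda>x. 1 * \<phi> x + (- 1) * (\<Sum>i\<in>UNIV. ?P i x))" by (simp add: helmholtz_def fun_eq_iff)
  then have "fourier_int (helmholtz \<phi>) \<xi> = 1 * fourier_int \<phi> \<xi> + (- 1) * fourier_int (\<lambda>x. \<Sum>i\<in>UNIV. ?P i x) \<xi>"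
    by (simp only: fourier_int_lincomb[OF schwartz_integrable[OF \<phi>] schwartz_integrable[OF schwartz_laplace[OF \<phi>]]])
  then show ?thesis unfolding s by (simp add: algebra_simps)
qed

text \<open>Applying \<open>helmholtz\<close> \<open>CARD('n)\<close> times multiplies the transform
  by (1 + |\<xi>|^2)^d and keeps it bounded, since the result is again the transform of an
  integrable function. This gives decay of order 2d.\<close>

lemma fourier_int_integrable:
  fixes \<phi> :: "real^'n \<Rightarrow> complex"
  assumes \<phi>: "\<phi> \<in> schwartz_space"
  shows "integrable lborel (fourier_int \<phi>)"
proof -
  define N where "N = CARD('n)"
  have it: "(helmholtz ^^ k) \<phi> \<in> schwartz_space \<and> fourier_int ((helmholtz ^^ k) \<phi>) \<xi> = complex_of_real (1 + (norm \<xi>)\<^sup>2) ^ k * fourier_int \<phi> \<xi>" for k \<xi>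
    by (induction k) (simp_all add: \<phi> schwartz_helmholtz fourier_int_helmholtz)
  define C where "C = 2 ^ N * (LINT y|lborel. cmod ((helmholtz ^^ N) \<phi> y))"
  have C0: "0 \<le> C" unfolding C_def by (intro mult_nonneg_nonneg integral_nonneg_AE) auto
  have b: "cmod (fourier_int \<phi> \<xi>) \<le> C * (1 / (1 + norm \<xi>) ^ (2 * CARD('n)))" for \<xi>
  proof -
    have p: "0 < (1 + norm \<xi>) ^ (2 * CARD('n))" by (intro zero_less_power) (simp add: add_pos_nonneg)
    have "(1 + norm \<xi>)\<^sup>2 \<le> 2 * (1 + (norm \<xi>)\<^sup>2)"
      using zero_le_power2[of "norm \<xi> - 1"] by (simp add: power2_eq_square algebra_simps)
    then have "((1 + norm \<xi>)\<^sup>2) ^ N \<le> (2 * (1 + (norm \<xi>)\<^sup>2)) ^ N" by (intro power_mono) auto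
    then have "(1 + norm \<xi>) ^ (2 * CARD('n)) \<le> 2 ^ N * (1 + (norm \<xi>)\<^sup>2) ^ N"
      by (simp only: power_mult[symmetric] power_mult_distrib N_def)
    then have "(1 + norm \<xi>) ^ (2 * CARD('n)) * cmod (fourier_int \<phi> \<xi>) \<le> 2 ^ N * (1 + (norm \<xi>)\<^sup>2) ^ N * cmod (fourier_int \<phi> \<xi>)"
      by (intro mult_right_mono) auto
    also have "\<dots> = 2 ^ N * cmod (fourier_int ((helmholtz ^^ N) \<phi>) \<xi>)"
      using conjunct2[OF it[of N \<xi>]] norm_of_real[of "1 + (norm \<xi>)\<^sup>2", where 'a=complex] by (simp add: norm_mult norm_power)
    also have "\<dots> \<le> C" unfolding C_def by (intro mult_left_mono fourier_int_bound) auto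
    finally show ?thesis using p by (simp add: field_simps)
  qed
  have i: "integrable lborel (\<lambda>x::real^'n. C * (1 / (1 + norm x) ^ (2 * CARD('n))))"
    using integrable_polynomial_decay by (rule integrable_mult_right)
  show ?thesis
  proof (rule Bochner_Integration.integrable_bound[OF i])
    show "fourier_int \<phi> \<in> borel_measurable lborel"
      using fourier_int_measurable[OF schwartz_measurable[OF \<phi>]] by simp
    show "AE x in lborel. norm (fourier_int \<phi> x) \<le> norm (C * (1 / (1 + norm x) ^ (2 * CARD('n))))"
      using C0 b by (intro AE_I2) simp
  qed
qed


section \<open>The Bessel symbol as a mixture of Gaussians\<close>

text \<open>A Gamma integral of rate \<open>1 + c\<close>; for
  \<open>c = (norm \<xi>)\<^sup>2\<close> it is the subordination formula on the Fourier
  side.\<close>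

lemma bessel_symbol_nn:
  assumes s: "0 < s" and c: "0 \<le> c"
  shows "(\<integral>\<^sup>+t. ennreal (bessel_density s t * exp (- t * c)) \<partial>lborel) = ennreal ((1 + c) powr (- s / 2))"
proof -
  have G: "0 < Gamma (s / 2)" using s by (intro Gamma_real_pos) simp
  have "ennreal (bessel_density s t * exp (- t * c)) = ennreal (1 / Gamma (s / 2)) * ennreal (indicator {0<..} t * (t powr (s / 2 - 1) * exp (- (1 + c) * t)))" for t
    using G by (subst ennreal_mult[symmetric]) (auto simp: bessel_density_def exp_add[symmetric] algebra_simps)
  then have "(\<integral>\<^sup>+t. ennreal (bessel_density s t * exp (- t * c)) \<partial>lborel) = ennreal (1 / Gamma (s / 2)) * ennreal (Gamma (s / 2) * (1 + c) powr (- (s / 2)))"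
    using s c by (simp only:) (subst nn_integral_cmult, measurable, subst nn_integral_Gamma, auto)
  also have "\<dots> = ennreal ((1 + c) powr (- s / 2))"
    using G by (subst ennreal_mult[symmetric]) auto
  finally show ?thesis .
qed

lemma bessel_symbol:
  assumes s: "0 < s" and c: "0 \<le> c"
  shows "(LINT t|lborel. bessel_density s t * exp (- t * c)) = (1 + c) powr (- s / 2)"
  using bessel_symbol_nn[OF s c] by (subst integral_eq_nn_integral) (auto simp: bessel_density_nonneg[OF s])

lemma bessel_kernel_eq_integral:
  assumes "0 < s" shows "(LINT t|lborel. bessel_density s t * heat t y) = bessel_kernel s y"
  unfolding bessel_kernel_def bessel_nn_def
  by (rule integral_eq_nn_integral) (measurable, simp add: bessel_density_heat_nonneg[OF assms])

text \<open>Fubini moves the oscillation onto the Gaussian, whose transform is explicit. The factor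
  (2 pi)^d is the constant in \<open>inv_fourier\<close>, so the multiplier is identified without
  the inversion theorem.\<close>

lemma gaussian_fourier_int:
  fixes \<phi> :: "real^'n \<Rightarrow> complex"
  assumes \<phi>: "integrable lborel \<phi>" and t: "0 < t"
  shows "(LINT \<xi>|lborel. exp (- \<i> * complex_of_real (\<xi> \<bullet> x)) * complex_of_real (exp (- t * (norm \<xi>)\<^sup>2)) * fourier_int \<phi> \<xi>)
    = complex_of_real ((2 * pi) ^ CARD('n)) * (LINT y|lborel. complex_of_real (heat t (x - y)) * \<phi> y)"
proof -
  have [measurable]: "\<phi> \<in> borel_measurable borel" using borel_measurable_integrable[OF \<phi>] by simp
  have "(LINT \<xi>|lborel. exp (- \<i> * complex_of_real (\<xi> \<bullet> x)) * complex_of_real (exp (- t * (norm \<xi>)\<^sup>2)) * fourier_int \<phi> \<xi>)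
    = (LINT \<xi>|lborel. LINT y|lborel. exp (- \<i> * complex_of_real (\<xi> \<bullet> x)) * complex_of_real (exp (- t * (norm \<xi>)\<^sup>2)) * (exp (\<i> * complex_of_real (y \<bullet> \<xi>)) * \<phi> y))"
    unfolding fourier_int_def integral_mult_right_zero ..
  also have "\<dots> = (LINT y|lborel. LINT \<xi>|lborel. exp (- \<i> * complex_of_real (\<xi> \<bullet> x)) * complex_of_real (exp (- t * (norm \<xi>)\<^sup>2)) * (exp (\<i> * complex_of_real (y \<bullet> \<xi>)) * \<phi> y))"
  proof (rule lborel_Fubini)
    show "(\<lambda>(\<xi>, y). exp (- \<i> * complex_of_real (\<xi> \<bullet> x)) * complex_of_real (exp (- t * (norm \<xi>)\<^sup>2)) * (exp (\<i> * complex_of_real (y \<bullet> \<xi>)) * \<phi> y)) \<in> borel_measurable (borel \<Otimes>\<^sub>M borel)"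
      by measurable
    have "(\<integral>\<^sup>+\<xi>. \<integral>\<^sup>+y. ennreal (norm (exp (- \<i> * complex_of_real (\<xi> \<bullet> x)) * complex_of_real (exp (- t * (norm \<xi>)\<^sup>2)) * (exp (\<i> * complex_of_real (y \<bullet> \<xi>)) * \<phi> y))) \<partial>lborel \<partial>lborel)
      = (\<integral>\<^sup>+\<xi>. ennreal (exp (- t * (norm \<xi>)\<^sup>2)) * (\<integral>\<^sup>+y. ennreal (norm (\<phi> y)) \<partial>lborel) \<partial>(lborel :: (real^'n) measure))"
      by (simp add: norm_mult ennreal_mult nn_integral_cmult)
    also have "\<dots> = ennreal (sqrt (pi / t) ^ CARD('n)) * (\<integral>\<^sup>+y. ennreal (norm (\<phi> y)) \<partial>lborel)"
      by (subst nn_integral_multc) (simp_all only: nn_integral_gaussian[OF t], measurable)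
    also have "\<dots> < \<infinity>" using \<phi> by (auto simp: integrable_iff_bounded ennreal_mult_less_top)
    finally show "(\<integral>\<^sup>+\<xi>. \<integral>\<^sup>+y. ennreal (norm (exp (- \<i> * complex_of_real (\<xi> \<bullet> x)) * complex_of_real (exp (- t * (norm \<xi>)\<^sup>2)) * (exp (\<i> * complex_of_real (y \<bullet> \<xi>)) * \<phi> y))) \<partial>lborel \<partial>lborel) < \<infinity>" .
  qed
  also have "\<dots> = (LINT y|lborel. complex_of_real ((2 * pi) ^ CARD('n)) * (complex_of_real (heat t (x - y)) * \<phi> y))"
  proof (intro Bochner_Integration.integral_cong refl)
    fix y :: "real^'n"
    have "(LINT \<xi>|lborel. exp (- \<i> * complex_of_real (\<xi> \<bullet> x)) * complex_of_real (exp (- t * (norm \<xi>)\<^sup>2)) * (exp (\<i> * complex_of_real (y \<bullet> \<xi>)) * \<phi> y))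
      = (LINT \<xi>|lborel. exp (- \<i> * complex_of_real (\<xi> \<bullet> (x - y))) * complex_of_real (exp (- t * (norm \<xi>)\<^sup>2)) * \<phi> y)"
    proof (intro Bochner_Integration.integral_cong refl)
      fix \<xi> :: "real^'n"
      have "exp (- \<i> * complex_of_real (\<xi> \<bullet> (x - y))) = exp (- \<i> * complex_of_real (\<xi> \<bullet> x)) * exp (\<i> * complex_of_real (y \<bullet> \<xi>))"
        by (simp add: exp_add[symmetric] inner_diff_right inner_commute[of y] algebra_simps)
      then show "exp (- \<i> * complex_of_real (\<xi> \<bullet> x)) * complex_of_real (exp (- t * (norm \<xi>)\<^sup>2)) * (exp (\<i> * complex_of_real (y \<bullet> \<xi>)) * \<phi> y)
        = exp (- \<i> * complex_of_real (\<xi> \<bullet> (x - y))) * complex_of_real (exp (- t * (norm \<xi>)\<^sup>2)) * \<phi> y"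
        by (simp only: mult_ac)
    qed
    also have "\<dots> = complex_of_real (sqrt (pi / t) ^ CARD('n) * exp (- (norm (x - y))\<^sup>2 / (4 * t))) * \<phi> y"
      by (simp only: integral_mult_left_zero gaussian_fourier(2)[OF t])
    also have "sqrt (pi / t) ^ CARD('n) * exp (- (norm (x - y))\<^sup>2 / (4 * t)) = (2 * pi) ^ CARD('n) * heat t (x - y)"
    proof -
      have "2 * pi = sqrt (pi / t) * sqrt (4 * pi * t)"
        using t by (simp add: real_sqrt_mult real_sqrt_divide)
      then show ?thesis using t by (simp only: power_mult_distrib) (simp add: heat_def)
    qed
    finally show "(LINT \<xi>|lborel. exp (- \<i> * complex_of_real (\<xi> \<bullet> x)) * complex_of_real (exp (- t * (norm \<xi>)\<^sup>2)) * (exp (\<i> * complex_of_real (y \<bullet> \<xi>)) * \<phi> y))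
      = complex_of_real ((2 * pi) ^ CARD('n)) * (complex_of_real (heat t (x - y)) * \<phi> y)"
      by simp
  qed
  finally show ?thesis by simp
qed

lemma bessel_conv_eq_integral:
  fixes \<phi> :: "real^'n \<Rightarrow> complex"
  assumes [measurable]: "\<phi> \<in> borel_measurable borel"
  shows "bessel_conv s \<phi> x = (LINT y|lborel. bessel_kernel s (x - y) *\<^sub>R \<phi> y)"
  unfolding bessel_conv_def
  using lborel_integral_reflect[of "\<lambda>y. bessel_kernel s y *\<^sub>R \<phi> (x - y)" x] by simp

text \<open>Unfolding the transposed operations, \<open>bessel_potential s u \<phi>\<close> is
  \<open>u\<close> at exactly this function. Each Gaussian in the mixture for the symbol acts as
  convolution with a heat kernel, and mixing these gives the Bessel kernel.\<close>

theorem fourier_bessel_multiplier: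
  fixes \<phi> :: "real^'n \<Rightarrow> complex"
  assumes s: "0 < s" and \<phi>: "\<phi> \<in> schwartz_space"
  shows "fourier (\<lambda>\<xi>. complex_of_real ((1 + (norm \<xi>)\<^sup>2) powr (- s / 2)) * inv_fourier \<phi> \<xi>) = bessel_conv s \<phi>"
proof (rule ext)
  fix x :: "real^'n"
  note schwartz_measurable[OF \<phi>, measurable]
  let ?P = "complex_of_real ((2 * pi) ^ CARD('n))"
  let ?E = "\<lambda>\<xi>. exp (- \<i> * complex_of_real (\<xi> \<bullet> x)) * fourier_int \<phi> \<xi>"
  have inv: "inv_fourier \<phi> \<xi> = fourier_int \<phi> \<xi> / ?P" for \<xi>
    unfolding inv_fourier_def fourier_int_def inner_commute[of \<xi>] by (subst integral_completion) auto
  have "fourier (\<lambda>\<xi>. complex_of_real ((1 + (norm \<xi>)\<^sup>2) powr (- s / 2)) * inv_fourier \<phi> \<xi>) x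
    = (LINT \<xi>|lborel. exp (- \<i> * complex_of_real (\<xi> \<bullet> x)) * (complex_of_real ((1 + (norm \<xi>)\<^sup>2) powr (- s / 2)) * (fourier_int \<phi> \<xi> / ?P)))"
    unfolding fourier_def inv by (subst integral_completion) auto
  also have "\<dots> = (LINT \<xi>|lborel. LINT t|lborel. complex_of_real (bessel_density s t * exp (- t * (norm \<xi>)\<^sup>2)) * ?E \<xi>) / ?P"
    unfolding integral_mult_left_zero integral_complex_of_real bessel_symbol[OF s zero_le_power2] integral_divide_zero[symmetric]
    by (intro Bochner_Integration.integral_cong refl) simp
  \<comment> \<open>First interchange: absolutely integrable, because the symbol is at most 1 and
    the transform of \<phi> is integrable.\<close>
  also have "(LINT \<xi>|lborel. LINT t|lborel. complex_of_real (bessel_density s t * exp (- t * (norm \<xi>)\<^sup>2)) * ?E \<xi>)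
    = (LINT t|lborel. LINT \<xi>|lborel. complex_of_real (bessel_density s t * exp (- t * (norm \<xi>)\<^sup>2)) * ?E \<xi>)"
  proof (rule lborel_Fubini)
    show "(\<lambda>(\<xi>, t). complex_of_real (bessel_density s t * exp (- t * (norm \<xi>)\<^sup>2)) * ?E \<xi>) \<in> borel_measurable (borel \<Otimes>\<^sub>M borel)"
      by measurable
    have "(\<integral>\<^sup>+\<xi>. \<integral>\<^sup>+t. ennreal (norm (complex_of_real (bessel_density s t * exp (- t * (norm \<xi>)\<^sup>2)) * ?E \<xi>)) \<partial>lborel \<partial>lborel)
      = (\<integral>\<^sup>+\<xi>. \<integral>\<^sup>+t. ennreal (bessel_density s t * exp (- t * (norm \<xi>)\<^sup>2)) * ennreal (norm (fourier_int \<phi> \<xi>)) \<partial>lborel \<partial>lborel)"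
      by (intro nn_integral_cong) (simp add: norm_mult ennreal_mult[symmetric] bessel_density_nonneg[OF s] abs_mult)
    also have "\<dots> = (\<integral>\<^sup>+\<xi>. ennreal ((1 + (norm \<xi>)\<^sup>2) powr (- s / 2)) * ennreal (norm (fourier_int \<phi> \<xi>)) \<partial>lborel)"
      by (intro nn_integral_cong, subst nn_integral_multc) (simp_all only: bessel_symbol_nn[OF s zero_le_power2], measurable)
    also have "\<dots> \<le> (\<integral>\<^sup>+\<xi>. ennreal (norm (fourier_int \<phi> \<xi>)) \<partial>lborel)"
    proof (rule nn_integral_mono)
      fix \<xi> :: "real^'n"
      have "(1 + (norm \<xi>)\<^sup>2) powr (- s / 2) \<le> 1"
        using powr_mono[of "- s / 2" 0 "1 + (norm \<xi>)\<^sup>2"] s add_pos_nonneg[OF zero_less_one zero_le_power2[of "norm \<xi>"]]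
        by (simp del: add_pos_nonneg split: if_splits)
      then show "ennreal ((1 + (norm \<xi>)\<^sup>2) powr (- s / 2)) * ennreal (norm (fourier_int \<phi> \<xi>)) \<le> ennreal (norm (fourier_int \<phi> \<xi>))"
        by (subst ennreal_mult[symmetric]) (auto intro!: ennreal_leI mult_left_le_one_le)
    qed
    also have "\<dots> < \<infinity>" using fourier_int_integrable[OF \<phi>] by (simp add: integrable_iff_bounded)
    finally show "(\<integral>\<^sup>+\<xi>. \<integral>\<^sup>+t. ennreal (norm (complex_of_real (bessel_density s t * exp (- t * (norm \<xi>)\<^sup>2)) * ?E \<xi>)) \<partial>lborel \<partial>lborel) < \<infinity>" .
  qed
  also have "\<dots> = (LINT t|lborel. ?P * (LINT y|lborel. complex_of_real (bessel_density s t * heat t (x - y)) * \<phi> y))"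
  proof (intro Bochner_Integration.integral_cong refl)
    fix t :: real
    show "(LINT \<xi>|lborel. complex_of_real (bessel_density s t * exp (- t * (norm \<xi>)\<^sup>2)) * ?E \<xi>)
      = ?P * (LINT y|lborel. complex_of_real (bessel_density s t * heat t (x - y)) * \<phi> y)"
    proof (cases "0 < t")
      case True
      have "(LINT \<xi>|lborel. complex_of_real (bessel_density s t * exp (- t * (norm \<xi>)\<^sup>2)) * ?E \<xi>)
        = complex_of_real (bessel_density s t) * (LINT \<xi>|lborel. exp (- \<i> * complex_of_real (\<xi> \<bullet> x)) * complex_of_real (exp (- t * (norm \<xi>)\<^sup>2)) * fourier_int \<phi> \<xi>)"
        unfolding integral_mult_right_zero[symmetric] by (intro Bochner_Integration.integral_cong refl) simp
      also have "\<dots> = ?P * (LINT y|lborel. complex_of_real (bessel_density s t) * (complex_of_real (heat t (x - y)) * \<phi> y))"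
        unfolding gaussian_fourier_int[OF schwartz_integrable[OF \<phi>] True] integral_mult_right_zero by (simp only: mult_ac)
      finally show ?thesis by (simp add: mult.assoc)
    qed (simp add: bessel_density_eq_0)
  qed
  also have "\<dots> = ?P * (LINT t|lborel. LINT y|lborel. complex_of_real (bessel_density s t * heat t (x - y)) * \<phi> y)"
    by simp
  \<comment> \<open>Second interchange: absolutely integrable, because \<phi> is bounded and the
    kernel has finite mass.\<close>
  also have "(LINT t|lborel. LINT y|lborel. complex_of_real (bessel_density s t * heat t (x - y)) * \<phi> y)
    = (LINT y|lborel. LINT t|lborel. complex_of_real (bessel_density s t * heat t (x - y)) * \<phi> y)"
  proof (rule lborel_Fubini[symmetric])
    show "(\<lambda>(y, t). complex_of_real (bessel_density s t * heat t (x - y)) * \<phi> y) \<in> borel_measurable (borel \<Otimes>\<^sub>M borel)"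
      unfolding heat_def by measurable
    obtain C where C: "0 \<le> C" "\<And>x. (1 + norm x) ^ 0 * cmod (\<phi> x) \<le> C" using schwartz_bound[OF \<phi>] by metis
    have "(\<integral>\<^sup>+y. \<integral>\<^sup>+t. ennreal (norm (complex_of_real (bessel_density s t * heat t (x - y)) * \<phi> y)) \<partial>lborel \<partial>lborel)
      \<le> (\<integral>\<^sup>+y. \<integral>\<^sup>+t. ennreal (bessel_density s t * heat t (x - y)) * ennreal C \<partial>lborel \<partial>lborel)"
    proof (intro nn_integral_mono)
      fix y :: "real^'n" and t :: real
      have "norm (complex_of_real (bessel_density s t * heat t (x - y)) * \<phi> y) \<le> (bessel_density s t * heat t (x - y)) * C"
        unfolding norm_mult[of _ "\<phi> y"] norm_of_real abs_of_nonneg[OF bessel_density_heat_nonneg[OF s]]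
        using C(2)[of y] by (intro mult_left_mono bessel_density_heat_nonneg[OF s]) simp
      then show "ennreal (norm (complex_of_real (bessel_density s t * heat t (x - y)) * \<phi> y)) \<le> ennreal (bessel_density s t * heat t (x - y)) * ennreal C"
        using C(1) by (subst ennreal_mult[symmetric]) (auto intro!: ennreal_leI bessel_density_heat_nonneg[OF s])
    qed
    also have "\<dots> = (\<integral>\<^sup>+y. bessel_nn s (x - y) * ennreal C \<partial>lborel)"
      unfolding bessel_nn_def
      by (intro nn_integral_cong nn_integral_multc) (unfold heat_def, measurable)
    also have "\<dots> = (\<integral>\<^sup>+y. bessel_nn s y \<partial>(lborel :: (real^'n) measure)) * ennreal C"
      by (subst nn_integral_multc) (auto simp: nn_integral_lborel_reflect)
    also have "\<dots> < \<infinity>" using bessel_moment_finite[OF s, of 0, where 'n='n] by (simp add: ennreal_mult_less_top)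
    finally show "(\<integral>\<^sup>+y. \<integral>\<^sup>+t. ennreal (norm (complex_of_real (bessel_density s t * heat t (x - y)) * \<phi> y)) \<partial>lborel \<partial>lborel) < \<infinity>" .
  qed
  also have "\<dots> = (LINT y|lborel. bessel_kernel s (x - y) *\<^sub>R \<phi> y)"
    by (simp only: integral_mult_left_zero integral_complex_of_real bessel_kernel_eq_integral[OF s] scaleR_conv_of_real)
  also have "\<dots> = bessel_conv s \<phi> x" by (simp add: bessel_conv_eq_integral)
  finally show "fourier (\<lambda>\<xi>. complex_of_real ((1 + (norm \<xi>)\<^sup>2) powr (- s / 2)) * inv_fourier \<phi> \<xi>) x = bessel_conv s \<phi> x"
    by simp
qed

section \<open>Gaussians are Schwartz functions\<close>

text \<open>Polynomials in \<open>x - c\<close> times a Gaussian, generated by rules instead of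
  coefficients: closure under partial derivatives and rapid decay then follow by rule
  induction.\<close>

inductive_set gaussian_span :: "real \<Rightarrow> real^'n \<Rightarrow> (real^'n \<Rightarrow> complex) set" for b c where
  gaussian: "(\<lambda>x. complex_of_real (exp (- b * (norm (x - c))\<^sup>2))) \<in> gaussian_span b c"
| coordinate: "\<psi> \<in> gaussian_span b c \<Longrightarrow> (\<lambda>x. complex_of_real ((x - c) $ i) * \<psi> x) \<in> gaussian_span b c"
| lincomb: "\<psi> \<in> gaussian_span b c \<Longrightarrow> \<eta> \<in> gaussian_span b c \<Longrightarrow> (\<lambda>x. \<alpha> * \<psi> x + \<beta> * \<eta> x) \<in> gaussian_span b c"

lemma gaussian_span_has_derivative:
  fixes c :: "real^'n"
  assumes "\<psi> \<in> gaussian_span b c"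
  shows "\<exists>D. (\<forall>i. D i \<in> gaussian_span b c) \<and> (\<forall>x. (\<psi> has_derivative (\<lambda>h. \<Sum>i\<in>UNIV. (h $ i) *\<^sub>R D i x)) (at x))"
  using assms
proof induction
  case gaussian
  let ?g = "\<lambda>x. complex_of_real (exp (- b * (norm (x - c))\<^sup>2))"
  have mem: "(\<lambda>x. complex_of_real (- 2 * b) * (complex_of_real ((x - c) $ i) * ?g x) + 0 * ?g x) \<in> gaussian_span b c" for i
    by (intro gaussian_span.intros)
  have d: "(?g has_derivative (\<lambda>h. complex_of_real (exp (- b * (norm (x - c))\<^sup>2) * (- b * (2 * ((x - c) \<bullet> h)))))) (at x)" for x
  proof -
    have "((\<lambda>x. exp (- b * (norm (x - c))\<^sup>2)) has_derivative (\<lambda>h. exp (- b * (norm (x - c))\<^sup>2) * (- b * (2 * ((x - c) \<bullet> h))))) (at x)"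
      unfolding power2_norm_eq_inner by (auto intro!: derivative_eq_intros simp: inner_commute algebra_simps)
    from has_derivative_of_real[OF this] show ?thesis .
  qed
  have e: "complex_of_real (exp (- b * (norm (x - c))\<^sup>2) * (- b * (2 * ((x - c) \<bullet> h))))
    = (\<Sum>i\<in>UNIV. (h $ i) *\<^sub>R (complex_of_real (- 2 * b) * (complex_of_real ((x - c) $ i) * ?g x) + 0 * ?g x))" for x h :: "real^'n"
    by (simp add: inner_vec_def sum_distrib_left scaleR_conv_of_real sum_negf algebra_simps)
  show ?case
    using d mem unfolding e
    by (intro exI[of _ "\<lambda>i x. complex_of_real (- 2 * b) * (complex_of_real ((x - c) $ i) * ?g x) + 0 * ?g x"]) blast
next
  case (coordinate \<psi> i)
  then obtain D where D: "\<And>j. D j \<in> gaussian_span b c" "\<And>x. (\<psi> has_derivative (\<lambda>h. \<Sum>j\<in>UNIV. (h $ j) *\<^sub>R D j x)) (at x)" by blast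
  define E where "E j x = of_bool (j = i) * \<psi> x + 1 * (complex_of_real ((x - c) $ i) * D j x)" for j x
  have mem: "E j \<in> gaussian_span b c" for j
    unfolding E_def[abs_def] by (intro gaussian_span.intros D(1) coordinate.hyps)
  have d: "((\<lambda>x. complex_of_real ((x - c) $ i) * \<psi> x) has_derivative (\<lambda>h. complex_of_real ((x - c) $ i) * (\<Sum>j\<in>UNIV. (h $ j) *\<^sub>R D j x) + complex_of_real (h $ i) * \<psi> x)) (at x)" for x
  proof -
    have "((\<lambda>x. (x - c) $ i) has_derivative (\<lambda>h. h $ i)) (at x)"
      by (auto intro!: derivative_eq_intros bounded_linear_imp_has_derivative bounded_linear_vec_nth)
    from has_derivative_mult[OF has_derivative_of_real[OF this] D(2)] show ?thesis .
  qed
  have e: "complex_of_real ((x - c) $ i) * (\<Sum>j\<in>UNIV. (h $ j) *\<^sub>R D j x) + complex_of_real (h $ i) * \<psi> x = (\<Sum>j\<in>UNIV. (h $ j) *\<^sub>R E j x)" for x h :: "real^'n"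
  proof -
    have "(\<Sum>j\<in>UNIV. (h $ j) *\<^sub>R E j x) = (\<Sum>j\<in>UNIV. if j = i then (h $ j) *\<^sub>R \<psi> x else 0) + (\<Sum>j\<in>UNIV. (h $ j) *\<^sub>R (complex_of_real ((x - c) $ i) * D j x))"
      unfolding sum.distrib[symmetric] by (intro sum.cong refl) (simp add: E_def scaleR_right_distrib)
    then show ?thesis
      by (simp only: sum.delta[OF finite] mult_scaleR_right[symmetric] sum_distrib_left[symmetric] UNIV_I if_True)
        (simp add: scaleR_conv_of_real)
  qed
  show ?case using d mem unfolding e by (intro exI[of _ E]) blast
next
  case (lincomb \<psi> \<eta> \<alpha> \<beta>)
  then obtain D E where D: "\<And>j. D j \<in> gaussian_span b c" "\<And>x. (\<psi> has_derivative (\<lambda>h. \<Sum>j\<in>UNIV. (h $ j) *\<^sub>R D j x)) (at x)"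
    and E: "\<And>j. E j \<in> gaussian_span b c" "\<And>x. (\<eta> has_derivative (\<lambda>h. \<Sum>j\<in>UNIV. (h $ j) *\<^sub>R E j x)) (at x)" by blast
  have d: "((\<lambda>x. \<alpha> * \<psi> x + \<beta> * \<eta> x) has_derivative (\<lambda>h. \<alpha> * (\<Sum>j\<in>UNIV. (h $ j) *\<^sub>R D j x) + \<beta> * (\<Sum>j\<in>UNIV. (h $ j) *\<^sub>R E j x))) (at x)" for x
    by (rule has_derivative_add[OF has_derivative_mult_right[OF D(2)] has_derivative_mult_right[OF E(2)]])
  have e: "\<alpha> * (\<Sum>j\<in>UNIV. (h $ j) *\<^sub>R D j x) + \<beta> * (\<Sum>j\<in>UNIV. (h $ j) *\<^sub>R E j x) = (\<Sum>j\<in>UNIV. (h $ j) *\<^sub>R (\<alpha> * D j x + \<beta> * E j x))" for x h :: "real^'n"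
    by (simp add: sum_distrib_left sum.distrib scaleR_right_distrib)
  have mem: "(\<lambda>x. \<alpha> * D j x + \<beta> * E j x) \<in> gaussian_span b c" for j by (intro gaussian_span.intros D(1) E(1))
  show ?case using d mem unfolding e by (intro exI[of _ "\<lambda>j x. \<alpha> * D j x + \<beta> * E j x"]) blast
qed

text \<open>The polynomial is at most a multiple of \<open>exp (1 + u)\<close>, and completing the
  square bounds \<open>u - b * u\<^sup>2\<close> by \<open>1 / (4 * b)\<close>.\<close>

lemma gaussian_decay:
  assumes b: "0 < b"
  obtains C where "0 < C" "\<And>u::real. 0 \<le> u \<Longrightarrow> (1 + u) ^ k * exp (- b * u\<^sup>2) \<le> C"
proof (rule that[of "fact k * exp (1 + 1 / (4 * b))"])
  show "0 < fact k * exp (1 + 1 / (4 * b))" by simp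
  fix u :: real assume u: "0 \<le> u"
  have "u - b * u\<^sup>2 \<le> 1 / (4 * b)"
    using b zero_le_power2[of "2 * b * u - 1"] by (simp add: power2_eq_square field_simps)
  then have "exp (1 + u) * exp (- b * u\<^sup>2) \<le> exp (1 + 1 / (4 * b))" by (simp add: exp_add[symmetric])
  then have "fact k * (exp (1 + u) * exp (- b * u\<^sup>2)) \<le> fact k * exp (1 + 1 / (4 * b))" by (intro mult_left_mono) auto
  moreover have "(1 + u) ^ k * exp (- b * u\<^sup>2) \<le> fact k * exp (1 + u) * exp (- b * u\<^sup>2)"
    using u by (intro mult_right_mono power_le_fact_exp) auto
  ultimately show "(1 + u) ^ k * exp (- b * u\<^sup>2) \<le> fact k * exp (1 + 1 / (4 * b))"
    unfolding mult.assoc by (rule order_trans[rotated])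
qed

lemma gaussian_span_bounded:
  fixes c :: "real^'n"
  assumes "\<psi> \<in> gaussian_span b c" and b: "0 < b"
  shows "\<exists>C. \<forall>x. (1 + norm x) ^ k * cmod (\<psi> x) \<le> C"
  using assms(1)
proof (induction arbitrary: k)
  case gaussian
  obtain C where C: "0 < C" "\<And>u. 0 \<le> u \<Longrightarrow> (1 + u) ^ k * exp (- b * u\<^sup>2) \<le> C" using gaussian_decay[OF b] by blast
  have "(1 + norm x) ^ k * cmod (complex_of_real (exp (- b * (norm (x - c))\<^sup>2))) \<le> (1 + norm c) ^ k * C" for x
  proof -
    have "norm x \<le> norm c + norm (x - c)" using norm_triangle_ineq[of c "x - c"] by simp
    moreover have "(1 + norm c) * (1 + norm (x - c)) = 1 + norm c + norm (x - c) + norm c * norm (x - c)" by (simp add: algebra_simps)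
    moreover have "0 \<le> norm c * norm (x - c)" by simp
    ultimately have "1 + norm x \<le> (1 + norm c) * (1 + norm (x - c))" by linarith
    then have "(1 + norm x) ^ k \<le> (1 + norm c) ^ k * (1 + norm (x - c)) ^ k"
      unfolding power_mult_distrib[symmetric] by (intro power_mono) auto
    then have "(1 + norm x) ^ k * exp (- b * (norm (x - c))\<^sup>2) \<le> (1 + norm c) ^ k * (1 + norm (x - c)) ^ k * exp (- b * (norm (x - c))\<^sup>2)"
      by (intro mult_right_mono) auto
    also have "\<dots> \<le> (1 + norm c) ^ k * C" unfolding mult.assoc by (intro mult_left_mono C(2)) auto
    finally show ?thesis by simp
  qed
  then show ?case by blast
next
  case (coordinate \<psi> i)
  \<comment> \<open>One more power of the weight pays for the coordinate factor, which is why the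
    induction is over all \<open>k\<close>.\<close>
  obtain C where C: "\<And>x. (1 + norm x) ^ Suc k * cmod (\<psi> x) \<le> C" using coordinate.IH[of "Suc k"] by blast
  have "(1 + norm x) ^ k * cmod (complex_of_real ((x - c) $ i) * \<psi> x) \<le> (1 + norm c) * C" for x
  proof -
    have "\<bar>(x - c) $ i\<bar> \<le> norm x + norm c" by (rule order_trans[OF component_le_norm_cart norm_triangle_ineq4])
    also have "\<dots> \<le> (1 + norm c) * (1 + norm x)" by (simp add: algebra_simps)
    finally have "(1 + norm x) ^ k * (\<bar>(x - c) $ i\<bar> * cmod (\<psi> x)) \<le> (1 + norm x) ^ k * ((1 + norm c) * (1 + norm x) * cmod (\<psi> x))"
      by (intro mult_left_mono mult_right_mono) auto
    also have "\<dots> = (1 + norm c) * ((1 + norm x) ^ Suc k * cmod (\<psi> x))" by (simp add: mult_ac)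
    also have "\<dots> \<le> (1 + norm c) * C" by (intro mult_left_mono C) auto
    finally show ?thesis by (simp add: norm_mult del: vector_minus_component)
  qed
  then show ?case by blast
next
  case (lincomb \<psi> \<eta> \<alpha> \<beta>)
  obtain C where C: "\<And>x. (1 + norm x) ^ k * cmod (\<psi> x) \<le> C" using lincomb.IH(1)[of k] by blast
  obtain D where D: "\<And>x. (1 + norm x) ^ k * cmod (\<eta> x) \<le> D" using lincomb.IH(2)[of k] by blast
  have "(1 + norm x) ^ k * cmod (\<alpha> * \<psi> x + \<beta> * \<eta> x) \<le> cmod \<alpha> * C + cmod \<beta> * D" for x
  proof -
    have "(1 + norm x) ^ k * cmod (\<alpha> * \<psi> x + \<beta> * \<eta> x) \<le> (1 + norm x) ^ k * (cmod \<alpha> * cmod (\<psi> x) + cmod \<beta> * cmod (\<eta> x))"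
      by (intro mult_left_mono order_trans[OF norm_triangle_ineq]) (auto simp: norm_mult)
    also have "\<dots> = cmod \<alpha> * ((1 + norm x) ^ k * cmod (\<psi> x)) + cmod \<beta> * ((1 + norm x) ^ k * cmod (\<eta> x))" by (simp add: algebra_simps)
    also have "\<dots> \<le> cmod \<alpha> * C + cmod \<beta> * D" by (intro add_mono mult_left_mono C D) auto
    finally show ?thesis .
  qed
  then show ?case by blast
qed

lemma gaussian_schwartz:
  fixes c :: "real^'n"
  assumes b: "0 < b"
  shows "(\<lambda>x. complex_of_real (exp (- b * (norm (x - c))\<^sup>2))) \<in> schwartz_space"
proof -
  let ?g = "\<lambda>x. complex_of_real (exp (- b * (norm (x - c))\<^sup>2))"
  have mem: "iterated_deriv is ?g \<in> gaussian_span b c" for "is"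
  proof (induction "is")
    case Nil
    then show ?case using gaussian_span.gaussian[of b c] by simp
  next
    case (Cons i "is")
    obtain D where D: "\<And>j. D j \<in> gaussian_span b c"
      "\<And>x. (iterated_deriv is ?g has_derivative (\<lambda>h. \<Sum>j\<in>UNIV. (h $ j) *\<^sub>R D j x)) (at x)"
      using gaussian_span_has_derivative[OF Cons] by blast
    have "partial_deriv i (iterated_deriv is ?g) = D i" by (rule ext) (rule partial_deriv_eq[OF D(2)])
    then show ?case using D(1)[of i] by simp
  qed
  have "\<exists>D. (iterated_deriv is ?g has_derivative D) (at x)" for "is" x
    using gaussian_span_has_derivative[OF mem] by blast
  then obtain D where "\<And>is x. (iterated_deriv is ?g has_derivative D is x) (at x)" by metis
  then show ?thesis by (rule schwartz_spaceI) (rule gaussian_span_bounded[OF mem b])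
qed

section \<open>Sufficiency\<close>

lemma scaleC_of_real_mult: "(a * complex_of_real r) *\<^sub>C (x :: 'x::complex_banach) = a *\<^sub>C (r *\<^sub>R x)"
  by (simp only: scaleC_scaleC[symmetric] scaleC_of_real)

text \<open>Distributions are total functions that matter only on Schwartz functions. The series for
  the potential and \<open>bessel_potential s u\<close> are compared only there.\<close>

lemma is_distribution_of_cong:
  assumes "is_distribution_of f u" and eq: "\<And>\<phi>. \<phi> \<in> schwartz_space \<Longrightarrow> u' \<phi> = u \<phi>"
  shows "is_distribution_of f u'"
proof -
  have add: "(\<lambda>x. \<phi> x + \<psi> x) \<in> schwartz_space" if "\<phi> \<in> schwartz_space" "\<psi> \<in> schwartz_space" for \<phi> \<psi> :: "real^'a \<Rightarrow> complex"
    using schwartz_lincomb[OF that, of 1 1] by simp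
  have mult: "(\<lambda>x. a * \<phi> x) \<in> schwartz_space" if "\<phi> \<in> schwartz_space" for \<phi> :: "real^'a \<Rightarrow> complex" and a
    using schwartz_lincomb[OF that that, of a 0] by simp
  show ?thesis
    using assms(1) unfolding is_distribution_of_def tempered_def by (simp add: eq add mult cong: ball_cong)
qed

text \<open>The weighted integral condition makes the norms of the terms summable, with a bound by
  one Schwartz norm; hence the series is tempered and may be integrated term by term. It serves
  twice: with indicators for \<open>f\<close>, and with their convolutions for its
  potential.\<close>

lemma series_distribution:
  fixes c :: "nat \<Rightarrow> real^'n \<Rightarrow> real" and v :: "nat \<Rightarrow> 'x::complex_banach"
  assumes c [measurable]: "\<And>k. c k \<in> borel_measurable borel" and c0: "\<And>k x. 0 \<le> c k x" "\<And>k x. c k x \<le> b"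
    and fin: "(\<integral>\<^sup>+x. (\<Sum>k. ennreal (c k x * norm (v k))) * ennreal (1 / (1 + norm x) ^ M) \<partial>lebesgue) < \<infinity>"
    and h: "AE x in lebesgue. (\<lambda>k. c k x *\<^sub>R v k) sums h x"
  shows "is_distribution_of h (\<lambda>\<phi>. \<Sum>k. (LINT x|lebesgue. \<phi> x * complex_of_real (c k x)) *\<^sub>C v k)"
proof -
  define u where "u \<phi> = (\<Sum>k. (LINT x|lebesgue. \<phi> x * complex_of_real (c k x)) *\<^sub>C v k)" for \<phi>
  define Z where "Z = enn2real (\<integral>\<^sup>+x. (\<Sum>k. ennreal (c k x * norm (v k))) * ennreal (1 / (1 + norm x) ^ M) \<partial>lebesgue)"
  have Z: "(\<integral>\<^sup>+x. (\<Sum>k. ennreal (c k x * norm (v k))) * ennreal (1 / (1 + norm x) ^ M) \<partial>lebesgue) = ennreal Z"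
    unfolding Z_def using fin by (intro ennreal_enn2real[symmetric]) simp
  have Z0: "0 \<le> Z" by (simp add: Z_def)
  have b0: "0 \<le> b" by (rule order_trans[OF c0])
  have int: "integrable lebesgue (\<lambda>x. \<phi> x * complex_of_real (c k x))" if \<phi>: "\<phi> \<in> schwartz_space" for \<phi> k
  proof -
    note schwartz_measurable[OF \<phi>, measurable]
    have "integrable lborel (\<lambda>x. \<phi> x * complex_of_real (c k x))"
    proof (rule Bochner_Integration.integrable_bound)
      show "integrable lborel (\<lambda>x. b * norm (\<phi> x))" by (intro integrable_mult_right integrable_norm schwartz_integrable \<phi>)
      show "AE x in lborel. norm (\<phi> x * complex_of_real (c k x)) \<le> norm (b * norm (\<phi> x))"
        using c0 b0 by (intro AE_I2) (simp add: norm_mult abs_mult mult.commute[of b] mult_left_mono)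
    qed measurable
    then show ?thesis by (subst integrable_completion) auto
  qed
  have sm: "summable (\<lambda>k. (LINT x|lebesgue. norm (\<phi> x * complex_of_real (c k x))) * norm (v k)) \<and>
      (\<Sum>k. (LINT x|lebesgue. norm (\<phi> x * complex_of_real (c k x))) * norm (v k)) \<le> schwartz_norm M \<phi> * Z"
    if \<phi>: "\<phi> \<in> schwartz_space" for \<phi>
  proof -
    note schwartz_measurable[OF \<phi>, measurable]
    have N0: "0 \<le> schwartz_norm M \<phi>" by (rule schwartz_norm_nonneg[OF \<phi>])
    let ?a = "\<lambda>k. (LINT x|lebesgue. norm (\<phi> x * complex_of_real (c k x))) * norm (v k)"
    have a0: "0 \<le> ?a k" for k by (intro mult_nonneg_nonneg integral_nonneg_AE) auto
    have m: "(\<lambda>x. ennreal (norm (\<phi> x * complex_of_real (c k x)) * norm (v k))) \<in> borel_measurable lebesgue" for k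
      by (intro measurable_completion) measurable
    have "(\<Sum>k. ennreal (?a k)) = (\<Sum>k. \<integral>\<^sup>+x. ennreal (norm (\<phi> x * complex_of_real (c k x)) * norm (v k)) \<partial>lebesgue)"
      by (intro suminf_cong, subst nn_integral_eq_integral) (auto intro!: int[OF \<phi>] integrable_mult_left integrable_norm)
    also have "\<dots> = (\<integral>\<^sup>+x. (\<Sum>k. ennreal (norm (\<phi> x * complex_of_real (c k x)) * norm (v k))) \<partial>lebesgue)"
      by (rule nn_integral_suminf[OF m, symmetric])
    also have "\<dots> \<le> (\<integral>\<^sup>+x. ennreal (schwartz_norm M \<phi>) * ((\<Sum>k. ennreal (c k x * norm (v k))) * ennreal (1 / (1 + norm x) ^ M)) \<partial>lebesgue)"
    proof (rule nn_integral_mono)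
      fix x :: "real^'n"
      have "norm (\<phi> x) \<le> schwartz_norm M \<phi> * (1 / (1 + norm x) ^ M)"
      proof -
        have "0 < (1 + norm x) ^ M" by (intro zero_less_power) (simp add: add_pos_nonneg)
        then show ?thesis using schwartz_norm_bound0[OF \<phi>, of x M] by (simp add: field_simps)
      qed
      then have "norm (\<phi> x * complex_of_real (c k x)) * norm (v k) \<le> schwartz_norm M \<phi> * (1 / (1 + norm x) ^ M) * (c k x * norm (v k))" for k
        unfolding norm_mult norm_of_real abs_of_nonneg[OF c0(1)] mult.assoc[of "cmod (\<phi> x)"]
        using c0(1) by (intro mult_right_mono mult_nonneg_nonneg) auto
      then have "(\<Sum>k. ennreal (norm (\<phi> x * complex_of_real (c k x)) * norm (v k))) \<le> (\<Sum>k. ennreal (schwartz_norm M \<phi> * (1 / (1 + norm x) ^ M)) * ennreal (c k x * norm (v k)))"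
        using c0(1) N0 by (intro suminf_le summableI) (auto simp: ennreal_mult[symmetric] intro!: ennreal_leI)
      also have "\<dots> = ennreal (schwartz_norm M \<phi>) * ((\<Sum>k. ennreal (c k x * norm (v k))) * ennreal (1 / (1 + norm x) ^ M))"
      proof -
        have d: "0 \<le> 1 / (1 + norm x) ^ M" by simp
        show ?thesis unfolding ennreal_suminf_cmult ennreal_mult[OF N0 d] by (simp only: mult_ac)
      qed
      finally show "(\<Sum>k. ennreal (norm (\<phi> x * complex_of_real (c k x)) * norm (v k))) \<le> \<dots>" .
    qed
    also have "\<dots> = ennreal (schwartz_norm M \<phi>) * ennreal Z"
      unfolding Z[symmetric] by (rule nn_integral_cmult) (intro measurable_completion, measurable)
    finally have "(\<Sum>k. ennreal (?a k)) \<le> ennreal (schwartz_norm M \<phi>) * ennreal Z" .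
    then have le: "(\<Sum>k. ennreal (?a k)) \<le> ennreal (schwartz_norm M \<phi> * Z)" by (simp only: ennreal_mult[OF N0 Z0])
    have "(\<Sum>k. ennreal (?a k)) \<noteq> \<top>" using le_less_trans[OF le ennreal_less_top] by (rule less_imp_neq)
    then have s: "summable ?a" by (rule summable_suminf_not_top[OF a0])
    moreover have "suminf ?a \<le> schwartz_norm M \<phi> * Z"
      using le unfolding suminf_ennreal2[OF a0 s] by (subst (asm) ennreal_le_iff) (rule mult_nonneg_nonneg[OF N0 Z0])
    ultimately show ?thesis ..
  qed
  have nb: "norm ((LINT x|lebesgue. \<phi> x * complex_of_real (c k x)) *\<^sub>C v k) \<le> (LINT x|lebesgue. norm (\<phi> x * complex_of_real (c k x))) * norm (v k)" for \<phi> k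
    unfolding norm_scaleC by (intro mult_right_mono integral_norm_bound) auto
  have su: "summable (\<lambda>k. (LINT x|lebesgue. \<phi> x * complex_of_real (c k x)) *\<^sub>C v k)" if \<phi>: "\<phi> \<in> schwartz_space" for \<phi>
    by (rule summable_comparison_test'[OF conjunct1[OF sm[OF \<phi>]] nb])
  have bound: "norm (u \<phi>) \<le> Z * schwartz_norm M \<phi>" if \<phi>: "\<phi> \<in> schwartz_space" for \<phi>
  proof -
    have sn: "summable (\<lambda>k. norm ((LINT x|lebesgue. \<phi> x * complex_of_real (c k x)) *\<^sub>C v k))"
      by (rule summable_comparison_test'[OF conjunct1[OF sm[OF \<phi>]]]) (simp only: real_norm_def abs_norm_cancel nb)
    have "norm (u \<phi>) \<le> (\<Sum>k. norm ((LINT x|lebesgue. \<phi> x * complex_of_real (c k x)) *\<^sub>C v k))"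
      unfolding u_def by (rule summable_norm[OF sn])
    also have "\<dots> \<le> (\<Sum>k. (LINT x|lebesgue. norm (\<phi> x * complex_of_real (c k x))) * norm (v k))"
      by (rule suminf_le[OF nb sn conjunct1[OF sm[OF \<phi>]]])
    also have "\<dots> \<le> Z * schwartz_norm M \<phi>" using sm[OF \<phi>] by (simp add: mult.commute)
    finally show ?thesis .
  qed
  have add: "u (\<lambda>x. \<phi> x + \<psi> x) = u \<phi> + u \<psi>" if "\<phi> \<in> schwartz_space" "\<psi> \<in> schwartz_space" for \<phi> \<psi>
    unfolding u_def suminf_add[OF su[OF that(1)] su[OF that(2)]]
    by (simp only: distrib_right Bochner_Integration.integral_add[OF int[OF that(1)] int[OF that(2)]] scaleC_add_left)
  have mult: "u (\<lambda>x. a * \<phi> x) = a *\<^sub>C u \<phi>" if "\<phi> \<in> schwartz_space" for \<phi> a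
    unfolding u_def bounded_linear.suminf[OF bounded_linear_scaleC_right su[OF that]]
    by (simp only: mult.assoc integral_mult_right_zero scaleC_scaleC)
  have ban: "has_bochner_integral_ban lebesgue (\<lambda>x. \<phi> x *\<^sub>C h x) (u \<phi>)" if \<phi>: "\<phi> \<in> schwartz_space" for \<phi>
    unfolding u_def
  proof (rule has_bochner_integral_ban_suminf)
    show "AE x in lebesgue. (\<lambda>k. (\<phi> x * complex_of_real (c k x)) *\<^sub>C v k) sums (\<phi> x *\<^sub>C h x)"
      using h by eventually_elim (simp only: scaleC_of_real_mult, rule bounded_linear.sums[OF bounded_linear_scaleC_right])
  qed (use int[OF \<phi>] sm[OF \<phi>] in auto)
  have "is_distribution_of h u"
    unfolding is_distribution_of_def tempered_def using add mult bound ban by blast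
  then show ?thesis by (simp add: u_def[abs_def])
qed


section \<open>The two-weight bound for the Bessel kernel\<close>

lemma muckenhoupt_pair_exists:
  fixes w0 w1 :: "real^'n \<Rightarrow> real"
  assumes p: "1 < p0" "p0 \<le> p1" and w: "w0 \<in> Muckenhoupt p0" "w1 \<in> Muckenhoupt p1"
  obtains B0 Bs B1 where "muckenhoupt_pair w0 w1 p0 p1 B0 Bs B1"
proof -
  obtain B0 where B0: "0 < B0" "\<And>c l. 0 < l \<Longrightarrow> weight_measure w0 (cube c l) * weight_measure (dual_weight p0 w0) (cube c l) powr (p0 - 1)
      \<le> B0 * measure lebesgue (cube c l) powr p0" "fat_sets_charged w0 p0 B0"
      "fat_sets_charged (dual_weight p0 w0) (p0 / (p0 - 1)) (B0 powr (1 / (p0 - 1)))"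
    using MuckenhouptE[OF w(1) p(1)] by metis
  obtain B1 where B1: "0 < B1" "fat_sets_charged w1 p1 B1"
    using MuckenhouptE[OF w(2)] p by (metis less_le_trans)
  show thesis
    by (rule that, unfold_locales) (use p B0 B1 in auto)
qed

lemma muckenhoupt_dyadic_cube_pos:
  fixes w :: "real^'n \<Rightarrow> real"
  assumes "w \<in> Muckenhoupt p" shows "0 < weight_measure w (dyadic_cube \<nu> m)"
proof -
  have "weight w" using assms by (simp add: Muckenhoupt_def)
  then show ?thesis
    unfolding dyadic_cube_def by (intro weight_measure_pos) (auto simp: weight_def measure_cube)
qed

text \<open>The supremum condition is rewritten as a comparison of the weights on all grid cells,
  with rate r = 2^(-s) at small scales. The lattice kernel then dominates the Bessel kernel off the
  single point where the argument is 0, a null set.\<close>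

lemma bessel_two_weight:
  fixes w0 w1 :: "real^'n \<Rightarrow> real"
  assumes s: "0 < s" and p: "1 < p0" "p0 \<le> p1" and w: "w0 \<in> Muckenhoupt p0" "w1 \<in> Muckenhoupt p1"
    and bdd: "bdd_above {2 powr (- real \<nu> * s) * weight_measure w0 (dyadic_cube \<nu> m) powr (- 1 / p0) *
      weight_measure w1 (dyadic_cube \<nu> m) powr (1 / p1) | (\<nu>::nat) (m::int^'n). True}"
  obtains C where "0 \<le> C"
    and "\<And>f A. f \<in> borel_measurable lebesgue \<Longrightarrow> (\<And>x. 0 \<le> f x) \<Longrightarrow> 0 \<le> A \<Longrightarrow>
      (\<integral>\<^sup>+x. ennreal (f x powr p0 * w0 x) \<partial>lebesgue) \<le> ennreal A \<Longrightarrow>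
      \<exists>T. T \<in> borel_measurable lebesgue \<and> (\<forall>x. 0 \<le> T x) \<and>
        (AE x in lebesgue. (\<integral>\<^sup>+y. bessel_nn s (x - y) * ennreal (f y) \<partial>lebesgue) \<le> ennreal (T x)) \<and>
        (\<integral>\<^sup>+x. ennreal (T x powr p1 * w1 x) \<partial>lebesgue) \<le> ennreal (C * A powr (p1 / p0))"
proof -
  obtain B0 Bs B1 where "muckenhoupt_pair w0 w1 p0 p1 B0 Bs B1" using muckenhoupt_pair_exists[OF p w] .
  then interpret muckenhoupt_pair w0 w1 p0 p1 B0 Bs B1 .
  obtain K' where K': "\<And>\<nu> m. 2 powr (- real \<nu> * s) * weight_measure w0 (dyadic_cube \<nu> m) powr (- 1 / p0) *
      weight_measure w1 (dyadic_cube \<nu> m) powr (1 / p1) \<le> K'"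
    using bdd unfolding bdd_above_def by blast
  define K where "K = max 0 K'"
  have K0: "0 \<le> K" by (simp add: K_def)
  have dyadic: "2 powr (- real \<nu> * s) * weight_measure w1 (dyadic_cube \<nu> m) powr (1 / p1)
      \<le> K * weight_measure w0 (dyadic_cube \<nu> m) powr (1 / p0)" for \<nu> and m :: "int^'n"
  proof -
    let ?a = "weight_measure w0 (dyadic_cube \<nu> m)"
    have a: "0 < ?a" by (rule muckenhoupt_dyadic_cube_pos[OF w(1)])
    have "?a powr (- 1 / p0) * ?a powr (1 / p0) = 1" using a by (simp add: powr_add[symmetric])
    then have "2 powr (- real \<nu> * s) * weight_measure w1 (dyadic_cube \<nu> m) powr (1 / p1)
      = (2 powr (- real \<nu> * s) * ?a powr (- 1 / p0) * weight_measure w1 (dyadic_cube \<nu> m) powr (1 / p1)) * ?a powr (1 / p0)"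
      by (simp add: mult_ac)
    also have "\<dots> \<le> K * ?a powr (1 / p0)"
      using K'[of \<nu> m] by (intro mult_right_mono) (auto simp: K_def)
    finally show ?thesis .
  qed
  define r where "r = 2 powr (- s)"
  have r: "0 < r" "r < 1" using s powr_less_mono[of "- s" 0 2] by (auto simp: r_def)
  have rp: "r ^ \<nu> * 2 powr (real \<nu> * s) = 1" for \<nu>
    by (simp add: r_def powr_realpow[symmetric] powr_powr powr_add[symmetric] mult.commute)
  define D where "D = B1 powr (1/p1) * B0 powr (1/p0) * 9 ^ CARD('n) * K"
  have D0: "0 \<le> D" using K0 by (simp add: D_def)
  have pp: "0 < p0" "0 < p1" using p by auto
  have tw: "weight_measure w1 (grid_cell L \<theta> k) powr (1 / p1)
    \<le> D * (L * 2 ^ \<nu>) ^ CARD('n) * 2 powr (real \<nu> * s) * weight_measure w0 (grid_cell L \<theta> k) powr (1 / p0)"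
    if "0 < L" "1 / 2 ^ \<nu> \<le> L" for L \<nu> \<theta> k
    unfolding D_def using two_weight_grid_cell[OF w0 w1 pp B(1,3) K0 dyadic that] .
  have tw1: "r ^ \<nu> * weight_measure w1 (grid_cell (1 / 2 ^ \<nu>) \<theta> k) powr (1 / p1)
      \<le> D * weight_measure w0 (grid_cell (1 / 2 ^ \<nu>) \<theta> k) powr (1 / p0)" for \<nu> \<theta> k
  proof -
    have "r ^ \<nu> * weight_measure w1 (grid_cell (1 / 2 ^ \<nu>) \<theta> k) powr (1 / p1)
      \<le> r ^ \<nu> * (D * ((1 / 2 ^ \<nu>) * 2 ^ \<nu>) ^ CARD('n) * 2 powr (real \<nu> * s) * weight_measure w0 (grid_cell (1 / 2 ^ \<nu>) \<theta> k) powr (1 / p0))"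
      using r(1) by (intro mult_left_mono tw) auto
    also have "\<dots> = (r ^ \<nu> * 2 powr (real \<nu> * s)) * (D * weight_measure w0 (grid_cell (1 / 2 ^ \<nu>) \<theta> k) powr (1 / p0))"
      by simp
    finally show ?thesis unfolding rp by simp
  qed
  \<comment> \<open>Cells of side at least 1 are compared with dyadic cubes of level 0, the largest
    ones covered by the condition; this costs \<open>2 ^ (i * CARD('n))\<close>.\<close>
  have tw2: "weight_measure w1 (grid_cell (2 ^ i) \<theta> k) powr (1 / p1)
      \<le> D * 2 ^ (i * CARD('n)) * weight_measure w0 (grid_cell (2 ^ i) \<theta> k) powr (1 / p0)" for i \<theta> k
    using tw[of "2 ^ i" 0 \<theta> k] by (simp add: power_mult)
  obtain C where C: "0 \<le> C"
    "\<And>f A. f \<in> borel_measurable lebesgue \<Longrightarrow> (\<And>x. 0 \<le> f x) \<Longrightarrow> 0 \<le> A \<Longrightarrow>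
      (\<integral>\<^sup>+x. ennreal (f x powr p0 * w0 x) \<partial>lebesgue) \<le> ennreal A \<Longrightarrow>
      \<exists>T. T \<in> borel_measurable lebesgue \<and> (\<forall>x. 0 \<le> T x) \<and>
        (AE x in lebesgue. (\<integral>\<^sup>+y. lattice_kernel r (x - y) * ennreal (f y) \<partial>lebesgue) \<le> ennreal (T x)) \<and>
        (\<integral>\<^sup>+x. ennreal (T x powr p1 * w1 x) \<partial>lebesgue) \<le> ennreal (C * A powr (p1 / p0))"
  proof (rule lattice_kernel_bounded[OF r D0 tw1 tw2], goal_cases)
    case (1 C)
    show ?case by (rule 1(1)[OF 1(2,3)])
  qed
  obtain E where E: "0 < E" "\<And>z::real^'n. z \<noteq> 0 \<Longrightarrow> bessel_nn s z \<le> ennreal E * lattice_kernel r z"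
    unfolding r_def using bessel_nn_le_lattice_kernel[OF s] by blast
  show thesis
  proof (rule that[of "E powr p1 * C"])
    show "0 \<le> E powr p1 * C" using C(1) by simp
    fix f :: "real^'n \<Rightarrow> real" and A
    assume f [measurable]: "f \<in> borel_measurable lebesgue" and f0: "\<And>x. 0 \<le> f x" and A: "0 \<le> A"
      "(\<integral>\<^sup>+x. ennreal (f x powr p0 * w0 x) \<partial>lebesgue) \<le> ennreal A"
    obtain T where T: "T \<in> borel_measurable lebesgue" "\<And>x. 0 \<le> T x"
        "AE x in lebesgue. (\<integral>\<^sup>+y. lattice_kernel r (x - y) * ennreal (f y) \<partial>lebesgue) \<le> ennreal (T x)"
        "(\<integral>\<^sup>+x. ennreal (T x powr p1 * w1 x) \<partial>lebesgue) \<le> ennreal (C * A powr (p1 / p0))"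
      using C(2)[OF f f0 A] by blast
    note T(1)[measurable]
    have lm: "lattice_kernel r \<in> borel_measurable (borel :: (real^'n) measure)"
      unfolding lattice_kernel_def by measurable
    have lmy: "(\<lambda>y. lattice_kernel r (x - y) * ennreal (f y)) \<in> borel_measurable lebesgue" for x :: "real^'n"
    proof -
      have "(\<lambda>y. lattice_kernel r (x - y)) \<in> borel_measurable lborel" using lm by measurable
      then have "(\<lambda>y. lattice_kernel r (x - y)) \<in> borel_measurable lebesgue" by (rule measurable_completion)
      then show ?thesis by measurable
    qed
    have le: "(\<integral>\<^sup>+y. bessel_nn s (x - y) * ennreal (f y) \<partial>lebesgue) \<le> ennreal E * (\<integral>\<^sup>+y. lattice_kernel r (x - y) * ennreal (f y) \<partial>lebesgue)" for x
    proof -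
      have ae: "AE y in lebesgue. y \<noteq> x" unfolding AE_lebesgue_iff by (rule AE_lborel_singleton)
      have "(\<integral>\<^sup>+y. bessel_nn s (x - y) * ennreal (f y) \<partial>lebesgue) \<le> (\<integral>\<^sup>+y. ennreal E * (lattice_kernel r (x - y) * ennreal (f y)) \<partial>lebesgue)"
        by (rule nn_integral_mono_AE, use ae in eventually_elim) (auto simp: mult.assoc[symmetric] intro!: mult_right_mono E(2))
      also have "\<dots> = ennreal E * (\<integral>\<^sup>+y. lattice_kernel r (x - y) * ennreal (f y) \<partial>lebesgue)"
        by (rule nn_integral_cmult[OF lmy])
      finally show ?thesis .
    qed
    have w1n: "\<And>x. 0 \<le> w1 x" and w1m [measurable]: "w1 \<in> borel_measurable lebesgue"
      using w1 by (auto simp: fat_sets_charged_def)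
    show "\<exists>T. T \<in> borel_measurable lebesgue \<and> (\<forall>x. 0 \<le> T x) \<and>
        (AE x in lebesgue. (\<integral>\<^sup>+y. bessel_nn s (x - y) * ennreal (f y) \<partial>lebesgue) \<le> ennreal (T x)) \<and>
        (\<integral>\<^sup>+x. ennreal (T x powr p1 * w1 x) \<partial>lebesgue) \<le> ennreal (E powr p1 * C * A powr (p1 / p0))"
    proof (intro exI[of _ "\<lambda>x. E * T x"] conjI allI)
      show "(\<lambda>x. E * T x) \<in> borel_measurable lebesgue" by measurable
      show "0 \<le> E * T x" for x using E(1) T(2) by simp
      show "AE x in lebesgue. (\<integral>\<^sup>+y. bessel_nn s (x - y) * ennreal (f y) \<partial>lebesgue) \<le> ennreal (E * T x)"
        using T(3)
      proof eventually_elim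
        case (elim x)
        have "ennreal E * (\<integral>\<^sup>+y. lattice_kernel r (x - y) * ennreal (f y) \<partial>lebesgue) \<le> ennreal E * ennreal (T x)"
          using elim by (rule mult_left_mono) simp
        then show ?case using le[of x] E(1) T(2)[of x] by (simp add: ennreal_mult)
      qed
      have "(\<integral>\<^sup>+x. ennreal ((E * T x) powr p1 * w1 x) \<partial>lebesgue) = (\<integral>\<^sup>+x. ennreal (E powr p1) * ennreal (T x powr p1 * w1 x) \<partial>lebesgue)"
        using E(1) T(2) w1n by (intro nn_integral_cong) (simp add: powr_mult ennreal_mult[symmetric] mult.assoc)
      also have "\<dots> = ennreal (E powr p1) * (\<integral>\<^sup>+x. ennreal (T x powr p1 * w1 x) \<partial>lebesgue)"
        by (rule nn_integral_cmult) measurable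
      also have "\<dots> \<le> ennreal (E powr p1) * ennreal (C * A powr (p1 / p0))" by (rule mult_left_mono[OF T(4)]) simp
      also have "\<dots> = ennreal (E powr p1 * C * A powr (p1 / p0))" using C(1) by (simp add: ennreal_mult mult.assoc)
      finally show "(\<integral>\<^sup>+x. ennreal ((E * T x) powr p1 * w1 x) \<partial>lebesgue) \<le> \<dots>" .
    qed
  qed
qed

lemma bessel_potential_apply:
  fixes u :: "('n::finite, 'x::complex_banach) distribution"
  assumes "0 < s" "\<phi> \<in> schwartz_space"
  shows "bessel_potential s u \<phi> = u (bessel_conv s \<phi>)"
  using fourier_bessel_multiplier[OF assms]
  by (simp add: bessel_potential_def inv_fourier_distr_def mult_distr_def fourier_distr_def)

section \<open>Potentials of indicators and of their series\<close>

definition indicator_conv :: "real \<Rightarrow> (real^'n) set \<Rightarrow> real^'n \<Rightarrow> real" where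
  "indicator_conv s A x = (LINT y|lborel. bessel_kernel s (x - y) * indicator A y)"

lemma bessel_kernel_shift_integrable:
  assumes "0 < s"
  shows "integrable lborel (\<lambda>y::real^'n. bessel_kernel s (x - y))"
  using lborel_integrable_reflect[of "bessel_kernel s :: real^'n \<Rightarrow> real" x] bessel_kernel_integrable[OF assms] by simp

lemma indicator_conv_measurable [measurable]:
  assumes [measurable]: "A \<in> sets borel"
  shows "indicator_conv s A \<in> borel_measurable borel"
proof -
  have "(\<lambda>(x, y). bessel_kernel s (x - y) * indicator A y :: real) \<in> borel_measurable (borel \<Otimes>\<^sub>M lborel)" by measurable
  from lborel.borel_measurable_lebesgue_integral[OF this] show ?thesis unfolding indicator_conv_def[abs_def] .
qed

lemma indicator_conv_integrable:
  assumes s: "0 < s" and [measurable]: "A \<in> sets borel"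
  shows "integrable lborel (\<lambda>y::real^'n. bessel_kernel s (x - y) * indicator A y)"
  by (rule Bochner_Integration.integrable_bound[OF bessel_kernel_shift_integrable[OF s, of x]])
    (auto simp: bessel_kernel_nonneg indicator_def)

lemma indicator_conv_nonneg: "0 \<le> indicator_conv s A x"
  unfolding indicator_conv_def by (intro integral_nonneg_AE) (simp add: bessel_kernel_nonneg)

lemma indicator_conv_le:
  fixes A :: "(real^'n) set"
  assumes s: "0 < s" and A: "A \<in> sets borel"
  shows "indicator_conv s A x \<le> (LINT y|lborel. bessel_kernel s (y :: real^'n))"
proof -
  have "indicator_conv s A x \<le> (LINT y|lborel. bessel_kernel s (x - y))"
    unfolding indicator_conv_def
    by (intro integral_mono indicator_conv_integrable[OF s A] bessel_kernel_shift_integrable[OF s]) (auto simp: bessel_kernel_nonneg indicator_def)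
  then show ?thesis by (simp add: lborel_integral_reflect)
qed

lemma ennreal_bessel_kernel_le: "ennreal (bessel_kernel s z) \<le> bessel_nn s z"
  unfolding bessel_kernel_def by (cases "bessel_nn s z") auto

lemma ennreal_indicator_conv_le:
  fixes A :: "(real^'n) set"
  assumes s: "0 < s" and A [measurable]: "A \<in> sets borel"
  shows "ennreal (indicator_conv s A x) \<le> (\<integral>\<^sup>+y. bessel_nn s (x - y) * ennreal (indicator A y) \<partial>lborel)"
proof -
  have "ennreal (indicator_conv s A x) = (\<integral>\<^sup>+y. ennreal (bessel_kernel s (x - y) * indicator A y) \<partial>lborel)"
    unfolding indicator_conv_def
    by (rule nn_integral_eq_integral[OF indicator_conv_integrable[OF s A], symmetric]) (simp add: bessel_kernel_nonneg)
  also have "\<dots> \<le> (\<integral>\<^sup>+y. bessel_nn s (x - y) * ennreal (indicator A y) \<partial>lborel)"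
    by (intro nn_integral_mono) (simp add: indicator_def ennreal_bessel_kernel_le)
  finally show ?thesis .
qed

text \<open>By Fubini and the symmetry of the kernel the convolution moves from the indicator to the
  test function. This matches, term by term, the series for the candidate \<open>g\<close> with the
  potential of \<open>u\<close>.\<close>

lemma integral_indicator_conv:
  fixes A :: "(real^'n) set" and \<phi> :: "real^'n \<Rightarrow> complex"
  assumes s: "0 < s" and A [measurable]: "A \<in> sets borel" and \<phi>: "\<phi> \<in> schwartz_space"
  shows "(LINT x|lebesgue. \<phi> x * complex_of_real (indicator_conv s A x)) = (LINT y|lebesgue. bessel_conv s \<phi> y * complex_of_real (indicator A y))"
proof -
  note schwartz_measurable[OF \<phi>, measurable] schwartz_measurable[OF bessel_conv_schwartz[OF s \<phi>], measurable]
  have "(LINT x|lborel. \<phi> x * complex_of_real (indicator_conv s A x)) = (LINT x|lborel. LINT y|lborel. \<phi> x * complex_of_real (bessel_kernel s (x - y) * indicator A y))"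
    unfolding indicator_conv_def integral_mult_right_zero integral_complex_of_real ..
  also have "\<dots> = (LINT y|lborel. LINT x|lborel. \<phi> x * complex_of_real (bessel_kernel s (x - y) * indicator A y))"
  proof (rule lborel_Fubini)
    show "(\<lambda>(x, y). \<phi> x * complex_of_real (bessel_kernel s (x - y) * indicator A y)) \<in> borel_measurable (borel \<Otimes>\<^sub>M borel)" by measurable
    let ?G = "\<integral>\<^sup>+y. ennreal (bessel_kernel s (y::real^'n)) \<partial>lborel"
    have "(\<integral>\<^sup>+x. \<integral>\<^sup>+y. ennreal (norm (\<phi> x * complex_of_real (bessel_kernel s (x - y) * indicator A y))) \<partial>lborel \<partial>lborel)
      \<le> (\<integral>\<^sup>+x. \<integral>\<^sup>+y. ennreal (norm (\<phi> x)) * ennreal (bessel_kernel s (x - y)) \<partial>lborel \<partial>lborel)"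
      by (intro nn_integral_mono) (auto simp: norm_mult indicator_def bessel_kernel_nonneg ennreal_mult[symmetric])
    also have "\<dots> = (\<integral>\<^sup>+x. ennreal (norm (\<phi> x)) * ?G \<partial>lborel)"
      by (simp add: nn_integral_cmult nn_integral_lborel_reflect[of "\<lambda>y. ennreal (bessel_kernel s y)"])
    also have "\<dots> = (\<integral>\<^sup>+x. ennreal (norm (\<phi> x)) \<partial>lborel) * ?G" by (rule nn_integral_multc) measurable
    also have "\<dots> < \<infinity>"
      using schwartz_integrable[OF \<phi>] bessel_kernel_integrable[OF s, where 'n='n]
      by (auto simp: integrable_iff_bounded ennreal_mult_less_top bessel_kernel_nonneg)
    finally show "(\<integral>\<^sup>+x. \<integral>\<^sup>+y. ennreal (norm (\<phi> x * complex_of_real (bessel_kernel s (x - y) * indicator A y))) \<partial>lborel \<partial>lborel) < \<infinity>" .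
  qed
  also have "\<dots> = (LINT y|lborel. bessel_conv s \<phi> y * complex_of_real (indicator A y))"
  proof (intro Bochner_Integration.integral_cong refl)
    fix y :: "real^'n"
    have "(LINT x|lborel. \<phi> x * complex_of_real (bessel_kernel s (x - y) * indicator A y))
      = (LINT x|lborel. (bessel_kernel s (y - x) *\<^sub>R \<phi> x) * complex_of_real (indicator A y))"
      by (intro Bochner_Integration.integral_cong refl) (simp add: bessel_kernel_commute[of s _ y] scaleR_conv_of_real mult_ac)
    also have "\<dots> = bessel_conv s \<phi> y * complex_of_real (indicator A y)"
      unfolding integral_mult_left_zero by (subst bessel_conv_eq_integral) auto
    finally show "(LINT x|lborel. \<phi> x * complex_of_real (bessel_kernel s (x - y) * indicator A y)) = \<dots>" .
  qed
  finally show ?thesis by (simp add: integral_completion)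
qed

text \<open>The function \<open>g\<close> is the series of \<open>f\<close> with every indicator
  replaced by its convolution with the kernel. Its norm is at most the kernel applied to the scalar
  sum of the norms, and that sum is at most \<open>3 * norm (f x)\<close>; the scalar theorem then
  gives the constant 3 C^(1/p1).\<close>

theorem bessel_potential_bounded:
  fixes w0 w1 :: "real^'n::finite \<Rightarrow> real"
  assumes s: "0 < s" and p: "1 < p0" "p0 \<le> p1" and w: "w0 \<in> Muckenhoupt p0" "w1 \<in> Muckenhoupt p1"
    and bdd: "bdd_above {2 powr (- real \<nu> * s) * weight_measure w0 (dyadic_cube \<nu> m) powr (- 1 / p0) *
      weight_measure w1 (dyadic_cube \<nu> m) powr (1 / p1) | (\<nu>::nat) (m::int^'n). True}"
  shows "Lp_bounded (bessel_potential s :: ('n, 'x::complex_banach) distribution \<Rightarrow> ('n, 'x) distribution) p0 w0 p1 w1"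
proof -
  let ?M = "CARD('n) + 1"
  have ww: "weight w0" "weight w1" using w by (auto simp: Muckenhoupt_def)
  have [measurable]: "w0 \<in> borel_measurable lebesgue" "w1 \<in> borel_measurable lebesgue"
    using ww weight_borel_measurable by auto
  have wn: "\<And>x. 0 \<le> w0 x" "\<And>x. 0 \<le> w1 x" using ww by (auto simp: weight_def)
  have p1: "1 < p1" using p by simp
  obtain C where C: "0 \<le> C"
    "\<And>f A. f \<in> borel_measurable lebesgue \<Longrightarrow> (\<And>x. 0 \<le> f x) \<Longrightarrow> 0 \<le> A \<Longrightarrow>
      (\<integral>\<^sup>+x. ennreal (f x powr p0 * w0 x) \<partial>lebesgue) \<le> ennreal A \<Longrightarrow>
      \<exists>T. T \<in> borel_measurable lebesgue \<and> (\<forall>x. 0 \<le> T x) \<and>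
        (AE x in lebesgue. (\<integral>\<^sup>+y. bessel_nn s (x - y) * ennreal (f y) \<partial>lebesgue) \<le> ennreal (T x)) \<and>
        (\<integral>\<^sup>+x. ennreal (T x powr p1 * w1 x) \<partial>lebesgue) \<le> ennreal (C * A powr (p1 / p0))"
  proof (rule bessel_two_weight[OF s p w bdd], goal_cases)
    case (1 C)
    show ?case by (rule 1(1)[OF 1(2,3)])
  qed
  show ?thesis
    unfolding Lp_bounded_def
  proof (intro exI[of _ "3 * C powr (1 / p1)"] ballI)
    fix f :: "real^'n \<Rightarrow> 'x" assume "f \<in> Lp_space p0 w0"
    then have fsm: "strongly_measurable lebesgue f" and fi: "integrable lebesgue (\<lambda>x. norm (f x) powr p0 * w0 x)"
      by (auto simp: Lp_space_def)
    obtain A :: "nat \<Rightarrow> (real^'n) set" and v :: "nat \<Rightarrow> 'x" where A [measurable]: "\<And>k. A k \<in> sets borel"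
      and ser: "AE x in lborel. summable (\<lambda>k. indicator (A k) x * norm (v k)) \<and>
          (\<Sum>k. indicator (A k) x * norm (v k)) \<le> 3 * norm (f x) \<and> (\<lambda>k. indicator (A k) x *\<^sub>R v k) sums f x"
      using strongly_measurable_series[OF fsm] by blast
    define S where "S x = (\<Sum>k. ennreal (indicator (A k) x * norm (v k)))" for x
    \<comment> \<open>\<open>S\<close> can be infinite on a null set; the scalar theorem takes its
      real version.\<close>
    define F where "F x = enn2real (S x)" for x
    have Sm [measurable]: "S \<in> borel_measurable borel" unfolding S_def[abs_def] by measurable
    then have Fm [measurable]: "F \<in> borel_measurable borel" unfolding F_def[abs_def] by measurable
    have F0: "0 \<le> F x" for x by (simp add: F_def)
    have SF: "AE x in lebesgue. S x = ennreal (F x) \<and> F x \<le> 3 * norm (f x)"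
      unfolding AE_lebesgue_iff using ser
    proof eventually_elim
      case (elim x)
      then have "S x = ennreal (\<Sum>k. indicator (A k) x * norm (v k))" unfolding S_def by (intro suminf_ennreal2) auto
      then show ?case using elim suminf_nonneg[of "\<lambda>k. indicator (A k) x * norm (v k)"] by (simp add: F_def)
    qed
    define I where "I = (LINT x|lebesgue. norm (f x) powr p0 * w0 x)"
    have I0: "0 \<le> I" unfolding I_def using wn by (intro integral_nonneg_AE) simp
    have Fle: "(\<integral>\<^sup>+x. ennreal (F x powr p0 * w0 x) \<partial>lebesgue) \<le> ennreal (3 powr p0 * I)"
    proof -
      have "(\<integral>\<^sup>+x. ennreal (F x powr p0 * w0 x) \<partial>lebesgue) \<le> (\<integral>\<^sup>+x. ennreal (3 powr p0 * (norm (f x) powr p0 * w0 x)) \<partial>lebesgue)"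
      proof (rule nn_integral_mono_AE, use SF in eventually_elim)
        fix x assume "S x = ennreal (F x) \<and> F x \<le> 3 * norm (f x)"
        then have "F x powr p0 \<le> 3 powr p0 * norm (f x) powr p0"
          using powr_mono2[of p0 "F x" "3 * norm (f x)"] F0[of x] p by (simp add: powr_mult)
        then show "ennreal (F x powr p0 * w0 x) \<le> ennreal (3 powr p0 * (norm (f x) powr p0 * w0 x))"
          unfolding mult.assoc[symmetric] by (intro ennreal_leI mult_right_mono wn)
      qed
      also have "\<dots> = ennreal (3 powr p0 * I)"
        using nn_integral_eq_integral[OF integrable_mult_right[OF fi, of "3 powr p0"]] wn by (simp add: I_def)
      finally show ?thesis .
    qed
    have A0: "0 \<le> 3 powr p0 * I" using I0 by simp
    have Fl: "F \<in> borel_measurable lebesgue" using Fm by (intro measurable_completion) simp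
    obtain T where T [measurable]: "T \<in> borel_measurable lebesgue" and T0: "\<And>x. 0 \<le> T x"
        and Tae: "AE x in lebesgue. (\<integral>\<^sup>+y. bessel_nn s (x - y) * ennreal (F y) \<partial>lebesgue) \<le> ennreal (T x)"
        and Tn: "(\<integral>\<^sup>+x. ennreal (T x powr p1 * w1 x) \<partial>lebesgue) \<le> ennreal (C * (3 powr p0 * I) powr (p1 / p0))"
      using C(2)[OF Fl F0 A0 Fle] by blast
    \<comment> \<open>Needed for both ends: with \<open>p0\<close> and \<open>w0\<close> for the
      temperedness of \<open>f\<close>, with \<open>p1\<close> and \<open>w1\<close> for that of its
      potential.\<close>
    have tail: "(\<integral>\<^sup>+x. ennreal (h x) * ennreal (1 / (1 + norm x) ^ ?M) \<partial>lebesgue) < \<infinity>"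
      if q: "1 < q" and u: "u \<in> Muckenhoupt q" and h: "h \<in> borel_measurable lebesgue" "\<And>x. 0 \<le> h x"
        and B: "0 \<le> B" "(\<integral>\<^sup>+x. ennreal (h x powr q * u x) \<partial>lebesgue) \<le> ennreal B" for q u B and h :: "real^'n \<Rightarrow> real"
    proof -
      obtain E where "\<And>c l f A. 0 < l \<Longrightarrow> f \<in> borel_measurable lebesgue \<Longrightarrow> (\<And>x. 0 \<le> f x) \<Longrightarrow> 0 \<le> A \<Longrightarrow>
        (\<integral>\<^sup>+x. ennreal (f x powr q * u x) \<partial>lebesgue) \<le> ennreal A \<Longrightarrow>
        (\<integral>\<^sup>+x. ennreal (f x / (1 + norm (x - c) / l) ^ (CARD('n) + 1)) \<partial>lebesgue)
          \<le> ennreal (E * A powr (1/q) * weight_measure (dual_weight q u) (cube c l) powr (1 - 1/q))"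
      proof (rule Lp_polynomial_tail[OF u q], goal_cases)
        case (1 C)
        show ?case by (rule 1(1)[OF 1(3)])
      qed
      from this[of 1 h B 0, OF zero_less_one h B]
      have "(\<integral>\<^sup>+x. ennreal (h x / (1 + norm x) ^ ?M) \<partial>lebesgue) < \<infinity>"
        by (simp del: power_Suc) (erule le_less_trans, simp)
      moreover have "ennreal (h x) * ennreal (1 / (1 + norm x) ^ ?M) = ennreal (h x / (1 + norm x) ^ ?M)" for x
        using h(2)[of x] by (subst ennreal_mult[symmetric]) auto
      ultimately show ?thesis by simp
    qed
    define u :: "('n, 'x) distribution" where "u \<phi> = (\<Sum>k. (LINT x|lebesgue. \<phi> x * complex_of_real (indicator (A k) x)) *\<^sub>C v k)" for \<phi>
    have fu: "is_distribution_of f u"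
      unfolding u_def[abs_def]
    proof (rule series_distribution[where b=1 and M="?M"])
      show "(\<integral>\<^sup>+x. (\<Sum>k. ennreal (indicator (A k) x * norm (v k))) * ennreal (1 / (1 + norm x) ^ ?M) \<partial>lebesgue) < \<infinity>"
      proof -
        have "(\<integral>\<^sup>+x. (\<Sum>k. ennreal (indicator (A k) x * norm (v k))) * ennreal (1 / (1 + norm x) ^ ?M) \<partial>lebesgue)
          = (\<integral>\<^sup>+x. ennreal (F x) * ennreal (1 / (1 + norm x) ^ ?M) \<partial>lebesgue)"
          by (rule nn_integral_cong_AE, use SF in eventually_elim) (simp add: S_def)
        then show ?thesis using tail[OF p(1) w(1) Fl F0 A0 Fle] by simp
      qed
      show "AE x in lebesgue. (\<lambda>k. indicator (A k) x *\<^sub>R v k) sums f x"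
        unfolding AE_lebesgue_iff using ser by eventually_elim simp
    qed (auto simp: indicator_def)
    let ?c = "\<lambda>k. indicator_conv s (A k)"
    have conv: "(\<Sum>k. ennreal (?c k x * norm (v k))) \<le> (\<integral>\<^sup>+y. bessel_nn s (x - y) * ennreal (F y) \<partial>lebesgue)" for x
    proof -
      have m: "(\<lambda>y. bessel_nn s (x - y) * ennreal (indicator (A k) y * norm (v k))) \<in> borel_measurable lborel" for k by measurable
      have "(\<Sum>k. ennreal (?c k x * norm (v k))) \<le> (\<Sum>k. \<integral>\<^sup>+y. bessel_nn s (x - y) * ennreal (indicator (A k) y * norm (v k)) \<partial>lborel)"
      proof (intro suminf_le summableI)
        fix k
        have "ennreal (?c k x * norm (v k)) \<le> (\<integral>\<^sup>+y. bessel_nn s (x - y) * ennreal (indicator (A k) y) \<partial>lborel) * ennreal (norm (v k))"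
          by (simp add: ennreal_mult indicator_conv_nonneg mult_right_mono ennreal_indicator_conv_le[OF s A])
        also have "\<dots> = (\<integral>\<^sup>+y. bessel_nn s (x - y) * ennreal (indicator (A k) y) * ennreal (norm (v k)) \<partial>lborel)"
          by (rule nn_integral_multc[symmetric]) measurable
        also have "\<dots> = (\<integral>\<^sup>+y. bessel_nn s (x - y) * ennreal (indicator (A k) y * norm (v k)) \<partial>lborel)"
          by (intro nn_integral_cong) (simp add: ennreal_mult mult.assoc)
        finally show "ennreal (?c k x * norm (v k)) \<le> \<dots>" .
      qed
      also have "\<dots> = (\<integral>\<^sup>+y. (\<Sum>k. bessel_nn s (x - y) * ennreal (indicator (A k) y * norm (v k))) \<partial>lborel)"
        by (rule nn_integral_suminf[OF m, symmetric])
      also have "\<dots> = (\<integral>\<^sup>+y. bessel_nn s (x - y) * S y \<partial>lborel)" unfolding ennreal_suminf_cmult S_def ..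
      also have "\<dots> = (\<integral>\<^sup>+y. bessel_nn s (x - y) * S y \<partial>lebesgue)"
        by (rule nn_integral_completion[symmetric])
      also have "\<dots> = (\<integral>\<^sup>+y. bessel_nn s (x - y) * ennreal (F y) \<partial>lebesgue)"
        by (rule nn_integral_cong_AE, use SF in eventually_elim) simp
      finally show ?thesis .
    qed
    define g where "g x = (\<Sum>k. ?c k x *\<^sub>R v k)" for x
    have gT: "AE x in lebesgue. (\<Sum>k. ennreal (?c k x * norm (v k))) \<le> ennreal (T x)"
      using Tae by eventually_elim (rule order_trans[OF conv])
    have g: "AE x in lebesgue. summable (\<lambda>k. ?c k x * norm (v k)) \<and> (\<lambda>k. ?c k x *\<^sub>R v k) sums g x \<and> norm (g x) \<le> T x"
      using gT
    proof eventually_elim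
      case (elim x)
      have a0: "0 \<le> ?c k x * norm (v k)" for k by (simp add: indicator_conv_nonneg)
      have "(\<Sum>k. ennreal (?c k x * norm (v k))) \<noteq> \<top>" using le_less_trans[OF elim ennreal_less_top] by (rule less_imp_neq)
      then have sm: "summable (\<lambda>k. ?c k x * norm (v k))" by (rule summable_suminf_not_top[OF a0])
      then have sn: "summable (\<lambda>k. norm (?c k x *\<^sub>R v k))" by (simp add: indicator_conv_nonneg)
      have "norm (g x) \<le> (\<Sum>k. norm (?c k x *\<^sub>R v k))" unfolding g_def by (rule summable_norm[OF sn])
      also have "\<dots> = (\<Sum>k. ?c k x * norm (v k))" by (simp add: indicator_conv_nonneg)
      also have "\<dots> \<le> T x" using elim unfolding suminf_ennreal2[OF a0 sm] by (simp add: ennreal_le_iff[OF T0])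
      finally have "norm (g x) \<le> T x" .
      then show ?case using sm summable_sums[OF summable_norm_cancel[OF sn]] by (simp add: g_def)
    qed
    have gu: "is_distribution_of g (\<lambda>\<phi>. \<Sum>k. (LINT x|lebesgue. \<phi> x * complex_of_real (?c k x)) *\<^sub>C v k)"
    proof (rule series_distribution[where b="LINT y|lborel. bessel_kernel s (y :: real^'n)" and M="?M"])
      show "(\<integral>\<^sup>+x. (\<Sum>k. ennreal (?c k x * norm (v k))) * ennreal (1 / (1 + norm x) ^ ?M) \<partial>lebesgue) < \<infinity>"
      proof (rule le_less_trans)
        show "(\<integral>\<^sup>+x. (\<Sum>k. ennreal (?c k x * norm (v k))) * ennreal (1 / (1 + norm x) ^ ?M) \<partial>lebesgue)
          \<le> (\<integral>\<^sup>+x. ennreal (T x) * ennreal (1 / (1 + norm x) ^ ?M) \<partial>lebesgue)"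
          by (rule nn_integral_mono_AE, use gT in eventually_elim) (rule mult_right_mono, auto)
        show "(\<integral>\<^sup>+x. ennreal (T x) * ennreal (1 / (1 + norm x) ^ ?M) \<partial>lebesgue) < \<infinity>"
          by (rule tail[OF p1 w(2) T T0 _ Tn]) (simp add: C(1))
      qed
      show "AE x in lebesgue. (\<lambda>k. ?c k x *\<^sub>R v k) sums g x" using g by eventually_elim simp
    qed (auto simp: indicator_conv_nonneg intro: indicator_conv_le[OF s A])
    have gTu: "is_distribution_of g (bessel_potential s u)"
      by (rule is_distribution_of_cong[OF gu])
        (simp only: bessel_potential_apply[OF s] u_def integral_indicator_conv[OF s A])
    have gsm: "strongly_measurable lebesgue g"
    proof (rule strongly_measurable_suminf[where d="\<lambda>k x. complex_of_real (?c k x)" and v=v])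
      show "(\<lambda>x. complex_of_real (?c k x)) \<in> borel_measurable lebesgue" for k
        by (intro measurable_completion) measurable
      show "AE x in lebesgue. summable (\<lambda>k. norm (complex_of_real (?c k x)) * norm (v k))"
        using g by eventually_elim (simp add: indicator_conv_nonneg)
      show "AE x in lebesgue. (\<lambda>k. complex_of_real (?c k x) *\<^sub>C v k) sums g x"
        using g by eventually_elim (simp add: scaleC_of_real)
    qed
    have gm [measurable]: "g \<in> borel_measurable lebesgue" by (rule strongly_measurable_imp_borel_measurable[OF gsm])
    have gle: "(\<integral>\<^sup>+x. ennreal (norm (g x) powr p1 * w1 x) \<partial>lebesgue) \<le> ennreal (C * (3 powr p0 * I) powr (p1 / p0))"
    proof (rule order_trans[OF _ Tn], rule nn_integral_mono_AE, use g in eventually_elim)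
      fix x assume "summable (\<lambda>k. ?c k x * norm (v k)) \<and> (\<lambda>k. ?c k x *\<^sub>R v k) sums g x \<and> norm (g x) \<le> T x"
      then show "ennreal (norm (g x) powr p1 * w1 x) \<le> ennreal (T x powr p1 * w1 x)"
        using p1 wn by (intro ennreal_leI mult_right_mono powr_mono2) auto
    qed
    have gi: "integrable lebesgue (\<lambda>x. norm (g x) powr p1 * w1 x)"
    proof (rule integrableI_bounded)
      show "(\<integral>\<^sup>+x. ennreal (norm (norm (g x) powr p1 * w1 x)) \<partial>lebesgue) < \<infinity>"
        using le_less_trans[OF gle ennreal_less_top] wn by simp
    qed measurable
    have gLp: "g \<in> Lp_space p1 w1" using gsm gi by (simp add: Lp_space_def)
    have "ennreal (LINT x|lebesgue. norm (g x) powr p1 * w1 x) \<le> ennreal (C * (3 powr p0 * I) powr (p1 / p0))"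
      using gle nn_integral_eq_integral[OF gi] wn by simp
    then have gI: "(LINT x|lebesgue. norm (g x) powr p1 * w1 x) \<le> C * (3 powr p0 * I) powr (p1 / p0)"
      using C(1) by (simp add: ennreal_le_iff)
    have "Lp_norm p1 w1 g \<le> (C * (3 powr p0 * I) powr (p1 / p0)) powr (1 / p1)"
      unfolding Lp_norm_def using gI p1 wn by (intro powr_mono2 integral_nonneg_AE) auto
    also have "\<dots> = C powr (1 / p1) * (3 powr p0 * I) powr (1 / p0)"
      using p1 C(1) by (simp add: powr_mult powr_powr)
    also have "(3 powr p0 * I) powr (1 / p0) = 3 * Lp_norm p0 w0 f"
      using p I0 by (simp add: powr_mult powr_powr Lp_norm_def I_def)
    finally have "Lp_norm p1 w1 g \<le> 3 * C powr (1 / p1) * Lp_norm p0 w0 f" by (simp add: mult_ac)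
    then show "\<exists>u. is_distribution_of f u \<and> (\<exists>g\<in>Lp_space p1 w1. is_distribution_of g (bessel_potential s u) \<and> Lp_norm p1 w1 g \<le> 3 * C powr (1 / p1) * Lp_norm p0 w0 f)"
      using fu gTu gLp by blast
  qed
qed

section \<open>Necessity\<close>

lemma dyadic_cube_norm_diff_le:
  fixes x y :: "real^'n"
  assumes "x \<in> dyadic_cube \<nu> m" "y \<in> dyadic_cube \<nu> m"
  shows "norm (x - y) \<le> CARD('n) / 2 ^ \<nu>"
proof -
  have "\<bar>(x - y) $ i\<bar> \<le> 1 / 2 ^ \<nu>" for i
  proof -
    have "\<bar>x $ i - real_of_int (m $ i) / 2 ^ \<nu>\<bar> \<le> 1 / 2 ^ \<nu> / 2" "\<bar>y $ i - real_of_int (m $ i) / 2 ^ \<nu>\<bar> \<le> 1 / 2 ^ \<nu> / 2"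
      using assms unfolding dyadic_cube_def mem_cube by auto
    then have "\<bar>x $ i - real_of_int (m $ i) / 2 ^ \<nu>\<bar> + \<bar>y $ i - real_of_int (m $ i) / 2 ^ \<nu>\<bar> \<le> 1 / 2 ^ \<nu> / 2 + 1 / 2 ^ \<nu> / 2"
      by (rule add_mono)
    also have "1 / 2 ^ \<nu> / 2 + 1 / 2 ^ \<nu> / 2 = (1 :: real) / 2 ^ \<nu>" by simp
    finally show ?thesis unfolding vector_minus_component by linarith
  qed
  then have "(\<Sum>i\<in>UNIV. \<bar>(x - y) $ i\<bar>) \<le> (\<Sum>i\<in>(UNIV :: 'n set). 1 / 2 ^ \<nu>)" by (intro sum_mono)
  then show ?thesis using norm_le_l1_cart[of "x - y"] by simp
qed

lemma dyadic_cube_borel [measurable]: "dyadic_cube \<nu> m \<in> sets borel" "dyadic_cube \<nu> m \<in> sets lebesgue"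
  by (simp_all add: dyadic_cube_def)

lemma measure_dyadic_cube:
  fixes m :: "int^'n"
  shows "measure lebesgue (dyadic_cube \<nu> m) = (1 / 2 ^ \<nu>) ^ CARD('n)" "measure lborel (dyadic_cube \<nu> m) = (1 / 2 ^ \<nu>) ^ CARD('n)"
  by (simp_all only: dyadic_cube_def measure_cube[of "1 / 2 ^ \<nu>"] zero_le_divide_1_iff zero_le_power zero_le_numeral)

lemma integrable_indicator_dyadic_cube:
  fixes m :: "int^'n"
  shows "integrable lborel (indicator (dyadic_cube \<nu> m) :: real^'n \<Rightarrow> real)"
  by (rule integrable_real_indicator)
    (simp, simp only: dyadic_cube_def cube_def emeasure_lborel_cbox_finite)

lemma bessel_nn_finite_AE_shift:
  assumes s: "0 < s"
  shows "AE y in lborel. ennreal (bessel_kernel s (x - y)) = bessel_nn s (x - y :: real^'n)"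
proof -
  have "AE y in distr lborel borel (\<lambda>y::real^'n. x - y). ennreal (bessel_kernel s y) = bessel_nn s y"
    unfolding lborel_distr_reflect by (rule bessel_nn_finite_AE[OF s])
  from AE_distrD[OF _ this] show ?thesis by simp
qed

text \<open>Kernel and \<open>f\<close> are nonnegative, so only \<open>y\<close> in the cube are
  kept in the convolution. The factor 2^(\<nu> d) of the kernel bound cancels the volume of the cube
  there; the remaining volume comes from the outer integration.\<close>

lemma bessel_conv_lower_bound:
  fixes f :: "real^'n \<Rightarrow> real"
  assumes s: "0 < s"
  obtains c where "0 < c" and "\<And>f \<nu> m a. (\<lambda>x::real^'n. complex_of_real (f x)) \<in> schwartz_space \<Longrightarrow> (\<And>x. 0 \<le> f x) \<Longrightarrow> 0 \<le> a \<Longrightarrow>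
    (\<And>x. x \<in> dyadic_cube \<nu> m \<Longrightarrow> a \<le> f x) \<Longrightarrow>
    c * a * 2 powr (- real \<nu> * s) * measure lebesgue (dyadic_cube \<nu> m)
      \<le> cmod (LINT x|lebesgue. bessel_conv s (\<lambda>x. complex_of_real (f x)) x * complex_of_real (indicator (dyadic_cube \<nu> m) x))"
proof -
  obtain c where c: "0 < c" "\<And>(z::real^'n) n. norm z \<le> CARD('n) / 2 ^ n \<Longrightarrow>
    ennreal (c * (2 powr (- s)) ^ n * 2 ^ (n * CARD('n))) \<le> bessel_nn s z"
    using bessel_nn_lower_bound[OF s] by blast
  show thesis
  proof (rule that[OF c(1)])
    fix f :: "real^'n \<Rightarrow> real" and \<nu> and m :: "int^'n" and a :: real
    assume S: "(\<lambda>x. complex_of_real (f x)) \<in> schwartz_space" and f0: "\<And>x. 0 \<le> f x" and a0: "0 \<le> a"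
      and a: "\<And>x. x \<in> dyadic_cube \<nu> m \<Longrightarrow> a \<le> f x"
    let ?Q = "dyadic_cube \<nu> m" and ?\<phi> = "\<lambda>x. complex_of_real (f x)"
    define R where "R x = (LINT y|lborel. bessel_kernel s (x - y) * f y)" for x
    have R: "bessel_conv s ?\<phi> x = complex_of_real (R x)" for x
      unfolding bessel_conv_eq_integral[OF schwartz_measurable[OF S]] R_def
      by (simp only: scaleR_conv_of_real of_real_mult[symmetric] integral_complex_of_real)
    have fm: "f \<in> borel_measurable borel"
      using measurable_compose[OF schwartz_measurable[OF S] borel_measurable_Re] by simp
    have Ri: "integrable lborel R"
      using integrable_Re[OF schwartz_integrable[OF bessel_conv_schwartz[OF s S]]] by (simp add: R)
    have int: "integrable lborel (\<lambda>y. bessel_kernel s (x - y) * f y)" for x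
    proof -
      have "integrable lborel (\<lambda>y. bessel_kernel s (x - (x - y)) *\<^sub>R ?\<phi> (x - y))"
        using bessel_conv_integrable[OF s S, of x] by simp
      then have "integrable lborel (\<lambda>y. bessel_kernel s (x - y) *\<^sub>R ?\<phi> y)"
        by (subst (asm) lborel_integrable_reflect[of "\<lambda>y. bessel_kernel s (x - y) *\<^sub>R ?\<phi> y"])
          (use schwartz_measurable[OF S] in measurable)
      from integrable_Re[OF this] show ?thesis by simp
    qed
    define \<kappa> where "\<kappa> = c * (2 powr (- s)) ^ \<nu> * 2 ^ (\<nu> * CARD('n)) * a"
    have \<kappa>0: "0 \<le> \<kappa>" using c(1) a0 by (simp add: \<kappa>_def)
    have Q1: "2 ^ (\<nu> * CARD('n)) * measure lebesgue ?Q = 1"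
      by (simp add: measure_dyadic_cube power_mult power_one_over)
    have lower: "c * a * 2 powr (- real \<nu> * s) \<le> R x" if x: "x \<in> ?Q" for x
    proof -
      have "(LINT y|lborel. \<kappa> * indicator ?Q y) \<le> R x"
        unfolding R_def
      proof (rule integral_mono_AE[OF integrable_mult_right[OF integrable_indicator_dyadic_cube] int])
        show "AE y in lborel. \<kappa> * indicator ?Q y \<le> bessel_kernel s (x - y) * f y"
          using bessel_nn_finite_AE_shift[OF s, of x]
        proof eventually_elim
          case (elim y)
          show ?case
          proof (cases "y \<in> ?Q")
            case True
            have "ennreal (c * (2 powr (- s)) ^ \<nu> * 2 ^ (\<nu> * CARD('n))) \<le> ennreal (bessel_kernel s (x - y))"
              unfolding elim by (rule c(2)[OF dyadic_cube_norm_diff_le[OF x True]])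
            then have "c * (2 powr (- s)) ^ \<nu> * 2 ^ (\<nu> * CARD('n)) \<le> bessel_kernel s (x - y)"
              by (simp add: bessel_kernel_nonneg)
            then have "\<kappa> \<le> bessel_kernel s (x - y) * f y"
              unfolding \<kappa>_def by (intro mult_mono a[OF True] bessel_kernel_nonneg a0)
            then show ?thesis using True by simp
          qed (simp add: bessel_kernel_nonneg f0)
        qed
      qed
      moreover have "(LINT y|lborel. \<kappa> * indicator ?Q y) = c * a * (2 powr (- s)) ^ \<nu> * (2 ^ (\<nu> * CARD('n)) * measure lebesgue ?Q)"
        using measure_dyadic_cube(1)[of \<nu> m] measure_dyadic_cube(2)[of \<nu> m] by (simp add: \<kappa>_def)
      moreover have "(2 powr (- s)) ^ \<nu> = 2 powr (- real \<nu> * s)"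
        by (simp add: powr_realpow[symmetric] powr_powr mult.commute)
      ultimately show ?thesis unfolding Q1 by simp
    qed
    have "(c * a * 2 powr (- real \<nu> * s)) * measure lebesgue ?Q = (LINT x|lborel. (c * a * 2 powr (- real \<nu> * s)) * indicator ?Q x)"
      using measure_dyadic_cube(1)[of \<nu> m] measure_dyadic_cube(2)[of \<nu> m] by simp
    also have "\<dots> \<le> (LINT x|lborel. R x * indicator ?Q x)"
    proof (rule integral_mono[OF integrable_mult_right[OF integrable_indicator_dyadic_cube]])
      show "integrable lborel (\<lambda>x. R x * indicator ?Q x)"
        by (rule integrable_real_mult_indicator[OF _ Ri]) simp
      show "(c * a * 2 powr (- real \<nu> * s)) * indicator ?Q x \<le> R x * indicator ?Q x" for x
        using lower[of x] by (simp add: indicator_def)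
    qed
    also have "\<dots> \<le> cmod (complex_of_real (LINT x|lborel. R x * indicator ?Q x))" by simp
    also have "complex_of_real (LINT x|lborel. R x * indicator ?Q x) = (LINT x|lborel. bessel_conv s ?\<phi> x * complex_of_real (indicator ?Q x))"
      unfolding R by (simp only: of_real_mult[symmetric] integral_complex_of_real)
    also have "\<dots> = (LINT x|lebesgue. bessel_conv s ?\<phi> x * complex_of_real (indicator ?Q x))"
      by (rule integral_completion[symmetric]) (use schwartz_measurable[OF bessel_conv_schwartz[OF s S]] in measurable)
    finally show "c * a * 2 powr (- real \<nu> * s) * measure lebesgue ?Q
      \<le> cmod (LINT x|lebesgue. bessel_conv s ?\<phi> x * complex_of_real (indicator ?Q x))" .
  qed
qed

text \<open>\<open>Lp_bounded\<close> provides the distribution only by existence; uniqueness of the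
  Banach-valued integral pins down its values, computed here as a series with one nonzero
  term.\<close>

lemma indicator_distribution_apply:
  fixes x0 :: "'x::complex_banach" and u :: "('n::finite, 'x) distribution"
  assumes A [measurable]: "A \<in> sets borel" and u: "is_distribution_of (\<lambda>x. indicator A x *\<^sub>R x0) u" and \<phi>: "\<phi> \<in> schwartz_space"
  shows "u \<phi> = (LINT x|lebesgue. \<phi> x * complex_of_real (indicator A x)) *\<^sub>C x0"
proof -
  note schwartz_measurable[OF \<phi>, measurable]
  have "integrable lborel (\<lambda>x. \<phi> x * complex_of_real (indicator A x))"
    by (rule Bochner_Integration.integrable_bound[OF schwartz_integrable[OF \<phi>]]) (auto simp: indicator_def)
  then have int: "integrable lebesgue (\<lambda>x. \<phi> x * complex_of_real (indicator A x))"
    by (subst integrable_completion) auto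
  let ?d = "\<lambda>k::nat. \<lambda>x. if k = 0 then \<phi> x * complex_of_real (indicator A x) else 0"
  have "has_bochner_integral_ban lebesgue (\<lambda>x. \<phi> x *\<^sub>C (indicator A x *\<^sub>R x0)) (\<Sum>k. (LINT x|lebesgue. ?d k x) *\<^sub>C x0)"
  proof (rule has_bochner_integral_ban_suminf)
    show "integrable lebesgue (?d k)" for k using int by (cases "k = 0") auto
    show "summable (\<lambda>k. (LINT x|lebesgue. norm (?d k x)) * norm x0)"
      by (rule summable_finite[of "{0}"]) auto
    have "(\<lambda>k. ?d k x *\<^sub>C x0) sums (\<Sum>k\<in>{0}. ?d k x *\<^sub>C x0)" for x by (rule sums_finite) auto
    then show "AE x in lebesgue. (\<lambda>k. ?d k x *\<^sub>C x0) sums (\<phi> x *\<^sub>C (indicator A x *\<^sub>R x0))"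
      by (intro AE_I2) (simp add: scaleC_of_real_mult)
  qed
  moreover have "(\<Sum>k. (LINT x|lebesgue. ?d k x) *\<^sub>C x0) = (\<Sum>k\<in>{0}. (LINT x|lebesgue. ?d k x) *\<^sub>C x0)"
    by (rule suminf_finite) auto
  ultimately have "has_bochner_integral_ban lebesgue (\<lambda>x. \<phi> x *\<^sub>C (indicator A x *\<^sub>R x0)) ((LINT x|lebesgue. \<phi> x * complex_of_real (indicator A x)) *\<^sub>C x0)"
    by simp
  moreover have "has_bochner_integral_ban lebesgue (\<lambda>x. \<phi> x *\<^sub>C (indicator A x *\<^sub>R x0)) (u \<phi>)"
    using u \<phi> by (simp add: is_distribution_of_def)
  ultimately show ?thesis by (rule has_bochner_integral_ban_unique[rotated])
qed

lemma indicator_Lp_space: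
  fixes x0 :: "'x::complex_banach" and w :: "real^'n::finite \<Rightarrow> real"
  assumes A: "A \<in> sets lebesgue" and w: "set_integrable lebesgue A w" and p: "0 < p"
  shows "(\<lambda>x. indicator A x *\<^sub>R x0) \<in> Lp_space p w"
    and "Lp_norm p w (\<lambda>x. indicator A x *\<^sub>R x0) = norm x0 * weight_measure w A powr (1 / p)"
proof -
  have eq: "norm (indicator A x *\<^sub>R x0) powr p * w x = norm x0 powr p * (indicator A x *\<^sub>R w x)" for x
    using p by (simp add: indicator_def)
  have "simple_function lebesgue (\<lambda>x. indicator A x *\<^sub>R x0)"
    by (rule simple_function_compose1[OF simple_function_indicator[OF A], of "\<lambda>r::real. r *\<^sub>R x0"])
  then have "strongly_measurable lebesgue (\<lambda>x. indicator A x *\<^sub>R x0)"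
    unfolding strongly_measurable_def by (intro exI[of _ "\<lambda>_ x. indicator A x *\<^sub>R x0"]) simp
  moreover have "integrable lebesgue (\<lambda>x. norm (indicator A x *\<^sub>R x0) powr p * w x)"
    unfolding eq using w by (intro integrable_mult_right) (simp add: set_integrable_def)
  ultimately show "(\<lambda>x. indicator A x *\<^sub>R x0) \<in> Lp_space p w" by (simp add: Lp_space_def)
  show "Lp_norm p w (\<lambda>x. indicator A x *\<^sub>R x0) = norm x0 * weight_measure w A powr (1 / p)"
    unfolding Lp_norm_def eq integral_mult_right_zero weight_measure_def set_lebesgue_integral_def
    using p by (simp add: powr_mult powr_powr)
qed

text \<open>The potential of the indicator of Q times x0 is paired with a Gaussian. The kernel
  bounds the pairing from below; boundedness and the tail estimate bound it from above by
  w0(Q)^(1/p0) times a power of the dual weight of Q. A nonzero x0 is essential: over the zero space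
  every such operator is bounded.\<close>

theorem bessel_potential_bounded_imp:
  fixes w0 w1 :: "real^'n::finite \<Rightarrow> real"
  assumes nontrivial: "\<exists>x::'x::complex_banach. x \<noteq> 0"
    and s: "0 < s" and p: "1 < p0" "p0 \<le> p1" and w: "w0 \<in> Muckenhoupt p0" "w1 \<in> Muckenhoupt p1"
    and bounded: "Lp_bounded (bessel_potential s :: ('n, 'x) distribution \<Rightarrow> ('n, 'x) distribution) p0 w0 p1 w1"
  shows "bdd_above {2 powr (- real \<nu> * s) * weight_measure w0 (dyadic_cube \<nu> m) powr (- 1 / p0) *
      weight_measure w1 (dyadic_cube \<nu> m) powr (1 / p1) | (\<nu>::nat) (m::int^'n). True}"
proof -
  let ?d = "CARD('n)"
  obtain x0 :: 'x where x0: "x0 \<noteq> 0" using nontrivial by blast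
  have p1: "1 < p1" using p by simp
  have ww: "weight w0" "weight w1" using w by (auto simp: Muckenhoupt_def)
  have w1n: "\<And>x. 0 \<le> w1 x" using ww by (auto simp: weight_def)
  obtain C where C: "\<And>f. f \<in> Lp_space p0 w0 \<Longrightarrow> \<exists>u. is_distribution_of f u \<and>
      (\<exists>g\<in>Lp_space p1 w1. is_distribution_of g (bessel_potential s u :: ('n, 'x) distribution) \<and> Lp_norm p1 w1 g \<le> C * Lp_norm p0 w0 f)"
    using bounded unfolding Lp_bounded_def by blast
  obtain c where c: "0 < c" "\<And>f \<nu> m a. (\<lambda>x::real^'n. complex_of_real (f x)) \<in> schwartz_space \<Longrightarrow> (\<And>x. 0 \<le> f x) \<Longrightarrow> 0 \<le> a \<Longrightarrow>
    (\<And>x. x \<in> dyadic_cube \<nu> m \<Longrightarrow> a \<le> f x) \<Longrightarrow>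
    c * a * 2 powr (- real \<nu> * s) * measure lebesgue (dyadic_cube \<nu> m)
      \<le> cmod (LINT x|lebesgue. bessel_conv s (\<lambda>x. complex_of_real (f x)) x * complex_of_real (indicator (dyadic_cube \<nu> m) x))"
  proof (rule bessel_conv_lower_bound[OF s, where 'n='n], goal_cases)
    case (1 c)
    show ?case by (rule 1(1)[OF 1(2,3)])
  qed
  obtain E where E: "0 < E" "\<And>c l f A. 0 < l \<Longrightarrow> f \<in> borel_measurable lebesgue \<Longrightarrow> (\<And>x. 0 \<le> f x) \<Longrightarrow> 0 \<le> A \<Longrightarrow>
        (\<integral>\<^sup>+x. ennreal (f x powr p1 * w1 x) \<partial>lebesgue) \<le> ennreal A \<Longrightarrow>
        (\<integral>\<^sup>+x. ennreal (f x / (1 + norm (x - c) / l) ^ (CARD('n) + 1)) \<partial>lebesgue)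
          \<le> ennreal (E * A powr (1/p1) * weight_measure (dual_weight p1 w1) (cube c l) powr (1 - 1/p1))"
  proof (rule Lp_polynomial_tail[OF w(2) p1], goal_cases)
    case (1 C)
    show ?case by (rule 1(1)[OF 1(2,3)])
  qed
  obtain H where H: "0 < H" "\<And>u::real. 0 \<le> u \<Longrightarrow> (1 + u) ^ (?d + 1) * exp (- 1 * u\<^sup>2) \<le> H"
    using gaussian_decay[of 1 "?d + 1"] by auto
  obtain B where B: "0 < B" "\<And>c l. 0 < l \<Longrightarrow> weight_measure w1 (cube c l) * weight_measure (dual_weight p1 w1) (cube c l) powr (p1 - 1)
      \<le> B * measure lebesgue (cube c l) powr p1"
    using MuckenhouptE[OF w(2) p1] by metis
  \<comment> \<open>Lower bound of the test Gaussian on the cube, whose points have distance at most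
    \<open>?d\<close> side lengths from the centre.\<close>
  define a where "a = exp (- (real ?d)\<^sup>2)"
  define K where "K = H * E * max 0 C * B powr (1 / p1) / (c * a)"
  have main: "2 powr (- real \<nu> * s) * weight_measure w0 (dyadic_cube \<nu> m) powr (- 1 / p0) *
      weight_measure w1 (dyadic_cube \<nu> m) powr (1 / p1) \<le> K" for \<nu> and m :: "int^'n"
  proof -
    let ?Q = "dyadic_cube \<nu> m"
    define z :: "real^'n" where "z = (\<chi> i. real_of_int (m $ i) / 2 ^ \<nu>)"
    define l :: real where "l = 1 / 2 ^ \<nu>"
    have l: "0 < l" by (simp add: l_def)
    have Q: "?Q = cube z l" by (simp add: dyadic_cube_def z_def l_def)
    let ?w0 = "weight_measure w0 ?Q" and ?w1 = "weight_measure w1 ?Q" and ?\<sigma> = "weight_measure (dual_weight p1 w1) ?Q"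
    have pos: "0 < ?w0" "0 < ?w1" using muckenhoupt_dyadic_cube_pos w by auto
    have \<sigma>0: "0 \<le> ?\<sigma>" by (rule weight_measure_nonneg) (simp add: dual_weight_def)
    have Qpos: "0 < measure lebesgue ?Q" by (simp add: measure_dyadic_cube)
    \<comment> \<open>The Gaussian has the width of the cube, so that neither its lower bound
      \<open>a\<close> on the cube nor its decay constant \<open>H\<close> depends on the
      cube.\<close>
    define f where "f x = exp (- (1 / l\<^sup>2) * (norm (x - z))\<^sup>2)" for x :: "real^'n"
    have fS: "(\<lambda>x. complex_of_real (f x)) \<in> schwartz_space"
      unfolding f_def using l by (intro gaussian_schwartz) simp
    have f0: "0 \<le> f x" for x by (simp add: f_def)
    have fa: "a \<le> f x" if "x \<in> ?Q" for x
    proof -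
      have zQ: "z \<in> ?Q" unfolding Q mem_cube using l by simp
      have "norm (x - z) \<le> ?d * l" using dyadic_cube_norm_diff_le[OF that zQ] by (simp add: l_def)
      then have "(norm (x - z))\<^sup>2 \<le> (?d * l)\<^sup>2" by (intro power_mono) auto
      then have "(1 / l\<^sup>2) * (norm (x - z))\<^sup>2 \<le> (real ?d)\<^sup>2" using l by (simp add: power_mult_distrib divide_le_eq)
      then show ?thesis by (simp add: a_def f_def)
    qed
    have fdecay: "f x \<le> H * (1 / (1 + norm (x - z) / l) ^ (?d + 1))" for x
    proof -
      have "(1 + norm (x - z) / l) ^ (?d + 1) * f x \<le> H"
        using H(2)[of "norm (x - z) / l"] l by (simp add: f_def power_divide)
      moreover have "0 < (1 + norm (x - z) / l) ^ (?d + 1)"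
        using l by (intro zero_less_power add_pos_nonneg) auto
      ultimately show ?thesis by (simp only: mult.right_neutral times_divide_eq_right pos_le_divide_eq mult.commute)
    qed
    have w0i: "set_integrable lebesgue ?Q w0" using ww(1) unfolding Q weight_def by simp
    note Lp = indicator_Lp_space[where w=w0 and p=p0, OF dyadic_cube_borel(2) w0i]
    have p0': "0 < p0" using p by simp
    obtain u and g :: "real^'n \<Rightarrow> 'x" where u: "is_distribution_of (\<lambda>x. indicator ?Q x *\<^sub>R x0) u" and g: "g \<in> Lp_space p1 w1"
      and Tu: "is_distribution_of g (bessel_potential s u)" and gn: "Lp_norm p1 w1 g \<le> C * Lp_norm p0 w0 (\<lambda>x. indicator ?Q x *\<^sub>R x0)"
      using C[OF Lp(1)[OF p0', of x0]] by blast
    let ?\<phi> = "\<lambda>x. complex_of_real (f x)"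
    have val: "bessel_potential s u ?\<phi> = (LINT x|lebesgue. bessel_conv s ?\<phi> x * complex_of_real (indicator ?Q x)) *\<^sub>C x0"
      unfolding bessel_potential_apply[OF s fS]
      by (rule indicator_distribution_apply[OF dyadic_cube_borel(1) u bessel_conv_schwartz[OF s fS]])
    have "c * a * 2 powr (- real \<nu> * s) * measure lebesgue ?Q * norm x0 \<le> norm (bessel_potential s u ?\<phi>)"
      unfolding val norm_scaleC by (intro mult_right_mono c(2) fS f0 fa) (auto simp: a_def)
    moreover have "norm (bessel_potential s u ?\<phi>) \<le> H * (E * (max 0 C * norm x0 * ?w0 powr (1 / p0)) * ?\<sigma> powr (1 - 1/p1))"
    proof -
      define I where "I = (LINT x|lebesgue. norm (g x) powr p1 * w1 x)"
      have gi: "integrable lebesgue (\<lambda>x. norm (g x) powr p1 * w1 x)" and gm: "g \<in> borel_measurable lebesgue"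
        using g strongly_measurable_imp_borel_measurable by (auto simp: Lp_space_def)
      have gm' [measurable]: "(\<lambda>x. norm (g x)) \<in> borel_measurable lebesgue"
        by (rule measurable_compose[OF gm borel_measurable_norm])
      have I0: "0 \<le> I" unfolding I_def using w1n by (intro integral_nonneg_AE) simp
      have Ie: "(\<integral>\<^sup>+x. ennreal (norm (g x) powr p1 * w1 x) \<partial>lebesgue) \<le> ennreal I"
        unfolding I_def by (rule eq_refl, rule nn_integral_eq_integral[OF gi]) (use w1n in simp)
      have "I powr (1 / p1) \<le> C * (norm x0 * ?w0 powr (1 / p0))"
        using gn unfolding Lp(2)[OF p0'] by (simp add: Lp_norm_def I_def)
      also have "\<dots> \<le> max 0 C * (norm x0 * ?w0 powr (1 / p0))" by (intro mult_right_mono) auto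
      finally have Ib: "I powr (1 / p1) \<le> max 0 C * norm x0 * ?w0 powr (1 / p0)" by (simp add: mult.assoc)
      have "ennreal (norm (bessel_potential s u ?\<phi>)) \<le> (\<integral>\<^sup>+x. ennreal (norm (?\<phi> x *\<^sub>C g x)) \<partial>lebesgue)"
        by (rule has_bochner_integral_ban_norm_le) (use Tu fS in \<open>simp add: is_distribution_of_def\<close>)
      also have "\<dots> \<le> (\<integral>\<^sup>+x. ennreal H * ennreal (norm (g x) / (1 + norm (x - z) / l) ^ (?d + 1)) \<partial>lebesgue)"
      proof (rule nn_integral_mono)
        fix x :: "real^'n"
        have "f x * norm (g x) \<le> H * (1 / (1 + norm (x - z) / l) ^ (?d + 1)) * norm (g x)"
          by (intro mult_right_mono fdecay) simp
        then show "ennreal (norm (?\<phi> x *\<^sub>C g x)) \<le> ennreal H * ennreal (norm (g x) / (1 + norm (x - z) / l) ^ (?d + 1))"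
          using H(1) l f0[of x] by (subst ennreal_mult[symmetric]) (auto simp: norm_scaleC intro!: ennreal_leI)
      qed
      also have "\<dots> = ennreal H * (\<integral>\<^sup>+x. ennreal (norm (g x) / (1 + norm (x - z) / l) ^ (?d + 1)) \<partial>lebesgue)"
      proof (rule nn_integral_cmult)
        have "(\<lambda>x. (1 + norm (x - z) / l) ^ (?d + 1)) \<in> borel_measurable lebesgue"
          by (intro measurable_completion) measurable
        then show "(\<lambda>x. ennreal (norm (g x) / (1 + norm (x - z) / l) ^ (?d + 1))) \<in> borel_measurable lebesgue" by measurable
      qed
      also have "\<dots> \<le> ennreal H * ennreal (E * I powr (1/p1) * ?\<sigma> powr (1 - 1/p1))"
        unfolding Q by (intro mult_left_mono E(2) l gm' I0 Ie) auto
      also have "\<dots> \<le> ennreal (H * (E * (max 0 C * norm x0 * ?w0 powr (1 / p0)) * ?\<sigma> powr (1 - 1/p1)))"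
        unfolding ennreal_mult'[OF less_imp_le[OF H(1)], symmetric] using H(1) E(1)
        by (intro ennreal_leI mult_left_mono mult_right_mono Ib) auto
      finally show ?thesis using H(1) E(1) by (subst (asm) ennreal_le_iff) auto
    qed
    ultimately have "(c * a * 2 powr (- real \<nu> * s) * measure lebesgue ?Q) * norm x0 \<le> (H * E * max 0 C * ?w0 powr (1 / p0) * ?\<sigma> powr (1 - 1/p1)) * norm x0"
      by (simp add: mult_ac)
    then have le: "c * a * 2 powr (- real \<nu> * s) * measure lebesgue ?Q \<le> H * E * max 0 C * ?w0 powr (1 / p0) * ?\<sigma> powr (1 - 1/p1)"
      using x0 by (subst (asm) mult_le_cancel_right_pos) auto
    \<comment> \<open>The A_p condition of \<open>w1\<close> in the form that exchanges the dual
      weight from the tail estimate for \<open>w1\<close>; the volume it produces cancels the volume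
      in the lower bound.\<close>
    have Ap: "?w1 powr (1 / p1) * ?\<sigma> powr (1 - 1/p1) \<le> B powr (1 / p1) * measure lebesgue ?Q"
    proof -
      have "(?w1 * ?\<sigma> powr (p1 - 1)) powr (1 / p1) \<le> (B * measure lebesgue ?Q powr p1) powr (1 / p1)"
        using B(2)[OF l, of z] p1 pos unfolding Q by (intro powr_mono2) auto
      moreover have "(?w1 * ?\<sigma> powr (p1 - 1)) powr (1 / p1) = ?w1 powr (1 / p1) * ?\<sigma> powr (1 - 1/p1)"
        using pos p1 by (simp add: powr_mult powr_powr diff_divide_distrib)
      moreover have "(B * measure lebesgue ?Q powr p1) powr (1 / p1) = B powr (1 / p1) * measure lebesgue ?Q"
        using B(1) Qpos p1 by (simp add: powr_mult powr_powr)
      ultimately show ?thesis by simp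
    qed
    have ca: "0 < c * a" using c(1) by (simp add: a_def)
    have "(c * a) * (2 powr (- real \<nu> * s) * ?w1 powr (1 / p1)) * measure lebesgue ?Q
      = (c * a * 2 powr (- real \<nu> * s) * measure lebesgue ?Q) * ?w1 powr (1 / p1)" by (simp only: mult_ac)
    also have "\<dots> \<le> (H * E * max 0 C * ?w0 powr (1 / p0) * ?\<sigma> powr (1 - 1/p1)) * ?w1 powr (1 / p1)"
      by (intro mult_right_mono le) simp
    also have "\<dots> = (H * E * max 0 C * ?w0 powr (1 / p0)) * (?w1 powr (1 / p1) * ?\<sigma> powr (1 - 1/p1))" by (simp only: mult_ac)
    also have "\<dots> \<le> (H * E * max 0 C * ?w0 powr (1 / p0)) * (B powr (1 / p1) * measure lebesgue ?Q)"
      using H(1) E(1) by (intro mult_left_mono Ap) auto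
    also have "\<dots> = (H * E * max 0 C * B powr (1 / p1) * ?w0 powr (1 / p0)) * measure lebesgue ?Q" by (simp only: mult_ac)
    finally have "(c * a) * (2 powr (- real \<nu> * s) * ?w1 powr (1 / p1)) \<le> H * E * max 0 C * B powr (1 / p1) * ?w0 powr (1 / p0)"
      using Qpos by (subst (asm) mult_le_cancel_right_pos)
    then have "2 powr (- real \<nu> * s) * ?w1 powr (1 / p1) \<le> K * ?w0 powr (1 / p0)"
      using ca by (simp add: K_def pos_le_divide_eq mult.commute[of _ "c * a"])
    then have "(2 powr (- real \<nu> * s) * ?w1 powr (1 / p1)) * ?w0 powr (- 1 / p0) \<le> (K * ?w0 powr (1 / p0)) * ?w0 powr (- 1 / p0)"
      by (rule mult_right_mono) simp
    also have "\<dots> = K" using pos(1) by (simp add: mult.assoc powr_add[symmetric])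
    finally show ?thesis by (simp add: mult_ac)
  qed
  show ?thesis by (rule bdd_aboveI[of _ K]) (use main in auto)
qed

theorem corollary1p4:
  fixes s p\<^sub>0 p\<^sub>1 :: real
    and w\<^sub>0 w\<^sub>1 :: "real^'n \<Rightarrow> real"
  assumes nontrivial: "\<exists>x::'x::complex_banach. x \<noteq> 0"
    and s: "0 < s"
    and p: "1 < p\<^sub>0" "p\<^sub>0 \<le> p\<^sub>1"
    and w: "w\<^sub>0 \<in> Muckenhoupt p\<^sub>0" "w\<^sub>1 \<in> Muckenhoupt p\<^sub>1"
  shows "Lp_bounded (bessel_potential s :: ('n::finite, 'x::complex_banach) distribution \<Rightarrow> ('n, 'x) distribution) p\<^sub>0 w\<^sub>0 p\<^sub>1 w\<^sub>1 \<longleftrightarrow>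
    bdd_above {2 powr (- real \<nu> * s) * weight_measure w\<^sub>0 (dyadic_cube \<nu> m) powr (- 1 / p\<^sub>0) *
      weight_measure w\<^sub>1 (dyadic_cube \<nu> m) powr (1 / p\<^sub>1) | (\<nu>::nat) (m::int^'n). True}"
proof
  assume "Lp_bounded (bessel_potential s :: ('n::finite, 'x::complex_banach) distribution \<Rightarrow> ('n, 'x) distribution) p\<^sub>0 w\<^sub>0 p\<^sub>1 w\<^sub>1"
  then show "bdd_above {2 powr (- real \<nu> * s) * weight_measure w\<^sub>0 (dyadic_cube \<nu> m) powr (- 1 / p\<^sub>0) *
      weight_measure w\<^sub>1 (dyadic_cube \<nu> m) powr (1 / p\<^sub>1) | (\<nu>::nat) (m::int^'n). True}"
    by (rule bessel_potential_bounded_imp[OF nontrivial s p w])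
next
  assume "bdd_above {2 powr (- real \<nu> * s) * weight_measure w\<^sub>0 (dyadic_cube \<nu> m) powr (- 1 / p\<^sub>0) *
      weight_measure w\<^sub>1 (dyadic_cube \<nu> m) powr (1 / p\<^sub>1) | (\<nu>::nat) (m::int^'n). True}"
  then show "Lp_bounded (bessel_potential s :: ('n::finite, 'x::complex_banach) distribution \<Rightarrow> ('n, 'x) distribution) p\<^sub>0 w\<^sub>0 p\<^sub>1 w\<^sub>1"
    by (rule bessel_potential_bounded[OF s p w])
qed

end
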